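(* Suppose that $\Omega$ satisfies Condition A (see context). Let $f$ be a smooth external force that is time-periodic with period $1$, and suppose that there exists a time-periodic (period $1$) solution $\bar v$ of the Navier-Stokes equations $v_t=-(v\cdot\nabla)v+\Delta v+f-\nabla p$, $\nabla\cdot v=0$ in $(0,\infty)\times\Omega$, $v=0$ on $\partial\Omega$, that belongs to the $C^3$-class on $[0,\infty)\times\bar\Omega$ (with pressure of $C^2$-class) and satisfies the smallness condition $$\max_{x\in\Omega,\ t\in[0,1]}|\bar v(t,x)|\le\beta_0:=\frac{A^{-1}}{4},$$ where $A$ is the constant given in the context. Take $\delta=(\tau,h)$ with $\tau=1/T_1$, $T_1\in\mathbb N$, satisfying $$\tau=\theta h^{3/4},\qquad 0<\theta_0\le\theta\le\theta_1,$$ and let $\tilde u^n,u^n$ be any time-global solution of the discrete Navier-Stokes equations (see context). Then there exist constants $\theta_1>\theta_0>0$ and $\beta>0$ for which we have, with each $\delta$ sufficiently small, $$\|\tilde u^n-\bar v(n\tau,\cdot)\|_{\Omega_h}\le e^{-\frac{A^{-2}}{2}n\tau}\|\tilde u^0-\bar v(0,\cdot)\|_{\Omega_h}+\beta h^{1/4}\quad\text{for all }n\in\mathbb N\cup\{0\}.$$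
   Context: $\Omega\subset\mathbb R^3$ is a bounded connected open set with Lipschitz boundary; $e^1,e^2,e^3$ is the standard basis of $\mathbb R^3$. Condition A on $\Omega$: there exist $s_0>0$ and a finite family $\{V_k\}_{k=1,\dots,K}$ of open subsets of planes in $\mathbb R^3$ such that: (1) each $V_k$ is contained in $\Omega$ and has a normal vector $\omega_k\in\{\pm e^j\}_{j=1,2,3}$ such that for each $y\in V_k$ the set $\{y+s\omega_k\mid s\ge0\}\cap\partial\Omega$ is a singleton, written $\{y+\varphi_k(y)\omega_k\}$ with $\varphi_k:V_k\to\mathbb R_{>0}$; (2) $\varphi_k(y)\ge s_0$ for all $k$ and $y\in V_k$; (3) $\bigcup_k\{y+\varphi_k(y)\omega_k\mid y\in V_k\}=\partial\Omega$. Grid: for $h>0$ and $B\subset h\mathbb Z^3$, $\partial B:=\{x\in B\mid \{x\pm he^i\}_{i=1,2,3}\not\subset B\}$. $C_r(x):=\prod_{i=1}^3[x_i-\frac r2,x_i+\frac r2]$ and $\Omega_h:=\{x\in\Omega\cap h\mathbb Z^3\mid C_{4h}(x)\subset\Omega\}$. Functions on $\Omega_h$ are extended by $0$ outside $\Omega_h$, and $D_i^+\phi(x)=\frac{\phi(x+he^i)-\phi(x)}{h}$, $D_i\phi(x)=\frac{\phi(x+he^i)-\phi(x-he^i)}{2h}$, $D_i^2\phi(x)=\frac{\phi(x+he^i)+\phi(x-he^i)-2\phi(x)}{h^2}$, $\mathcal D\phi=(D_1\phi,D_2\phi,D_3\phi)$, $\mathcal D\cdot w=\sum_iD_iw_i$.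 Norm: $\|u\|_{\Omega_h}=(\sum_{x\in\Omega_h}|u(x)|^2h^3)^{1/2}$. $A>0$ is a constant depending only on the diameter of $\Omega$ such that $\sum_{x\in\Omega_h}|\phi(x)|^2\le A^2\sum_{x\in\Omega_h\setminus\partial\Omega_h}|D_i^+\phi(x)|^2$ for $i=1,2,3$ and every $\phi:\Omega_h\to\mathbb R$ with $\phi|_{\partial\Omega_h}=0$ (a discrete Poincaré inequality). $h\mathbb Z^3$ is partitioned into the eight parity classes $G^1,\dots,G^8$ (points $hz$ according to the parities of $z_1,z_2,z_3$). $\Omega_h^\circ:=\{x\in\Omega_h\setminus\partial\Omega_h\mid x+\sum_ia^ihe^i\in\Omega_h\setminus\partial\Omega_h \text{ for all } a^1,a^2,a^3\in\{0,1,2\}\}$, $\Omega_h^{\circ j}:=\Omega_h^\circ\cap G^j$. Standing assumption: $h$ is small enough that each $\Omega_h^{\circ j}$ is connected (via steps in $\{\pm2he^i\}$). Discrete Helmholtz-Hodge decomposition: for each $u:\Omega_h\to\mathbb R^3$ there are $w:\Omega_h\to\mathbb R^3$, $\phi:\Omega_h\to\mathbb R$ with $\mathcal D\cdot w=0$ on $\Omega_h$, $w+\mathcal D\phi=u$ on $\Omega_h\setminus\partial\Omega_h$, $w=0$ on $\partial\Omega_h$, $\sum_{x\in\Omega_h^{\circ j}}\phi(x)=0$ ($j=1,\dots,8$); $w$ is uniquely determined and $P_hu:=w$. Discrete Navier-Stokes equations: with $f^n(x):=\tau^{-1}h^{-3}\int_{\tau n}^{\tau(n+1)}\int_{C_h(x)}f(t,y)\,dy\,dt$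 and given $\tilde u^0:\Omega_h\to\mathbb R^3$ with $\tilde u^0|_{\partial\Omega_h}=0$, put $u^0=P_h\tilde u^0$ and for $n\ge0$ $$\frac{\tilde u^{n+1}(x)-u^n(x)}{\tau}=-\frac12\sum_{j=1}^3\Big(u^n_j(x-he^j)D_j\tilde u^{n+1}(x-he^j)+u^n_j(x+he^j)D_j\tilde u^{n+1}(x+he^j)\Big)+\sum_{j=1}^3D_j^2\tilde u^{n+1}(x)+f^n(x)$$ for $x\in\Omega_h\setminus\partial\Omega_h$, $\tilde u^{n+1}=0$ on $\partial\Omega_h$, $u^{n+1}=P_h\tilde u^{n+1}$. A time-global solution is one defined for all $n\ge0$. *)

theory Defs
  imports "HOL-Analysis.Analysis"
begin

section \<open>The domain\<close>

text \<open>Near each boundary point, \<open>\<Omega>\<close> is the strict epigraph, in some direction \<open>\<nu>\<close>, of a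
  Lipschitz function \<open>\<gamma>\<close> on the plane orthogonal to \<open>\<nu>\<close>.\<close>

definition lipschitz_boundary :: "(real^3) set \<Rightarrow> bool" where
  "lipschitz_boundary \<Omega> \<longleftrightarrow>
     (\<forall>x0\<in>frontier \<Omega>. \<exists>r>0. \<exists>\<nu> \<gamma> L. norm \<nu> = 1 \<and> L-lipschitz_on {y. y \<bullet> \<nu> = 0} \<gamma> \<and>
        \<Omega> \<inter> ball x0 r = {y \<in> ball x0 r. \<gamma> (y - (y \<bullet> \<nu>) *\<^sub>R \<nu>) < y \<bullet> \<nu>})"

definition condition_A :: "(real^3) set \<Rightarrow> bool" where
  "condition_A \<Omega> \<longleftrightarrow>
     (\<exists>s0>0. \<exists>(K::nat) (V :: nat \<Rightarrow> (real^3) set) (\<omega> :: nat \<Rightarrow> real^3) (\<phi> :: nat \<Rightarrow> real^3 \<Rightarrow> real).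
        (\<forall>k\<in>{1..K}.
           (\<exists>j. \<omega> k = axis j 1 \<or> \<omega> k = - axis j 1) \<and>
           (\<exists>c. openin (top_of_set {y. y \<bullet> \<omega> k = c}) (V k)) \<and>
           V k \<subseteq> \<Omega> \<and>
           (\<forall>y\<in>V k. \<phi> k y > 0 \<and>
              {y + s *\<^sub>R \<omega> k |s. s \<ge> 0} \<inter> frontier \<Omega> = {y + \<phi> k y *\<^sub>R \<omega> k}) \<and>
           (\<forall>y\<in>V k. \<phi> k y \<ge> s0)) \<and>
        (\<Union>k\<in>{1..K}. {y + \<phi> k y *\<^sub>R \<omega> k |y. y \<in> V k}) = frontier \<Omega>)"


section \<open>Classical solutions of the Navier-Stokes equations\<close>

text \<open>\<open>C_class k U S g\<close>, meant for open \<open>U\<close> and \<open>U \<subseteq> S \<subseteq> closure U\<close>: \<open>g\<close> is of class \<open>C\<^sup>k\<close> on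
  \<open>U\<close>, and \<open>g\<close> and its partial derivatives up to order \<open>k\<close> extend continuously to \<open>S\<close>. The
  function \<open>g' b\<close> is the partial derivative in direction \<open>b\<close> on \<open>U\<close> and its continuous extension
  on \<open>S - U\<close>.\<close>

primrec C_class :: "nat \<Rightarrow> 'a::euclidean_space set \<Rightarrow> 'a set \<Rightarrow> ('a \<Rightarrow> 'b::real_normed_vector) \<Rightarrow> bool"
where
  "C_class 0 U S g \<longleftrightarrow> continuous_on S g"
| "C_class (Suc k) U S g \<longleftrightarrow> continuous_on S g \<and>
     (\<exists>g'. (\<forall>z\<in>U. (g has_derivative (\<lambda>v. \<Sum>b\<in>Basis. (v \<bullet> b) *\<^sub>R g' b z)) (at z)) \<and>
           (\<forall>b\<in>Basis. C_class k U S (g' b)))"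

definition partial_deriv :: "3 \<Rightarrow> (real^3 \<Rightarrow> 'b::real_normed_vector) \<Rightarrow> real^3 \<Rightarrow> 'b" where
  "partial_deriv i g x = vector_derivative (\<lambda>s. g (x + s *\<^sub>R axis i 1)) (at 0)"

definition navier_stokes ::
  "(real^3) set \<Rightarrow> (real \<Rightarrow> real^3 \<Rightarrow> real^3) \<Rightarrow> (real \<Rightarrow> real^3 \<Rightarrow> real^3) \<Rightarrow> (real \<Rightarrow> real^3 \<Rightarrow> real) \<Rightarrow> bool"
where
  "navier_stokes \<Omega> f v p \<longleftrightarrow>
     (\<forall>t>0. \<forall>x\<in>\<Omega>.
        vector_derivative (\<lambda>s. v s x) (at t) =
          - (\<Sum>j\<in>UNIV. v t x $ j *\<^sub>R partial_deriv j (v t) x)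
          + (\<Sum>j\<in>UNIV. partial_deriv j (partial_deriv j (v t)) x)
          + f t x - (\<chi> i. partial_deriv i (p t) x) \<and>
        (\<Sum>i\<in>UNIV. partial_deriv i (v t) x $ i) = 0) \<and>
     (\<forall>t>0. \<forall>x\<in>frontier \<Omega>. v t x = 0)"


section \<open>The grid\<close>

definition grid :: "real \<Rightarrow> (real^3) set" where
  "grid h = {x. \<exists>z::int^3. x = (\<chi> i. h * real_of_int (z $ i))}"

definition cube :: "real \<Rightarrow> real^3 \<Rightarrow> (real^3) set" where
  "cube r x = {y. \<forall>i. x $ i - r / 2 \<le> y $ i \<and> y $ i \<le> x $ i + r / 2}"

definition grid_dom :: "(real^3) set \<Rightarrow> real \<Rightarrow> (real^3) set" where
  "grid_dom \<Omega> h = {x \<in> \<Omega> \<inter> grid h. cube (4 * h) x \<subseteq> \<Omega>}"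

definition grid_bdry :: "real \<Rightarrow> (real^3) set \<Rightarrow> (real^3) set" where
  "grid_bdry h B = {x \<in> B. \<not> (\<Union>i. {x + h *\<^sub>R axis i 1, x - h *\<^sub>R axis i 1}) \<subseteq> B}"

definition dom_bdry :: "(real^3) set \<Rightarrow> real \<Rightarrow> (real^3) set" where
  "dom_bdry \<Omega> h = grid_bdry h (grid_dom \<Omega> h)"

definition dom_int :: "(real^3) set \<Rightarrow> real \<Rightarrow> (real^3) set" where
  "dom_int \<Omega> h = grid_dom \<Omega> h - dom_bdry \<Omega> h"

text \<open>The eight parity classes are indexed by \<open>q :: bool^3\<close>.\<close>

definition parity_class :: "real \<Rightarrow> bool^3 \<Rightarrow> (real^3) set" where
  "parity_class h q =
     {x. \<exists>z::int^3. x = (\<chi> i. h * real_of_int (z $ i)) \<and> (\<forall>i. even (z $ i) \<longleftrightarrow> q $ i)}"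

definition dom_circ :: "(real^3) set \<Rightarrow> real \<Rightarrow> (real^3) set" where
  "dom_circ \<Omega> h = {x \<in> dom_int \<Omega> h. \<forall>a::nat^3. (\<forall>i. a $ i \<in> {0,1,2}) \<longrightarrow>
     x + (\<Sum>i\<in>UNIV. (real (a $ i) * h) *\<^sub>R axis i 1) \<in> dom_int \<Omega> h}"

definition dom_circ_class :: "(real^3) set \<Rightarrow> real \<Rightarrow> bool^3 \<Rightarrow> (real^3) set" where
  "dom_circ_class \<Omega> h q = dom_circ \<Omega> h \<inter> parity_class h q"

definition step_connected :: "real \<Rightarrow> (real^3) set \<Rightarrow> bool" where
  "step_connected h S \<longleftrightarrow>
     (\<forall>x\<in>S. \<forall>y\<in>S. (x, y) \<in> {(a, b). a \<in> S \<and> b \<in> S \<and>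
        (\<exists>i. b = a + (2 * h) *\<^sub>R axis i 1 \<or> b = a - (2 * h) *\<^sub>R axis i 1)}\<^sup>*)"

text \<open>Functions on the discrete domain are represented by their extension by zero.\<close>

definition grid_fun :: "(real^3) set \<Rightarrow> real \<Rightarrow> (real^3 \<Rightarrow> 'b::zero) \<Rightarrow> bool" where
  "grid_fun \<Omega> h \<phi> \<longleftrightarrow> (\<forall>x. x \<notin> grid_dom \<Omega> h \<longrightarrow> \<phi> x = 0)"

definition grid_norm :: "(real^3) set \<Rightarrow> real \<Rightarrow> (real^3 \<Rightarrow> real^3) \<Rightarrow> real" where
  "grid_norm \<Omega> h u = sqrt (\<Sum>x\<in>grid_dom \<Omega> h. (norm (u x))\<^sup>2 * h ^ 3)"


section \<open>Difference operators\<close>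

definition diff_plus :: "real \<Rightarrow> 3 \<Rightarrow> (real^3 \<Rightarrow> 'b::real_vector) \<Rightarrow> real^3 \<Rightarrow> 'b" where
  "diff_plus h i \<phi> x = (\<phi> (x + h *\<^sub>R axis i 1) - \<phi> x) /\<^sub>R h"

definition diff_central :: "real \<Rightarrow> 3 \<Rightarrow> (real^3 \<Rightarrow> 'b::real_vector) \<Rightarrow> real^3 \<Rightarrow> 'b" where
  "diff_central h i \<phi> x = (\<phi> (x + h *\<^sub>R axis i 1) - \<phi> (x - h *\<^sub>R axis i 1)) /\<^sub>R (2 * h)"

definition diff_second :: "real \<Rightarrow> 3 \<Rightarrow> (real^3 \<Rightarrow> 'b::real_vector) \<Rightarrow> real^3 \<Rightarrow> 'b" where
  "diff_second h i \<phi> x =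
     (\<phi> (x + h *\<^sub>R axis i 1) + \<phi> (x - h *\<^sub>R axis i 1) - 2 *\<^sub>R \<phi> x) /\<^sub>R h\<^sup>2"

definition disc_grad :: "real \<Rightarrow> (real^3 \<Rightarrow> real) \<Rightarrow> real^3 \<Rightarrow> real^3" where
  "disc_grad h \<phi> x = (\<chi> i. diff_central h i \<phi> x)"

definition disc_div :: "real \<Rightarrow> (real^3 \<Rightarrow> real^3) \<Rightarrow> real^3 \<Rightarrow> real" where
  "disc_div h w x = (\<Sum>i\<in>UNIV. diff_central h i (\<lambda>y. w y $ i) x)"

definition disc_poincare_const :: "(real^3) set \<Rightarrow> real \<Rightarrow> bool" where
  "disc_poincare_const \<Omega> A \<longleftrightarrow> A > 0 \<and>
     (\<forall>h>0. \<forall>i. \<forall>\<phi>::real^3 \<Rightarrow> real. grid_fun \<Omega> h \<phi> \<and> (\<forall>x\<in>dom_bdry \<Omega> h. \<phi> x = 0) \<longrightarrow>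
        (\<Sum>x\<in>grid_dom \<Omega> h. \<bar>\<phi> x\<bar>\<^sup>2) \<le> A\<^sup>2 * (\<Sum>x\<in>dom_int \<Omega> h. \<bar>diff_plus h i \<phi> x\<bar>\<^sup>2))"


section \<open>Discrete Helmholtz-Hodge projection and discrete Navier-Stokes equations\<close>

definition helmholtz_hodge ::
  "(real^3) set \<Rightarrow> real \<Rightarrow> (real^3 \<Rightarrow> real^3) \<Rightarrow> (real^3 \<Rightarrow> real^3) \<Rightarrow> (real^3 \<Rightarrow> real) \<Rightarrow> bool"
where
  "helmholtz_hodge \<Omega> h u w \<phi> \<longleftrightarrow>
     grid_fun \<Omega> h w \<and> grid_fun \<Omega> h \<phi> \<and>
     (\<forall>x\<in>grid_dom \<Omega> h. disc_div h w x = 0) \<and>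
     (\<forall>x\<in>dom_int \<Omega> h. w x + disc_grad h \<phi> x = u x) \<and>
     (\<forall>x\<in>dom_bdry \<Omega> h. w x = 0) \<and>
     (\<forall>q. (\<Sum>x\<in>dom_circ_class \<Omega> h q. \<phi> x) = 0)"

definition hh_proj :: "(real^3) set \<Rightarrow> real \<Rightarrow> (real^3 \<Rightarrow> real^3) \<Rightarrow> (real^3 \<Rightarrow> real^3)" where
  "hh_proj \<Omega> h u = (THE w. \<exists>\<phi>. helmholtz_hodge \<Omega> h u w \<phi>)"

definition force_avg ::
  "real \<Rightarrow> real \<Rightarrow> (real \<Rightarrow> real^3 \<Rightarrow> real^3) \<Rightarrow> nat \<Rightarrow> real^3 \<Rightarrow> real^3" where
  "force_avg \<tau> h f n x =
     integral {\<tau> * real n .. \<tau> * real (n + 1)} (\<lambda>t. integral (cube h x) (\<lambda>y. f t y)) /\<^sub>R (\<tau> * h ^ 3)"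

text \<open>Time-global solutions; \<open>ut n\<close> is the predictor (with tilde), \<open>u n\<close> its projection.\<close>

definition discrete_navier_stokes ::
  "(real^3) set \<Rightarrow> real \<Rightarrow> real \<Rightarrow> (real \<Rightarrow> real^3 \<Rightarrow> real^3) \<Rightarrow>
   (nat \<Rightarrow> real^3 \<Rightarrow> real^3) \<Rightarrow> (nat \<Rightarrow> real^3 \<Rightarrow> real^3) \<Rightarrow> bool"
where
  "discrete_navier_stokes \<Omega> \<tau> h f ut u \<longleftrightarrow>
     (\<forall>n. grid_fun \<Omega> h (ut n) \<and> (\<forall>x\<in>dom_bdry \<Omega> h. ut n x = 0) \<and> u n = hh_proj \<Omega> h (ut n)) \<and>
     (\<forall>n. \<forall>x\<in>dom_int \<Omega> h.
        (ut (Suc n) x - u n x) /\<^sub>R \<tau> =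
          - (1/2) *\<^sub>R (\<Sum>j\<in>UNIV.
               u n (x - h *\<^sub>R axis j 1) $ j *\<^sub>R diff_central h j (ut (Suc n)) (x - h *\<^sub>R axis j 1)
             + u n (x + h *\<^sub>R axis j 1) $ j *\<^sub>R diff_central h j (ut (Suc n)) (x + h *\<^sub>R axis j 1))
          + (\<Sum>j\<in>UNIV. diff_second h j (ut (Suc n)) x)
          + force_avg \<tau> h f n x)"

end

theory Submission
  imports Defs
begin

text \<open>Transporting face averages of \<open>v\<close> inwards, by changes of variables that preserve solenoidality on
  the grid, gives an exactly discretely solenoidal field that vanishes near the boundary and is
  \<open>O(h)\<close>-close to \<open>v\<close>. Its consistency error is \<open>O(h + \<tau>)\<close>, except in a boundary layer of
  \<open>O(h powr -2)\<close> grid points, where it is \<open>O(1)\<close>. The energy method for the difference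
  from this field, with the smallness of \<open>v\<close> absorbing the convective term and the discrete
  Poincare inequality giving the decay, yields an error of squared norm \<open>O(h + \<tau>)\<close>, hence
  \<open>O(h powr (3/8))\<close> in norm, plus an exponentially decaying initial error.\<close>

section \<open>Summation by parts on the grid\<close>

text \<open>The pressure of the scheme enters only through the projection, and no bound for it is at
  hand. It can be removed only by orthogonality, which asks the comparison field to be exactly
  discretely solenoidal and zero on the grid outside \<open>dom_int\<close>. Translating a field
  inwards preserves solenoidality, but the inward direction varies along a Lipschitz boundary, and
  gluing translations by cutoffs destroys it. The remedy is to cut off a potential instead: a
  translation by even numbers of grid steps changes a solenoidal w by the divergence of h times an
  explicit antisymmetric matrix field built from values of w. Cutting off that matrix field keeps
  solenoidality and costs only O(h). The price is that second differences of the resulting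
  perturbation are not small; hence the discrete Laplacians of the comparison field and of v are
  never compared pointwise, only after a summation by parts. The exact pressure p is not small
  either; tested against the solenoidal part it vanishes, and the remainder is absorbed by the
  dissipation of the implicit step at a cost of order \<tau>.\<close>

lemma grid_shift: 
  assumes "x \<in> grid h"
  shows "x + h *\<^sub>R axis i 1 \<in> grid h" "x - h *\<^sub>R axis i 1 \<in> grid h"
proof -
  obtain z :: "int^3" where z: "x = (\<chi> j. h * real_of_int (z $ j))"
    using assms by (auto simp: grid_def)
  have "x + h *\<^sub>R axis i 1 = (\<chi> j. h * real_of_int ((z + axis i 1) $ j))"
    by (simp add: z vec_eq_iff axis_def algebra_simps)
  moreover have "x - h *\<^sub>R axis i 1 = (\<chi> j. h * real_of_int ((z - axis i 1) $ j))"
    by (simp add: z vec_eq_iff axis_def algebra_simps)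
  ultimately show "x + h *\<^sub>R axis i 1 \<in> grid h" "x - h *\<^sub>R axis i 1 \<in> grid h"
    unfolding grid_def by blast+
qed

lemma grid_domD:
  assumes "x \<in> grid_dom \<Omega> h"
  shows "x \<in> \<Omega>" "x \<in> grid h" "cube (4 * h) x \<subseteq> \<Omega>"
  using assms by (auto simp: grid_dom_def)

lemma dom_intD:
  assumes "x \<in> dom_int \<Omega> h"
  shows "x \<in> grid_dom \<Omega> h" "x + h *\<^sub>R axis i 1 \<in> grid_dom \<Omega> h" "x - h *\<^sub>R axis i 1 \<in> grid_dom \<Omega> h"
  using assms by (auto simp: dom_int_def dom_bdry_def grid_bdry_def)

lemma dom_int_subset: "dom_int \<Omega> h \<subseteq> grid_dom \<Omega> h"
  by (auto simp: dom_int_def)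

lemma dom_bdry_subset: "dom_bdry \<Omega> h \<subseteq> grid_dom \<Omega> h"
  by (auto simp: dom_bdry_def grid_bdry_def)

lemma card_grid_box:
  assumes "h > 0" "b \<ge> 0"
  shows "finite {x \<in> grid h. \<forall>i. \<bar>x $ i\<bar> \<le> b}"
    and "real (card {x \<in> grid h. \<forall>i. \<bar>x $ i\<bar> \<le> b}) \<le> (2 * (b / h) + 1) ^ 3"
proof -
  define S where "S = {x \<in> grid h. \<forall>i. \<bar>x $ i\<bar> \<le> b}"
  define Z where "Z = {-\<lfloor>b / h\<rfloor> .. \<lfloor>b / h\<rfloor>}"
  \<comment> \<open>Rounding recovers the integer coordinates of a grid point, so this map is
    injective on \<open>S\<close>.\<close>
  define g where "g = (\<lambda>x::real^3. (\<lfloor>x $ 1 / h\<rfloor>, \<lfloor>x $ 2 / h\<rfloor>, \<lfloor>x $ 3 / h\<rfloor>))"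
  have comp: "\<exists>k::int. x $ i = h * of_int k \<and> k \<in> Z \<and> \<lfloor>x $ i / h\<rfloor> = k" if xS: "x \<in> S" for x i
  proof -
    obtain z :: "int^3" where z: "x = (\<chi> j. h * real_of_int (z $ j))"
      using xS unfolding S_def grid_def by blast
    have "\<bar>h * of_int (z $ i)\<bar> \<le> b" using xS unfolding S_def z by simp
    then have "\<bar>real_of_int (z $ i)\<bar> \<le> b / h" using assms by (simp add: abs_mult field_simps)
    then have "z $ i \<le> \<lfloor>b / h\<rfloor>" "- (z $ i) \<le> \<lfloor>b / h\<rfloor>" by (simp_all add: le_floor_iff)
    then have "z $ i \<in> Z" by (simp add: Z_def)
    then show ?thesis using assms z by auto
  qed
  have "inj_on g S"
  proof (rule inj_onI)
    fix x y assume xy: "x \<in> S" "y \<in> S" "g x = g y"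
    have "x $ i = y $ i" for i
    proof -
      have "\<lfloor>x $ i / h\<rfloor> = \<lfloor>y $ i / h\<rfloor>"
        using xy(3) exhaust_3[of i] by (auto simp: g_def)
      then show ?thesis using comp[OF xy(1), of i] comp[OF xy(2), of i] by metis
    qed
    then show "x = y" by (simp add: vec_eq_iff)
  qed
  moreover have sub: "g ` S \<subseteq> Z \<times> Z \<times> Z"
    using comp by (fastforce simp: g_def)
  moreover have "finite (Z \<times> Z \<times> Z)" by (simp add: Z_def)
  ultimately have fin: "finite S" and card: "card S \<le> card (Z \<times> Z \<times> Z)"
    using inj_on_finite card_inj_on_le by metis+
  show "finite {x \<in> grid h. \<forall>i. \<bar>x $ i\<bar> \<le> b}" using fin by (simp add: S_def)
  have cZ: "real (card Z) \<le> 2 * (b / h) + 1"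
  proof -
    have "0 \<le> \<lfloor>b / h\<rfloor>" using assms by simp
    then have "real (card Z) = 2 * real_of_int \<lfloor>b/h\<rfloor> + 1" by (simp add: Z_def)
    then show ?thesis using of_int_floor_le[of "b/h"] by linarith
  qed
  have "real (card S) \<le> real (card Z) ^ 3"
  proof -
    have "real (card S) \<le> real (card (Z \<times> Z \<times> Z))" using card by (rule of_nat_mono)
    then show ?thesis by (simp add: card_cartesian_product power3_eq_cube)
  qed
  also have "\<dots> \<le> (2 * (b / h) + 1) ^ 3" using cZ by (intro power_mono) auto
  finally show "real (card {x \<in> grid h. \<forall>i. \<bar>x $ i\<bar> \<le> b}) \<le> (2 * (b / h) + 1) ^ 3"
    by (simp add: S_def)
qed

lemma finite_grid_dom:
  assumes "bounded \<Omega>" "h > 0"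
  shows "finite (grid_dom \<Omega> h)"
proof -
  obtain b where b: "\<forall>x\<in>\<Omega>. norm x \<le> b" using assms bounded_iff by blast
  have "\<bar>x $ i\<bar> \<le> \<bar>b\<bar>" if "x \<in> \<Omega>" for x i
    using b that component_le_norm_cart[of x i] by (smt (verit))
  then have "grid_dom \<Omega> h \<subseteq> {x \<in> grid h. \<forall>i. \<bar>x $ i\<bar> \<le> \<bar>b\<bar>}"
    by (auto simp: grid_dom_def)
  then show ?thesis using card_grid_box(1)[OF assms(2), of "\<bar>b\<bar>"] finite_subset by auto
qed

text \<open>Only points of \<open>dom_int\<close> carry nonzero values, and all their neighbours
  belong to the domain. The shift therefore merely permutes the nonzero terms and no boundary term
  appears.\<close>

lemma sum_shift_aux:
  fixes k :: "real^3 \<Rightarrow> 'b::comm_monoid_add"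
  assumes fin: "finite (grid_dom \<Omega> h)"
    and k: "\<And>x. x \<in> grid h \<Longrightarrow> x \<notin> dom_int \<Omega> h \<Longrightarrow> k x = 0"
    and d: "d = h *\<^sub>R axis j 1 \<or> d = - (h *\<^sub>R axis j 1)"
  shows "(\<Sum>x\<in>grid_dom \<Omega> h. k (x + d)) = (\<Sum>x\<in>grid_dom \<Omega> h. k x)"
proof -
  let ?D = "grid_dom \<Omega> h" and ?I = "dom_int \<Omega> h"
  have sh: "x + d \<in> grid h" if "x \<in> ?D" for x
    using grid_shift[OF grid_domD(2)[OF that], of j] d by auto
  have "(\<Sum>x\<in>?D. k (x + d)) = (\<Sum>x\<in>{x\<in>?D. x + d \<in> ?I}. k (x + d))"
    using fin sh k by (intro sum.mono_neutral_right) auto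
  also have "\<dots> = (\<Sum>x\<in>?I. k x)"
  proof (rule sum.reindex_bij_witness[of _ "\<lambda>y. y - d" "\<lambda>x. x + d"])
    fix y assume "y \<in> ?I"
    then show "y - d \<in> {x\<in>?D. x + d \<in> ?I}" using dom_intD(1)[of y \<Omega> h] dom_intD(2,3)[of y \<Omega> h j] d by auto
  qed auto
  also have "\<dots> = (\<Sum>x\<in>?D. k x)"
    using fin k by (intro sum.mono_neutral_left) (auto simp: dom_int_subset grid_domD(2) dom_intD(1))
  finally show ?thesis .
qed

lemma sum_shift:
  fixes k :: "real^3 \<Rightarrow> 'b::comm_monoid_add"
  assumes "finite (grid_dom \<Omega> h)"
    and "\<And>x. x \<in> grid h \<Longrightarrow> x \<notin> dom_int \<Omega> h \<Longrightarrow> k x = 0"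
  shows "(\<Sum>x\<in>grid_dom \<Omega> h. k (x + h *\<^sub>R axis j 1)) = (\<Sum>x\<in>grid_dom \<Omega> h. k x)"
    and "(\<Sum>x\<in>grid_dom \<Omega> h. k (x - h *\<^sub>R axis j 1)) = (\<Sum>x\<in>grid_dom \<Omega> h. k x)"
  using sum_shift_aux[where k = k and j = j and d = "h *\<^sub>R axis j 1", OF assms]
    sum_shift_aux[where k = k and j = j and d = "- (h *\<^sub>R axis j 1)", OF assms] by simp_all

text \<open>Vanishing is asked only at grid points: the comparison field lives on all of space and
  is in general no \<open>grid_fun\<close>. Grid points outside the domain are included, since
  difference quotients at boundary points read them.\<close>

definition int_supported :: "(real^3) set \<Rightarrow> real \<Rightarrow> (real^3 \<Rightarrow> 'b::zero) \<Rightarrow> bool" where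
  "int_supported \<Omega> h k \<longleftrightarrow> (\<forall>x\<in>grid h. x \<notin> dom_int \<Omega> h \<longrightarrow> k x = 0)"

text \<open>Only w has to vanish off the interior. The other factor is arbitrary, which admits
  pressures that do not vanish near the boundary.\<close>

lemma sum_central_by_parts:
  fixes w \<psi> :: "real^3 \<Rightarrow> real"
  assumes fin: "finite (grid_dom \<Omega> h)" and w: "int_supported \<Omega> h w"
  shows "(\<Sum>x\<in>grid_dom \<Omega> h. w x * diff_central h j \<psi> x) =
         - (\<Sum>x\<in>grid_dom \<Omega> h. diff_central h j w x * \<psi> x)"
proof -
  let ?D = "grid_dom \<Omega> h" and ?e = "h *\<^sub>R axis j (1::real)"
  have 1: "(\<Sum>x\<in>?D. w (x - ?e) * \<psi> x) = (\<Sum>x\<in>?D. w x * \<psi> (x + ?e))"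
    using sum_shift(2)[OF fin, where k="\<lambda>x. w x * \<psi> (x + ?e)" and j=j] w
    by (simp add: int_supported_def)
  have 2: "(\<Sum>x\<in>?D. w (x + ?e) * \<psi> x) = (\<Sum>x\<in>?D. w x * \<psi> (x - ?e))"
    using sum_shift(1)[OF fin, where k="\<lambda>x. w x * \<psi> (x - ?e)" and j=j] w
    by (simp add: int_supported_def)
  have "(\<Sum>x\<in>?D. w x * diff_central h j \<psi> x) =
      ((\<Sum>x\<in>?D. w x * \<psi> (x + ?e)) - (\<Sum>x\<in>?D. w x * \<psi> (x - ?e))) / (2 * h)"
    by (simp add: diff_central_def sum_divide_distrib sum_subtractf[symmetric] field_simps)
  moreover have "(\<Sum>x\<in>?D. diff_central h j w x * \<psi> x) =
      ((\<Sum>x\<in>?D. w (x + ?e) * \<psi> x) - (\<Sum>x\<in>?D. w (x - ?e) * \<psi> x)) / (2 * h)"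
    by (simp add: diff_central_def sum_divide_distrib sum_subtractf[symmetric] field_simps)
  ultimately show ?thesis unfolding 1 2 by (simp only: minus_divide_left minus_diff_eq)
qed

lemma sum_grad_div:
  assumes fin: "finite (grid_dom \<Omega> h)" and w: "int_supported \<Omega> h w"
  shows "(\<Sum>x\<in>grid_dom \<Omega> h. w x \<bullet> disc_grad h \<psi> x) =
         - (\<Sum>x\<in>grid_dom \<Omega> h. disc_div h w x * \<psi> x)"
proof -
  have "(\<Sum>x\<in>grid_dom \<Omega> h. w x \<bullet> disc_grad h \<psi> x)
      = (\<Sum>i\<in>UNIV. \<Sum>x\<in>grid_dom \<Omega> h. w x $ i * diff_central h i \<psi> x)"
    by (subst sum.swap) (simp add: inner_vec_def disc_grad_def)
  also have "\<dots> = (\<Sum>i\<in>UNIV. - (\<Sum>x\<in>grid_dom \<Omega> h. diff_central h i (\<lambda>y. w y $ i) x * \<psi> x))"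
    using w by (intro sum.cong refl sum_central_by_parts[OF fin]) (auto simp: int_supported_def)
  also have "\<dots> = - (\<Sum>x\<in>grid_dom \<Omega> h. disc_div h w x * \<psi> x)"
    unfolding sum_negf by (subst sum.swap) (simp add: disc_div_def sum_distrib_right)
  finally show ?thesis .
qed

text \<open>The function q is arbitrary: it will be both the error itself and the difference between
  comparison field and solution, whose second differences are not small.\<close>

lemma sum_second_by_parts:
  fixes q e :: "real^3 \<Rightarrow> real^3"
  assumes fin: "finite (grid_dom \<Omega> h)" and e: "int_supported \<Omega> h e"
  shows "(\<Sum>x\<in>grid_dom \<Omega> h. diff_second h j q x \<bullet> e x) =
         - (\<Sum>x\<in>grid_dom \<Omega> h. diff_plus h j q x \<bullet> diff_plus h j e x)"
proof -
  let ?D = "grid_dom \<Omega> h" and ?e = "h *\<^sub>R axis j (1::real)"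
  have 1: "(\<Sum>x\<in>?D. (q (x + ?e) - q x) \<bullet> e (x + ?e)) = (\<Sum>x\<in>?D. (q x - q (x - ?e)) \<bullet> e x)"
    using sum_shift(1)[OF fin, where k="\<lambda>x. (q x - q (x - ?e)) \<bullet> e x" and j=j] e
    by (simp add: int_supported_def)
  have "diff_plus h j q x \<bullet> diff_plus h j e x = (q (x + ?e) - q x) \<bullet> (e (x + ?e) - e x) / h\<^sup>2" for x
    by (simp add: diff_plus_def power2_eq_square divide_inverse)
  then have "(\<Sum>x\<in>?D. diff_plus h j q x \<bullet> diff_plus h j e x) =
      ((\<Sum>x\<in>?D. (q (x + ?e) - q x) \<bullet> e (x + ?e)) - (\<Sum>x\<in>?D. (q (x + ?e) - q x) \<bullet> e x)) / h\<^sup>2"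
    by (simp add: sum_divide_distrib sum_subtractf[symmetric] inner_diff_right)
  moreover have s2: "diff_second h j q x \<bullet> e x = ((q (x + ?e) - q x) \<bullet> e x - (q x - q (x - ?e)) \<bullet> e x) / h\<^sup>2" for x
    unfolding diff_second_def inner_scaleR_left inner_diff_left inner_add_left
    by (simp add: divide_inverse)
  have "(\<Sum>x\<in>?D. diff_second h j q x \<bullet> e x) =
      ((\<Sum>x\<in>?D. (q (x + ?e) - q x) \<bullet> e x) - (\<Sum>x\<in>?D. (q x - q (x - ?e)) \<bullet> e x)) / h\<^sup>2"
    by (simp only: s2 sum_subtractf flip: sum_divide_distrib)
  ultimately show ?thesis unfolding 1 by (simp only: minus_divide_left minus_diff_eq)
qed

section \<open>The discrete Helmholtz-Hodge decomposition\<close>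

text \<open>Gram-Schmidt over the points of S, one at a time. This tolerates a kernel of G, and the
  discrete gradient has one: constants on each parity class are invisible to central
  differences.\<close>

lemma orthogonal_projection_exists:
  fixes G :: "('a \<Rightarrow> real) \<Rightarrow> 'b \<Rightarrow> 'c::real_inner"
  assumes lin: "\<And>\<alpha> \<beta> c y. G (\<lambda>x. \<alpha> x + c * \<beta> x) y = G \<alpha> y + c *\<^sub>R G \<beta> y"
    and fin: "finite S"
  shows "\<exists>\<phi>. (\<forall>x. x \<notin> S \<longrightarrow> \<phi> x = 0) \<and>
     (\<forall>\<psi>. (\<forall>x. x \<notin> S \<longrightarrow> \<psi> x = 0) \<longrightarrow> (\<Sum>y\<in>I. (u y - G \<phi> y) \<bullet> G \<psi> y) = 0)"
  using fin
proof (induction S arbitrary: u)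
  case empty
  have "G (\<lambda>x. 0) y = 0" for y using lin[of "\<lambda>x. 0" 1 "\<lambda>x. 0" y] by simp
  then have "(\<Sum>y\<in>I. (u y - G (\<lambda>x. 0) y) \<bullet> G \<psi> y) = 0" if "\<forall>x. x \<notin> {} \<longrightarrow> \<psi> x = 0" for \<psi>
  proof -
    have "\<psi> = (\<lambda>x. 0)" using that by auto
    then show ?thesis using \<open>\<And>y. G (\<lambda>x. 0) y = 0\<close> by simp
  qed
  then show ?case by (intro exI[of _ "\<lambda>x. 0"] conjI allI impI refl)
next
  case (insert s S)
  define \<delta> where "\<delta> = (\<lambda>x. if x = s then 1 else (0::real))"
  obtain \<phi> where \<phi>: "\<And>x. x \<notin> S \<Longrightarrow> \<phi> x = 0"
      "\<And>\<psi>. (\<And>x. x \<notin> S \<Longrightarrow> \<psi> x = 0) \<Longrightarrow> (\<Sum>y\<in>I. (u y - G \<phi> y) \<bullet> G \<psi> y) = 0"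
    using insert.IH[of u] by blast
  obtain \<sigma> where \<sigma>: "\<And>x. x \<notin> S \<Longrightarrow> \<sigma> x = 0"
      "\<And>\<psi>. (\<And>x. x \<notin> S \<Longrightarrow> \<psi> x = 0) \<Longrightarrow> (\<Sum>y\<in>I. (G \<delta> y - G \<sigma> y) \<bullet> G \<psi> y) = 0"
    using insert.IH[of "G \<delta>"] by blast
  \<comment> \<open>The component of \<open>G \<delta>\<close> orthogonal to the directions already
    treated; the new projection adds a multiple of it.\<close>
  define g where "g = (\<lambda>y. G \<delta> y - G \<sigma> y)"
  define c where "c = (\<Sum>y\<in>I. (u y - G \<phi> y) \<bullet> g y) / (\<Sum>y\<in>I. g y \<bullet> g y)"
  define \<phi>' where "\<phi>' = (\<lambda>x. \<phi> x + c * (\<delta> x + (-1) * \<sigma> x))"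
  have G': "G \<phi>' y = G \<phi> y + c *\<^sub>R g y" for y
    unfolding \<phi>'_def lin g_def by simp
  have cg: "(\<Sum>y\<in>I. (u y - G \<phi> y - c *\<^sub>R g y) \<bullet> g y) = 0"
  \<comment> \<open>If the new direction depends on the old ones, g vanishes on I and the value 0
    that division by zero gives to c is harmless.\<close>
  proof (cases "(\<Sum>y\<in>I. g y \<bullet> g y) = 0")
    case True
    show ?thesis
    proof (cases "finite I")
      case fI: True
      then have "g y = 0" if "y \<in> I" for y
        using True that by (subst (asm) sum_nonneg_eq_0_iff) auto
      then show ?thesis by simp
    qed simp
  next
    case False
    define \<rho> where "\<rho> = (\<lambda>y. u y - G \<phi> y)"
    have "(\<Sum>y\<in>I. (\<rho> y - c *\<^sub>R g y) \<bullet> g y) = (\<Sum>y\<in>I. \<rho> y \<bullet> g y) - c * (\<Sum>y\<in>I. g y \<bullet> g y)"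
      by (simp add: inner_diff_left sum_subtractf sum_distrib_left)
    then show ?thesis using False by (simp add: c_def \<rho>_def)
  qed
  show ?case
  proof (intro exI[of _ \<phi>'] conjI allI impI)
    fix x assume "x \<notin> insert s S" then show "\<phi>' x = 0" by (simp add: \<phi>'_def \<delta>_def \<phi> \<sigma>)
  next
    fix \<psi> :: "'a \<Rightarrow> real" assume \<psi>: "\<forall>x. x \<notin> insert s S \<longrightarrow> \<psi> x = 0"
    define \<psi>' where "\<psi>' = (\<lambda>x. (if x = s then 0 else \<psi> x) + \<psi> s * \<sigma> x)"
    have supp: "\<psi>' x = 0" if "x \<notin> S" for x using \<psi> \<sigma>(1)[OF that] that by (auto simp: \<psi>'_def)
    have "\<psi> = (\<lambda>x. \<psi>' x + \<psi> s * (\<delta> x + (-1) * \<sigma> x))"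
      by (auto simp: \<psi>'_def \<delta>_def algebra_simps)
    then have "G \<psi> y = G (\<lambda>x. \<psi>' x + \<psi> s * (\<delta> x + (-1) * \<sigma> x)) y" for y by (rule arg_cong)
    then have G\<psi>: "G \<psi> y = G \<psi>' y + \<psi> s *\<^sub>R g y" for y
      unfolding lin g_def by simp
    have "(u y - G \<phi>' y) \<bullet> G \<psi> y = (u y - G \<phi> y) \<bullet> G \<psi>' y - c * (g y \<bullet> G \<psi>' y)
        + \<psi> s * ((u y - G \<phi> y - c *\<^sub>R g y) \<bullet> g y)" for y
      by (simp add: G' G\<psi> inner_diff_left inner_add_left inner_add_right algebra_simps)
    then have "(\<Sum>y\<in>I. (u y - G \<phi>' y) \<bullet> G \<psi> y) =
        (\<Sum>y\<in>I. (u y - G \<phi> y) \<bullet> G \<psi>' y) - c * (\<Sum>y\<in>I. g y \<bullet> G \<psi>' y)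
        + \<psi> s * (\<Sum>y\<in>I. (u y - G \<phi> y - c *\<^sub>R g y) \<bullet> g y)"
      by (simp only: sum.distrib sum_subtractf sum_distrib_left)
    also have "\<dots> = 0" using \<phi>(2)[of \<psi>'] \<sigma>(2)[of \<psi>'] supp cg by (simp add: g_def)
    finally show "(\<Sum>y\<in>I. (u y - G \<phi>' y) \<bullet> G \<psi> y) = 0" .
  qed
qed

lemma disc_grad_linear:
  "disc_grad h (\<lambda>x. \<alpha> x + c * \<beta> x) y = disc_grad h \<alpha> y + c *\<^sub>R disc_grad h \<beta> y"
  by (simp add: disc_grad_def diff_central_def vec_eq_iff algebra_simps)

definition parity :: "real \<Rightarrow> real^3 \<Rightarrow> bool^3" where
  "parity h x = (THE q. x \<in> parity_class h q)"

lemma parity_eq: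
  assumes "h > 0" "x \<in> parity_class h q"
  shows "parity h x = q"
  unfolding parity_def
proof (rule the_equality)
  fix q' assume "x \<in> parity_class h q'"
  then show "q' = q" using assms by (auto simp: parity_class_def vec_eq_iff)
qed (fact assms)

text \<open>A central difference compares two points of the same parity class. Hence subtracting a
  constant on each class from a potential leaves its gradient unchanged, which makes the
  normalisation of \<phi> possible.\<close>

lemma parity_shift:
  assumes "h > 0" "x \<in> grid h"
  shows "parity h (x + h *\<^sub>R axis i 1) = parity h (x - h *\<^sub>R axis i 1)"
proof -
  obtain z :: "int^3" where z: "x = (\<chi> j. h * real_of_int (z $ j))"
    using assms by (auto simp: grid_def)
  define q :: "bool^3" where "q = (\<chi> j. even ((z + axis i 1) $ j))"
  have "x + h *\<^sub>R axis i 1 \<in> parity_class h q"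
    unfolding parity_class_def
    by (rule CollectI, rule exI[of _ "z + axis i 1"]) (simp add: q_def z vec_eq_iff axis_def algebra_simps)
  moreover have "x - h *\<^sub>R axis i 1 \<in> parity_class h q"
    unfolding parity_class_def
    by (rule CollectI, rule exI[of _ "z - axis i 1"]) (auto simp add: q_def z vec_eq_iff axis_def algebra_simps)
  ultimately show ?thesis using parity_eq[OF assms(1)] by metis
qed

text \<open>w is the residual of u after projection onto gradients, restricted to
  \<open>dom_int\<close>. Orthogonality to the gradient of a point mass at y says, after summation
  by parts, that the divergence of w vanishes at y.\<close>

lemma helmholtz_hodge_exists:
  assumes fin: "finite (grid_dom \<Omega> h)" and h: "h > 0"
  shows "\<exists>w \<phi>. helmholtz_hodge \<Omega> h u w \<phi>"
proof -
  let ?D = "grid_dom \<Omega> h" and ?I = "dom_int \<Omega> h"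
  have finI: "finite ?I" using fin dom_int_subset finite_subset by blast
  obtain \<phi> where \<phi>: "\<And>x. x \<notin> ?D \<Longrightarrow> \<phi> x = 0"
      "\<And>\<psi>. (\<And>x. x \<notin> ?D \<Longrightarrow> \<psi> x = 0) \<Longrightarrow>
         (\<Sum>y\<in>?I. (u y - disc_grad h \<phi> y) \<bullet> disc_grad h \<psi> y) = 0"
    using orthogonal_projection_exists[where G="disc_grad h" and S="?D" and I="?I" and u=u,
        OF disc_grad_linear fin] by blast
  define w where "w = (\<lambda>x. if x \<in> ?I then u x - disc_grad h \<phi> x else 0)"
  have wI: "int_supported \<Omega> h w" by (simp add: int_supported_def w_def)
  have div0: "disc_div h w y = 0" if y: "y \<in> ?D" for y
  proof -
    define \<psi> where "\<psi> = (\<lambda>x. if x = y then 1 else (0::real))"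
    have "0 = (\<Sum>x\<in>?I. (u x - disc_grad h \<phi> x) \<bullet> disc_grad h \<psi> x)"
    proof -
      have "\<psi> x = 0" if "x \<notin> ?D" for x using that y by (auto simp: \<psi>_def)
      then show ?thesis by (rule \<phi>(2)[symmetric])
    qed
    also have "\<dots> = (\<Sum>x\<in>?I. w x \<bullet> disc_grad h \<psi> x)"
      by (intro sum.cong) (auto simp: w_def)
    also have "\<dots> = (\<Sum>x\<in>?D. w x \<bullet> disc_grad h \<psi> x)"
      using fin dom_int_subset by (intro sum.mono_neutral_left) (auto simp: w_def)
    also have "\<dots> = - (\<Sum>x\<in>?D. disc_div h w x * \<psi> x)" by (rule sum_grad_div[OF fin wI])
    also have "(\<Sum>x\<in>?D. disc_div h w x * \<psi> x) = (\<Sum>x\<in>{y}. disc_div h w x * \<psi> x)"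
      using fin y by (intro sum.mono_neutral_right) (auto simp: \<psi>_def)
    finally show ?thesis by (simp add: \<psi>_def)
  qed
  \<comment> \<open>Means over the parity classes, to be subtracted from \<phi> at every point of
    the domain according to its parity.\<close>
  define c where "c = (\<lambda>q. (\<Sum>x\<in>dom_circ_class \<Omega> h q. \<phi> x) / real (card (dom_circ_class \<Omega> h q)))"
  define \<phi>' where "\<phi>' = (\<lambda>x. if x \<in> ?D then \<phi> x - c (parity h x) else 0)"
  have grad: "disc_grad h \<phi>' x = disc_grad h \<phi> x" if "x \<in> ?I" for x
  proof -
    have "diff_central h i \<phi>' x = diff_central h i \<phi> x" for i
      using dom_intD(2,3)[OF that, of i] parity_shift[OF h grid_domD(2)[OF dom_intD(1)[OF that]], of i]
      by (simp add: diff_central_def \<phi>'_def)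
    then show ?thesis by (simp add: disc_grad_def)
  qed
  have mean: "(\<Sum>x\<in>dom_circ_class \<Omega> h q. \<phi>' x) = 0" for q
  proof -
    have "dom_circ_class \<Omega> h q \<subseteq> ?D"
      by (auto simp: dom_circ_class_def dom_circ_def dom_intD(1))
    then have "(\<Sum>x\<in>dom_circ_class \<Omega> h q. \<phi>' x) = (\<Sum>x\<in>dom_circ_class \<Omega> h q. \<phi> x - c q)"
      by (intro sum.cong) (auto simp: \<phi>'_def parity_eq[OF h] dom_circ_class_def)
    also have "\<dots> = 0"
      using finite_subset[OF \<open>_ \<subseteq> ?D\<close> fin]
      by (cases "card (dom_circ_class \<Omega> h q) = 0") (auto simp: sum_subtractf c_def)
    finally show ?thesis .
  qed
  have "helmholtz_hodge \<Omega> h u w \<phi>'"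
    unfolding helmholtz_hodge_def grid_fun_def
    using div0 grad mean
    by (auto simp: w_def \<phi>'_def dom_int_def)
  then show ?thesis by blast
qed

lemma helmholtz_hodge_int_supported:
  assumes "helmholtz_hodge \<Omega> h u w \<phi>"
  shows "int_supported \<Omega> h w"
  using assms by (auto simp: helmholtz_hodge_def int_supported_def grid_fun_def dom_int_def)

text \<open>The difference of two candidates is solenoidal and a gradient at once, hence orthogonal
  to itself. This gives the \<open>THE\<close> in \<open>hh_proj\<close> its meaning.\<close>

lemma helmholtz_hodge_unique:
  assumes fin: "finite (grid_dom \<Omega> h)"
    and 1: "helmholtz_hodge \<Omega> h u w \<phi>" and 2: "helmholtz_hodge \<Omega> h u w' \<phi>'"
  shows "w = w'"
proof -
  let ?D = "grid_dom \<Omega> h" and ?I = "dom_int \<Omega> h"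
  define d where "d = (\<lambda>x. w x - w' x)"
  define \<psi> where "\<psi> = (\<lambda>x. \<phi>' x + (-1) * \<phi> x)"
  have dI: "int_supported \<Omega> h d"
    using helmholtz_hodge_int_supported[OF 1] helmholtz_hodge_int_supported[OF 2]
    by (auto simp: int_supported_def d_def)
  have div0: "disc_div h d x = 0" if "x \<in> ?D" for x
  proof -
    have "disc_div h d x = disc_div h w x - disc_div h w' x"
      by (simp add: disc_div_def diff_central_def d_def sum_subtractf[symmetric] algebra_simps)
    then show ?thesis using 1 2 that by (simp add: helmholtz_hodge_def)
  qed
  have dgrad: "d x = disc_grad h \<psi> x" if "x \<in> ?I" for x
  proof -
    have "w x + disc_grad h \<phi> x = w' x + disc_grad h \<phi>' x"
      using 1 2 that by (simp add: helmholtz_hodge_def)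
    then show ?thesis unfolding d_def \<psi>_def disc_grad_linear by (simp add: algebra_simps)
  qed
  have "(\<Sum>x\<in>?D. d x \<bullet> d x) = (\<Sum>x\<in>?D. d x \<bullet> disc_grad h \<psi> x)"
    using dI dgrad by (intro sum.cong refl) (metis int_supported_def grid_domD(2) inner_zero_left)
  also have "\<dots> = 0" using sum_grad_div[OF fin dI, of \<psi>] div0 by simp
  finally have "d x = 0" if "x \<in> ?D" for x
    using that fin by (subst (asm) sum_nonneg_eq_0_iff) auto
  then have "w x = w' x" for x
    using 1 2 by (cases "x \<in> ?D") (auto simp: d_def helmholtz_hodge_def grid_fun_def)
  then show ?thesis by blast
qed

lemma hh_proj_decomposition:
  assumes "finite (grid_dom \<Omega> h)" "h > 0"
  obtains \<phi> where "helmholtz_hodge \<Omega> h u (hh_proj \<Omega> h u) \<phi>"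
proof -
  obtain w \<phi> where "helmholtz_hodge \<Omega> h u w \<phi>" using helmholtz_hodge_exists[OF assms] by blast
  then have "\<exists>\<phi>. helmholtz_hodge \<Omega> h u (hh_proj \<Omega> h u) \<phi>"
    unfolding hh_proj_def
    by (rule_tac theI[of "\<lambda>w. \<exists>\<phi>. helmholtz_hodge \<Omega> h u w \<phi>" w])
       (auto intro: helmholtz_hodge_unique[OF assms(1)])
  then show thesis using that by blast
qed

section \<open>The discrete energy inequality\<close>

definition convection :: "real \<Rightarrow> (real^3 \<Rightarrow> real^3) \<Rightarrow> (real^3 \<Rightarrow> real^3) \<Rightarrow> real^3 \<Rightarrow> real^3" where
  "convection h u v x = (1/2) *\<^sub>R (\<Sum>j\<in>UNIV.
      u (x - h *\<^sub>R axis j 1) $ j *\<^sub>R diff_central h j v (x - h *\<^sub>R axis j 1)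
    + u (x + h *\<^sub>R axis j 1) $ j *\<^sub>R diff_central h j v (x + h *\<^sub>R axis j 1))"

definition nbr_mean :: "real \<Rightarrow> 3 \<Rightarrow> (real^3 \<Rightarrow> real^3) \<Rightarrow> real^3 \<Rightarrow> real^3" where
  "nbr_mean h j e x = (1/2) *\<^sub>R (e (x + h *\<^sub>R axis j 1) + e (x - h *\<^sub>R axis j 1))"

text \<open>Evaluating the convective product at the two neighbours of x is the transpose of
  averaging the test function over the neighbours of x.\<close>

lemma convection_adjoint:
  assumes fin: "finite (grid_dom \<Omega> h)" and u: "int_supported \<Omega> h u"
  shows "(\<Sum>x\<in>grid_dom \<Omega> h. convection h u v x \<bullet> e x) =
     (\<Sum>j\<in>UNIV. \<Sum>x\<in>grid_dom \<Omega> h. u x $ j * (diff_central h j v x \<bullet> nbr_mean h j e x))"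
proof -
  let ?D = "grid_dom \<Omega> h" and ?e = "\<lambda>j::3. h *\<^sub>R axis j (1::real)"
  define g where "g = (\<lambda>j x. u x $ j *\<^sub>R diff_central h j v x)"
  have g0: "g j x = 0" if "x \<in> grid h" "x \<notin> dom_int \<Omega> h" for j x
    using u that by (simp add: int_supported_def g_def)
  have 1: "(\<Sum>x\<in>?D. g j (x - ?e j) \<bullet> e x) = (\<Sum>x\<in>?D. g j x \<bullet> e (x + ?e j))" for j
    using sum_shift(2)[OF fin, where k="\<lambda>x. g j x \<bullet> e (x + ?e j)" and j=j] g0 by simp
  have 2: "(\<Sum>x\<in>?D. g j (x + ?e j) \<bullet> e x) = (\<Sum>x\<in>?D. g j x \<bullet> e (x - ?e j))" for j
    using sum_shift(1)[OF fin, where k="\<lambda>x. g j x \<bullet> e (x - ?e j)" and j=j] g0 by simp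
  have "(\<Sum>x\<in>?D. convection h u v x \<bullet> e x) =
     (\<Sum>x\<in>?D. \<Sum>j\<in>UNIV. (1/2) * (g j (x - ?e j) \<bullet> e x + g j (x + ?e j) \<bullet> e x))"
    by (simp add: convection_def g_def inner_sum_left inner_add_left sum_distrib_left)
  also have "\<dots> = (\<Sum>j\<in>UNIV. (1/2) * ((\<Sum>x\<in>?D. g j (x - ?e j) \<bullet> e x) + (\<Sum>x\<in>?D. g j (x + ?e j) \<bullet> e x)))"
    by (subst sum.swap) (simp only: sum_distrib_left[symmetric] sum.distrib)
  also have "\<dots> = (\<Sum>j\<in>UNIV. (1/2) * ((\<Sum>x\<in>?D. g j x \<bullet> e (x + ?e j)) + (\<Sum>x\<in>?D. g j x \<bullet> e (x - ?e j))))"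
    by (simp only: 1 2)
  also have "\<dots> = (\<Sum>j\<in>UNIV. \<Sum>x\<in>?D. u x $ j * (diff_central h j v x \<bullet> nbr_mean h j e x))"
    by (simp add: g_def nbr_mean_def sum_distrib_left sum.distrib[symmetric] inner_add_right algebra_simps)
  finally show ?thesis .
qed

text \<open>There is an exact product rule: the central difference of v . e pairs the difference of
  each factor with the neighbour mean of the other. After summation by parts the only remainder
  contains the divergence of u.\<close>

lemma convection_skew:
  assumes fin: "finite (grid_dom \<Omega> h)" and u: "int_supported \<Omega> h u"
    and div: "\<And>x. x \<in> grid_dom \<Omega> h \<Longrightarrow> disc_div h u x = 0"
  shows "(\<Sum>x\<in>grid_dom \<Omega> h. convection h u v x \<bullet> e x) = - (\<Sum>x\<in>grid_dom \<Omega> h. convection h u e x \<bullet> v x)"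
proof -
  let ?D = "grid_dom \<Omega> h"
  have pw: "diff_central h j v x \<bullet> nbr_mean h j e x + diff_central h j e x \<bullet> nbr_mean h j v x
      = diff_central h j (\<lambda>y. v y \<bullet> e y) x" for j x
    by (simp add: diff_central_def nbr_mean_def inner_add_right inner_diff_left inner_commute algebra_simps)
  have "(\<Sum>x\<in>?D. convection h u v x \<bullet> e x) + (\<Sum>x\<in>?D. convection h u e x \<bullet> v x) =
    (\<Sum>j\<in>UNIV. \<Sum>x\<in>?D. u x $ j * diff_central h j (\<lambda>y. v y \<bullet> e y) x)"
    by (simp only: convection_adjoint[OF fin u] sum.distrib[symmetric] distrib_left[symmetric] pw)
  also have "\<dots> = (\<Sum>j\<in>UNIV. - (\<Sum>x\<in>?D. diff_central h j (\<lambda>y. u y $ j) x * (v x \<bullet> e x)))"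
    using u by (intro sum.cong refl sum_central_by_parts[OF fin]) (auto simp: int_supported_def)
  also have "\<dots> = - (\<Sum>x\<in>?D. disc_div h u x * (v x \<bullet> e x))"
    unfolding sum_negf by (subst sum.swap) (simp add: disc_div_def sum_distrib_right)
  also have "\<dots> = 0" using div by simp
  finally show ?thesis by simp
qed

lemma norm_diff_central_le:
  "(norm (diff_central h j v x))\<^sup>2 \<le>
    ((norm (diff_plus h j v x))\<^sup>2 + (norm (diff_plus h j v (x - h *\<^sub>R axis j 1)))\<^sup>2) / 2"
proof -
  define a where "a = diff_plus h j v x"
  define b where "b = diff_plus h j v (x - h *\<^sub>R axis j 1)"
  have *: "diff_central h j v x = (1/2) *\<^sub>R (a + b)"
    by (simp add: diff_central_def diff_plus_def a_def b_def scaleR_add_right[symmetric] mult.commute)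
  have "(norm (a + b))\<^sup>2 \<le> 2 * ((norm a)\<^sup>2 + (norm b)\<^sup>2)"
  proof -
    have "(norm (a + b))\<^sup>2 \<le> (norm a + norm b)\<^sup>2" by (simp add: norm_triangle_ineq power_mono)
    also have "\<dots> \<le> 2 * ((norm a)\<^sup>2 + (norm b)\<^sup>2)"
      using zero_le_power2[of "norm a - norm b"] by (simp add: power2_eq_square algebra_simps)
    finally show ?thesis .
  qed
  then show ?thesis unfolding * a_def[symmetric] b_def[symmetric] by (simp add: power_divide)
qed

text \<open>A central difference is the mean of two one-sided ones, and the backward shifted sum
  picks up nothing nonzero from outside the domain.\<close>

lemma sum_diff_central_le:
  assumes fin: "finite (grid_dom \<Omega> h)" and v: "int_supported \<Omega> h v"
  shows "(\<Sum>x\<in>grid_dom \<Omega> h. (norm (diff_central h j v x))\<^sup>2) \<le>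
    (\<Sum>x\<in>grid_dom \<Omega> h. (norm (diff_plus h j v x))\<^sup>2)"
proof -
  let ?D = "grid_dom \<Omega> h" and ?e = "h *\<^sub>R axis j (1::real)"
  let ?g = "\<lambda>x. (norm (diff_plus h j v x))\<^sup>2"
  have "(\<Sum>x\<in>?D. ?g (x - ?e)) \<le> (\<Sum>x\<in>?D. ?g x)"
  proof -
    have "(\<Sum>x\<in>?D. ?g (x - ?e)) = (\<Sum>x\<in>{x\<in>?D. x - ?e \<in> ?D}. ?g (x - ?e))"
    proof (intro sum.mono_neutral_right fin ballI)
      fix x assume x: "x \<in> ?D - {x \<in> ?D. x - ?e \<in> ?D}"
      then have g: "x - ?e \<in> grid h" "x \<in> grid h" using grid_shift grid_domD by blast+
      have "x - ?e \<notin> dom_int \<Omega> h" "x \<notin> dom_int \<Omega> h"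
        using x dom_intD(1)[of "x - ?e" \<Omega> h] dom_intD(3)[of x \<Omega> h j] by auto
      then show "?g (x - ?e) = 0" using v g by (simp add: diff_plus_def int_supported_def)
    qed auto
    also have "\<dots> = (\<Sum>x\<in>(\<lambda>x. x - ?e) ` {x\<in>?D. x - ?e \<in> ?D}. ?g x)"
      by (subst sum.reindex) (auto simp: inj_on_def)
    also have "\<dots> \<le> (\<Sum>x\<in>?D. ?g x)"
      using fin by (intro sum_mono2) auto
    finally show ?thesis .
  qed
  moreover have "(\<Sum>x\<in>?D. (norm (diff_central h j v x))\<^sup>2) \<le> (\<Sum>x\<in>?D. (?g x + ?g (x - ?e)) / 2)"
    by (intro sum_mono norm_diff_central_le)
  ultimately show ?thesis by (simp add: sum_divide_distrib[symmetric] sum.distrib)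
qed

lemma poincare_vector:
  fixes e :: "real^3 \<Rightarrow> real^3"
  assumes A: "disc_poincare_const \<Omega> A" and h: "h > 0" and fin: "finite (grid_dom \<Omega> h)"
    and e: "int_supported \<Omega> h e"
  shows "(\<Sum>x\<in>grid_dom \<Omega> h. (norm (e x))\<^sup>2) \<le> A\<^sup>2 * (\<Sum>x\<in>grid_dom \<Omega> h. (norm (diff_plus h j e x))\<^sup>2)"
proof -
  let ?D = "grid_dom \<Omega> h" and ?I = "dom_int \<Omega> h"
  \<comment> \<open>The Poincare constant is formulated for functions that vanish at every point
    outside the domain, so the components of e are truncated first; on the grid this changes
    nothing.\<close>
  define f where "f = (\<lambda>k x. if x \<in> ?D then e x $ k else 0)"
  have fe: "f k x = e x $ k" if "x \<in> grid h" for k x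
    using e that by (auto simp: f_def int_supported_def dom_int_def)
  have 1: "(\<Sum>x\<in>?D. (e x $ k)\<^sup>2) \<le> A\<^sup>2 * (\<Sum>x\<in>?D. (diff_plus h j e x $ k)\<^sup>2)" for k
  proof -
    have "(\<Sum>x\<in>?D. \<bar>f k x\<bar>\<^sup>2) \<le> A\<^sup>2 * (\<Sum>x\<in>?I. \<bar>diff_plus h j (f k) x\<bar>\<^sup>2)"
    proof -
      have "grid_fun \<Omega> h (f k)" by (simp add: f_def grid_fun_def)
      moreover have "f k x = 0" if "x \<in> dom_bdry \<Omega> h" for x
        using e that dom_bdry_subset[of \<Omega> h] by (auto simp: fe int_supported_def dom_int_def grid_domD(2))
      ultimately show ?thesis using A h unfolding disc_poincare_const_def by blast
    qed
    also have "\<dots> \<le> A\<^sup>2 * (\<Sum>x\<in>?D. \<bar>diff_plus h j (f k) x\<bar>\<^sup>2)"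
      using fin dom_int_subset by (intro mult_left_mono sum_mono2) auto
    also have "(\<Sum>x\<in>?D. \<bar>diff_plus h j (f k) x\<bar>\<^sup>2) = (\<Sum>x\<in>?D. (diff_plus h j e x $ k)\<^sup>2)"
      by (intro sum.cong refl) (simp add: diff_plus_def fe grid_domD(2) grid_shift)
    also have "(\<Sum>x\<in>?D. \<bar>f k x\<bar>\<^sup>2) = (\<Sum>x\<in>?D. (e x $ k)\<^sup>2)"
      by (intro sum.cong refl) (simp add: f_def)
    finally show ?thesis .
  qed
  have nrm: "(norm y)\<^sup>2 = (\<Sum>k\<in>UNIV. (y $ k)\<^sup>2)" for y :: "real^3"
    by (simp add: norm_vec_def L2_set_def sum_nonneg)
  have "(\<Sum>x\<in>?D. (norm (e x))\<^sup>2) = (\<Sum>k\<in>UNIV. \<Sum>x\<in>?D. (e x $ k)\<^sup>2)"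
    unfolding nrm by (rule sum.swap)
  also have "\<dots> \<le> (\<Sum>k\<in>UNIV. A\<^sup>2 * (\<Sum>x\<in>?D. (diff_plus h j e x $ k)\<^sup>2))"
    by (intro sum_mono 1)
  also have "\<dots> = A\<^sup>2 * (\<Sum>x\<in>?D. (norm (diff_plus h j e x))\<^sup>2)"
    unfolding nrm sum_distrib_left[symmetric] by (subst sum.swap) simp
  finally show ?thesis .
qed

text \<open>The equation is tested with e'. The implicit step yields the dissipation |e' - E|^2 / (2
  \<tau>), and E is the orthogonal projection of e, so passing from E to e costs nothing. Convection
  of e' by u drops out; convection of z' by E and the residual consume a quarter of the viscous term
  G each, which leaves one half of it.\<close>

lemma energy_step:
  fixes \<Omega> :: "(real^3) set" and h \<tau> \<beta> K P :: real and e e' E u z' r :: "real^3 \<Rightarrow> real^3" and p \<phi> :: "real^3 \<Rightarrow> real"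
  defines "N \<equiv> \<lambda>a::real^3 \<Rightarrow> real^3. \<Sum>x\<in>grid_dom \<Omega> h. (norm (a x))\<^sup>2"
    and "G \<equiv> \<Sum>j\<in>UNIV. \<Sum>x\<in>grid_dom \<Omega> h. (norm (diff_plus h j e' x))\<^sup>2"
  assumes fin: "finite (grid_dom \<Omega> h)" and \<tau>: "\<tau> > 0" and \<beta>: "\<beta> \<ge> 0"
    and supp: "int_supported \<Omega> h e" "int_supported \<Omega> h e'" "int_supported \<Omega> h E" "int_supported \<Omega> h u"
    and div: "\<And>x. x \<in> grid_dom \<Omega> h \<Longrightarrow> disc_div h u x = 0"
      "\<And>x. x \<in> grid_dom \<Omega> h \<Longrightarrow> disc_div h E x = 0"
    and z': "\<And>x. x \<in> grid h \<Longrightarrow> norm (z' x) \<le> \<beta>"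
    and dec: "\<And>x. x \<in> dom_int \<Omega> h \<Longrightarrow> E x + disc_grad h \<phi> x = e x"
    and eq: "\<And>x. x \<in> dom_int \<Omega> h \<Longrightarrow> (e' x - E x) /\<^sub>R \<tau> =
       - convection h u e' x - convection h E z' x + (\<Sum>j\<in>UNIV. diff_second h j e' x) - r x + disc_grad h p x"
    and r: "- (\<Sum>x\<in>grid_dom \<Omega> h. r x \<bullet> e' x) \<le> G / 4 + K"
    and p: "(\<Sum>x\<in>dom_int \<Omega> h. (norm (disc_grad h p x))\<^sup>2) \<le> P"
  shows "(N e' - N e) / (2 * \<tau>) + G / 2 \<le> \<beta>\<^sup>2 * N e + K + \<tau> / 2 * P"
proof -
  let ?D = "grid_dom \<Omega> h" and ?I = "dom_int \<Omega> h"
  have onD: "(\<Sum>x\<in>?I. f x) = (\<Sum>x\<in>?D. f x)" if "\<And>x. x \<in> grid h \<Longrightarrow> x \<notin> ?I \<Longrightarrow> f x = (0::real)" for f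
    using fin that dom_int_subset by (intro sum.mono_neutral_left) (auto simp: grid_domD(2))
  have z0: "e x = 0" "e' x = 0" "E x = 0" "u x = 0" if "x \<in> grid h" "x \<notin> ?I" for x
    using supp that by (auto simp: int_supported_def)
  \<comment> \<open>Pythagoras: E is solenoidal and supported in the interior, hence orthogonal to
    the gradient part of e.\<close>
  have NE: "N e = N E + (\<Sum>x\<in>?I. (norm (disc_grad h \<phi> x))\<^sup>2)"
  proof -
    have "N e = (\<Sum>x\<in>?I. (norm (e x))\<^sup>2)" unfolding N_def by (rule onD[symmetric]) (simp add: z0)
    also have "\<dots> = (\<Sum>x\<in>?I. (norm (E x))\<^sup>2 + 2 * (E x \<bullet> disc_grad h \<phi> x) + (norm (disc_grad h \<phi> x))\<^sup>2)"
      by (intro sum.cong refl)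
        (simp add: dec[symmetric] power2_norm_eq_inner inner_add_left inner_add_right inner_commute)
    also have "\<dots> = (\<Sum>x\<in>?I. (norm (E x))\<^sup>2) + 2 * (\<Sum>x\<in>?I. E x \<bullet> disc_grad h \<phi> x)
        + (\<Sum>x\<in>?I. (norm (disc_grad h \<phi> x))\<^sup>2)"
      by (simp add: sum.distrib sum_distrib_left)
    also have "(\<Sum>x\<in>?I. E x \<bullet> disc_grad h \<phi> x) = (\<Sum>x\<in>?D. E x \<bullet> disc_grad h \<phi> x)"
      by (rule onD) (simp add: z0)
    also have "\<dots> = 0" using sum_grad_div[OF fin supp(3), of \<phi>] div(2) by simp
    also have "(\<Sum>x\<in>?I. (norm (E x))\<^sup>2) = N E" unfolding N_def by (rule onD) (simp add: z0)
    finally show ?thesis by simp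
  qed
  then have NEle: "N E \<le> N e" by (simp add: sum_nonneg)
  define Q where "Q = (\<Sum>x\<in>?D. (norm (e' x - E x))\<^sup>2)"
  have lhs: "(\<Sum>x\<in>?D. ((e' x - E x) /\<^sub>R \<tau>) \<bullet> e' x) = (N e' - N E + Q) / (2 * \<tau>)"
  proof -
    have "((e' x - E x) /\<^sub>R \<tau>) \<bullet> e' x = ((norm (e' x))\<^sup>2 - (norm (E x))\<^sup>2 + (norm (e' x - E x))\<^sup>2) / (2 * \<tau>)" for x
      using \<tau> by (simp add: power2_norm_eq_inner inner_diff_left inner_diff_right inner_commute field_simps)
    then show ?thesis
      by (simp add: N_def Q_def sum_divide_distrib[symmetric] sum.distrib sum_subtractf)
  qed
  have skew1: "(\<Sum>x\<in>?D. convection h u e' x \<bullet> e' x) = 0"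
    using convection_skew[OF fin supp(4) div(1), of e' e'] by simp
  \<comment> \<open>Skew symmetry moves the difference from z' to e', so only the supremum of z'
    enters and none of its derivatives.\<close>
  have skew2: "- (\<Sum>x\<in>?D. convection h E z' x \<bullet> e' x) \<le> \<beta>\<^sup>2 * N E + G / 4"
  proof -
    have pt: "E x $ j * (diff_central h j e' x \<bullet> nbr_mean h j z' x)
        \<le> \<beta>\<^sup>2 * (E x $ j)\<^sup>2 + (norm (diff_central h j e' x))\<^sup>2 / 4" if "x \<in> ?D" for x j
    proof -
      have "norm (nbr_mean h j z' x) \<le> \<beta>"
        using z'[OF grid_shift(1)[OF grid_domD(2)[OF that]], of j]
          z'[OF grid_shift(2)[OF grid_domD(2)[OF that]], of j]
          norm_triangle_ineq[of "z' (x + h *\<^sub>R axis j 1)" "z' (x - h *\<^sub>R axis j 1)"]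
        by (simp add: nbr_mean_def)
      then have "\<bar>diff_central h j e' x \<bullet> nbr_mean h j z' x\<bar> \<le> norm (diff_central h j e' x) * \<beta>"
        using Cauchy_Schwarz_ineq2 order_trans mult_left_mono[OF _ norm_ge_zero] by blast
      then have "\<bar>E x $ j\<bar> * \<bar>diff_central h j e' x \<bullet> nbr_mean h j z' x\<bar>
          \<le> \<bar>E x $ j\<bar> * (norm (diff_central h j e' x) * \<beta>)"
        by (intro mult_left_mono) auto
      then have "E x $ j * (diff_central h j e' x \<bullet> nbr_mean h j z' x)
          \<le> \<bar>E x $ j\<bar> * (norm (diff_central h j e' x) * \<beta>)"
        unfolding abs_mult[symmetric] by linarith
      also have "\<dots> \<le> (\<beta> * \<bar>E x $ j\<bar>)\<^sup>2 + (norm (diff_central h j e' x))\<^sup>2 / 4"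
        using zero_le_power2[of "\<beta> * \<bar>E x $ j\<bar> - norm (diff_central h j e' x) / 2"]
        by (simp add: power2_eq_square algebra_simps)
      finally show ?thesis by (simp add: power_mult_distrib)
    qed
    have "- (\<Sum>x\<in>?D. convection h E z' x \<bullet> e' x) = (\<Sum>x\<in>?D. convection h E e' x \<bullet> z' x)"
      using convection_skew[OF fin supp(3) div(2), of z' e'] by simp
    also have "\<dots> = (\<Sum>j\<in>UNIV. \<Sum>x\<in>?D. E x $ j * (diff_central h j e' x \<bullet> nbr_mean h j z' x))"
      by (rule convection_adjoint[OF fin supp(3)])
    also have "\<dots> \<le> (\<Sum>j\<in>UNIV. \<Sum>x\<in>?D. \<beta>\<^sup>2 * (E x $ j)\<^sup>2 + (norm (diff_central h j e' x))\<^sup>2 / 4)"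
      by (intro sum_mono pt)
    also have "\<dots> = \<beta>\<^sup>2 * (\<Sum>j\<in>UNIV. \<Sum>x\<in>?D. (E x $ j)\<^sup>2)
        + (\<Sum>j\<in>UNIV. \<Sum>x\<in>?D. (norm (diff_central h j e' x))\<^sup>2) / 4"
      by (simp add: sum.distrib sum_distrib_left sum_divide_distrib)
    also have "(\<Sum>j\<in>UNIV. \<Sum>x\<in>?D. (E x $ j)\<^sup>2) = N E"
      unfolding N_def by (subst sum.swap) (simp add: norm_vec_def L2_set_def sum_nonneg)
    also have "(\<Sum>j\<in>UNIV. \<Sum>x\<in>?D. (norm (diff_central h j e' x))\<^sup>2) \<le> G"
      unfolding G_def by (intro sum_mono sum_diff_central_le[OF fin supp(2)])
    finally show ?thesis by simp
  qed
  have visc: "(\<Sum>x\<in>?D. (\<Sum>j\<in>UNIV. diff_second h j e' x) \<bullet> e' x) = - G"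
    unfolding inner_sum_left
    by (subst sum.swap) (simp add: sum_second_by_parts[OF fin supp(2)] G_def power2_norm_eq_inner sum_negf)
  \<comment> \<open>E is orthogonal to gradients, so the pressure acts on e' - E alone, and this is
    absorbed by the dissipation of the implicit step.\<close>
  have press: "(\<Sum>x\<in>?D. disc_grad h p x \<bullet> e' x) \<le> Q / (2 * \<tau>) + \<tau> / 2 * P"
  proof -
    have "(\<Sum>x\<in>?D. disc_grad h p x \<bullet> e' x) = (\<Sum>x\<in>?D. disc_grad h p x \<bullet> (e' x - E x))"
      using sum_grad_div[OF fin supp(3), of p] div(2)
      by (simp add: inner_diff_right sum_subtractf inner_commute)
    also have "\<dots> = (\<Sum>x\<in>?I. disc_grad h p x \<bullet> (e' x - E x))"
      by (rule onD[symmetric]) (simp add: z0)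
    also have "\<dots> \<le> (\<Sum>x\<in>?I. (norm (e' x - E x))\<^sup>2 / (2 * \<tau>) + \<tau> / 2 * (norm (disc_grad h p x))\<^sup>2)"
    proof (rule sum_mono)
      fix x
      define a b where "a = norm (disc_grad h p x)" and "b = norm (e' x - E x)"
      have "disc_grad h p x \<bullet> (e' x - E x) \<le> a * b" unfolding a_def b_def by (rule norm_cauchy_schwarz)
      also have "\<dots> \<le> b\<^sup>2 / (2 * \<tau>) + \<tau> / 2 * a\<^sup>2"
      proof -
        have "0 \<le> (b - \<tau> * a)\<^sup>2 / (2 * \<tau>)" using \<tau> by simp
        also have "\<dots> = b\<^sup>2 / (2 * \<tau>) + \<tau> / 2 * a\<^sup>2 - a * b"
          using \<tau> by (simp add: power2_eq_square field_simps)
        finally show ?thesis by simp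
      qed
      finally show "disc_grad h p x \<bullet> (e' x - E x)
        \<le> (norm (e' x - E x))\<^sup>2 / (2 * \<tau>) + \<tau> / 2 * (norm (disc_grad h p x))\<^sup>2" by (simp add: a_def b_def)
    qed
    also have "\<dots> = (\<Sum>x\<in>?I. (norm (e' x - E x))\<^sup>2) / (2 * \<tau>) + \<tau> / 2 * (\<Sum>x\<in>?I. (norm (disc_grad h p x))\<^sup>2)"
      by (simp add: sum.distrib sum_distrib_left sum_divide_distrib)
    also have "(\<Sum>x\<in>?I. (norm (e' x - E x))\<^sup>2) = Q" unfolding Q_def by (rule onD) (simp add: z0)
    finally show ?thesis using p \<tau> by (smt (verit, best) mult_left_mono divide_nonneg_pos)
  qed
  have "(\<Sum>x\<in>?D. ((e' x - E x) /\<^sub>R \<tau>) \<bullet> e' x) = (\<Sum>x\<in>?D. (- convection h u e' x - convection h E z' x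
      + (\<Sum>j\<in>UNIV. diff_second h j e' x) - r x + disc_grad h p x) \<bullet> e' x)"
    by (intro sum.cong refl) (metis eq z0(2) grid_domD(2) inner_zero_right)
  also have "\<dots> = - (\<Sum>x\<in>?D. convection h u e' x \<bullet> e' x) - (\<Sum>x\<in>?D. convection h E z' x \<bullet> e' x)
     + (\<Sum>x\<in>?D. (\<Sum>j\<in>UNIV. diff_second h j e' x) \<bullet> e' x) - (\<Sum>x\<in>?D. r x \<bullet> e' x)
     + (\<Sum>x\<in>?D. disc_grad h p x \<bullet> e' x)"
    by (simp add: inner_diff_left inner_add_left sum_subtractf sum.distrib sum_negf)
  also have "\<dots> \<le> \<beta>\<^sup>2 * N E + G / 4 - G + (G / 4 + K) + (Q / (2 * \<tau>) + \<tau> / 2 * P)"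
    unfolding skew1 visc using skew2 r press by linarith
  finally have "(N e' - N E + Q) / (2 * \<tau>) \<le> \<beta>\<^sup>2 * N E + G / 4 - G + (G / 4 + K) + (Q / (2 * \<tau>) + \<tau> / 2 * P)"
    unfolding lhs .
  moreover have "(N e' - N E + Q) / (2 * \<tau>) = (N e' - N E) / (2 * \<tau>) + Q / (2 * \<tau>)"
    by (simp add: add_divide_distrib)
  moreover have "(N e' - N e) / (2 * \<tau>) \<le> (N e' - N E) / (2 * \<tau>)"
    using NEle \<tau> by (intro divide_right_mono) auto
  moreover have "\<beta>\<^sup>2 * N E \<le> \<beta>\<^sup>2 * N e" using NEle by (intro mult_left_mono) auto
  ultimately show ?thesis by linarith
qed

section \<open>Lipschitz and second difference bounds\<close>

text \<open>The third bound is imposed only near \<open>x\<close>, so that it may be much smaller than the second one.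
  For \<open>\<rho> < 0\<close> the last two bounds are void and \<open>x\<close> is irrelevant.\<close>

definition diff_bounds ::
  "(real^3 \<Rightarrow> 'b::real_normed_vector) \<Rightarrow> real^3 \<Rightarrow> real \<Rightarrow> real \<Rightarrow> real \<Rightarrow> real \<Rightarrow> real \<Rightarrow> bool" where
  "diff_bounds f x \<rho> k l m n \<longleftrightarrow>
     (\<forall>y. norm (f y) \<le> k) \<and> (\<forall>y a. norm (f (y + a) - f y) \<le> l * norm a) \<and>
     (\<forall>y a. norm (y - x) + norm a \<le> \<rho> \<longrightarrow> norm (f (y + a) - f y) \<le> m * norm a) \<and>
     (\<forall>y a b. norm (y - x) + norm a + norm b \<le> \<rho> \<longrightarrow>
        norm (f (y + a + b) - f (y + a) - f (y + b) + f y) \<le> n * norm a * norm b)"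

abbreviation "regular f x \<rho> M \<equiv> diff_bounds f x \<rho> M M M M"

text \<open>Profile of an O(h) perturbation. Its global Lipschitz constant stays of order one,
  because the zero extension of the solution has a gradient jump at the boundary. Near x the
  constant is O(h), while second differences are merely bounded.\<close>

abbreviation "small_regular h f x \<rho> M \<equiv> diff_bounds f x \<rho> (M * h) M (M * h) M"

lemma diff_boundsD:
  assumes "diff_bounds f x \<rho> k l m n"
  shows "norm (f y) \<le> k" "norm (f (y + a) - f y) \<le> l * norm a"
    "norm (y - x) + norm a \<le> \<rho> \<Longrightarrow> norm (f (y + a) - f y) \<le> m * norm a"
    "norm (y - x) + norm a + norm b \<le> \<rho> \<Longrightarrow>
        norm (f (y + a + b) - f (y + a) - f (y + b) + f y) \<le> n * norm a * norm b"
  using assms unfolding diff_bounds_def by blast+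

lemma diff_bounds_nonneg:
  assumes "diff_bounds f x \<rho> k l m n"
  shows "k \<ge> 0" "l \<ge> 0"
proof -
  show "k \<ge> 0" using diff_boundsD(1)[OF assms, of x] norm_ge_zero order_trans by blast
  have "0 \<le> l * norm (axis 1 1 :: real^3)"
    using diff_boundsD(2)[OF assms, of x "axis 1 1"] norm_ge_zero order_trans by blast
  then show "l \<ge> 0" by (simp add: norm_axis_1)
qed

lemma diff_bounds_mono:
  assumes "diff_bounds f x \<rho> k l m n" "\<rho>' \<le> \<rho>" "k \<le> k'" "l \<le> l'" "m \<le> m'" "n \<le> n'"
  shows "diff_bounds f x \<rho>' k' l' m' n'"
  unfolding diff_bounds_def
proof (intro conjI allI impI)
  fix y a b :: "real^3"
  show "norm (f y) \<le> k'" using diff_boundsD(1)[OF assms(1), of y] assms(3) by linarith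
  show "norm (f (y + a) - f y) \<le> l' * norm a"
    using diff_boundsD(2)[OF assms(1), of y a] mult_right_mono[OF assms(4), of "norm a"] by simp
  show "norm (f (y + a) - f y) \<le> m' * norm a" if "norm (y - x) + norm a \<le> \<rho>'"
    using diff_boundsD(3)[OF assms(1), of y a] mult_right_mono[OF assms(5), of "norm a"] that assms(2) by simp
  show "norm (f (y + a + b) - f (y + a) - f (y + b) + f y) \<le> n' * norm a * norm b"
    if "norm (y - x) + norm a + norm b \<le> \<rho>'"
  proof -
    have "n * (norm a * norm b) \<le> n' * (norm a * norm b)" using assms(6) by (intro mult_right_mono) auto
    then show ?thesis
      using diff_boundsD(4)[OF assms(1), of y a b] that assms(2) by (simp add: mult.assoc)
  qed
qed

lemma diff_bounds_add:
  assumes f: "diff_bounds f x \<rho> k l m n" and g: "diff_bounds g x \<rho> k' l' m' n'"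
  shows "diff_bounds (\<lambda>y. f y + g y) x \<rho> (k + k') (l + l') (m + m') (n + n')"
  unfolding diff_bounds_def
proof (intro conjI allI impI)
  fix y a b :: "real^3"
  show "norm (f y + g y) \<le> k + k'"
    using norm_triangle_mono[OF diff_boundsD(1)[OF f] diff_boundsD(1)[OF g]] .
  have eq: "f (y + a) + g (y + a) - (f y + g y) = (f (y + a) - f y) + (g (y + a) - g y)" by simp
  show "norm (f (y + a) + g (y + a) - (f y + g y)) \<le> (l + l') * norm a"
    unfolding eq distrib_right
    using norm_triangle_mono[OF diff_boundsD(2)[OF f] diff_boundsD(2)[OF g]] .
  show "norm (f (y + a) + g (y + a) - (f y + g y)) \<le> (m + m') * norm a" if "norm (y - x) + norm a \<le> \<rho>"
    unfolding eq distrib_right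
    using norm_triangle_mono[OF diff_boundsD(3)[OF f that] diff_boundsD(3)[OF g that]] .
  have eq2: "f (y + a + b) + g (y + a + b) - (f (y + a) + g (y + a)) - (f (y + b) + g (y + b)) + (f y + g y)
      = (f (y + a + b) - f (y + a) - f (y + b) + f y) + (g (y + a + b) - g (y + a) - g (y + b) + g y)"
    by simp
  show "norm (f (y + a + b) + g (y + a + b) - (f (y + a) + g (y + a)) - (f (y + b) + g (y + b)) + (f y + g y))
      \<le> (n + n') * norm a * norm b" if "norm (y - x) + norm a + norm b \<le> \<rho>"
    unfolding eq2 distrib_right
    using norm_triangle_mono[OF diff_boundsD(4)[OF f that] diff_boundsD(4)[OF g that]] .
qed

lemma diff_bounds_linear:
  assumes f: "diff_bounds f x \<rho> k l m n" and L: "linear L" and B: "\<And>v. norm (L v) \<le> B * norm v" "B \<ge> 0"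
  shows "diff_bounds (\<lambda>y. L (f y)) x \<rho> (B * k) (B * l) (B * m) (B * n)"
  unfolding diff_bounds_def
proof (intro conjI allI impI)
  note sums = linear_diff[OF L, symmetric] linear_add[OF L, symmetric]
  have Ble: "norm (L v) \<le> B * c" if "norm v \<le> c" for v c
    using B(1)[of v] mult_left_mono[OF that B(2)] by linarith
  fix y a b :: "real^3"
  show "norm (L (f y)) \<le> B * k" by (intro Ble diff_boundsD(1)[OF f])
  show "norm (L (f (y + a)) - L (f y)) \<le> B * l * norm a"
    unfolding sums mult.assoc by (intro Ble diff_boundsD(2)[OF f])
  show "norm (L (f (y + a)) - L (f y)) \<le> B * m * norm a" if "norm (y - x) + norm a \<le> \<rho>"
    unfolding sums mult.assoc by (intro Ble diff_boundsD(3)[OF f that])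
  show "norm (L (f (y + a + b)) - L (f (y + a)) - L (f (y + b)) + L (f y)) \<le> B * n * norm a * norm b"
    if "norm (y - x) + norm a + norm b \<le> \<rho>"
    unfolding sums using Ble[OF diff_boundsD(4)[OF f that]] by (simp add: mult.assoc)
qed

lemma diff_bounds_minus:
  assumes "diff_bounds f x \<rho> k l m n"
  shows "diff_bounds (\<lambda>y. - f y) x \<rho> k l m n"
  using diff_bounds_linear[OF assms, of uminus 1] by (simp add: linear_uminus)

lemma diff_bounds_scale:
  assumes "diff_bounds f x \<rho> k l m n" "c \<ge> 0"
  shows "diff_bounds (\<lambda>y. c *\<^sub>R f y) x \<rho> (c * k) (c * l) (c * m) (c * n)"
  using diff_bounds_linear[OF assms(1), of "\<lambda>v. c *\<^sub>R v" c] assms(2) by (simp add: linear_scale_self)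

lemma diff_bounds_shift:
  assumes f: "diff_bounds f x \<rho> k l m n"
  shows "diff_bounds (\<lambda>y. f (y + s)) x (\<rho> - norm s) k l m n"
  unfolding diff_bounds_def
proof (intro conjI allI impI)
  fix y a b :: "real^3"
  have tri: "norm (y + s - x) \<le> norm (y - x) + norm s"
    using norm_triangle_ineq[of "y - x" s] by (simp add: algebra_simps)
  have c: "y + a + s = y + s + a" "y + b + s = y + s + b" "y + a + b + s = y + s + a + b" by simp_all
  show "norm (f (y + s)) \<le> k" by (rule diff_boundsD(1)[OF f])
  show "norm (f (y + a + s) - f (y + s)) \<le> l * norm a" unfolding c by (rule diff_boundsD(2)[OF f])
  show "norm (f (y + a + s) - f (y + s)) \<le> m * norm a" if "norm (y - x) + norm a \<le> \<rho> - norm s"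
    unfolding c using tri that by (intro diff_boundsD(3)[OF f]) linarith
  show "norm (f (y + a + b + s) - f (y + a + s) - f (y + b + s) + f (y + s)) \<le> n * norm a * norm b"
    if "norm (y - x) + norm a + norm b \<le> \<rho> - norm s"
    unfolding c using tri that by (intro diff_boundsD(4)[OF f]) linarith
qed

text \<open>Discrete Leibniz rule. The cross terms of the second difference are products of first
  differences near x, so only the local constants m and m' occur in them.\<close>

lemma diff_bounds_mult:
  fixes c :: "real^3 \<Rightarrow> real" and f :: "real^3 \<Rightarrow> 'b::real_normed_vector"
  assumes c: "diff_bounds c x \<rho> k l m n" and f: "diff_bounds f x \<rho> k' l' m' n'"
    and pos: "m \<ge> 0" "m' \<ge> 0" "n \<ge> 0" "n' \<ge> 0"
  shows "diff_bounds (\<lambda>y. c y *\<^sub>R f y) x \<rho> (k * k') (k * l' + l * k') (k * m' + m * k')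
           (k * n' + 2 * m * m' + n * k')"
  unfolding diff_bounds_def
proof (intro conjI allI impI)
  note nn = diff_bounds_nonneg[OF c] diff_bounds_nonneg[OF f]
  have sc: "norm (u *\<^sub>R v) \<le> p * q" if "norm u \<le> p" "norm v \<le> q" for u :: real and v :: 'b and p q
  proof -
    have "0 \<le> p" using that(1) norm_ge_zero order_trans by blast
    then show ?thesis using that by (simp add: mult_mono)
  qed
  fix y a b :: "real^3"
  show "norm (c y *\<^sub>R f y) \<le> k * k'" by (intro sc diff_boundsD(1)[OF c] diff_boundsD(1)[OF f])
  have eq: "c (y + a) *\<^sub>R f (y + a) - c y *\<^sub>R f y = c (y + a) *\<^sub>R (f (y + a) - f y) + (c (y + a) - c y) *\<^sub>R f y"
    by (simp add: algebra_simps)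
  have "norm (c (y + a) *\<^sub>R f (y + a) - c y *\<^sub>R f y) \<le> k * (l' * norm a) + (l * norm a) * k'"
    unfolding eq by (intro norm_triangle_mono sc diff_boundsD(1,2)[OF c] diff_boundsD(1,2)[OF f])
  then show "norm (c (y + a) *\<^sub>R f (y + a) - c y *\<^sub>R f y) \<le> (k * l' + l * k') * norm a"
    by (simp add: algebra_simps)
  show "norm (c (y + a) *\<^sub>R f (y + a) - c y *\<^sub>R f y) \<le> (k * m' + m * k') * norm a"
    if "norm (y - x) + norm a \<le> \<rho>"
  proof -
    have "norm (c (y + a) *\<^sub>R f (y + a) - c y *\<^sub>R f y) \<le> k * (m' * norm a) + (m * norm a) * k'"
      unfolding eq using that
      by (intro norm_triangle_mono sc diff_boundsD(1,3)[OF c] diff_boundsD(1,3)[OF f])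
    then show ?thesis by (simp add: algebra_simps)
  qed
  show "norm (c (y + a + b) *\<^sub>R f (y + a + b) - c (y + a) *\<^sub>R f (y + a) - c (y + b) *\<^sub>R f (y + b) + c y *\<^sub>R f y)
      \<le> (k * n' + 2 * m * m' + n * k') * norm a * norm b" if "norm (y - x) + norm a + norm b \<le> \<rho>"
  proof -
    have ya: "norm (y + a - x) + norm b \<le> \<rho>"
      using norm_triangle_ineq[of "y - x" a] that by (simp add: algebra_simps)
    have yb: "norm (y + b - x) + norm a \<le> \<rho>"
      using norm_triangle_ineq[of "y - x" b] that by (simp add: algebra_simps)
    have y1: "norm (y - x) + norm a \<le> \<rho>" "norm (y - x) + norm b \<le> \<rho>" using that by (smt (verit) norm_ge_zero)+
    have c1: "norm (c (y + a + b) - c (y + b)) \<le> m * norm a"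
      using diff_boundsD(3)[OF c yb] by (simp add: add_ac)
    have c2: "norm (c (y + a + b) - c (y + a)) \<le> m * norm b" by (rule diff_boundsD(3)[OF c ya])
    have "c (y + a + b) *\<^sub>R f (y + a + b) - c (y + a) *\<^sub>R f (y + a) - c (y + b) *\<^sub>R f (y + b) + c y *\<^sub>R f y
      = c (y + a + b) *\<^sub>R (f (y + a + b) - f (y + a) - f (y + b) + f y)
        + (c (y + a + b) - c (y + b)) *\<^sub>R (f (y + b) - f y)
        + (c (y + a + b) - c (y + a)) *\<^sub>R (f (y + a) - f y)
        + (c (y + a + b) - c (y + a) - c (y + b) + c y) *\<^sub>R f y"
      by (simp add: algebra_simps)
    also have "norm \<dots> \<le> k * (n' * norm a * norm b) + (m * norm a) * (m' * norm b)
        + (m * norm b) * (m' * norm a) + (n * norm a * norm b) * k'"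
      by (intro norm_triangle_mono sc c1 c2 diff_boundsD(1)[OF c] diff_boundsD(1)[OF f]
          diff_boundsD(3)[OF f y1(1)] diff_boundsD(3)[OF f y1(2)] diff_boundsD(4)[OF f that] diff_boundsD(4)[OF c that])
    finally show ?thesis by (simp add: algebra_simps)
  qed
qed

lemma diff_bounds_sum:
  assumes "finite I" "\<And>i. i \<in> I \<Longrightarrow> diff_bounds (f i) x \<rho> k l m n"
  shows "diff_bounds (\<lambda>y. \<Sum>i\<in>I. f i y) x \<rho> (real (card I) * k) (real (card I) * l) (real (card I) * m) (real (card I) * n)"
  using assms
proof (induction I)
  case empty then show ?case by (simp add: diff_bounds_def)
next
  case (insert i I)
  then have "diff_bounds (\<lambda>y. f i y + (\<Sum>i\<in>I. f i y)) x \<rho> (k + card I * k) (l + card I * l)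
      (m + card I * m) (n + card I * n)"
    by (intro diff_bounds_add) auto
  then show ?case using insert.hyps by (simp add: algebra_simps)
qed

lemma diff_bounds_sum_list:
  assumes "\<And>p. p \<in> set P \<Longrightarrow> diff_bounds (f p) x \<rho> k l m n"
  shows "diff_bounds (\<lambda>y. \<Sum>p\<leftarrow>P. f p y) x \<rho> (real (length P) * k) (real (length P) * l) (real (length P) * m) (real (length P) * n)"
  using assms
proof (induction P)
  case Nil then show ?case by (simp add: diff_bounds_def)
next
  case (Cons p P)
  then have "diff_bounds (\<lambda>y. f p y + (\<Sum>i\<leftarrow>P. f i y)) x \<rho> (k + length P * k) (l + length P * l)
      (m + length P * m) (n + length P * n)"
    by (intro diff_bounds_add) auto
  then show ?case by (simp add: algebra_simps)
qed

text \<open>Differencing over a distance O(h) gains one order: for values by the Lipschitz bound,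
  for local first differences by mixed second differences. The other two bounds gain nothing and
  follow from the triangle inequality, whence the 2 in K + 2.\<close>

lemma regular_shift_diff:
  assumes f: "regular f x \<rho> M" and s: "norm s \<le> K * h" and h: "h \<ge> 0" and K: "K \<ge> 0"
  shows "small_regular h (\<lambda>y. f (y + s) - f y) x (\<rho> - K * h) ((K + 2) * M)"
  unfolding diff_bounds_def
proof (intro conjI allI impI)
  note M = diff_bounds_nonneg(1)[OF f]
  have "M * norm s \<le> M * (K * h)" using s M by (intro mult_left_mono)
  moreover have "0 \<le> 2 * M * h" using M h by simp
  ultimately have bd: "M * norm s \<le> (K + 2) * M * h" by (simp add: algebra_simps)
  fix y a b :: "real^3"
  show "norm (f (y + s) - f y) \<le> (K + 2) * M * h" using diff_boundsD(2)[OF f, of y s] bd by linarith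
  have eq: "f (y + a + s) - f (y + a) - (f (y + s) - f y) = f (y + a + s) - f (y + a) - f (y + s) + f y" by simp
  have "norm (f (y + a + s) - f (y + a) - (f (y + s) - f y)) \<le> 2 * M * norm a"
    using norm_triangle_ineq4[of "f (y + s + a) - f (y + s)" "f (y + a) - f y"]
      diff_boundsD(2)[OF f, of "y + s" a] diff_boundsD(2)[OF f, of y a]
    by (simp add: algebra_simps)
  moreover have "2 * M * norm a \<le> (K + 2) * M * norm a" using K M by (intro mult_right_mono) auto
  ultimately show "norm (f (y + a + s) - f (y + a) - (f (y + s) - f y)) \<le> (K + 2) * M * norm a" by linarith
  show "norm (f (y + a + s) - f (y + a) - (f (y + s) - f y)) \<le> (K + 2) * M * h * norm a"
    if "norm (y - x) + norm a \<le> \<rho> - K * h"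
  proof -
    have "norm (f (y + a + s) - f (y + a) - (f (y + s) - f y)) \<le> M * norm a * norm s"
      unfolding eq using that s by (intro diff_boundsD(4)[OF f]) linarith
    also have "\<dots> = M * norm s * norm a" by simp
    also have "\<dots> \<le> (K + 2) * M * h * norm a" using bd by (intro mult_right_mono) auto
    finally show ?thesis .
  qed
  show "norm (f (y + a + b + s) - f (y + a + b) - (f (y + a + s) - f (y + a)) - (f (y + b + s) - f (y + b))
      + (f (y + s) - f y)) \<le> (K + 2) * M * norm a * norm b"
    if r: "norm (y - x) + norm a + norm b \<le> \<rho> - K * h"
  proof -
    have "norm (y + s - x) \<le> norm (y - x) + norm s"
      using norm_triangle_ineq[of "y - x" s] by (simp add: algebra_simps)
    then have 1: "norm (f (y + s + a + b) - f (y + s + a) - f (y + s + b) + f (y + s)) \<le> M * norm a * norm b"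
      using r s by (intro diff_boundsD(4)[OF f]) linarith
    have "0 \<le> K * h" using K h by simp
    then have 2: "norm (f (y + a + b) - f (y + a) - f (y + b) + f y) \<le> M * norm a * norm b"
      using r by (intro diff_boundsD(4)[OF f]) linarith
    have "f (y + a + b + s) - f (y + a + b) - (f (y + a + s) - f (y + a)) - (f (y + b + s) - f (y + b))
      + (f (y + s) - f y) = (f (y + s + a + b) - f (y + s + a) - f (y + s + b) + f (y + s))
        - (f (y + a + b) - f (y + a) - f (y + b) + f y)"
      by (simp add: algebra_simps)
    also have "norm \<dots> \<le> M * norm a * norm b + M * norm a * norm b"
      using norm_triangle_ineq4 1 2 by (smt (verit))
    also have "\<dots> = 2 * M * (norm a * norm b)" by simp
    also have "\<dots> \<le> (K + 2) * M * (norm a * norm b)" using K M by (intro mult_right_mono) auto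
    finally show ?thesis by (simp add: mult.assoc)
  qed
qed

lemma small_regular_imp_regular:
  assumes "small_regular h f x \<rho> M" "0 \<le> h" "h \<le> 1"
  shows "regular f x \<rho> M"
proof -
  have "M \<ge> 0" using diff_bounds_nonneg[OF assms(1)] by simp
  then have "M * h \<le> M" using assms by (simp add: mult_left_le)
  then show ?thesis by (intro diff_bounds_mono[OF assms(1)]) auto
qed

lemma small_regular_scaleR:
  assumes c: "small_regular h c x \<rho> M" and f: "regular f x \<rho> N" and h: "0 \<le> h" "h \<le> 1"
  shows "small_regular h (\<lambda>y. c y *\<^sub>R f y) x \<rho> (4 * M * N)"
proof -
  have MN: "M \<ge> 0" "N \<ge> 0" using diff_bounds_nonneg[OF c] diff_bounds_nonneg[OF f] by auto
  have "M * N * h \<le> M * N" "0 \<le> M * N" "0 \<le> M * N * h" using MN h by (simp_all add: mult_left_le)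
  moreover have "M * h * N = M * N * h" "M * (N * h) = M * N * h" "2 * (M * h) * N = 2 * (M * N * h)"
    "2 * M * (N * h) = 2 * (M * N * h)" "4 * M * N = 4 * (M * N)" "4 * M * N * h = 4 * (M * N * h)" by simp_all
  ultimately show ?thesis
    using MN h by (intro diff_bounds_mono[OF diff_bounds_mult[OF c f]]) (linarith | simp)+
qed

lemma scaleR_small_regular:
  assumes c: "regular c x \<rho> M" and f: "small_regular h f x \<rho> N" and h: "0 \<le> h" "h \<le> 1"
  shows "small_regular h (\<lambda>y. c y *\<^sub>R f y) x \<rho> (4 * M * N)"
proof -
  have MN: "M \<ge> 0" "N \<ge> 0" using diff_bounds_nonneg[OF c] diff_bounds_nonneg[OF f] by auto
  have "M * N * h \<le> M * N" "0 \<le> M * N" "0 \<le> M * N * h" using MN h by (simp_all add: mult_left_le)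
  moreover have "M * h * N = M * N * h" "M * (N * h) = M * N * h" "2 * (M * h) * N = 2 * (M * N * h)"
    "2 * M * (N * h) = 2 * (M * N * h)" "4 * M * N = 4 * (M * N)" "4 * M * N * h = 4 * (M * N * h)" by simp_all
  ultimately show ?thesis
    using MN h by (intro diff_bounds_mono[OF diff_bounds_mult[OF c f]]) (linarith | simp)+
qed

lemma regular_scaleR:
  assumes c: "regular c x \<rho> M" and f: "regular f x \<rho> N"
  shows "regular (\<lambda>y. c y *\<^sub>R f y) x \<rho> (4 * M * N)"
proof -
  have MN: "M \<ge> 0" "N \<ge> 0" using diff_bounds_nonneg[OF c] diff_bounds_nonneg[OF f] by auto
  then have "0 \<le> M * N" by simp
  moreover have "2 * M * N = 2 * (M * N)" "4 * M * N = 4 * (M * N)" by simp_all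
  ultimately show ?thesis
    using MN by (intro diff_bounds_mono[OF diff_bounds_mult[OF c f]]) (auto simp: algebra_simps)
qed

section \<open>Cutoff functions\<close>

lemma has_real_derivative_quadratic:
  fixes f :: "real \<Rightarrow> real"
  assumes "\<And>v. \<bar>f v - f u - d * (v - u)\<bar> \<le> C * (v - u)\<^sup>2"
  shows "(f has_real_derivative d) (at u)"
  unfolding DERIV_def
proof (rule Lim_null[THEN iffD2], rule Lim_null_comparison)
  show "\<forall>\<^sub>F k in at 0. norm ((f (u + k) - f u) / k - d) \<le> \<bar>C\<bar> * \<bar>k\<bar>"
  proof (rule eventually_at_filter[THEN iffD2], rule always_eventually, intro allI impI)
    fix k :: real assume k: "k \<noteq> 0"
    have "\<bar>(f (u + k) - f u) / k - d\<bar> = \<bar>f (u + k) - f u - d * k\<bar> / \<bar>k\<bar>"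
      using k by (simp add: abs_divide[symmetric] diff_divide_distrib)
    also have "\<dots> \<le> C * k\<^sup>2 / \<bar>k\<bar>" using assms[of "u + k"] by (intro divide_right_mono) auto
    also have "\<dots> = C * \<bar>k\<bar>" using k by (simp add: power2_eq_square abs_if divide_simps)
    also have "\<dots> \<le> \<bar>C\<bar> * \<bar>k\<bar>" by (intro mult_right_mono) auto
    finally show "norm ((f (u + k) - f u) / k - d) \<le> \<bar>C\<bar> * \<bar>k\<bar>" by simp
  qed
  show "((\<lambda>k. \<bar>C\<bar> * \<bar>k\<bar>) \<longlongrightarrow> 0) (at (0::real))" by (rule tendsto_eq_intros refl | simp)+
qed

definition possq :: "real \<Rightarrow> real" where "possq u = (max 0 u)\<^sup>2"

lemma possq_deriv: "(possq has_real_derivative 2 * max 0 u) (at u)"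
proof (rule has_real_derivative_quadratic[where C=1])
  fix v :: real
  have sq: "max 0 v * v = max 0 v * max 0 v" "max 0 u * u = max 0 u * max 0 u" by (auto simp: max_def)
  have "\<bar>(max 0 v)\<^sup>2 - (max 0 u)\<^sup>2 - 2 * max 0 u * (v - u)\<bar> \<le> (v - u)\<^sup>2"
  proof (cases "u \<ge> 0")
    case u: True
    show ?thesis
    proof (cases "v \<ge> 0")
      case True
      have "v\<^sup>2 - u\<^sup>2 - 2 * u * (v - u) = (v - u)\<^sup>2" by (simp add: power2_eq_square algebra_simps)
      then have "\<bar>v\<^sup>2 - u\<^sup>2 - 2 * u * (v - u)\<bar> = (v - u)\<^sup>2" by simp
      then show ?thesis using u True by simp
    next
      case False
      then have "u * v \<le> 0" using u by (simp add: mult_nonneg_nonpos)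
      moreover have "\<bar>(max 0 v)\<^sup>2 - (max 0 u)\<^sup>2 - 2 * max 0 u * (v - u)\<bar> = \<bar>u * u - 2 * (u * v)\<bar>"
        using u False by (simp add: power2_eq_square algebra_simps)
      moreover have "(v - u)\<^sup>2 = u * u - 2 * (u * v) + v * v" by (simp add: power2_eq_square algebra_simps)
      moreover have "0 \<le> v * v" "0 \<le> u * u" by simp_all
      ultimately show ?thesis by linarith
    qed
  next
    case u: False
    have "(max 0 v)\<^sup>2 \<le> (v - u)\<^sup>2" using u by (cases "v \<ge> 0") (auto intro: power_mono)
    then show ?thesis using u by simp
  qed
  then show "\<bar>possq v - possq u - 2 * max 0 u * (v - u)\<bar> \<le> 1 * (v - u)\<^sup>2" by (simp add: possq_def)
qed

text \<open>A quadratic spline with second derivative 4 on (0, 1/2) and -4 on (1/2, 1). A Lipschitz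
  derivative is enough smoothness, because the cutoff enters through second differences
  only.\<close>

definition smooth_step :: "real \<Rightarrow> real" where
  "smooth_step u = 2 * possq u - 4 * possq (u - 1/2) + 2 * possq (u - 1)"

lemma smooth_step_0: "u \<le> 0 \<Longrightarrow> smooth_step u = 0"
  by (simp add: smooth_step_def possq_def)

lemma smooth_step_1: "u \<ge> 1 \<Longrightarrow> smooth_step u = 1"
  by (simp add: smooth_step_def possq_def power2_eq_square algebra_simps)

definition smooth_step' :: "real \<Rightarrow> real" where
  "smooth_step' u = 4 * max 0 u - 8 * max 0 (u - 1/2) + 4 * max 0 (u - 1)"

lemma smooth_step_deriv: "(smooth_step has_real_derivative smooth_step' u) (at u)"
proof -
  have s: "((\<lambda>u. possq (u - c)) has_real_derivative 2 * max 0 (u - c)) (at u)" for c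
    using DERIV_shift[of possq "2 * max 0 (u - c)" u "- c"] possq_deriv[of "u - c"] by simp
  show ?thesis
    unfolding smooth_step_def[abs_def] smooth_step'_def
    by (rule derivative_eq_intros s[of 0, simplified] s[of "1/2"] s[of 1] refl | simp)+
qed

lemma smooth_step'_bound: "\<bar>smooth_step' u\<bar> \<le> 2"
  unfolding smooth_step'_def by (auto simp: max_def)

lemma smooth_step'_lipschitz: "\<bar>smooth_step' u - smooth_step' v\<bar> \<le> 16 * \<bar>u - v\<bar>"
proof -
  have "\<bar>max 0 (u - c) - max 0 (v - c)\<bar> \<le> \<bar>u - v\<bar>" for c by (auto simp: max_def)
  from this[of 0] this[of "1/2"] this[of 1] show ?thesis
    unfolding smooth_step'_def by (simp add: abs_le_iff)
qed

lemma smooth_step_lipschitz: "\<bar>smooth_step u - smooth_step v\<bar> \<le> 2 * \<bar>u - v\<bar>"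
  using field_differentiable_bound[of UNIV smooth_step smooth_step' 2 u v]
    smooth_step_deriv smooth_step'_bound by simp

lemma smooth_step_bound: "\<bar>smooth_step u\<bar> \<le> 2"
proof -
  consider "u \<le> 0" | "u \<ge> 1" | "0 \<le> u" "u \<le> 1" by linarith
  then show ?thesis
  proof cases
    case 3
    then show ?thesis using smooth_step_lipschitz[of u 0] smooth_step_0[of 0] by simp
  qed (auto simp: smooth_step_0 smooth_step_1)
qed

text \<open>Mean value inequality, in the variable a, for the increment of the step by b; the
  derivative of that increment is O(|b|).\<close>

lemma smooth_step_second_diff:
  "\<bar>smooth_step (u + a + b) - smooth_step (u + a) - smooth_step (u + b) + smooth_step u\<bar> \<le> 16 * \<bar>a\<bar> * \<bar>b\<bar>"
proof -
  define \<psi> where "\<psi> = (\<lambda>t. smooth_step (u + t + b) - smooth_step (u + t))"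
  have d: "(\<psi> has_real_derivative smooth_step' (u + t + b) - smooth_step' (u + t)) (at t)" for t
  proof -
    have s: "((\<lambda>t. smooth_step (u + t + c)) has_real_derivative smooth_step' (u + t + c)) (at t)" for c
      using DERIV_shift[of smooth_step "smooth_step' (u + t + c)" t "u + c"] smooth_step_deriv[of "u + t + c"]
      by (simp add: add_ac)
    show ?thesis unfolding \<psi>_def using DERIV_diff[OF s[of b] s[of 0]] by simp
  qed
  have lip: "\<bar>smooth_step' (u + t + b) - smooth_step' (u + t)\<bar> \<le> 16 * \<bar>b\<bar>" for t
    using smooth_step'_lipschitz[of "u + t + b" "u + t"] by simp
  have "norm (\<psi> a - \<psi> 0) \<le> (16 * \<bar>b\<bar>) * norm (a - 0)"
    by (rule field_differentiable_bound[of UNIV \<psi> "\<lambda>t. smooth_step' (u + t + b) - smooth_step' (u + t)"])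
      (use d lip in simp_all)
  then show ?thesis by (simp add: \<psi>_def algebra_simps)
qed

text \<open>The constant dominates at once the bound 2, the Lipschitz constant 2 |\<beta>| and the
  second difference constant 16 \<beta>^2.\<close>

lemma regular_smooth_step:
  "regular (\<lambda>x::real^3. smooth_step (\<alpha> + \<beta> * x $ i)) y \<rho> (2 + 16 * \<beta>\<^sup>2)"
proof -
  have ab: "2 * \<bar>\<beta>\<bar> \<le> 2 + 16 * \<beta>\<^sup>2"
  proof -
    have "2 * \<bar>\<beta>\<bar> \<le> 1 + \<beta>\<^sup>2"
      using zero_le_power2[of "\<bar>\<beta>\<bar> - 1"] by (simp add: power2_eq_square algebra_simps)
    then show ?thesis using zero_le_power2[of \<beta>] by linarith
  qed
  have lip: "\<bar>smooth_step (\<alpha> + \<beta> * (z + a) $ i) - smooth_step (\<alpha> + \<beta> * z $ i)\<bar> \<le> (2 + 16 * \<beta>\<^sup>2) * norm a"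
    for z a :: "real^3"
  proof -
    have "\<bar>smooth_step (\<alpha> + \<beta> * (z + a) $ i) - smooth_step (\<alpha> + \<beta> * z $ i)\<bar> \<le> (2 * \<bar>\<beta>\<bar>) * \<bar>a $ i\<bar>"
      using smooth_step_lipschitz[of "\<alpha> + \<beta> * (z + a) $ i" "\<alpha> + \<beta> * z $ i"]
      by (simp add: distrib_left abs_mult)
    also have "\<dots> \<le> (2 + 16 * \<beta>\<^sup>2) * norm a"
      using ab component_le_norm_cart[of a i] by (intro mult_mono) auto
    finally show ?thesis .
  qed
  have second: "\<bar>smooth_step (\<alpha> + \<beta> * (z + a + b) $ i) - smooth_step (\<alpha> + \<beta> * (z + a) $ i)
     - smooth_step (\<alpha> + \<beta> * (z + b) $ i) + smooth_step (\<alpha> + \<beta> * z $ i)\<bar> \<le> (2 + 16 * \<beta>\<^sup>2) * norm a * norm b"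
    for z a b :: "real^3"
  proof -
    have "\<bar>smooth_step (\<alpha> + \<beta> * (z + a + b) $ i) - smooth_step (\<alpha> + \<beta> * (z + a) $ i)
     - smooth_step (\<alpha> + \<beta> * (z + b) $ i) + smooth_step (\<alpha> + \<beta> * z $ i)\<bar>
      \<le> 16 * \<bar>\<beta> * a $ i\<bar> * \<bar>\<beta> * b $ i\<bar>"
      using smooth_step_second_diff[of "\<alpha> + \<beta> * z $ i" "\<beta> * a $ i" "\<beta> * b $ i"]
      by (simp add: algebra_simps)
    also have "\<dots> = 16 * \<beta>\<^sup>2 * (\<bar>a $ i\<bar> * \<bar>b $ i\<bar>)" by (simp add: abs_mult power2_eq_square)
    also have "\<dots> \<le> (2 + 16 * \<beta>\<^sup>2) * (norm a * norm b)"
      using component_le_norm_cart[of a i] component_le_norm_cart[of b i] by (intro mult_mono) auto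
    finally show ?thesis by (simp add: mult.assoc)
  qed
  have bound: "\<bar>smooth_step u\<bar> \<le> 2 + 16 * \<beta>\<^sup>2" for u
    using smooth_step_bound[of u] zero_le_power2[of \<beta>] by linarith
  show ?thesis
    unfolding diff_bounds_def real_norm_def using lip second bound by blast
qed

text \<open>Product over the coordinates of a falling and a rising step. The bounds hold around
  every point and for every radius, so a product with the cutoff keeps the local information of the
  other factor.\<close>

lemma cutoff_exists:
  fixes c :: "real^3"
  assumes "a < b"
  obtains \<eta> :: "real^3 \<Rightarrow> real" and M where "\<And>y \<rho>. regular \<eta> y \<rho> M"
    "\<And>x. (\<And>i. \<bar>x $ i - c $ i\<bar> \<le> a) \<Longrightarrow> \<eta> x = 1"
    "\<And>x i. \<bar>x $ i - c $ i\<bar> \<ge> b \<Longrightarrow> \<eta> x = 0"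
proof -
  define \<beta> where "\<beta> = 1 / (b - a)"
  have \<beta>: "\<beta> > 0" using assms by (simp add: \<beta>_def)
  define u where "u = (\<lambda>i (x::real^3). smooth_step ((b + c $ i) * \<beta> + (-\<beta>) * x $ i))"
  define l where "l = (\<lambda>i (x::real^3). smooth_step ((b - c $ i) * \<beta> + \<beta> * x $ i))"
  define g where "g = (\<lambda>i x. u i x *\<^sub>R l i x)"
  define \<eta> where "\<eta> = (\<lambda>x. g 1 x *\<^sub>R (g 2 x *\<^sub>R g 3 x))"
  have reg: "regular (g i) y \<rho> (4 * (2 + 16 * \<beta>\<^sup>2) * (2 + 16 * \<beta>\<^sup>2))" for i y \<rho>
    unfolding g_def
    by (intro regular_scaleR)
      (use regular_smooth_step[of "(b + c $ i) * \<beta>" "-\<beta>" i y \<rho>] regular_smooth_step[of "(b - c $ i) * \<beta>" \<beta> i y \<rho>]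
        in \<open>simp_all add: u_def l_def\<close>)
  obtain M where M: "\<And>y \<rho>. regular \<eta> y \<rho> M"
    unfolding \<eta>_def using regular_scaleR[OF reg regular_scaleR[OF reg reg]] by blast
  have e1: "(b + c $ i) * \<beta> + (-\<beta>) * x $ i = (b - (x $ i - c $ i)) / (b - a)" for x i
    by (simp add: \<beta>_def diff_divide_distrib add_divide_distrib)
  have e2: "(b - c $ i) * \<beta> + \<beta> * x $ i = (b + (x $ i - c $ i)) / (b - a)" for x i
    by (simp add: \<beta>_def diff_divide_distrib add_divide_distrib)
  have one: "\<eta> x = 1" if "\<And>i. \<bar>x $ i - c $ i\<bar> \<le> a" for x
  proof -
    have "g i x = 1" for i
    proof -
      have "1 \<le> (b - (x $ i - c $ i)) / (b - a)" "1 \<le> (b + (x $ i - c $ i)) / (b - a)"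
        using that[of i] assms by (auto simp: field_simps abs_le_iff)
      then show ?thesis by (simp only: g_def u_def l_def e1 e2 smooth_step_1) simp
    qed
    then show ?thesis by (simp add: \<eta>_def)
  qed
  have zero: "\<eta> x = 0" if "\<bar>x $ i - c $ i\<bar> \<ge> b" for x i
  proof -
    have "b - (x $ i - c $ i) \<le> 0 \<or> b + (x $ i - c $ i) \<le> 0" using that by linarith
    then have "(b - (x $ i - c $ i)) / (b - a) \<le> 0 \<or> (b + (x $ i - c $ i)) / (b - a) \<le> 0"
      using assms by (auto intro: divide_nonpos_pos)
    then have "g i x = 0" unfolding g_def u_def l_def e1 e2 by (auto simp: smooth_step_0)
    then show ?thesis using exhaust_3[of i] by (auto simp: \<eta>_def)
  qed
  show thesis using that M one zero by blast
qed

section \<open>Divergence-free transport\<close>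

text \<open>A list of pairs \<open>(\<gamma>, \<alpha>)\<close> encodes the antisymmetric matrix field with entries
  \<open>\<Sum> \<gamma>\<^sub>j w\<^sub>i(x - h\<alpha>) - \<gamma>\<^sub>i w\<^sub>j(x - h\<alpha>)\<close>; \<open>pot_field\<close> is its \<open>j\<close>-th column. The divergence of an
  antisymmetric matrix field is divergence free, for central differences as well.\<close>

definition pot_field ::
  "((real^3) \<times> (real^3)) list \<Rightarrow> real \<Rightarrow> (real^3 \<Rightarrow> real^3) \<Rightarrow> 3 \<Rightarrow> real^3 \<Rightarrow> real^3" where
  "pot_field P h w j x =
     (\<Sum>p\<leftarrow>P. fst p $ j *\<^sub>R w (x - h *\<^sub>R snd p) - (w (x - h *\<^sub>R snd p) $ j) *\<^sub>R fst p)"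

text \<open>The vector s is counted in mesh sizes. The list P depends neither on h nor on w, so
  constants derived from it are uniform in h, and the factor h makes the potential itself
  O(h).\<close>

definition shift_potential :: "((real^3) \<times> (real^3)) list \<Rightarrow> real^3 \<Rightarrow> bool" where
  "shift_potential P s \<longleftrightarrow> (\<forall>h w x. h > 0 \<longrightarrow> (\<forall>x. disc_div h w x = 0) \<longrightarrow>
     (\<Sum>j\<in>UNIV. diff_central h j (\<lambda>x. h *\<^sub>R pot_field P h w j x) x) = w (x - h *\<^sub>R s) - w x)"

definition shift_path :: "real^3 \<Rightarrow> ((real^3) \<times> (real^3)) list \<Rightarrow> ((real^3) \<times> (real^3)) list" where
  "shift_path s P = map (\<lambda>p. (fst p, snd p + s)) P"

lemma diff_central_add: "diff_central h j (\<lambda>x. f x + g x) x = diff_central h j f x + diff_central h j g x"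
  by (simp add: diff_central_def algebra_simps)

lemma diff_central_shift: "diff_central h j (\<lambda>x. f (x - s)) x = diff_central h j f (x - s)"
  by (simp add: diff_central_def algebra_simps)

lemma diff_central_nth: "diff_central h j f x $ i = diff_central h j (\<lambda>y. f y $ i) x"
  for f :: "real^3 \<Rightarrow> real^3"
  by (simp add: diff_central_def)

lemma diff_central_sum: "diff_central h j (\<lambda>x. \<Sum>i\<in>I. f i x) x = (\<Sum>i\<in>I. diff_central h j (f i) x)"
  by (simp add: diff_central_def scaleR_sum_right sum_subtractf[symmetric] scaleR_diff_right)

lemma diff_central_commute:
  "diff_central h i (diff_central h j f) x = diff_central h j (diff_central h i f) x"
  by (simp add: diff_central_def algebra_simps)

lemma diff_central_scaleR: "diff_central h j (\<lambda>x. c *\<^sub>R f x) x = c *\<^sub>R diff_central h j f x"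
  by (simp add: diff_central_def algebra_simps)

lemma shift_potential_Nil: "shift_potential [] 0"
  by (simp add: shift_potential_def pot_field_def diff_central_def)

lemma pot_field_append_shift:
  "pot_field (P @ shift_path s Q) h w j x = pot_field P h w j x + pot_field Q h w j (x - h *\<^sub>R s)"
  by (simp add: pot_field_def shift_path_def o_def algebra_simps)

text \<open>Telescoping: the second path is applied to the field already translated by s.\<close>

lemma shift_potential_append:
  assumes P: "shift_potential P s" and Q: "shift_potential Q t"
  shows "shift_potential (P @ shift_path s Q) (s + t)"
  unfolding shift_potential_def
proof (intro allI impI)
  fix h :: real and w :: "real^3 \<Rightarrow> real^3" and x
  assume h: "h > 0" and w: "\<forall>x. disc_div h w x = 0"
  have "(\<Sum>j\<in>UNIV. diff_central h j (\<lambda>x. h *\<^sub>R pot_field (P @ shift_path s Q) h w j x) x)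
     = (\<Sum>j\<in>UNIV. diff_central h j (\<lambda>x. h *\<^sub>R pot_field P h w j x) x)
       + (\<Sum>j\<in>UNIV. diff_central h j (\<lambda>x. h *\<^sub>R pot_field Q h w j x) (x - h *\<^sub>R s))"
    unfolding pot_field_append_shift scaleR_add_right diff_central_add sum.distrib
    by (simp only: diff_central_shift[of h _ "\<lambda>x. h *\<^sub>R pot_field Q h w _ x"])
  also have "\<dots> = (w (x - h *\<^sub>R s) - w x) + (w (x - h *\<^sub>R s - h *\<^sub>R t) - w (x - h *\<^sub>R s))"
    using P Q h w unfolding shift_potential_def by simp
  finally show "(\<Sum>j\<in>UNIV. diff_central h j (\<lambda>x. h *\<^sub>R pot_field (P @ shift_path s Q) h w j x) x)
     = w (x - h *\<^sub>R (s + t)) - w x" by (simp add: algebra_simps)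
qed

text \<open>A translation by two steps is a central difference at the midpoint: w(x - 2 h \<sigma>
  e) - w(x) is -2 \<sigma> h times the difference of w at x - h \<sigma> e. Since w is solenoidal,
  this is the divergence of an antisymmetric field. A single step is not of this form, so only even
  shifts occur.\<close>

lemma shift_potential_step:
  assumes "\<sigma> = 1 \<or> \<sigma> = (-1::real)"
  shows "shift_potential [((-2 * \<sigma>) *\<^sub>R axis k 1, \<sigma> *\<^sub>R axis k 1)] ((2 * \<sigma>) *\<^sub>R axis k 1)"
  unfolding shift_potential_def
proof (intro allI impI)
  fix h :: real and w :: "real^3 \<Rightarrow> real^3" and x
  assume h: "h > 0" and w: "\<forall>x. disc_div h w x = 0"
  let ?e = "axis k 1 :: real^3"
  let ?s = "h *\<^sub>R \<sigma> *\<^sub>R ?e"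
  have pf: "pot_field [((-2 * \<sigma>) *\<^sub>R ?e, \<sigma> *\<^sub>R ?e)] h w j y =
     (-2 * \<sigma>) *\<^sub>R (?e $ j *\<^sub>R w (y - ?s) - (w (y - ?s) $ j) *\<^sub>R ?e)" for j y
    by (simp add: pot_field_def algebra_simps)
  have c: "diff_central h j (\<lambda>y. h *\<^sub>R pot_field [((-2 * \<sigma>) *\<^sub>R ?e, \<sigma> *\<^sub>R ?e)] h w j y) x
      = (-2 * \<sigma> * h) *\<^sub>R (?e $ j *\<^sub>R diff_central h j w (x - ?s)
         - (diff_central h j (\<lambda>y. w y $ j) (x - ?s)) *\<^sub>R ?e)" for j
    unfolding pf by (simp add: diff_central_def algebra_simps)
  have "(\<Sum>j\<in>UNIV. diff_central h j (\<lambda>y. h *\<^sub>R pot_field [((-2 * \<sigma>) *\<^sub>R ?e, \<sigma> *\<^sub>R ?e)] h w j y) x)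
     = (-2 * \<sigma> * h) *\<^sub>R ((\<Sum>j\<in>UNIV. ?e $ j *\<^sub>R diff_central h j w (x - ?s)) - disc_div h w (x - ?s) *\<^sub>R ?e)"
    unfolding c scaleR_sum_right[symmetric] sum_subtractf disc_div_def scaleR_sum_left by simp
  also have "(\<Sum>j\<in>UNIV. ?e $ j *\<^sub>R diff_central h j w (x - ?s)) = diff_central h k w (x - ?s)"
  proof -
    have "(\<Sum>j\<in>UNIV. ?e $ j *\<^sub>R diff_central h j w (x - ?s)) = (\<Sum>j\<in>UNIV. if j = k then diff_central h j w (x - ?s) else 0)"
      by (intro sum.cong refl) (simp add: axis_def)
    then show ?thesis by simp
  qed
  also have "(-2 * \<sigma> * h) *\<^sub>R (diff_central h k w (x - ?s) - disc_div h w (x - ?s) *\<^sub>R ?e)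
      = w (x - h *\<^sub>R ((2 * \<sigma>) *\<^sub>R ?e)) - w x"
  proof -
    have 1: "x - h *\<^sub>R \<sigma> *\<^sub>R ?e - \<sigma> *\<^sub>R h *\<^sub>R ?e = x - h *\<^sub>R ((2 * \<sigma>) *\<^sub>R ?e)"
      by (simp add: vec_eq_iff algebra_simps)
    show ?thesis
      using assms h w 1 by (elim disjE) (simp_all add: diff_central_def algebra_simps)
  qed
  finally show "(\<Sum>j\<in>UNIV. diff_central h j (\<lambda>y. h *\<^sub>R pot_field [((-2 * \<sigma>) *\<^sub>R ?e, \<sigma> *\<^sub>R ?e)] h w j y) x)
     = w (x - h *\<^sub>R ((2 * \<sigma>) *\<^sub>R ?e)) - w x" .
qed

text \<open>Axis steps are concatenated until every vector with even integer entries is reached.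
  Inward directions are chosen integer below for this reason.\<close>

lemma shift_potential_exists:
  fixes m :: "int^3"
  shows "\<exists>P. shift_potential P (2 *\<^sub>R (\<chi> i. real_of_int (m $ i)))"
proof -
  let ?S = "\<lambda>s. \<exists>P. shift_potential P s"
  have add: "?S (s + t)" if "?S s" "?S t" for s t
    using that shift_potential_append by blast
  have mul: "?S (real n *\<^sub>R s)" if s: "?S s" for n s
  proof (induction n)
    case 0 show ?case using shift_potential_Nil by auto
  next
    case (Suc n) then show ?case using add[OF Suc s] by (simp add: algebra_simps)
  qed
  have ax: "?S ((2 * real_of_int z) *\<^sub>R axis k 1)" for z k
  proof (cases "z \<ge> 0")
    case True
    have "?S ((2 * 1) *\<^sub>R axis k 1)" using shift_potential_step[of 1 k] by blast
    from mul[OF this, of "nat z"] True show ?thesis by (simp add: mult.commute)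
  next
    case False
    have "?S ((2 * (-1)) *\<^sub>R axis k 1)" using shift_potential_step[of "-1" k] by blast
    from mul[OF this, of "nat (-z)"] False show ?thesis by (simp add: mult.commute)
  qed
  have "2 *\<^sub>R (\<chi> i. real_of_int (m $ i)) = (2 * real_of_int (m $ 1)) *\<^sub>R axis 1 1
      + (2 * real_of_int (m $ 2)) *\<^sub>R axis 2 1 + (2 * real_of_int (m $ 3)) *\<^sub>R (axis 3 1 :: real^3)"
    by (simp add: vec_eq_iff forall_3 axis_def)
  then show ?thesis using add[OF add[OF ax[of "m $ 1" 1] ax[of "m $ 2" 2]] ax[of "m $ 3" 3]] by simp
qed

text \<open>Repeating a path keeps all sampling points within c of the multiples of s, with c
  independent of J. This permits \<open>chart_step\<close> to choose J after c.\<close>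

lemma long_shift_potential:
  assumes P: "shift_potential P s" and c: "\<And>p. p \<in> set P \<Longrightarrow> norm (snd p) \<le> c"
  shows "\<exists>Q. shift_potential Q (real J *\<^sub>R s) \<and> (\<forall>q\<in>set Q. \<exists>j::nat. norm (snd q - real j *\<^sub>R s) \<le> c)"
proof (induction J)
  case 0 show ?case using shift_potential_Nil by auto
next
  case (Suc J)
  then obtain Q where Q: "shift_potential Q (real J *\<^sub>R s)"
    "\<forall>q\<in>set Q. \<exists>j::nat. norm (snd q - real j *\<^sub>R s) \<le> c" by blast
  have "shift_potential (Q @ shift_path (real J *\<^sub>R s) P) (real (Suc J) *\<^sub>R s)"
    using shift_potential_append[OF Q(1) P] by (simp add: algebra_simps)
  moreover have "\<exists>j::nat. norm (snd q - real j *\<^sub>R s) \<le> c" if "q \<in> set (Q @ shift_path (real J *\<^sub>R s) P)" for q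
  proof -
    consider "q \<in> set Q" | p where "p \<in> set P" "q = (fst p, snd p + real J *\<^sub>R s)"
      using \<open>q \<in> _\<close> by (auto simp: shift_path_def)
    then show ?thesis
    proof cases
      case 1 then show ?thesis using Q(2) by blast
    next
      case 2 then show ?thesis using c by (intro exI[of _ J]) simp
    qed
  qed
  ultimately show ?case by blast
qed

text \<open>For solenoidal w this is w plus the divergence of \<eta> times the potential, expanded
  by the product rule. The expanded form is linear and O(h)-close to w for every regular w, and it
  is visibly the translation by h s where \<eta> = 1 at x and its neighbours.\<close>

definition transport ::
  "(real^3 \<Rightarrow> real) \<Rightarrow> ((real^3) \<times> (real^3)) list \<Rightarrow> real^3 \<Rightarrow> real \<Rightarrow> (real^3 \<Rightarrow> real^3) \<Rightarrow> real^3 \<Rightarrow> real^3" where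
  "transport \<eta> P s h w x = w x + (\<eta> x *\<^sub>R (w (x - h *\<^sub>R s) - w x) + (1/2) *\<^sub>R (\<Sum>j\<in>UNIV.
      (\<eta> (x + h *\<^sub>R axis j 1) - \<eta> x) *\<^sub>R pot_field P h w j (x + h *\<^sub>R axis j 1)
    + (\<eta> x - \<eta> (x - h *\<^sub>R axis j 1)) *\<^sub>R pot_field P h w j (x - h *\<^sub>R axis j 1)))"

lemma pot_field_linear:
  "pot_field P h (\<lambda>y. c *\<^sub>R (w y - w' y)) j x = c *\<^sub>R (pot_field P h w j x - pot_field P h w' j x)"
proof (induction P)
  case (Cons p P)
  then show ?case by (simp add: pot_field_def algebra_simps)
qed (simp add: pot_field_def)

lemma transport_linear:
  "transport \<eta> P s h (\<lambda>y. c *\<^sub>R (w y - w' y)) x = c *\<^sub>R (transport \<eta> P s h w x - transport \<eta> P s h w' x)"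
  unfolding transport_def pot_field_linear
  by (simp add: algebra_simps scaleR_sum_right sum_subtractf sum.distrib)

text \<open>Where \<eta> is not differenced, the potential collapses to the translation; elsewhere
  its factor h cancels against the mesh size in the central difference.\<close>

lemma transport_eq_potential:
  assumes P: "shift_potential P s" and h: "h > 0" and w: "\<And>x. disc_div h w x = 0"
  shows "transport \<eta> P s h w x =
    w x + (\<Sum>j\<in>UNIV. diff_central h j (\<lambda>x. \<eta> x *\<^sub>R (h *\<^sub>R pot_field P h w j x)) x)"
proof -
  let ?F = "pot_field P h w"
  have j: "diff_central h j (\<lambda>x. \<eta> x *\<^sub>R (h *\<^sub>R ?F j x)) x =
     \<eta> x *\<^sub>R diff_central h j (\<lambda>x. h *\<^sub>R ?F j x) x + (1/2) *\<^sub>R (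
       (\<eta> (x + h *\<^sub>R axis j 1) - \<eta> x) *\<^sub>R ?F j (x + h *\<^sub>R axis j 1)
    + (\<eta> x - \<eta> (x - h *\<^sub>R axis j 1)) *\<^sub>R ?F j (x - h *\<^sub>R axis j 1))" for j
  proof -
    have dc: "diff_central h j (\<lambda>x. h *\<^sub>R g x) x = (1/2) *\<^sub>R (g (x + h *\<^sub>R axis j 1) - g (x - h *\<^sub>R axis j 1))"
      for g :: "real^3 \<Rightarrow> real^3"
      using h by (simp add: diff_central_def scaleR_diff_right[symmetric])
    show ?thesis
      unfolding scaleR_left_commute[of "\<eta> _" h] dc by (simp add: algebra_simps)
  qed
  have "(\<Sum>j\<in>UNIV. diff_central h j (\<lambda>x. h *\<^sub>R ?F j x) x) = w (x - h *\<^sub>R s) - w x"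
    using P h w unfolding shift_potential_def by blast
  then show ?thesis
    unfolding transport_def j sum.distrib scaleR_sum_right[symmetric] by simp
qed

lemma pot_field_antisym: "pot_field P h w j x $ i = - (pot_field P h w i x $ j)"
proof (induction P)
  case (Cons p P)
  then show ?case by (simp add: pot_field_def)
qed (simp add: pot_field_def)

text \<open>Central differences commute, so the double sum changes sign when its two indices are
  exchanged.\<close>

lemma disc_div_antisym:
  fixes B :: "3 \<Rightarrow> real^3 \<Rightarrow> real^3"
  assumes anti: "\<And>i j x. B j x $ i = - (B i x $ j)"
  shows "disc_div h (\<lambda>x. \<Sum>j\<in>UNIV. diff_central h j (B j) x) x = 0"
proof -
  let ?d = "\<lambda>i j. diff_central h i (diff_central h j (\<lambda>y. B j y $ i)) x"
  have "disc_div h (\<lambda>x. \<Sum>j\<in>UNIV. diff_central h j (B j) x) x = (\<Sum>i\<in>UNIV. \<Sum>j\<in>UNIV. ?d i j)"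
    unfolding disc_div_def sum_component diff_central_sum diff_central_nth by simp
  moreover have "?d i j = - ?d j i" for i j
  proof -
    have "?d i j = diff_central h j (diff_central h i (\<lambda>y. - (B i y $ j))) x"
      unfolding anti[of j _ i] by (rule diff_central_commute)
    also have "\<dots> = - ?d j i"
      using diff_central_scaleR[of h _ "-1"] by (simp add: diff_central_def algebra_simps)
    finally show ?thesis .
  qed
  then have "(\<Sum>i\<in>UNIV. \<Sum>j\<in>UNIV. ?d i j) = - (\<Sum>i\<in>UNIV. \<Sum>j\<in>UNIV. ?d j i)"
    unfolding sum_negf[symmetric] by (intro sum.cong refl) blast
  moreover have "(\<Sum>i\<in>UNIV. \<Sum>j\<in>UNIV. ?d j i) = (\<Sum>i\<in>UNIV. \<Sum>j\<in>UNIV. ?d i j)" by (rule sum.swap)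
  ultimately show ?thesis by linarith
qed

lemma disc_div_transport:
  assumes P: "shift_potential P s" and h: "h > 0" and w: "\<And>x. disc_div h w x = 0"
  shows "disc_div h (transport \<eta> P s h w) x = 0"
proof -
  let ?B = "\<lambda>j x. \<eta> x *\<^sub>R (h *\<^sub>R pot_field P h w j x)"
  have "disc_div h (transport \<eta> P s h w) x =
      disc_div h w x + disc_div h (\<lambda>x. \<Sum>j\<in>UNIV. diff_central h j (?B j) x) x"
    unfolding transport_eq_potential[OF P h w, abs_def] disc_div_def
    by (simp add: diff_central_add sum.distrib)
  also have "disc_div h (\<lambda>x. \<Sum>j\<in>UNIV. diff_central h j (?B j) x) x = 0"
  proof (rule disc_div_antisym)
    show "?B j x $ i = - (?B i x $ j)" for i j x using pot_field_antisym[of P h w j x i] by simp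
  qed
  finally show ?thesis using w by simp
qed

lemma pot_field_regular:
  assumes w: "regular w x \<rho> M" and h: "h \<ge> 0"
    and P: "\<And>p. p \<in> set P \<Longrightarrow> norm (fst p) \<le> b \<and> norm (snd p) \<le> b" and b: "b \<ge> 0"
  shows "regular (pot_field P h w j) x (\<rho> - b * h) (real (length P) * (2 * b * M))"
proof -
  have M: "M \<ge> 0" using diff_bounds_nonneg[OF w] by simp
  have "regular (\<lambda>y. fst p $ j *\<^sub>R w (y - h *\<^sub>R snd p) - (w (y - h *\<^sub>R snd p) $ j) *\<^sub>R fst p) x (\<rho> - b * h) (2 * b * M)"
    if "p \<in> set P" for p
  proof -
    let ?L = "\<lambda>v::real^3. fst p $ j *\<^sub>R v - (v $ j) *\<^sub>R fst p"
    have L: "linear ?L" by (rule linearI) (simp_all add: algebra_simps)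
    have B: "norm (?L v) \<le> (2 * b) * norm v" for v
    proof -
      have "norm (?L v) \<le> \<bar>fst p $ j\<bar> * norm v + \<bar>v $ j\<bar> * norm (fst p)"
        using norm_triangle_ineq4[of "fst p $ j *\<^sub>R v" "(v $ j) *\<^sub>R fst p"] by simp
      also have "\<dots> \<le> b * norm v + norm v * b"
        using P[OF that] b component_le_norm_cart[of "fst p" j] component_le_norm_cart[of v j]
        by (intro add_mono mult_mono) auto
      finally show ?thesis by simp
    qed
    have "norm (h *\<^sub>R snd p) \<le> b * h" using P[OF that] h mult_right_mono[of "norm (snd p)" b h] by (simp add: mult.commute)
    then have "regular (\<lambda>y. w (y + - (h *\<^sub>R snd p))) x (\<rho> - b * h) M"
      by (intro diff_bounds_mono[OF diff_bounds_shift[OF w]]) auto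
    from diff_bounds_linear[OF this L B] b show ?thesis by simp
  qed
  from diff_bounds_sum_list[of P, OF this] show ?thesis unfolding pot_field_def[abs_def] by simp
qed

text \<open>Every term beyond w contains a difference over O(h) either of w or of \<eta>, and so
  gains a factor h. The radius shrinks by the reach (b + 1) h of the operator.\<close>

lemma transport_regular:
  assumes \<eta>: "\<And>y \<rho>. regular \<eta> y \<rho> E" and P: "\<And>p. p \<in> set P \<Longrightarrow> norm (fst p) \<le> b \<and> norm (snd p) \<le> b"
    and s: "norm s \<le> b" and b: "b \<ge> 0"
  shows "\<exists>C\<ge>0. \<forall>h w x \<rho> M. 0 \<le> h \<longrightarrow> h \<le> 1 \<longrightarrow> regular w x \<rho> M \<longrightarrow>
     small_regular h (\<lambda>y. transport \<eta> P s h w y - w y) x (\<rho> - (b + 1) * h) (C * M)"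
proof -
  have E: "E \<ge> 0" using diff_bounds_nonneg[OF \<eta>] by simp
  define N where "N = real (length P) * (2 * b)"
  have N: "N \<ge> 0" using b by (simp add: N_def)
  define C where "C = 4 * E * (b + 2) + 3 * (1/2 * (4 * (3 * E) * N + 4 * (3 * E) * N))"
  have C: "C \<ge> 0" using E N b by (simp add: C_def)
  have main: "small_regular h (\<lambda>y. transport \<eta> P s h w y - w y) x (\<rho> - (b + 1) * h) (C * M)"
    if h: "0 \<le> h" "h \<le> 1" and w: "regular w x \<rho> M" for h w x \<rho> M
  proof -
    have M: "M \<ge> 0" using diff_bounds_nonneg[OF w] by simp
    have \<rho>: "\<rho> - (b + 1) * h = \<rho> - b * h - h" by (simp add: algebra_simps)
    have "norm (- (h *\<^sub>R s)) \<le> b * h" using s h mult_right_mono[of "norm s" b h] by (simp add: mult.commute)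
    from regular_shift_diff[OF w this h(1) b]
    have "small_regular h (\<lambda>y. w (y - h *\<^sub>R s) - w y) x (\<rho> - (b + 1) * h) ((b + 2) * M)"
      using h by (auto intro: diff_bounds_mono simp: \<rho>)
    from scaleR_small_regular[OF \<eta> this h]
    have t1: "small_regular h (\<lambda>y. \<eta> y *\<^sub>R (w (y - h *\<^sub>R s) - w y)) x (\<rho> - (b + 1) * h) (4 * E * ((b + 2) * M))" .
    have pf: "regular (pot_field P h w j) x (\<rho> - b * h) (N * M)" for j
      using pot_field_regular[OF w h(1) P b] by (simp add: N_def mult.assoc)
    have pfs: "regular (\<lambda>y. pot_field P h w j (y + a)) x (\<rho> - (b + 1) * h) (N * M)" if "norm a \<le> h" for j a
      using that by (intro diff_bounds_mono[OF diff_bounds_shift[OF pf]]) (auto simp: \<rho>)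
    have na: "norm (h *\<^sub>R axis j (1::real)) = h" "norm (- (h *\<^sub>R axis j (1::real))) = h" for j :: 3
      using h by (simp_all add: norm_axis_1)
    have e1: "small_regular h (\<lambda>y. \<eta> (y + a) - \<eta> y) x (\<rho> - (b + 1) * h) (3 * E)" if "norm a = h" for a
      using regular_shift_diff[OF \<eta>[of x "\<rho> - b * h"], of a 1 h] that h by (simp add: \<rho>)
    have e2: "small_regular h (\<lambda>y. \<eta> y - \<eta> (y + a)) x (\<rho> - (b + 1) * h) (3 * E)" if "norm a = h" for a
      using diff_bounds_minus[OF e1[OF that]] by simp
    have t2: "small_regular h (\<lambda>y. (1/2) *\<^sub>R ((\<eta> (y + h *\<^sub>R axis j 1) - \<eta> y) *\<^sub>R pot_field P h w j (y + h *\<^sub>R axis j 1)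
        + (\<eta> y - \<eta> (y + - (h *\<^sub>R axis j 1))) *\<^sub>R pot_field P h w j (y + - (h *\<^sub>R axis j 1))))
        x (\<rho> - (b + 1) * h) ((1/2 * (4 * (3 * E) * N + 4 * (3 * E) * N)) * M)" for j
    proof -
      note a = small_regular_scaleR[OF e1[OF na(1)] pfs[OF eq_refl[OF na(1)]] h, of j j j]
      note b = small_regular_scaleR[OF e2[OF na(2)] pfs[OF eq_refl[OF na(2)]] h, of j j j]
      from diff_bounds_scale[OF diff_bounds_add[OF a b], of "1/2"] show ?thesis
        by (rule diff_bounds_mono) (simp_all add: algebra_simps)
    qed
    from diff_bounds_add[OF t1 diff_bounds_sum[OF finite_class.finite_UNIV t2]]
    have "small_regular h (\<lambda>y. \<eta> y *\<^sub>R (w (y - h *\<^sub>R s) - w y) + (\<Sum>j\<in>UNIV. (1/2) *\<^sub>R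
          ((\<eta> (y + h *\<^sub>R axis j 1) - \<eta> y) *\<^sub>R pot_field P h w j (y + h *\<^sub>R axis j 1)
        + (\<eta> y - \<eta> (y + - (h *\<^sub>R axis j 1))) *\<^sub>R pot_field P h w j (y + - (h *\<^sub>R axis j 1)))))
        x (\<rho> - (b + 1) * h) (C * M)"
      by (rule diff_bounds_mono) (simp_all add: C_def algebra_simps)
    then show ?thesis by (simp add: transport_def scaleR_sum_right)
  qed
  show ?thesis using C main by blast
qed

section \<open>Pushing a solenoidal field inwards\<close>

text \<open>Near \<open>x0\<close> the set is \<open>{y. l y > 0}\<close>; the integer vector \<open>m\<close> points into it.\<close>

definition inward_chart :: "(real^3) set \<Rightarrow> real^3 \<Rightarrow> real \<Rightarrow> (real^3 \<Rightarrow> real) \<Rightarrow> real^3 \<Rightarrow> real \<Rightarrow> bool" where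
  "inward_chart \<Omega> x0 r l m \<Lambda> \<longleftrightarrow> r > 0 \<and> \<Lambda> \<ge> 0 \<and> (\<exists>z::int^3. m = (\<chi> i. real_of_int (z $ i))) \<and>
     (\<forall>y y'. l y - l y' \<le> \<Lambda> * norm (y - y')) \<and> (\<forall>y c. c \<ge> 0 \<longrightarrow> l y + c \<le> l (y + c *\<^sub>R m)) \<and>
     (\<forall>y. norm (y - x0) < r \<longrightarrow> (y \<in> \<Omega> \<longleftrightarrow> l y > 0))"

lemma norm_le_sum3: "norm (x::real^3) \<le> \<bar>x $ 1\<bar> + \<bar>x $ 2\<bar> + \<bar>x $ 3\<bar>"
  using norm_le_l1_cart[of x] by (simp add: sum_3)

text \<open>l is the height above the graph of \<gamma> in direction \<nu>. The inward vector has to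
  be integer to be usable for grid translations, so a long multiple of \<nu> is rounded.\<close>

lemma inward_chart_exists:
  assumes "lipschitz_boundary \<Omega>" "x0 \<in> frontier \<Omega>"
  obtains r l m \<Lambda> where "inward_chart \<Omega> x0 r l m \<Lambda>"
proof -
  obtain r \<nu> \<gamma> L where r: "r > 0" and \<nu>: "norm \<nu> = 1" and \<gamma>: "L-lipschitz_on {y. y \<bullet> \<nu> = 0} \<gamma>"
    and \<Omega>: "\<Omega> \<inter> ball x0 r = {y \<in> ball x0 r. \<gamma> (y - (y \<bullet> \<nu>) *\<^sub>R \<nu>) < y \<bullet> \<nu>}"
    using assms unfolding lipschitz_boundary_def by meson
  have L: "L \<ge> 0" using \<gamma> lipschitz_on_nonneg by blast
  define \<pi> where "\<pi> = (\<lambda>y::real^3. y - (y \<bullet> \<nu>) *\<^sub>R \<nu>)"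
  define l where "l = (\<lambda>y. y \<bullet> \<nu> - \<gamma> (\<pi> y))"
  have \<nu>\<nu>: "\<nu> \<bullet> \<nu> = 1" using \<nu> by (simp add: dot_square_norm)
  have \<pi>0: "\<pi> y \<in> {y. y \<bullet> \<nu> = 0}" for y by (simp add: \<pi>_def inner_diff_left \<nu>\<nu>)
  have in\<nu>: "\<bar>a \<bullet> \<nu>\<bar> \<le> norm a" for a using Cauchy_Schwarz_ineq2[of a \<nu>] \<nu> by simp
  have n\<pi>: "norm (\<pi> a) \<le> 2 * norm a" for a
    using norm_triangle_ineq4[of a "(a \<bullet> \<nu>) *\<^sub>R \<nu>"] in\<nu>[of a] \<nu> by (simp add: \<pi>_def)
  have \<pi>lin: "\<pi> y - \<pi> y' = \<pi> (y - y')" for y y' by (simp add: \<pi>_def algebra_simps inner_diff_left)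
  have \<gamma>': "\<gamma> (\<pi> y) - \<gamma> (\<pi> y') \<le> L * norm (\<pi> (y - y'))" for y y'
    using lipschitz_onD[OF \<gamma> \<pi>0 \<pi>0, of y y'] by (simp add: dist_norm \<pi>lin dist_real_def abs_le_iff)
  \<comment> \<open>Rounding errs by a vector of norm at most 3, whose projection has norm at most
    6. So m rises by at least b - 3 along \<nu> while the graph rises by at most 6 L, which leaves
    1.\<close>
  define b where "b = 4 + 6 * L"
  define z :: "int^3" where "z = (\<chi> i. \<lfloor>b * \<nu> $ i\<rfloor>)"
  define m :: "real^3" where "m = (\<chi> i. real_of_int (z $ i))"
  define d where "d = m - b *\<^sub>R \<nu>"
  have di: "\<bar>d $ i\<bar> \<le> 1" for i unfolding d_def m_def z_def by simp linarith
  have d3: "norm d \<le> 3" using norm_le_sum3[of d] di[of 1] di[of 2] di[of 3] by linarith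
  have m\<nu>: "m \<bullet> \<nu> = b + d \<bullet> \<nu>" by (simp add: d_def inner_diff_left \<nu>\<nu>)
  have \<pi>m: "\<pi> m = \<pi> d" unfolding \<pi>_def d_def by (simp add: inner_diff_left \<nu>\<nu> algebra_simps)
  have "L * norm (\<pi> m) \<le> L * 6" unfolding \<pi>m using n\<pi>[of d] d3 L by (intro mult_left_mono) auto
  then have key: "1 + L * norm (\<pi> m) \<le> m \<bullet> \<nu>"
    unfolding m\<nu> b_def using in\<nu>[of d] d3 by (simp add: abs_le_iff)
  have mono: "l y + c \<le> l (y + c *\<^sub>R m)" if "c \<ge> 0" for y c
  proof -
    have "\<pi> (c *\<^sub>R m) = c *\<^sub>R \<pi> m" by (simp add: \<pi>_def algebra_simps)
    then have "\<gamma> (\<pi> (y + c *\<^sub>R m)) - \<gamma> (\<pi> y) \<le> L * (c * norm (\<pi> m))"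
      using \<gamma>'[of "y + c *\<^sub>R m" y] that by simp
    moreover have "c * (1 + L * norm (\<pi> m)) \<le> c * (m \<bullet> \<nu>)" using key that by (intro mult_left_mono)
    ultimately show ?thesis unfolding l_def by (simp add: inner_add_left algebra_simps)
  qed
  have lip: "l y - l y' \<le> (1 + 2 * L) * norm (y - y')" for y y'
  proof -
    have "\<gamma> (\<pi> y') - \<gamma> (\<pi> y) \<le> L * (2 * norm (y - y'))"
      using \<gamma>'[of y' y] mult_left_mono[OF n\<pi>[of "y' - y"] L] by (simp add: norm_minus_commute)
    moreover have "y \<bullet> \<nu> - y' \<bullet> \<nu> \<le> norm (y - y')" using in\<nu>[of "y - y'"] by (simp add: inner_diff_left)
    ultimately show ?thesis unfolding l_def by (simp add: algebra_simps)
  qed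
  have dom: "y \<in> \<Omega> \<longleftrightarrow> l y > 0" if "norm (y - x0) < r" for y
  proof -
    have "y \<in> ball x0 r" using that by (simp add: dist_norm norm_minus_commute)
    then have "y \<in> \<Omega> \<longleftrightarrow> y \<in> {y \<in> ball x0 r. \<gamma> (y - (y \<bullet> \<nu>) *\<^sub>R \<nu>) < y \<bullet> \<nu>}" using \<Omega> by blast
    then show ?thesis using \<open>y \<in> ball x0 r\<close> by (simp add: l_def \<pi>_def)
  qed
  have "inward_chart \<Omega> x0 r l m (1 + 2 * L)"
    unfolding inward_chart_def using r L mono lip dom m_def by auto
  then show thesis using that by blast
qed

definition far_from :: "(real^3) set \<Rightarrow> real \<Rightarrow> real^3 \<Rightarrow> bool" where
  "far_from \<Omega> d x \<longleftrightarrow> (\<forall>y\<in>\<Omega>. d < norm (x - y))"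

text \<open>T pushes fields inwards near the part of the boundary covered by F. Supports may spread
  from R h to R' h around \<Omega>, but in the balls of F the result vanishes within t h of the
  complement. The width t is a parameter because an operator applied later, of reach s h, spoils a
  layer of that width. All widths are counted in mesh sizes.\<close>

definition inward_op ::
  "(real^3) set \<Rightarrow> ((real^3) \<times> real) set \<Rightarrow> real \<Rightarrow> real \<Rightarrow> real \<Rightarrow> real \<Rightarrow> real \<Rightarrow> real
     \<Rightarrow> ((real^3 \<Rightarrow> real^3) \<Rightarrow> real^3 \<Rightarrow> real^3) \<Rightarrow> bool" where
  "inward_op \<Omega> F R R' t s C h T \<longleftrightarrow>
     (\<forall>c w w' x. T (\<lambda>y. c *\<^sub>R (w y - w' y)) x = c *\<^sub>R (T w x - T w' x)) \<and>
     (\<forall>w. (\<forall>x. disc_div h w x = 0) \<longrightarrow> (\<forall>x. disc_div h (T w) x = 0)) \<and>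
     (\<forall>w. (\<forall>x. far_from \<Omega> (R * h) x \<longrightarrow> w x = 0) \<longrightarrow> (\<forall>x. far_from \<Omega> (R' * h) x \<longrightarrow> T w x = 0)) \<and>
     (\<forall>w. (\<forall>x. far_from \<Omega> (R * h) x \<longrightarrow> w x = 0) \<longrightarrow>
        (\<forall>x y. (\<exists>(x0, r)\<in>F. norm (x - x0) < r + t * h) \<longrightarrow> y \<notin> \<Omega> \<longrightarrow> norm (x - y) \<le> t * h \<longrightarrow> T w x = 0)) \<and>
     (\<forall>w x. (\<forall>y. norm (y - x) \<le> s * h \<longrightarrow> w y = 0) \<longrightarrow> T w x = 0) \<and>
     (\<forall>w x \<rho> M. regular w x \<rho> M \<longrightarrow> small_regular h (\<lambda>y. T w y - w y) x (\<rho> - s * h) (C * M))"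

definition inward_family ::
  "(real^3) set \<Rightarrow> ((real^3) \<times> real) set \<Rightarrow> real \<Rightarrow> real \<Rightarrow> real \<Rightarrow> bool" where
  "inward_family \<Omega> F R R' t \<longleftrightarrow> (\<exists>s C h0. 0 \<le> s \<and> 0 \<le> C \<and> 0 < h0 \<and> h0 \<le> 1 \<and>
     (\<forall>h. 0 < h \<and> h < h0 \<longrightarrow> (\<exists>T. inward_op \<Omega> F R R' t s C h T)))"

lemma inward_familyI:
  assumes "0 \<le> s" "0 \<le> C" "0 < h0" "h0 \<le> 1"
    and "\<And>h. 0 < h \<Longrightarrow> h < h0 \<Longrightarrow> \<exists>T. inward_op \<Omega> F R R' t s C h T"
  shows "inward_family \<Omega> F R R' t"
  unfolding inward_family_def
  by (rule exI[of _ s], rule exI[of _ C], rule exI[of _ h0]) (simp add: assms)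

lemma inward_familyE:
  assumes "inward_family \<Omega> F R R' t"
  obtains s C h0 where "0 \<le> s" "0 \<le> C" "0 < h0" "h0 \<le> 1"
    "\<forall>h. 0 < h \<and> h < h0 \<longrightarrow> (\<exists>T. inward_op \<Omega> F R R' t s C h T)"
  using assms[unfolded inward_family_def] by (elim exE conjE) (rule that)

lemma list_norm_bound:
  fixes f :: "'a \<Rightarrow> 'b::real_normed_vector"
  obtains b where "b \<ge> 0" "\<And>p. p \<in> set P \<Longrightarrow> norm (f p) \<le> b"
proof -
  have "finite ((\<lambda>p. norm (f p)) ` set P)" by simp
  then obtain b where "\<And>p. p \<in> set P \<Longrightarrow> norm (f p) \<le> b"
    by (meson bdd_above.E bdd_above_finite image_eqI)
  then show thesis using that[of "max 0 b"] by (simp add: le_max_iff_disj)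
qed

lemma pot_field_zero:
  assumes "\<And>p. p \<in> set P \<Longrightarrow> w (x - h *\<^sub>R snd p) = 0"
  shows "pot_field P h w j x = 0"
  using assms by (induction P) (auto simp: pot_field_def)

text \<open>A cut-off translation along the inward direction, repeated J times. Supports spread by a
  constant c that depends neither on R nor on t, although J does: all sampling points lie near an
  inward ray, and a point of \<Omega> moved inwards stays in \<Omega>. This independence prevents a
  circular choice of widths in \<open>inward_family_finite\<close>.\<close>

lemma chart_step:
  assumes ch: "inward_chart \<Omega> x0 r l m \<Lambda>"
  shows "\<exists>c\<ge>0. \<forall>R\<ge>0. \<forall>t\<ge>0. inward_family \<Omega> {(x0, r / 8)} R (R + c) t"
proof -
  have r: "r > 0" and \<Lambda>: "\<Lambda> \<ge> 0" and lip: "\<And>y y'. l y - l y' \<le> \<Lambda> * norm (y - y')"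
    and mono: "\<And>y c. c \<ge> 0 \<Longrightarrow> l y + c \<le> l (y + c *\<^sub>R m)"
    and dom: "\<And>y. norm (y - x0) < r \<Longrightarrow> y \<in> \<Omega> \<longleftrightarrow> l y > 0"
    using ch by (auto simp: inward_chart_def)
  obtain z :: "int^3" where z: "m = (\<chi> i. real_of_int (z $ i))" using ch by (auto simp: inward_chart_def)
  obtain P where P: "shift_potential P (2 *\<^sub>R m)" unfolding z using shift_potential_exists by blast
  obtain c0 where c0: "c0 \<ge> 0" "\<And>p. p \<in> set P \<Longrightarrow> norm (snd p) \<le> c0"
    using list_norm_bound[of P snd] by blast
  have "inward_family \<Omega> {(x0, r / 8)} R (R + (c0 + 3)) t"
    if R: "R \<ge> 0" and t: "t \<ge> 0" for R t
  proof -
    \<comment> \<open>Each repetition raises the height by at least 2 h, while a point within (R +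
      t) h of the complement has height at most \<Lambda> (R + t) h.\<close>
    obtain J :: nat where J: "\<Lambda> * (R + t) \<le> real J" using real_arch_simple by blast
    define s where "s = real J *\<^sub>R (2 *\<^sub>R m)"
    obtain Q where Q: "shift_potential Q s"
      and Qnear: "\<And>q. q \<in> set Q \<Longrightarrow> \<exists>j::nat. norm (snd q - real j *\<^sub>R (2 *\<^sub>R m)) \<le> c0"
      unfolding s_def using long_shift_potential[OF P c0(2), of J] by blast
    obtain b1 where b1: "b1 \<ge> 0" "\<And>q. q \<in> set Q \<Longrightarrow> norm (fst q) \<le> b1" using list_norm_bound[of Q fst] by blast
    obtain b2 where b2: "b2 \<ge> 0" "\<And>q. q \<in> set Q \<Longrightarrow> norm (snd q) \<le> b2" using list_norm_bound[of Q snd] by blast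
    define b where "b = b1 + b2 + norm s"
    have b: "b \<ge> 0" "norm s \<le> b" and bQ: "\<And>q. q \<in> set Q \<Longrightarrow> norm (fst q) \<le> b \<and> norm (snd q) \<le> b"
      using b1 b2 norm_ge_zero[of s] unfolding b_def by (auto simp: add_increasing add_increasing2 intro: add_mono)
    obtain \<eta> :: "real^3 \<Rightarrow> real" and E where \<eta>reg: "\<And>y \<rho>. regular \<eta> y \<rho> E"
      and \<eta>1: "\<And>x. (\<And>i. \<bar>x $ i - x0 $ i\<bar> \<le> r / 5) \<Longrightarrow> \<eta> x = 1"
      and \<eta>0: "\<And>x i. \<bar>x $ i - x0 $ i\<bar> \<ge> r / 4 \<Longrightarrow> \<eta> x = 0"
      using cutoff_exists[of "r / 5" "r / 4" x0] r by auto
    obtain C where C: "C \<ge> 0" and Creg: "\<And>h w x \<rho> M. 0 \<le> h \<Longrightarrow> h \<le> 1 \<Longrightarrow> regular w x \<rho> M \<Longrightarrow>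
       small_regular h (\<lambda>y. transport \<eta> Q s h w y - w y) x (\<rho> - (b + 1) * h) (C * M)"
      using transport_regular[OF \<eta>reg bQ b(2) b(1)] by meson
    \<comment> \<open>Total length of all displacements in mesh sizes; for h below \<open>h0\<close>
      every point considered stays in the ball where l describes \<Omega>.\<close>
    define \<kappa> where "\<kappa> = b + R + c0 + 2 * t + 2"
    have \<kappa>: "\<kappa> \<ge> 2" using b R c0 t by (simp add: \<kappa>_def)
    define h0 where "h0 = min 1 (r / (20 * \<kappa>))"
    have h0: "h0 > 0" "h0 \<le> 1" using r \<kappa> by (auto simp: h0_def)
    have "inward_op \<Omega> {(x0, r / 8)} R (R + (c0 + 3)) t (b + 1) C h (transport \<eta> Q s h)"
      if h: "0 < h" "h < h0" for h
    proof -
      have "h * \<kappa> < r / 20" using h \<kappa> by (simp add: h0_def field_simps)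
      then have h\<kappa>: "b * h + R * h + c0 * h + 2 * (t * h) + 2 * h < r / 20"
        by (simp add: \<kappa>_def algebra_simps)
      have hnn: "0 \<le> b * h" "0 \<le> R * h" "0 \<le> c0 * h" "0 \<le> t * h" using b R c0 t h by simp_all
      have \<eta>near: "norm (x - x0) < 3 * r / 4" if "\<eta> x \<noteq> 0" for x
      proof -
        have "\<bar>x $ i - x0 $ i\<bar> < r / 4" for i using \<eta>0[of x i] that by (meson not_le)
        from this[of 1] this[of 2] this[of 3] show ?thesis using norm_le_sum3[of "x - x0"] by simp
      qed
      \<comment> \<open>Were the field nonzero at the sampling point, some \<omega> in \<Omega>
        would be within R h of it. Moved inwards by the same number of double steps, \<omega> stays
        in \<Omega> and comes within (R + c0) h of x', which contradicts the distance of x from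
        \<Omega>.\<close>
      have supp: "w (x' - h *\<^sub>R \<alpha>) = 0"
        if w: "\<forall>x. far_from \<Omega> (R * h) x \<longrightarrow> w x = 0" and x: "far_from \<Omega> ((R + (c0 + 3)) * h) x"
          and x': "norm (x' - x0) < 3 * r / 4 + h" "norm (x' - x) \<le> h"
          and \<alpha>: "norm \<alpha> \<le> b" "norm (\<alpha> - real j *\<^sub>R (2 *\<^sub>R m)) \<le> c0"
        for w :: "real^3 \<Rightarrow> real^3" and x x' \<alpha> and j :: nat
      proof (rule ccontr)
        assume "w (x' - h *\<^sub>R \<alpha>) \<noteq> 0"
        then obtain \<omega> where \<omega>: "\<omega> \<in> \<Omega>" "norm (x' - h *\<^sub>R \<alpha> - \<omega>) \<le> R * h"
          using w unfolding far_from_def by (meson not_le)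
        define \<omega>' where "\<omega>' = \<omega> + (h * real j * 2) *\<^sub>R m"
        have h\<alpha>: "norm (h *\<^sub>R \<alpha>) \<le> b * h" using \<alpha>(1) h by (simp add: mult.commute[of b] mult_left_mono)
        have "norm (\<omega> - x0) \<le> norm (x' - h *\<^sub>R \<alpha> - \<omega>) + norm (h *\<^sub>R \<alpha>) + norm (x' - x0)"
          using norm_triangle_ineq4[of "x' - x0 - h *\<^sub>R \<alpha>" "x' - h *\<^sub>R \<alpha> - \<omega>"]
            norm_triangle_ineq4[of "x' - x0" "h *\<^sub>R \<alpha>"] by (simp add: algebra_simps)
        then have "norm (\<omega> - x0) < r" using \<omega>(2) h\<alpha> x'(1) h\<kappa> hnn r h(1) by linarith
        then have l\<omega>: "l \<omega> > 0" using dom \<omega>(1) by blast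
        have c0h: "norm (h *\<^sub>R (\<alpha> - real j *\<^sub>R (2 *\<^sub>R m))) \<le> c0 * h"
          using \<alpha>(2) h by (simp add: mult.commute[of c0] mult_left_mono)
        have eq: "x' - \<omega>' = (x' - h *\<^sub>R \<alpha> - \<omega>) + h *\<^sub>R (\<alpha> - real j *\<^sub>R (2 *\<^sub>R m))"
          by (simp add: \<omega>'_def algebra_simps)
        have x\<omega>': "norm (x' - \<omega>') \<le> R * h + c0 * h"
          unfolding eq
          using norm_triangle_ineq[of "x' - h *\<^sub>R \<alpha> - \<omega>" "h *\<^sub>R (\<alpha> - real j *\<^sub>R (2 *\<^sub>R m))"] \<omega>(2) c0h by linarith
        have "norm (\<omega>' - x0) \<le> norm (x' - \<omega>') + norm (x' - x0)"
          using norm_triangle_ineq4[of "x' - x0" "x' - \<omega>'"] by simp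
        then have "norm (\<omega>' - x0) < r" using x\<omega>' x'(1) h\<kappa> hnn r h(1) by linarith
        moreover have "l \<omega>' > 0"
        proof -
          have "0 \<le> h * real j * 2" using h by simp
          then show ?thesis unfolding \<omega>'_def using mono[of "h * real j * 2" \<omega>] l\<omega> by linarith
        qed
        ultimately have "\<omega>' \<in> \<Omega>" using dom by blast
        moreover have "norm (x - \<omega>') \<le> h + (R * h + c0 * h)"
          using norm_triangle_ineq4[of "x' - \<omega>'" "x' - x"] x'(2) x\<omega>' by simp
        ultimately show False using x h unfolding far_from_def by (force simp: algebra_simps)
      qed
      have lin: "transport \<eta> Q s h (\<lambda>y. c *\<^sub>R (w y - w' y)) x = c *\<^sub>R (transport \<eta> Q s h w x - transport \<eta> Q s h w' x)"
        for c w w' x by (rule transport_linear)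
      have div: "\<forall>x. disc_div h (transport \<eta> Q s h w) x = 0" if "\<forall>x. disc_div h w x = 0" for w
        using disc_div_transport[OF Q h(1)] that by blast
      have c1: "transport \<eta> Q s h w x = 0"
        if w: "\<forall>x. far_from \<Omega> (R * h) x \<longrightarrow> w x = 0" and x: "far_from \<Omega> ((R + (c0 + 3)) * h) x" for w x
      proof -
        have "far_from \<Omega> (R * h) x"
          using x hnn h unfolding far_from_def by (force simp: algebra_simps)
        then have wx: "w x = 0" using w by blast
        have t1: "\<eta> x *\<^sub>R (w (x - h *\<^sub>R s) - w x) = 0"
        proof (cases "\<eta> x = 0")
          case False
          then have "w (x - h *\<^sub>R s) = 0"
            using supp[OF w x, of x s J] \<eta>near[OF False] h b c0 by (simp add: s_def)
          then show ?thesis using wx by simp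
        qed simp
        have pf: "pot_field Q h w j x' = 0" if "norm (x' - x0) < 3 * r / 4 + h" "norm (x' - x) \<le> h" for x' j
        proof (rule pot_field_zero)
          fix q assume q: "q \<in> set Q"
          then show "w (x' - h *\<^sub>R snd q) = 0" using Qnear[OF q] bQ[OF q] supp[OF w x that, of "snd q"] by blast
        qed
        have pf2: "c *\<^sub>R pot_field Q h w j x' = 0" if c: "c = \<eta> x' - \<eta> x \<or> c = \<eta> x - \<eta> x'" and x': "norm (x' - x) \<le> h" for c x' j
        proof (cases "\<eta> x' = 0 \<and> \<eta> x = 0")
          case False
          have "norm (x' - x0) < 3 * r / 4 + h"
            using False \<eta>near[of x] \<eta>near[of x'] norm_triangle_ineq[of "x' - x" "x - x0"] x' h by auto
          then show ?thesis using pf x' by simp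
        qed (use c in auto)
        have "norm (x + h *\<^sub>R axis j 1 - x) \<le> h" "norm (x - h *\<^sub>R axis j 1 - x) \<le> h" for j :: 3
          using h by (simp_all add: norm_axis_1)
        then have "(\<eta> (x + h *\<^sub>R axis j 1) - \<eta> x) *\<^sub>R pot_field Q h w j (x + h *\<^sub>R axis j 1)
            + (\<eta> x - \<eta> (x - h *\<^sub>R axis j 1)) *\<^sub>R pot_field Q h w j (x - h *\<^sub>R axis j 1) = 0" for j
          using pf2[of "\<eta> (x + h *\<^sub>R axis j 1) - \<eta> x" "x + h *\<^sub>R axis j 1" j]
            pf2[of "\<eta> x - \<eta> (x - h *\<^sub>R axis j 1)" "x - h *\<^sub>R axis j 1" j] by auto
        then show ?thesis unfolding transport_def t1 using wx by simp
      qed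
      \<comment> \<open>Here the cutoff is 1 at x and its neighbours, so the transport is a pure
        translation. A nonzero value would place a point of height above 2 J h within (R + t) h of
        y, whose height is not positive.\<close>
      have c2: "transport \<eta> Q s h w x = 0"
        if w: "\<forall>x. far_from \<Omega> (R * h) x \<longrightarrow> w x = 0" and x: "norm (x - x0) < r / 8 + t * h"
          and y: "y \<notin> \<Omega>" "norm (x - y) \<le> t * h" for w x y
      proof -
        have one: "\<eta> x' = 1" if "norm (x' - x) \<le> h" for x'
        proof (rule \<eta>1)
          fix i
          have "norm (x' - x0) < r / 5"
            using norm_triangle_ineq[of "x' - x" "x - x0"] that x h\<kappa> hnn h by simp
          then show "\<bar>x' $ i - x0 $ i\<bar> \<le> r / 5" using component_le_norm_cart[of "x' - x0" i] by simp
        qed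
        have "norm (x + h *\<^sub>R axis j 1 - x) \<le> h" "norm (x - h *\<^sub>R axis j 1 - x) \<le> h" for j :: 3
          using h by (simp_all add: norm_axis_1)
        then have tr: "transport \<eta> Q s h w x = w (x - h *\<^sub>R s)"
          unfolding transport_def using one[of x] one h by simp
        show ?thesis
        proof (rule ccontr)
          assume "transport \<eta> Q s h w x \<noteq> 0"
          then obtain \<omega> where \<omega>: "\<omega> \<in> \<Omega>" "norm (x - h *\<^sub>R s - \<omega>) \<le> R * h"
            using w unfolding tr far_from_def by (meson not_le)
          have hs: "norm (h *\<^sub>R s) \<le> b * h" using b(2) h by (simp add: mult.commute[of b] mult_left_mono)
          have "norm (\<omega> - x0) \<le> norm (x - h *\<^sub>R s - \<omega>) + norm (h *\<^sub>R s) + norm (x - x0)"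
            using norm_triangle_ineq4[of "x - x0 - h *\<^sub>R s" "x - h *\<^sub>R s - \<omega>"]
              norm_triangle_ineq4[of "x - x0" "h *\<^sub>R s"] by (simp add: algebra_simps)
          then have "norm (\<omega> - x0) < r" using \<omega>(2) hs x h\<kappa> hnn r h by linarith
          then have l\<omega>: "l \<omega> > 0" using dom \<omega>(1) by blast
          have "norm (y - x0) < r"
            using norm_triangle_ineq4[of "x - x0" "x - y"] x y(2) h\<kappa> hnn r h by simp
          then have ly: "l y \<le> 0" using dom y(1) by (meson not_le)
          have "l \<omega> + h * (2 * real J) \<le> l (\<omega> + h *\<^sub>R s)"
            using mono[of "h * (2 * real J)" \<omega>] h by (simp add: s_def mult_ac)
          moreover have "l (\<omega> + h *\<^sub>R s) - l y \<le> \<Lambda> * ((R + t) * h)"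
          proof -
            have "norm (\<omega> + h *\<^sub>R s - y) \<le> (R + t) * h"
              using norm_triangle_ineq4[of "x - y" "x - h *\<^sub>R s - \<omega>"] \<omega>(2) y(2) by (simp add: algebra_simps)
            then show ?thesis using lip[of "\<omega> + h *\<^sub>R s" y] \<Lambda> mult_left_mono order_trans by blast
          qed
          moreover have "\<Lambda> * ((R + t) * h) \<le> real J * h" using J h mult_right_mono[of "\<Lambda> * (R + t)" "real J" h] by (simp add: mult.assoc)
          moreover have "real J * h \<le> h * (2 * real J)" using h by simp
          ultimately show False using l\<omega> ly by linarith
        qed
      qed
      have loc: "transport \<eta> Q s h w x = 0" if w: "\<forall>y. norm (y - x) \<le> (b + 1) * h \<longrightarrow> w y = 0" for w x
      proof -
        have far: "w (x' - h *\<^sub>R \<alpha>) = 0" if "norm (x' - x) \<le> h" "norm \<alpha> \<le> b" for x' \<alpha>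
        proof -
          have "norm (h *\<^sub>R \<alpha>) \<le> b * h" using that(2) h by (simp add: mult.commute[of b] mult_left_mono)
          then have "norm (x' - h *\<^sub>R \<alpha> - x) \<le> (b + 1) * h"
            using norm_triangle_ineq4[of "x' - x" "h *\<^sub>R \<alpha>"] that(1) by (simp add: algebra_simps)
          then show ?thesis using w by blast
        qed
        have pf: "pot_field Q h w j x' = 0" if "norm (x' - x) \<le> h" for x' j
          using bQ far[OF that] by (intro pot_field_zero) blast
        have "norm (x + h *\<^sub>R axis j 1 - x) \<le> h" "norm (x - h *\<^sub>R axis j 1 - x) \<le> h" for j :: 3
          using h by (simp_all add: norm_axis_1)
        then show ?thesis
          unfolding transport_def using far[of x s] far[of x 0] pf b h by simp
      qed
      have est: "small_regular h (\<lambda>y. transport \<eta> Q s h w y - w y) x (\<rho> - (b + 1) * h) (C * M)"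
        if "regular w x \<rho> M" for w x \<rho> M
        using Creg[OF _ _ that, of h] h h0 by simp
      show ?thesis unfolding inward_op_def
      proof (intro conjI)
        show "\<forall>w. (\<forall>x. far_from \<Omega> (R * h) x \<longrightarrow> w x = 0) \<longrightarrow>
            (\<forall>x. far_from \<Omega> ((R + (c0 + 3)) * h) x \<longrightarrow> transport \<eta> Q s h w x = 0)" using c1 by blast
        show "\<forall>w. (\<forall>x. far_from \<Omega> (R * h) x \<longrightarrow> w x = 0) \<longrightarrow>
            (\<forall>x y. (\<exists>(x0, r)\<in>{(x0, r / 8)}. norm (x - x0) < r + t * h) \<longrightarrow> y \<notin> \<Omega> \<longrightarrow>
               norm (x - y) \<le> t * h \<longrightarrow> transport \<eta> Q s h w x = 0)"
          by (intro allI impI, rule c2) auto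
      qed (use lin div loc est in blast)+
    qed
    then show ?thesis using b C h0 by (intro inward_familyI[of "b + 1" C h0]) auto
  qed
  moreover have "0 \<le> c0 + 3" using c0(1) by simp
  ultimately show ?thesis by blast
qed

lemma inward_opD:
  assumes "inward_op \<Omega> F R R' t s C h T"
  shows "T (\<lambda>y. c *\<^sub>R (w y - w' y)) x = c *\<^sub>R (T w x - T w' x)"
    and "(\<And>x. disc_div h w x = 0) \<Longrightarrow> disc_div h (T w) x = 0"
    and "(\<And>x. far_from \<Omega> (R * h) x \<Longrightarrow> w x = 0) \<Longrightarrow> far_from \<Omega> (R' * h) x \<Longrightarrow> T w x = 0"
    and "(\<And>x. far_from \<Omega> (R * h) x \<Longrightarrow> w x = 0) \<Longrightarrow> (x0, r) \<in> F \<Longrightarrow> norm (x - x0) < r + t * h \<Longrightarrow>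
       y \<notin> \<Omega> \<Longrightarrow> norm (x - y) \<le> t * h \<Longrightarrow> T w x = 0"
    and "(\<And>y. norm (y - x) \<le> s * h \<Longrightarrow> w y = 0) \<Longrightarrow> T w x = 0"
    and "regular w x \<rho> M \<Longrightarrow> small_regular h (\<lambda>y. T w y - w y) x (\<rho> - s * h) (C * M)"
proof -
  note d = assms[unfolded inward_op_def]
  note d1 = d[THEN conjunct1] and d2 = d[THEN conjunct2, THEN conjunct1]
    and d3 = d[THEN conjunct2, THEN conjunct2, THEN conjunct1]
    and d4 = d[THEN conjunct2, THEN conjunct2, THEN conjunct2, THEN conjunct1]
    and d5 = d[THEN conjunct2, THEN conjunct2, THEN conjunct2, THEN conjunct2, THEN conjunct1]
    and d6 = d[THEN conjunct2, THEN conjunct2, THEN conjunct2, THEN conjunct2, THEN conjunct2]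
  show "T (\<lambda>y. c *\<^sub>R (w y - w' y)) x = c *\<^sub>R (T w x - T w' x)" by (rule d1[rule_format])
  show "disc_div h (T w) x = 0" if "\<And>x. disc_div h w x = 0" by (rule d2[rule_format]) (rule that)
  show "T w x = 0" if "\<And>x. far_from \<Omega> (R * h) x \<Longrightarrow> w x = 0" "far_from \<Omega> (R' * h) x"
    by (rule d3[rule_format]) (rule that, assumption?)+
  show "T w x = 0" if w: "\<And>x. far_from \<Omega> (R * h) x \<Longrightarrow> w x = 0" and x: "(x0, r) \<in> F" "norm (x - x0) < r + t * h"
    and y: "y \<notin> \<Omega>" "norm (x - y) \<le> t * h"
  proof -
    have "\<exists>(x0, r)\<in>F. norm (x - x0) < r + t * h" using x by blast
    from d4[rule_format, OF w this y] show ?thesis .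
  qed
  show "T w x = 0" if "\<And>y. norm (y - x) \<le> s * h \<Longrightarrow> w y = 0" by (rule d5[rule_format]) (rule that)
  show "small_regular h (\<lambda>y. T w y - w y) x (\<rho> - s * h) (C * M)" if "regular w x \<rho> M"
    by (rule d6[rule_format]) (rule that)
qed

lemma inward_op_id: "inward_op \<Omega> {} R R t 0 0 h (\<lambda>w. w)"
  by (auto simp: inward_op_def diff_bounds_def)

text \<open>In the balls of F the first operator clears a layer of width (t + s2) h, so the second,
  whose reach is s2 h, sees only zeros within t h of the complement. In the balls of F2 the second
  operator clears the layer itself.\<close>

lemma inward_op_compose:
  assumes T1: "inward_op \<Omega> F R R1 (t + s2) s1 C1 h T1" and T2: "inward_op \<Omega> F2 R1 R2 t s2 C2 h T2"
    and h: "0 < h" "h \<le> 1" and s: "s1 \<ge> 0" "s2 \<ge> 0"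
  shows "inward_op \<Omega> (F \<union> F2) R R2 t (s1 + s2) (C2 * (1 + C1) + C1) h (\<lambda>w. T2 (T1 w))"
proof -
  note D1 = inward_opD[OF T1] and D2 = inward_opD[OF T2]
  have lin: "T2 (T1 (\<lambda>y. c *\<^sub>R (w y - w' y))) x = c *\<^sub>R (T2 (T1 w) x - T2 (T1 w') x)" for c w w' x
    using D2(1)[of c "T1 w" "T1 w'" x] D1(1)[abs_def, of c w w'] by simp
  have supp: "T2 (T1 w) x = 0" if "\<And>x. far_from \<Omega> (R * h) x \<Longrightarrow> w x = 0" "far_from \<Omega> (R2 * h) x" for w x
    using D2(3)[of "T1 w"] D1(3)[of w] that by blast
  have van: "T2 (T1 w) x = 0" if w: "\<And>x. far_from \<Omega> (R * h) x \<Longrightarrow> w x = 0"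
    and x0: "(x0, r) \<in> F \<union> F2" and x: "norm (x - x0) < r + t * h" and y: "y \<notin> \<Omega>" "norm (x - y) \<le> t * h"
    for w :: "real^3 \<Rightarrow> real^3" and x x0 r y
  proof (cases "(x0, r) \<in> F2")
    case True
    then show ?thesis using D2(4)[of "T1 w"] D1(3)[of w] w x y by blast
  next
    case False
    then have F: "(x0, r) \<in> F" using x0 by blast
    show ?thesis
    proof (rule D2(5))
      fix x' assume x': "norm (x' - x) \<le> s2 * h"
      have "norm (x' - x0) < r + (t + s2) * h"
        using norm_triangle_ineq[of "x' - x" "x - x0"] x' x by (simp add: algebra_simps)
      moreover have "norm (x' - y) \<le> (t + s2) * h"
        using norm_triangle_ineq[of "x' - x" "x - y"] x' y(2) by (simp add: algebra_simps)
      ultimately show "T1 w x' = 0" using D1(4)[of w x0 r x' y] w F y(1) by blast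
    qed
  qed
  have loc: "T2 (T1 w) x = 0" if w: "\<And>y. norm (y - x) \<le> (s1 + s2) * h \<Longrightarrow> w y = 0" for w x
  proof (rule D2(5), rule D1(5))
    fix y z assume "norm (y - x) \<le> s2 * h" "norm (z - y) \<le> s1 * h"
    then have "norm (z - x) \<le> (s1 + s2) * h"
      using norm_triangle_ineq[of "z - y" "y - x"] by (simp add: algebra_simps)
    then show "w z = 0" by (rule w)
  qed
  have est: "small_regular h (\<lambda>y. T2 (T1 w) y - w y) x (\<rho> - (s1 + s2) * h) ((C2 * (1 + C1) + C1) * M)"
    if w: "regular w x \<rho> M" for w x \<rho> M
  proof -
    note e1 = D1(6)[OF w]
    have "regular (\<lambda>y. w y + (T1 w y - w y)) x (\<rho> - s1 * h) (M + C1 * M)"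
      using s h by (intro diff_bounds_add diff_bounds_mono[OF w] small_regular_imp_regular[OF e1]) auto
    then have "regular (T1 w) x (\<rho> - s1 * h) ((1 + C1) * M)" by (simp add: algebra_simps)
    from D2(6)[OF this] have e2: "small_regular h (\<lambda>y. T2 (T1 w) y - T1 w y) x (\<rho> - (s1 + s2) * h) (C2 * ((1 + C1) * M))"
      by (simp add: algebra_simps)
    have e1': "small_regular h (\<lambda>y. T1 w y - w y) x (\<rho> - (s1 + s2) * h) (C1 * M)"
      using s h by (intro diff_bounds_mono[OF e1]) (auto simp: algebra_simps)
    from diff_bounds_add[OF e2 e1'] show ?thesis by (simp add: algebra_simps)
  qed
  show ?thesis unfolding inward_op_def
  proof (intro conjI allI impI)
    show "T2 (T1 (\<lambda>y. c *\<^sub>R (w y - w' y))) x = c *\<^sub>R (T2 (T1 w) x - T2 (T1 w') x)" for c w w' x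
      by (rule lin)
    show "disc_div h (T2 (T1 w)) x = 0" if "\<forall>x. disc_div h w x = 0" for w x
      using that D1(2)[of w] D2(2)[of "T1 w"] by simp
    show "T2 (T1 w) x = 0" if "\<forall>x. far_from \<Omega> (R * h) x \<longrightarrow> w x = 0" "far_from \<Omega> (R2 * h) x" for w x
      using that by (intro supp) auto
    show "T2 (T1 w) x = 0" if w: "\<forall>x. far_from \<Omega> (R * h) x \<longrightarrow> w x = 0"
      and x: "\<exists>(x0, r)\<in>F \<union> F2. norm (x - x0) < r + t * h" and y: "y \<notin> \<Omega>" "norm (x - y) \<le> t * h" for w x y
    proof -
      obtain x0 r where x0: "(x0, r) \<in> F \<union> F2" "norm (x - x0) < r + t * h" using x by auto
      show ?thesis by (rule van[OF _ x0 y]) (use w in simp)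
    qed
    show "T2 (T1 w) x = 0" if "\<forall>y. norm (y - x) \<le> (s1 + s2) * h \<longrightarrow> w y = 0" for w x
      using that by (intro loc) auto
    show "small_regular h (\<lambda>y. T2 (T1 w) y - w y) x (\<rho> - (s1 + s2) * h) ((C2 * (1 + C1) + C1) * M)"
      if "regular w x \<rho> M" for w x \<rho> M using that by (rule est)
  qed
qed

text \<open>The new chart acts last. Its reach s2 is known only after R and t are fixed, and then
  the earlier operators are requested with width t + s2; this is consistent because their spread c1
  serves for every t.\<close>

lemma inward_family_finite:
  assumes "finite F" "\<And>x0 r. (x0, r) \<in> F \<Longrightarrow> \<exists>l m \<Lambda>. inward_chart \<Omega> x0 (8 * r) l m \<Lambda>"
  shows "\<exists>c\<ge>0. \<forall>R\<ge>0. \<forall>t\<ge>0. inward_family \<Omega> F R (R + c) t"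
  using assms
proof (induction F)
  case empty
  have "inward_family \<Omega> {} R (R + 0) t" for R t
    using inward_op_id[of \<Omega> R t] by (intro inward_familyI[of 0 0 1]) auto
  then show ?case by blast
next
  case (insert p F)
  obtain x0 r where p: "p = (x0, r)" by (cases p)
  have "\<exists>c\<ge>0. \<forall>R\<ge>0. \<forall>t\<ge>0. inward_family \<Omega> F R (R + c) t"
    by (rule insert.IH[OF insert.prems[OF insertI2]])
  then obtain c1 where c1: "c1 \<ge> 0" and IH: "\<And>R t. R \<ge> 0 \<Longrightarrow> t \<ge> 0 \<Longrightarrow> inward_family \<Omega> F R (R + c1) t"
    by blast
  obtain l m \<Lambda> where ch: "inward_chart \<Omega> x0 (8 * r) l m \<Lambda>" using insert.prems p by blast
  have "\<exists>c\<ge>0. \<forall>R\<ge>0. \<forall>t\<ge>0. inward_family \<Omega> {(x0, r)} R (R + c) t"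
    using chart_step[OF ch] by simp
  then obtain c2 where c2: "c2 \<ge> 0" and
    step: "\<And>R t. R \<ge> 0 \<Longrightarrow> t \<ge> 0 \<Longrightarrow> inward_family \<Omega> {(x0, r)} R (R + c2) t" by blast
  have "inward_family \<Omega> (insert p F) R (R + (c1 + c2)) t" if R: "R \<ge> 0" and t: "t \<ge> 0" for R t
  proof -
    have R': "R + c1 \<ge> 0" using R c1 by simp
    obtain s2 C2 h2 where 2: "s2 \<ge> 0" "C2 \<ge> 0" "h2 > 0" "h2 \<le> 1"
      and T2ex: "\<forall>h. 0 < h \<and> h < h2 \<longrightarrow> (\<exists>T. inward_op \<Omega> {(x0, r)} (R + c1) (R + c1 + c2) t s2 C2 h T)"
      by (rule inward_familyE[OF step[OF R' t]])
    have t': "t + s2 \<ge> 0" using t 2 by simp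
    obtain s1 C1 h1 where 1: "s1 \<ge> 0" "C1 \<ge> 0" "h1 > 0" "h1 \<le> 1"
      and T1ex: "\<forall>h. 0 < h \<and> h < h1 \<longrightarrow> (\<exists>T. inward_op \<Omega> F R (R + c1) (t + s2) s1 C1 h T)"
      by (rule inward_familyE[OF IH[OF R t']])
    show ?thesis
    proof (rule inward_familyI[of "s1 + s2" "C2 * (1 + C1) + C1" "min h1 h2"])
      fix h assume h: "0 < h" "h < min h1 h2"
      obtain T1 where T1: "inward_op \<Omega> F R (R + c1) (t + s2) s1 C1 h T1" using T1ex h by auto
      obtain T2 where T2: "inward_op \<Omega> {(x0, r)} (R + c1) (R + c1 + c2) t s2 C2 h T2" using T2ex h by auto
      have "inward_op \<Omega> (F \<union> {(x0, r)}) R (R + c1 + c2) t (s1 + s2) (C2 * (1 + C1) + C1) h (\<lambda>w. T2 (T1 w))"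
        using h 1 2 by (intro inward_op_compose[OF T1 T2]) auto
      moreover have "F \<union> {(x0, r)} = insert p F" "R + c1 + c2 = R + (c1 + c2)" using p by auto
      ultimately show "\<exists>T. inward_op \<Omega> (insert p F) R (R + (c1 + c2)) t (s1 + s2) (C2 * (1 + C1) + C1) h T"
        by metis
    qed (use 1 2 in auto)
  qed
  moreover have "0 \<le> c1 + c2" using c1 c2 by simp
  ultimately show ?case by blast
qed

section \<open>Covering the boundary by charts\<close>

definition boundary_cover :: "(real^3) set \<Rightarrow> ((real^3) \<times> real) set \<Rightarrow> real \<Rightarrow> bool" where
  "boundary_cover \<Omega> F \<epsilon> \<longleftrightarrow> finite F \<and> \<epsilon> > 0 \<and>
     (\<forall>x0 r. (x0, r) \<in> F \<longrightarrow> (\<exists>l m \<Lambda>. inward_chart \<Omega> x0 (8 * r) l m \<Lambda>)) \<and>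
     (\<forall>x y. x \<in> \<Omega> \<longrightarrow> y \<notin> \<Omega> \<longrightarrow> norm (x - y) < \<epsilon> \<longrightarrow>
       (\<exists>(x0, r)\<in>F. norm (x - x0) < r) \<and> (\<exists>(x0, r)\<in>F. norm (y - x0) < r))"

lemma boundary_coverD:
  assumes "boundary_cover \<Omega> F \<epsilon>"
  shows "finite F" "\<epsilon> > 0" "(x0, r) \<in> F \<Longrightarrow> \<exists>l m \<Lambda>. inward_chart \<Omega> x0 (8 * r) l m \<Lambda>"
    "x \<in> \<Omega> \<Longrightarrow> y \<notin> \<Omega> \<Longrightarrow> norm (x - y) < \<epsilon> \<Longrightarrow>
       (\<exists>(x0, r)\<in>F. norm (x - x0) < r) \<and> (\<exists>(x0, r)\<in>F. norm (y - x0) < r)"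
  using assms unfolding boundary_cover_def by simp_all

text \<open>Compactness yields finitely many balls whose union contains a uniform neighbourhood of
  the boundary. A short segment from \<Omega> to its complement meets the boundary, so both ends lie
  in that neighbourhood.\<close>

lemma boundary_charts:
  assumes "bounded \<Omega>" "lipschitz_boundary \<Omega>"
  obtains F \<epsilon> where "boundary_cover \<Omega> F \<epsilon>"
proof -
  have "\<forall>x0\<in>frontier \<Omega>. \<exists>r. r > 0 \<and> (\<exists>l m \<Lambda>. inward_chart \<Omega> x0 (8 * r) l m \<Lambda>)"
  proof
    fix x0 assume "x0 \<in> frontier \<Omega>"
    then obtain r l m \<Lambda> where ch: "inward_chart \<Omega> x0 r l m \<Lambda>" using inward_chart_exists[OF assms(2)] by blast
    then have "inward_chart \<Omega> x0 (8 * (r / 8)) l m \<Lambda>" "r / 8 > 0" by (simp_all add: inward_chart_def)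
    then show "\<exists>r. r > 0 \<and> (\<exists>l m \<Lambda>. inward_chart \<Omega> x0 (8 * r) l m \<Lambda>)" by blast
  qed
  then obtain \<rho> where \<rho>: "\<And>x0. x0 \<in> frontier \<Omega> \<Longrightarrow> \<rho> x0 > 0 \<and> (\<exists>l m \<Lambda>. inward_chart \<Omega> x0 (8 * \<rho> x0) l m \<Lambda>)"
    by metis
  have cpt: "compact (frontier \<Omega>)" using assms(1) by (rule compact_frontier_bounded)
  have "frontier \<Omega> \<subseteq> (\<Union>x0\<in>frontier \<Omega>. ball x0 (\<rho> x0))" using \<rho> by fastforce
  then obtain X where X: "X \<subseteq> frontier \<Omega>" "finite X" "frontier \<Omega> \<subseteq> (\<Union>x0\<in>X. ball x0 (\<rho> x0))"
    using compactE_image[OF cpt, of "frontier \<Omega>" "\<lambda>x0. ball x0 (\<rho> x0)"] by auto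
  obtain \<epsilon> where \<epsilon>: "\<epsilon> > 0" "(\<Union>x\<in>frontier \<Omega>. ball x \<epsilon>) \<subseteq> (\<Union>x0\<in>X. ball x0 (\<rho> x0))"
    using compact_subset_open_imp_ball_epsilon_subset[OF cpt _ X(3)] by blast
  define F where "F = (\<lambda>x0. (x0, \<rho> x0)) ` X"
  have cover: "\<exists>(x0, r)\<in>F. norm (x - x0) < r" if b: "b \<in> frontier \<Omega>" "dist b x < \<epsilon>" for x b
  proof -
    have "x \<in> (\<Union>x\<in>frontier \<Omega>. ball x \<epsilon>)" using b by auto
    then have "x \<in> (\<Union>x0\<in>X. ball x0 (\<rho> x0))" using \<epsilon>(2) by blast
    then show ?thesis by (auto simp: F_def dist_norm norm_minus_commute)
  qed
  show thesis
  proof (rule that[of F \<epsilon>], unfold boundary_cover_def, intro conjI allI impI)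
    show "finite F" "\<epsilon> > 0" using X \<epsilon> by (simp_all add: F_def)
    show "\<exists>l m \<Lambda>. inward_chart \<Omega> x0 (8 * r) l m \<Lambda>" if "(x0, r) \<in> F" for x0 r
      using that \<rho> X(1) by (auto simp: F_def)
    fix x y assume xy: "x \<in> \<Omega>" "y \<notin> \<Omega>" "norm (x - y) < \<epsilon>"
    have both: "(\<exists>(x0, r)\<in>F. norm (x - x0) < r) \<and> (\<exists>(x0, r)\<in>F. norm (y - x0) < r)"
    proof -
      have "closed_segment x y \<inter> frontier \<Omega> \<noteq> {}"
        using xy by (intro connected_Int_frontier) auto
      then obtain b where b: "b \<in> closed_segment x y" "b \<in> frontier \<Omega>" by blast
      have "dist b x < \<epsilon>" "dist b y < \<epsilon>"
        using dist_in_closed_segment[OF b(1)] xy(3) by (auto simp: dist_norm norm_minus_commute)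
      then show ?thesis using cover[OF b(2)] by blast
    qed
    then show "\<exists>(x0, r)\<in>F. norm (x - x0) < r" "\<exists>(x0, r)\<in>F. norm (y - x0) < r" by blast+
  qed
qed

text \<open>A point farther than (R + c) h from \<Omega> is handled by the support bound. Any other
  point that has the complement within t h is close to the boundary, hence in a ball of the cover,
  where the layer is cleared.\<close>

lemma solenoidal_inward:
  assumes \<Omega>: "bounded \<Omega>" "lipschitz_boundary \<Omega>" and R: "R \<ge> 0" and t: "t \<ge> 0"
  obtains s C h0 where "s \<ge> 0" "C \<ge> 0" "h0 > 0" "h0 \<le> 1"
    "\<And>h. 0 < h \<Longrightarrow> h < h0 \<Longrightarrow> \<exists>T.
       (\<forall>c w w' x. T (\<lambda>y. c *\<^sub>R (w y - w' y)) x = c *\<^sub>R (T w x - T w' x)) \<and>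
       (\<forall>w. (\<forall>x. disc_div h w x = 0) \<longrightarrow> (\<forall>x. disc_div h (T w) x = 0)) \<and>
       (\<forall>w. (\<forall>x. far_from \<Omega> (R * h) x \<longrightarrow> w x = 0) \<longrightarrow>
          (\<forall>x y. y \<notin> \<Omega> \<longrightarrow> norm (x - y) \<le> t * h \<longrightarrow> T w x = 0)) \<and>
       (\<forall>w x \<rho> M. regular w x \<rho> M \<longrightarrow> small_regular h (\<lambda>y. T w y - w y) x (\<rho> - s * h) (C * M))"
proof -
  obtain F \<epsilon> where bc: "boundary_cover \<Omega> F \<epsilon>" by (rule boundary_charts[OF \<Omega>])
  note F = boundary_coverD(1)[OF bc] and \<epsilon> = boundary_coverD(2)[OF bc]
    and ch = boundary_coverD(3)[OF bc] and cover = boundary_coverD(4)[OF bc]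
  obtain c where c: "c \<ge> 0" and fam: "inward_family \<Omega> F R (R + c) t"
    using inward_family_finite[OF F ch] R t by blast
  obtain s C h1 where s: "s \<ge> 0" "C \<ge> 0" "h1 > 0" "h1 \<le> 1"
    and sT: "\<forall>h. 0 < h \<and> h < h1 \<longrightarrow> (\<exists>T. inward_op \<Omega> F R (R + c) t s C h T)"
    by (rule inward_familyE[OF fam])
  define h0 where "h0 = min h1 (\<epsilon> / (R + c + t + 1))"
  show thesis
  proof (rule that[of s C h0])
    show "s \<ge> 0" "C \<ge> 0" "h0 > 0" "h0 \<le> 1" using s \<epsilon> R c t by (auto simp: h0_def)
    fix h assume h: "0 < h" "h < h0"
    have "h * (R + c + t + 1) < \<epsilon>" using h R c t by (simp add: h0_def field_simps)
    moreover have "0 \<le> R * h" "0 \<le> c * h" "0 \<le> t * h" using R c t h by simp_all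
    ultimately have small: "(R + c) * h < \<epsilon>" "t * h < \<epsilon>" using h by (simp_all add: algebra_simps)
    obtain T where T: "inward_op \<Omega> F R (R + c) t s C h T" using sT h by (auto simp: h0_def)
    note D = inward_opD[OF T]
    have van: "T w x = 0" if w: "\<And>x. far_from \<Omega> (R * h) x \<Longrightarrow> w x = 0" and y: "y \<notin> \<Omega>" "norm (x - y) \<le> t * h" for w x y
    proof -
      have th: "0 \<le> t * h" by fact
      show ?thesis
      proof (cases "far_from \<Omega> ((R + c) * h) x")
        case True then show ?thesis using D(3)[of w x] w by blast
      next
        case False
        then obtain z where z: "z \<in> \<Omega>" "norm (x - z) \<le> (R + c) * h" by (auto simp: far_from_def not_less)
        have "\<exists>(x0, r)\<in>F. norm (x - x0) < r"
        proof (cases "x \<in> \<Omega>")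
          case True then show ?thesis using cover[of x y] y small by simp
        next
          case False then show ?thesis using cover[of z x] z small by (simp add: norm_minus_commute)
        qed
        then obtain x0 r where x0: "(x0, r) \<in> F" "norm (x - x0) < r" by blast
        show ?thesis by (rule D(4)[OF w x0(1) _ y]) (use x0(2) th in linarith)+
      qed
    qed
    show "\<exists>T. (\<forall>c w w' x. T (\<lambda>y. c *\<^sub>R (w y - w' y)) x = c *\<^sub>R (T w x - T w' x)) \<and>
       (\<forall>w. (\<forall>x. disc_div h w x = 0) \<longrightarrow> (\<forall>x. disc_div h (T w) x = 0)) \<and>
       (\<forall>w. (\<forall>x. far_from \<Omega> (R * h) x \<longrightarrow> w x = 0) \<longrightarrow>
          (\<forall>x y. y \<notin> \<Omega> \<longrightarrow> norm (x - y) \<le> t * h \<longrightarrow> T w x = 0)) \<and>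
       (\<forall>w x \<rho> M. regular w x \<rho> M \<longrightarrow> small_regular h (\<lambda>y. T w y - w y) x (\<rho> - s * h) (C * M))"
    proof (rule exI[of _ T], intro conjI)
      show "\<forall>w. (\<forall>x. far_from \<Omega> (R * h) x \<longrightarrow> w x = 0) \<longrightarrow>
          (\<forall>x y. y \<notin> \<Omega> \<longrightarrow> norm (x - y) \<le> t * h \<longrightarrow> T w x = 0)" using van by blast
    qed (use D(1,2,6) in blast)+
  qed
qed

section \<open>Counting grid points near the boundary\<close>

text \<open>Stacking argument: layer points have height in (0, q h], and a shift by q h m raises the
  height by at least q h, so about 1/h successive translates of the layer are disjoint. They lie in
  one box with O(h^-3) grid points, which leaves O(h^-2) for the layer.\<close>

lemma chart_layer_card:
  assumes ch: "inward_chart \<Omega> x0 (8 * r) l m \<Lambda>" and \<kappa>: "\<kappa> \<ge> 0"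
  shows "\<exists>K\<ge>0. \<exists>h0>0. \<forall>h. 0 < h \<and> h < h0 \<longrightarrow>
    real (card {x \<in> grid h. norm (x - x0) < r \<and> x \<in> \<Omega> \<and> (\<exists>y. y \<notin> \<Omega> \<and> norm (x - y) \<le> \<kappa> * h)}) \<le> K / h\<^sup>2"
proof -
  have r: "r > 0" and \<Lambda>: "\<Lambda> \<ge> 0" and lip: "\<And>y y'. l y - l y' \<le> \<Lambda> * norm (y - y')"
    and mono: "\<And>y c. c \<ge> 0 \<Longrightarrow> l y + c \<le> l (y + c *\<^sub>R m)"
    and dom: "\<And>y. norm (y - x0) < 8 * r \<Longrightarrow> y \<in> \<Omega> \<longleftrightarrow> l y > 0"
    using ch by (auto simp: inward_chart_def)
  obtain z :: "int^3" where z: "m = (\<chi> i. real_of_int (z $ i))" using ch by (auto simp: inward_chart_def)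
  obtain q0 :: nat where "\<Lambda> * \<kappa> \<le> real q0" using real_arch_simple by blast
  then obtain q :: nat where q: "\<Lambda> * \<kappa> \<le> real q" "q \<ge> 1" by (intro that[of "Suc q0"]) auto
  define b where "b = norm x0 + 2 * r"
  \<comment> \<open>a h bounds the length of one shift, the added 1 making a positive; hence r / (a
    h) shifts move a point by at most r.\<close>
  define a where "a = real q * (norm m + 1)"
  have a: "a > 0" using q(2) by (simp add: a_def add_nonneg_pos)
  have b: "b \<ge> 0" using r by (simp add: b_def)
  define K where "K = (2 * b + 1) ^ 3 * (2 * a) / r"
  define h0 where "h0 = min (min 1 (r / a)) (r / (\<kappa> + 1))"
  have "real (card {x \<in> grid h. norm (x - x0) < r \<and> x \<in> \<Omega> \<and> (\<exists>y. y \<notin> \<Omega> \<and> norm (x - y) \<le> \<kappa> * h)}) \<le> K / h\<^sup>2"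
    if h: "0 < h" "h < h0" for h
  proof -
    define S where "S = {x \<in> grid h. norm (x - x0) < r \<and> x \<in> \<Omega> \<and> (\<exists>y. y \<notin> \<Omega> \<and> norm (x - y) \<le> \<kappa> * h)}"
    have h1: "h < 1" "h * a < r" "h * (\<kappa> + 1) < r" using h a \<kappa> by (auto simp: h0_def field_simps)
    define n where "n = nat \<lfloor>r / (a * h)\<rfloor>"
    have ratio: "1 \<le> r / (a * h)" using h1(2) a h by (simp add: field_simps)
    have n: "real n \<le> r / (a * h)" "r / (2 * a * h) \<le> real n"
    proof -
      have fl: "real n = of_int \<lfloor>r / (a * h)\<rfloor>" using ratio by (simp add: n_def)
      show "real n \<le> r / (a * h)" unfolding fl by simp
      have "1 \<le> \<lfloor>r / (a * h)\<rfloor>" using ratio by simp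
      then have "1 \<le> real_of_int \<lfloor>r / (a * h)\<rfloor>" by linarith
      then have "r / (a * h) \<le> 2 * real n" unfolding fl using floor_correct[of "r / (a * h)"] by linarith
      moreover have "r / (a * h) = 2 * (r / (2 * a * h))" by simp
      ultimately show "r / (2 * a * h) \<le> real n" by linarith
    qed
    define g where "g = (\<lambda>(x::real^3, j::nat). x + (real j * real q * h) *\<^sub>R m)"
    define B where "B = {x \<in> grid h. \<forall>i. \<bar>x $ i\<bar> \<le> b}"
    have Sl: "0 < l x \<and> l x \<le> real q * h" if x: "x \<in> S" for x
    proof -
      obtain y where y: "y \<notin> \<Omega>" "norm (x - y) \<le> \<kappa> * h" and x': "norm (x - x0) < r" "x \<in> \<Omega>"
        using x by (auto simp: S_def)
      have lx: "0 < l x" using dom[of x] x' r by simp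
      have "\<kappa> * h < r" using h1(3) h by (simp add: algebra_simps)
      then have "norm (y - x0) < 8 * r"
        using norm_triangle_ineq4[of "x - x0" "x - y"] x' y(2) r by simp
      then have "l y \<le> 0" using dom y(1) by (meson not_le)
      moreover have "l x - l y \<le> \<Lambda> * (\<kappa> * h)"
        using lip[of x y] mult_left_mono[OF y(2) \<Lambda>] by linarith
      moreover have "\<Lambda> * (\<kappa> * h) \<le> real q * h"
        using mult_right_mono[OF q(1), of h] h by (simp add: mult.assoc)
      ultimately show ?thesis using lx by linarith
    qed
    have inj: "inj_on g (S \<times> {..<n})"
    proof -
      have False if x: "x \<in> S" "x' \<in> S" and eq: "x + (real j * real q * h) *\<^sub>R m = x' + (real j' * real q * h) *\<^sub>R m"
        and j: "j < j'" for x x' and j j' :: nat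
      proof -
        define d where "d = real j' - real j"
        have d: "d \<ge> 1" using j by (simp add: d_def)
        have xx: "x = x' + (d * (real q * h)) *\<^sub>R m" using eq by (simp add: d_def algebra_simps)
        have "real q * h \<le> d * (real q * h)" using d h mult_right_mono[OF d, of "real q * h"] by simp
        moreover have "l x' + d * (real q * h) \<le> l x" unfolding xx using d h by (intro mono) simp
        ultimately show False using Sl[OF x(1)] Sl[OF x(2)] by linarith
      qed
      note no = this
      show ?thesis
      proof (rule inj_onI)
        fix p p' assume p: "p \<in> S \<times> {..<n}" "p' \<in> S \<times> {..<n}" and eq: "g p = g p'"
        obtain x j x' j' where pp: "p = (x, j)" "p' = (x', j')" by (cases p, cases p')
        have e: "x + (real j * real q * h) *\<^sub>R m = x' + (real j' * real q * h) *\<^sub>R m"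
          using eq by (simp add: pp g_def)
        have xS: "x \<in> S" "x' \<in> S" using p pp by auto
        have "j = j'"
          using no[OF xS(1) xS(2) e] no[OF xS(2) xS(1) e[symmetric]] by (meson linorder_neqE_nat)
        then show "p = p'" using e pp by simp
      qed
    qed
    have "g ` (S \<times> {..<n}) \<subseteq> B"
    proof clarify
      fix x and j :: nat assume x: "x \<in> S" and j: "j < n"
      obtain zx :: "int^3" where zx: "x = (\<chi> i. h * real_of_int (zx $ i))" using x by (auto simp: S_def grid_def)
      have "g (x, j) = (\<chi> i. h * real_of_int ((\<chi> i. zx $ i + int j * int q * z $ i) $ i))"
        by (simp add: g_def zx z vec_eq_iff algebra_simps)
      then have gr: "g (x, j) \<in> grid h" unfolding grid_def by blast
      have "real j * (real q * norm m) * h \<le> real n * a * h"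
      proof -
        have "real j * (real q * norm m) \<le> real n * a"
          unfolding a_def using j by (intro mult_mono) auto
        then show ?thesis using h(1) by (intro mult_right_mono) auto
      qed
      also have "\<dots> \<le> r" using n(1) a h by (simp add: field_simps)
      finally have "norm ((real j * real q * h) *\<^sub>R m) \<le> r" using h by (simp add: mult_ac)
      then have "norm (g (x, j)) \<le> b"
        using norm_triangle_ineq[of x "(real j * real q * h) *\<^sub>R m"] norm_triangle_ineq[of "x - x0" x0] x
        by (simp add: g_def S_def b_def)
      then show "g (x, j) \<in> B" using gr component_le_norm_cart[of "g (x, j)"] by (auto simp: B_def intro: order_trans)
    qed
    then have "card (S \<times> {..<n}) \<le> card B"
      using card_inj_on_le[OF inj] card_grid_box(1)[OF h(1) b] by (simp add: B_def)
    then have "real (card S) * real n \<le> real (card B)" by (simp add: card_cartesian_product flip: of_nat_mult)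
    also have "\<dots> \<le> (2 * (b / h) + 1) ^ 3" using card_grid_box(2)[OF h(1) b] by (simp add: B_def)
    also have "\<dots> \<le> ((2 * b + 1) / h) ^ 3"
      using h h1 b by (intro power_mono) (auto simp: field_simps)
    finally have "real (card S) * real n \<le> ((2 * b + 1) / h) ^ 3" .
    moreover have "real (card S) * (r / (2 * a * h)) \<le> real (card S) * real n"
      using n(2) by (intro mult_left_mono) auto
    ultimately have "real (card S) * (r / (2 * a * h)) \<le> ((2 * b + 1) / h) ^ 3" by linarith
    then have "real (card S) \<le> ((2 * b + 1) / h) ^ 3 / (r / (2 * a * h))"
      using r a h by (subst pos_le_divide_eq) auto
    also have "\<dots> = K / h\<^sup>2" using r a h by (simp add: K_def power_divide power3_eq_cube power2_eq_square field_simps)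
    finally show ?thesis by (simp add: S_def)
  qed
  then have "\<forall>h. 0 < h \<and> h < h0 \<longrightarrow>
    real (card {x \<in> grid h. norm (x - x0) < r \<and> x \<in> \<Omega> \<and> (\<exists>y. y \<notin> \<Omega> \<and> norm (x - y) \<le> \<kappa> * h)}) \<le> K / h\<^sup>2"
    by simp
  moreover have "K \<ge> 0" "h0 > 0" using a b r \<kappa> by (auto simp: K_def h0_def)
  ultimately show ?thesis by (intro exI conjI)
qed

lemma layer_card:
  assumes \<Omega>: "bounded \<Omega>" "lipschitz_boundary \<Omega>" and \<kappa>: "\<kappa> \<ge> 0"
  obtains K h0 where "K \<ge> 0" "h0 > 0" "\<And>h. 0 < h \<Longrightarrow> h < h0 \<Longrightarrow>
    real (card {x \<in> grid_dom \<Omega> h. \<exists>y. y \<notin> \<Omega> \<and> norm (x - y) \<le> \<kappa> * h}) \<le> K / h\<^sup>2"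
proof -
  obtain F \<epsilon> where bc: "boundary_cover \<Omega> F \<epsilon>" by (rule boundary_charts[OF \<Omega>])
  note F = boundary_coverD(1)[OF bc] and \<epsilon> = boundary_coverD(2)[OF bc]
    and ch = boundary_coverD(3)[OF bc] and cover = boundary_coverD(4)[OF bc]
  let ?L = "\<lambda>h x. x \<in> \<Omega> \<and> (\<exists>y. y \<notin> \<Omega> \<and> norm (x - y) \<le> \<kappa> * h)"
  let ?S = "\<lambda>h p. {x \<in> grid h. norm (x - fst p) < snd p \<and> ?L h x}"
  have "\<forall>p\<in>F. \<exists>q. fst q \<ge> 0 \<and> snd q > (0::real) \<and> (\<forall>h. 0 < h \<and> h < snd q \<longrightarrow> real (card (?S h p)) \<le> fst q / h\<^sup>2)"
  proof
    fix p assume pF: "p \<in> F"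
    obtain l m \<Lambda> where "inward_chart \<Omega> (fst p) (8 * snd p) l m \<Lambda>"
      using pF ch[of "fst p" "snd p"] by auto
    from chart_layer_card[OF this \<kappa>] obtain K h0 where "K \<ge> 0" "h0 > 0"
      "\<forall>h. 0 < h \<and> h < h0 \<longrightarrow> real (card (?S h p)) \<le> K / h\<^sup>2" by blast
    then show "\<exists>q. fst q \<ge> 0 \<and> snd q > (0::real) \<and> (\<forall>h. 0 < h \<and> h < snd q \<longrightarrow> real (card (?S h p)) \<le> fst q / h\<^sup>2)"
      by (intro exI[of _ "(K, h0)"]) simp
  qed
  from bchoice[OF this] obtain k where k: "\<forall>p\<in>F. fst (k p) \<ge> 0 \<and> snd (k p) > (0::real) \<and>
      (\<forall>h. 0 < h \<and> h < snd (k p) \<longrightarrow> real (card (?S h p)) \<le> fst (k p) / h\<^sup>2)"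
    by (elim exE) (rule that)
  define K h0 where "K = (\<lambda>p. fst (k p))" and "h0 = (\<lambda>p. snd (k p))"
  have Kh: "K p \<ge> 0" "h0 p > 0" "0 < h \<Longrightarrow> h < h0 p \<Longrightarrow> real (card (?S h p)) \<le> K p / h\<^sup>2"
    if "p \<in> F" for p h
    using bspec[OF k that] by (auto simp: K_def h0_def)
  define h1 where "h1 = Min (insert (\<epsilon> / (\<kappa> + 1)) (h0 ` F))"
  show thesis
  proof (rule that[of "sum K F" h1])
    show "sum K F \<ge> 0" using Kh(1) by (simp add: sum_nonneg)
    show "h1 > 0" unfolding h1_def using F Kh(2) \<epsilon> \<kappa> by (subst Min_gr_iff) auto
    fix h assume h: "0 < h" "h < h1"
    have hF: "h < h0 p" if "p \<in> F" for p
    proof -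
      have "h1 \<le> h0 p" unfolding h1_def using F that by (intro Min_le) auto
      then show ?thesis using h by simp
    qed
    have "h1 \<le> \<epsilon> / (\<kappa> + 1)" unfolding h1_def using F by (intro Min_le) auto
    then have "h < \<epsilon> / (\<kappa> + 1)" using h by linarith
    then have "h * (\<kappa> + 1) < \<epsilon>" using \<kappa> by (simp add: pos_less_divide_eq)
    then have \<kappa>h: "\<kappa> * h < \<epsilon>" using h by (simp add: algebra_simps)
    let ?U = "\<Union>p\<in>F. ?S h p \<inter> grid_dom \<Omega> h"
    have sub: "{x \<in> grid_dom \<Omega> h. \<exists>y. y \<notin> \<Omega> \<and> norm (x - y) \<le> \<kappa> * h} \<subseteq> ?U"
    proof
      fix x assume x: "x \<in> {x \<in> grid_dom \<Omega> h. \<exists>y. y \<notin> \<Omega> \<and> norm (x - y) \<le> \<kappa> * h}"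
      then obtain y where y: "y \<notin> \<Omega>" "norm (x - y) \<le> \<kappa> * h" by blast
      have x': "x \<in> \<Omega>" "x \<in> grid h" "x \<in> grid_dom \<Omega> h" using x by (auto simp: grid_dom_def)
      obtain x0 r where "(x0, r) \<in> F" "norm (x - x0) < r" using cover[OF x'(1) y(1)] y(2) \<kappa>h by fastforce
      then show "x \<in> ?U" using x' y by (intro UN_I[of "(x0, r)"]) auto
    qed
    have finD: "finite (grid_dom \<Omega> h)" using finite_grid_dom[OF \<Omega>(1) h(1)] .
    have finS: "finite (?S h p)" if "p \<in> F" for p
    proof -
      obtain B where B: "\<And>x. x \<in> \<Omega> \<Longrightarrow> norm x \<le> B" "B > 0" using \<Omega>(1) bounded_pos by blast
      have "?S h p \<subseteq> {x \<in> grid h. \<forall>i. \<bar>x $ i\<bar> \<le> B}"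
        using B(1) component_le_norm_cart order_trans by blast
      then show ?thesis using card_grid_box(1)[OF h(1), of B] B(2) finite_subset by auto
    qed
    have "card {x \<in> grid_dom \<Omega> h. \<exists>y. y \<notin> \<Omega> \<and> norm (x - y) \<le> \<kappa> * h} \<le> card ?U"
      using F finD sub by (intro card_mono) auto
    also have "\<dots> \<le> (\<Sum>p\<in>F. card (?S h p \<inter> grid_dom \<Omega> h))" by (rule card_UN_le[OF F])
    also have "\<dots> \<le> (\<Sum>p\<in>F. card (?S h p))" using finS by (intro sum_mono card_mono) auto
    finally have "real (card {x \<in> grid_dom \<Omega> h. \<exists>y. y \<notin> \<Omega> \<and> norm (x - y) \<le> \<kappa> * h}) \<le> (\<Sum>p\<in>F. real (card (?S h p)))"
      by (simp flip: of_nat_sum)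
    also have "\<dots> \<le> (\<Sum>p\<in>F. K p / h\<^sup>2)" using Kh(3) h hF by (intro sum_mono) auto
    finally show "real (card {x \<in> grid_dom \<Omega> h. \<exists>y. y \<notin> \<Omega> \<and> norm (x - y) \<le> \<kappa> * h}) \<le> sum K F / h\<^sup>2"
      by (simp add: sum_divide_distrib)
  qed
qed

section \<open>Face averages\<close>

lemma real_divideR: "a /\<^sub>R c = a / c" for a c :: real
  by (simp only: real_scaleR_def divide_inverse_commute)

definition line_avg :: "real \<Rightarrow> 3 \<Rightarrow> (real^3 \<Rightarrow> real) \<Rightarrow> real^3 \<Rightarrow> real" where
  "line_avg h i g x = integral {-h..h} (\<lambda>s. g (x + s *\<^sub>R axis i 1)) / (2 * h)"

text \<open>Indices are taken modulo 3, so component i is averaged over the square of side 2 h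
  orthogonal to axis i: the mean flux through a face of a cube. The central divergence of such
  fluxes is the mean of the divergence over the cube.\<close>

definition face_avg :: "real \<Rightarrow> (real^3 \<Rightarrow> real^3) \<Rightarrow> real^3 \<Rightarrow> real^3" where
  "face_avg h V x = (\<chi> i. line_avg h (i + 1) (line_avg h (i + 2) (\<lambda>y. V y $ i)) x)"

lemma continuous_line:
  fixes g :: "real^3 \<Rightarrow> 'b::topological_space"
  assumes "continuous_on UNIV g"
  shows "continuous_on S (\<lambda>s. g (x + s *\<^sub>R axis i 1))"
  by (rule continuous_on_compose2[OF assms]) (auto intro!: continuous_intros)

lemma integrable_line:
  fixes g :: "real^3 \<Rightarrow> real"
  assumes "continuous_on UNIV g"
  shows "(\<lambda>s. g (x + s *\<^sub>R axis i 1)) integrable_on {a..b}"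
  by (rule integrable_continuous_interval[OF continuous_line[OF assms]])

lemma line_avg_abs_le:
  assumes h: "h > 0" and f: "f integrable_on {-h..h}" and b: "\<And>s. s \<in> {-h..h} \<Longrightarrow> \<bar>f s\<bar> \<le> k"
  shows "\<bar>integral {-h..h} f / (2 * h)\<bar> \<le> (k::real)"
proof -
  have "norm (integral {-h..h} f) \<le> integral {-h..h} (\<lambda>s. k)"
    using b by (intro integral_norm_bound_integral f) auto
  then have "\<bar>integral {-h..h} f\<bar> \<le> k * (2 * h)" using h by (simp add: mult_ac)
  moreover have "\<bar>integral {-h..h} f / (2 * h)\<bar> = \<bar>integral {-h..h} f\<bar> / (2 * h)" using h by simp
  ultimately show ?thesis using h by (simp only: pos_divide_le_eq mult_pos_pos zero_less_numeral)
qed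

text \<open>Stated for a family F rather than for the translates of one function, so that it serves
  both for the line average and for its difference from the function.\<close>

lemma diff_bounds_line_avg_gen:
  fixes F :: "real \<Rightarrow> real^3 \<Rightarrow> real"
  assumes h: "h > 0" and F: "\<And>y. F' y integrable_on {-h..h}" "\<And>s y. F' y s = F s y"
    and b: "\<And>s. s \<in> {-h..h} \<Longrightarrow> diff_bounds (F s) x \<rho> k l m n"
  shows "diff_bounds (\<lambda>y. integral {-h..h} (F' y) / (2 * h)) x \<rho> k l m n"
  unfolding diff_bounds_def
proof (intro conjI allI impI)
  fix y a c :: "real^3"
  let ?I = "\<lambda>f. integral {-h..h} f"
  have d2: "?I (F' (y + a)) / (2 * h) - ?I (F' y) / (2 * h) = ?I (\<lambda>s. F' (y + a) s - F' y s) / (2 * h)"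
    by (simp add: integral_diff F(1) diff_divide_distrib)
  have d4: "?I (F' (y + a + c)) / (2 * h) - ?I (F' (y + a)) / (2 * h) - ?I (F' (y + c)) / (2 * h) + ?I (F' y) / (2 * h)
      = ?I (\<lambda>s. F' (y + a + c) s - F' (y + a) s - F' (y + c) s + F' y s) / (2 * h)"
    by (simp add: integral_diff integral_add integrable_diff F(1) diff_divide_distrib add_divide_distrib)
  show "norm (?I (F' y) / (2 * h)) \<le> k"
    unfolding real_norm_def using diff_boundsD(1)[OF b]
    by (intro line_avg_abs_le[OF h F(1)]) (auto simp: F(2))
  show "norm (?I (F' (y + a)) / (2 * h) - ?I (F' y) / (2 * h)) \<le> l * norm a"
    unfolding d2 real_norm_def using diff_boundsD(2)[OF b]
    by (intro line_avg_abs_le[OF h] integrable_diff F(1)) (auto simp: F(2))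
  show "norm (?I (F' (y + a)) / (2 * h) - ?I (F' y) / (2 * h)) \<le> m * norm a" if "norm (y - x) + norm a \<le> \<rho>"
    unfolding d2 real_norm_def using diff_boundsD(3)[OF b that]
    by (intro line_avg_abs_le[OF h] integrable_diff F(1)) (auto simp: F(2))
  show "norm (?I (F' (y + a + c)) / (2 * h) - ?I (F' (y + a)) / (2 * h) - ?I (F' (y + c)) / (2 * h) + ?I (F' y) / (2 * h))
    \<le> n * norm a * norm c" if "norm (y - x) + norm a + norm c \<le> \<rho>"
    unfolding d4 real_norm_def using diff_boundsD(4)[OF b that]
    by (intro line_avg_abs_le[OF h] integrable_diff integrable_add F(1)) (auto simp: F(2))
qed

lemma regular_line_avg:
  assumes h: "h > 0" and g: "continuous_on UNIV g" and r: "regular g x \<rho> M"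
  shows "regular (line_avg h i g) x (\<rho> - h) M"
    and "small_regular h (\<lambda>y. line_avg h i g y - g y) x (\<rho> - h) (3 * M)"
proof -
  have M: "M \<ge> 0" using diff_bounds_nonneg[OF r] by simp
  have n: "norm (s *\<^sub>R axis i (1::real)) \<le> 1 * h" if "s \<in> {-h..h}" for s
    using that by (auto simp: norm_axis_1)
  show "regular (line_avg h i g) x (\<rho> - h) M"
    unfolding line_avg_def[abs_def]
  proof (rule diff_bounds_line_avg_gen[OF h integrable_line[OF g] refl])
    fix s assume s: "s \<in> {-h..h}"
    show "regular (\<lambda>y. g (y + s *\<^sub>R axis i 1)) x (\<rho> - h) M"
      using n[OF s] by (intro diff_bounds_mono[OF diff_bounds_shift[OF r]]) auto
  qed
  have "small_regular h (\<lambda>y. integral {-h..h} (\<lambda>s. g (y + s *\<^sub>R axis i 1) - g y) / (2 * h)) x (\<rho> - h) (3 * M)"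
  proof (rule diff_bounds_line_avg_gen[OF h _ refl])
    show "(\<lambda>s. g (y + s *\<^sub>R axis i 1) - g y) integrable_on {-h..h}" for y
      by (intro integrable_diff integrable_line[OF g]) auto
    fix s assume s: "s \<in> {-h..h}"
    show "small_regular h (\<lambda>y. g (y + s *\<^sub>R axis i 1) - g y) x (\<rho> - h) (3 * M)"
      using regular_shift_diff[OF r n[OF s]] h by simp
  qed
  moreover have "integral {-h..h} (\<lambda>s. g (y + s *\<^sub>R axis i 1) - g y) / (2 * h) = line_avg h i g y - g y" for y
    using h by (subst integral_diff) (auto simp: integrable_line[OF g] line_avg_def field_simps)
  ultimately show "small_regular h (\<lambda>y. line_avg h i g y - g y) x (\<rho> - h) (3 * M)" by simp
qed

lemma continuous_line_avg:
  assumes g: "continuous_on UNIV g" and h: "h > 0"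
  shows "continuous_on UNIV (line_avg h i g)"
proof -
  have "continuous_on (UNIV \<times> cbox (-h) h) (\<lambda>(x, s). g (x + s *\<^sub>R axis i 1))"
    unfolding case_prod_beta
    by (rule continuous_on_compose2[OF g]) (auto intro!: continuous_intros)
  then have "continuous_on UNIV (\<lambda>x. integral (cbox (-h) h) (\<lambda>s. g (x + s *\<^sub>R axis i 1)))"
    by (rule integral_continuous_on_param)
  then show ?thesis unfolding line_avg_def[abs_def] using h
    by (auto intro!: continuous_intros simp: cbox_interval)
qed

lemma line_avg_commute:
  assumes g: "continuous_on UNIV g" and h: "h > 0"
  shows "line_avg h i (line_avg h j g) x = line_avg h j (line_avg h i g) x"
proof -
  have "integral (cbox (-h) h) (\<lambda>s. integral (cbox (-h) h) (\<lambda>t. g (x + s *\<^sub>R axis i 1 + t *\<^sub>R axis j 1)))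
      = integral (cbox (-h) h) (\<lambda>t. integral (cbox (-h) h) (\<lambda>s. g (x + s *\<^sub>R axis i 1 + t *\<^sub>R axis j 1)))"
  proof (rule integral_swap_continuous)
    show "continuous_on (cbox (-h, -h) (h, h)) (\<lambda>(s, t). g (x + s *\<^sub>R axis i 1 + t *\<^sub>R axis j 1))"
      unfolding case_prod_beta
      by (rule continuous_on_compose2[OF g]) (auto intro!: continuous_intros)
  qed
  then show ?thesis by (simp add: line_avg_def cbox_interval add_ac integral_divide)
qed

lemma line_avg_add:
  assumes "continuous_on UNIV f" "continuous_on UNIV g"
  shows "line_avg h i (\<lambda>y. f y + c * g y) x = line_avg h i f x + c * line_avg h i g x"
proof -
  have cg: "(\<lambda>s. c * g (x + s *\<^sub>R axis i 1)) integrable_on {-h..h}"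
    using assms(2) by (intro integrable_line[of "\<lambda>y. c * g y"]) (auto intro!: continuous_intros)
  have "integral {-h..h} (\<lambda>s. f (x + s *\<^sub>R axis i 1) + c * g (x + s *\<^sub>R axis i 1))
      = integral {-h..h} (\<lambda>s. f (x + s *\<^sub>R axis i 1)) + integral {-h..h} (\<lambda>s. c * g (x + s *\<^sub>R axis i 1))"
    by (rule integral_add[OF integrable_line[OF assms(1)] cg])
  also have "integral {-h..h} (\<lambda>s. c * g (x + s *\<^sub>R axis i 1)) = c * integral {-h..h} (\<lambda>s. g (x + s *\<^sub>R axis i 1))"
    by (rule integral_mult_right)
  finally have "integral {-h..h} (\<lambda>s. f (x + s *\<^sub>R axis i 1) + c * g (x + s *\<^sub>R axis i 1))
      = integral {-h..h} (\<lambda>s. f (x + s *\<^sub>R axis i 1)) + c * integral {-h..h} (\<lambda>s. g (x + s *\<^sub>R axis i 1))" .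
  then show ?thesis by (simp add: line_avg_def add_divide_distrib)
qed

text \<open>Fundamental theorem of calculus. The identity is exact, which is why the discrete
  divergence comes out as zero and not merely small.\<close>

lemma line_avg_deriv:
  assumes h: "h > 0" and d: "\<And>s. ((\<lambda>s. g (x + s *\<^sub>R axis i 1)) has_real_derivative g' (x + s *\<^sub>R axis i 1)) (at s)"
  shows "line_avg h i g' x = diff_central h i g x"
proof -
  have "((\<lambda>s. g' (x + s *\<^sub>R axis i 1)) has_integral
      (g (x + h *\<^sub>R axis i 1) - g (x + (-h) *\<^sub>R axis i 1))) {-h..h}"
  proof (rule fundamental_theorem_of_calculus)
    show "((\<lambda>s. g (x + s *\<^sub>R axis i 1)) has_vector_derivative g' (x + s *\<^sub>R axis i 1)) (at s within {-h..h})" for s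
      using has_field_derivative_at_within[OF d[of s]] by (simp only: has_real_derivative_iff_has_vector_derivative)
  qed (use h in simp)
  from integral_unique[OF this] show ?thesis
    unfolding line_avg_def diff_central_def real_divideR by simp
qed

lemma line_avg_diff_central:
  assumes g: "continuous_on UNIV g"
  shows "diff_central h i (line_avg h j g) x = line_avg h j (diff_central h i g) x"
proof -
  let ?e = "h *\<^sub>R axis i (1::real)"
  have e: "diff_central h i g (x + s *\<^sub>R axis j 1)
      = (g (x + ?e + s *\<^sub>R axis j 1) - g (x - ?e + s *\<^sub>R axis j 1)) / (2 * h)" for s
  proof -
    have "x + s *\<^sub>R axis j 1 + ?e = x + ?e + s *\<^sub>R axis j 1" "x + s *\<^sub>R axis j 1 - ?e = x - ?e + s *\<^sub>R axis j 1"
      by simp_all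
    then show ?thesis unfolding diff_central_def real_divideR by (simp only:)
  qed
  have "integral {-h..h} (\<lambda>s. diff_central h i g (x + s *\<^sub>R axis j 1))
      = (integral {-h..h} (\<lambda>s. g (x + ?e + s *\<^sub>R axis j 1)) - integral {-h..h} (\<lambda>s. g (x - ?e + s *\<^sub>R axis j 1))) / (2 * h)"
    unfolding e by (simp add: integral_diff integrable_line[OF g])
  note I = this
  have c: "(a / c - b / c) /\<^sub>R c = (a - b) / c / c" for a b c :: real
    unfolding real_divideR diff_divide_distrib by simp
  show ?thesis unfolding diff_central_def[of h i "line_avg h j g"] line_avg_def I by (rule c)
qed

text \<open>Dominated convergence. The conclusions reproduce the hypotheses, so the lemma can be
  iterated for repeated averages.\<close>

lemma line_avg_tendsto_zero:
  fixes g :: "nat \<Rightarrow> real^3 \<Rightarrow> real"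
  assumes h: "h > 0" and c: "\<And>n. continuous_on UNIV (g n)" and b: "\<And>n y. \<bar>g n y\<bar> \<le> k"
    and l: "\<And>y. (\<lambda>n. g n y) \<longlonglongrightarrow> 0"
  shows "\<And>n. continuous_on UNIV (line_avg h i (g n))" "\<And>n y. \<bar>line_avg h i (g n) y\<bar> \<le> k"
    "\<And>y. (\<lambda>n. line_avg h i (g n) y) \<longlonglongrightarrow> 0"
proof -
  show "continuous_on UNIV (line_avg h i (g n))" for n by (rule continuous_line_avg[OF c h])
  show "\<bar>line_avg h i (g n) y\<bar> \<le> k" for n y
    unfolding line_avg_def by (intro line_avg_abs_le[OF h integrable_line[OF c]] b)
  show "(\<lambda>n. line_avg h i (g n) y) \<longlonglongrightarrow> 0" for y
  proof -
    have "(\<lambda>n. integral {-h..h} (\<lambda>s. g n (y + s *\<^sub>R axis i 1))) \<longlonglongrightarrow> integral {-h..h} (\<lambda>s. 0)"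
      by (rule dominated_convergence(2)[where h="\<lambda>s. k"]) (use integrable_line[OF c] b l in auto)
    from tendsto_divide[OF this tendsto_const[of "2 * h"]] h show ?thesis by (simp add: line_avg_def)
  qed
qed

lemma face_avg_linear:
  assumes V: "continuous_on UNIV V" and W: "continuous_on UNIV W" and h: "h > 0"
  shows "face_avg h (\<lambda>y. c *\<^sub>R (V y - W y)) x = c *\<^sub>R (face_avg h V x - face_avg h W x)"
proof -
  have cV: "continuous_on UNIV (\<lambda>y. V y $ i)" and cW: "continuous_on UNIV (\<lambda>y. W y $ i)" for i
    using V W by (auto intro!: continuous_intros)
  have sub: "line_avg h i (\<lambda>y. c * (f y - g y)) = (\<lambda>x. c * (line_avg h i f x - line_avg h i g x))"
    if f: "continuous_on UNIV f" and g: "continuous_on UNIV g" for f g i c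
  proof
    fix x
    have z: "continuous_on UNIV (\<lambda>y::real^3. 0::real)" by simp
    have fg: "continuous_on UNIV (\<lambda>y. f y + (-1) * g y)" using f g by (auto intro!: continuous_intros)
    have "line_avg h i (\<lambda>y. 0 + c * (f y + (-1) * g y)) x = line_avg h i (\<lambda>y. 0) x + c * (line_avg h i f x + (-1) * line_avg h i g x)"
      by (simp only: line_avg_add[OF z fg] line_avg_add[OF f g])
    then show "line_avg h i (\<lambda>y. c * (f y - g y)) x = c * (line_avg h i f x - line_avg h i g x)"
      by (simp add: line_avg_def)
  qed
  show ?thesis
    by (simp add: face_avg_def vec_eq_iff sub cV cW continuous_line_avg[OF _ h])
qed

text \<open>Each of the two averages contributes 3 M, and there are three components.\<close>

lemma face_avg_small_regular:
  assumes h: "0 < h" "h \<le> 1" and V: "continuous_on UNIV V" and r: "regular V x \<rho> M"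
  shows "small_regular h (\<lambda>y. face_avg h V y - V y) x (\<rho> - 2 * h) (18 * M)"
proof -
  have M: "M \<ge> 0" using diff_bounds_nonneg[OF r] by simp
  have cV: "continuous_on UNIV (\<lambda>y. V y $ i)" for i using V by (auto intro!: continuous_intros)
  have "small_regular h (\<lambda>y. (line_avg h (i+1) (line_avg h (i+2) (\<lambda>y. V y $ i)) y - V y $ i) *\<^sub>R (axis i 1 :: real^3))
      x (\<rho> - 2 * h) (6 * M)" for i
  proof -
    have ri: "regular (\<lambda>y. V y $ i) x \<rho> M"
    proof -
      have B: "norm (v $ i) \<le> 1 * norm v" for v :: "real^3" using component_le_norm_cart[of v i] by simp
      from diff_bounds_linear[OF r bounded_linear.linear[OF bounded_linear_vec_nth] B] show ?thesis by simp
    qed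
    note a = regular_line_avg(2)[OF h(1) cV ri, of "i+2"]
    note b = regular_line_avg(2)[OF h(1) continuous_line_avg[OF cV h(1)] regular_line_avg(1)[OF h(1) cV ri], of "i+1" "i+2"]
    have a': "small_regular h (\<lambda>y. line_avg h (i+2) (\<lambda>y. V y $ i) y - V y $ i) x (\<rho> - h - h) (3 * M)"
      using h by (intro diff_bounds_mono[OF a]) auto
    from diff_bounds_add[OF b a']
    have s: "small_regular h (\<lambda>y. line_avg h (i+1) (line_avg h (i+2) (\<lambda>y. V y $ i)) y - V y $ i) x (\<rho> - 2 * h) (6 * M)"
      by (simp add: algebra_simps)
    have "linear (\<lambda>c. c *\<^sub>R (axis i 1 :: real^3))" by (rule linearI) (simp_all add: algebra_simps)
    from diff_bounds_linear[OF s this, of 1] show ?thesis by (simp add: norm_axis_1)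
  qed
  from diff_bounds_sum[where I="UNIV :: 3 set" and f="\<lambda>i y.
      (line_avg h (i+1) (line_avg h (i+2) (\<lambda>y. V y $ i)) y - V y $ i) *\<^sub>R (axis i 1 :: real^3)",
    OF finite_class.finite_UNIV this]
  have "small_regular h (\<lambda>y. \<Sum>i\<in>UNIV. (line_avg h (i+1) (line_avg h (i+2) (\<lambda>y. V y $ i)) y - V y $ i) *\<^sub>R (axis i 1 :: real^3))
      x (\<rho> - 2 * h) (18 * M)" by (simp add: mult.assoc)
  moreover have "(\<Sum>i\<in>UNIV. (line_avg h (i+1) (line_avg h (i+2) (\<lambda>y. V y $ i)) y - V y $ i) *\<^sub>R (axis i 1 :: real^3))
     = face_avg h V y - V y" for y
    by (simp add: face_avg_def vec_eq_iff sum_3 forall_3 axis_def)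
  ultimately show ?thesis by simp
qed

lemma face_avg_far:
  assumes h: "h > 0" and V: "\<And>y. y \<notin> \<Omega> \<Longrightarrow> V y = 0" and x: "far_from \<Omega> (2 * h) x"
  shows "face_avg h V x = 0"
proof -
  have "V (x + s *\<^sub>R axis j 1 + t *\<^sub>R axis k 1) = 0" if "s \<in> {-h..h}" "t \<in> {-h..h}" for s t j k
  proof (rule V, rule notI)
    assume "x + s *\<^sub>R axis j 1 + t *\<^sub>R axis k 1 \<in> \<Omega>"
    then have "2 * h < norm (x - (x + s *\<^sub>R axis j 1 + t *\<^sub>R axis k 1))" using x unfolding far_from_def by blast
    also have "\<dots> = norm (s *\<^sub>R axis j 1 + t *\<^sub>R (axis k 1 :: real^3))" by (simp add: norm_minus_commute algebra_simps)
    also have "\<dots> \<le> \<bar>s\<bar> + \<bar>t\<bar>"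
      using norm_triangle_ineq[of "s *\<^sub>R axis j 1" "t *\<^sub>R (axis k 1 :: real^3)"] by (simp add: norm_axis_1)
    finally show False using that by auto
  qed
  then have inner: "integral {-h..h} (\<lambda>t. V (x + s *\<^sub>R axis j 1 + t *\<^sub>R axis k 1) $ i) = 0" if "s \<in> {-h..h}" for s i j k
    using that by (intro integral_unique has_integral_is_0) simp
  have z: "integral {-h..h} (\<lambda>s. integral {-h..h} (\<lambda>t. V (x + s *\<^sub>R axis j 1 + t *\<^sub>R axis k 1) $ i)) = 0" for i j k
    by (intro integral_unique has_integral_is_0 inner)
  show ?thesis by (simp add: face_avg_def line_avg_def vec_eq_iff z)
qed

text \<open>The field is cut off where it is small, which keeps it solenoidal up to an error that is
  bounded and tends to zero pointwise; the cut-off field is of class \<open>C\<^sup>1\<close> on the whole space.\<close>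

lemma disc_div_face_avg_eq_0:
  fixes V :: "real^3 \<Rightarrow> real^3" and W :: "3 \<Rightarrow> real^3 \<Rightarrow> real^3"
  assumes h: "h > 0" and M: "M \<ge> 0" and op: "open \<Omega>" and V: "continuous_on UNIV V" and V0: "\<And>y. y \<notin> \<Omega> \<Longrightarrow> V y = 0"
    and d: "\<And>i y. y \<in> \<Omega> \<Longrightarrow> ((\<lambda>s. V (y + s *\<^sub>R axis i 1)) has_vector_derivative W i y) (at 0)"
    and W: "\<And>i. continuous_on \<Omega> (W i)" and Wb: "\<And>i y. y \<in> \<Omega> \<Longrightarrow> norm (W i y) \<le> M"
    and div: "\<And>y. y \<in> \<Omega> \<Longrightarrow> (\<Sum>i\<in>UNIV. W i y $ i) = 0"
  shows "disc_div h (face_avg h V) x = 0"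
proof -
  \<comment> \<open>The cut-off removes the set where n |V| is at most 1, a neighbourhood of every
    point outside \<Omega>, and changes nothing where n^2 |V|^2 is at least 2.\<close>
  define q where "q = (\<lambda>n y. (real n)\<^sup>2 * (V y \<bullet> V y) - 1)"
  define Z where "Z = (\<lambda>n y. smooth_step (q n y) *\<^sub>R V y)"
  define G where "G = (\<lambda>n i y. if y \<in> \<Omega> then smooth_step' (q n y) * ((real n)\<^sup>2 * (2 * (V y \<bullet> W i y))) * V y $ i
      + smooth_step (q n y) * W i y $ i else 0)"
  have css: "continuous_on UNIV smooth_step"
    by (rule DERIV_continuous_on[of _ _ smooth_step']) (rule has_field_derivative_at_within[OF smooth_step_deriv])
  have css': "continuous_on UNIV smooth_step'"
    unfolding smooth_step'_def[abs_def] by (intro continuous_intros)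
  have cq: "continuous_on S (q n)" if "continuous_on S V" for S n
    unfolding q_def using that by (auto intro!: continuous_intros)
  have cZ: "continuous_on UNIV (Z n)" for n
    unfolding Z_def by (intro continuous_intros V continuous_on_compose2[OF css cq[OF V]]) auto
  have qneg: "\<forall>\<^sub>F z in nhds y. q n z < 0" if "y \<notin> \<Omega>" for y n
  proof -
    have "isCont (q n) y" using cq[OF V, of n] by (simp add: continuous_on_eq_continuous_at)
    moreover have "q n y < 0" using V0[OF that] by (simp add: q_def)
    ultimately show ?thesis
      by (metis eventually_nhds_conv_at isCont_def order_tendstoD(2))
  qed
  have s0: "smooth_step u = 0 \<and> smooth_step' u = 0" if "u < 0" for u
    using that by (auto simp: smooth_step_0 smooth_step'_def)
  have cG: "continuous_on UNIV (G n i)" for n i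
    unfolding continuous_on_eq_continuous_at[OF open_UNIV]
  proof
    fix y
    show "isCont (G n i) y"
    proof (cases "y \<in> \<Omega>")
      case True
      have VO: "continuous_on \<Omega> V" using V continuous_on_subset by blast
      have "continuous_on \<Omega> (\<lambda>y. smooth_step' (q n y) * ((real n)\<^sup>2 * (2 * (V y \<bullet> W i y))) * V y $ i
        + smooth_step (q n y) * W i y $ i)"
        by (intro continuous_intros VO W continuous_on_compose2[OF css cq[OF VO]]
            continuous_on_compose2[OF css' cq[OF VO]]) auto
      then have "continuous_on \<Omega> (G n i)" by (rule continuous_on_eq) (simp add: G_def)
      then show ?thesis using True op by (simp add: continuous_on_eq_continuous_at)
    next
      case False
      have "\<forall>\<^sub>F z in nhds y. G n i z = 0"
        using qneg[OF False, of n] by eventually_elim (use s0 in \<open>auto simp: G_def\<close>)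
      then have "isCont (G n i) y \<longleftrightarrow> isCont (\<lambda>_. 0 :: real) y" by (rule isCont_cong)
      then show ?thesis by simp
    qed
  qed
  have dZ0: "((\<lambda>s. Z n (y + s *\<^sub>R axis i 1) $ i) has_real_derivative G n i y) (at 0)" for n i y
  proof (cases "y \<in> \<Omega>")
    case True
    note dV = d[OF True, of i]
    have dVj: "((\<lambda>s. V (y + s *\<^sub>R axis i 1) $ i) has_real_derivative W i y $ i) (at 0)"
      using bounded_linear.has_vector_derivative[OF bounded_linear_vec_nth dV, of i]
      by (simp add: has_real_derivative_iff_has_vector_derivative)
    have dVV: "((\<lambda>s. V (y + s *\<^sub>R axis i 1) \<bullet> V (y + s *\<^sub>R axis i 1)) has_real_derivative 2 * (V y \<bullet> W i y)) (at 0)"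
      using bounded_bilinear.has_vector_derivative[OF bounded_bilinear_inner dV dV]
      by (simp add: has_real_derivative_iff_has_vector_derivative inner_commute)
    have dq: "((\<lambda>s. q n (y + s *\<^sub>R axis i 1)) has_real_derivative (real n)\<^sup>2 * (2 * (V y \<bullet> W i y))) (at 0)"
      unfolding q_def using DERIV_diff[OF DERIV_cmult[OF dVV, of "(real n)\<^sup>2"] DERIV_const[of 1]] by simp
    have "((\<lambda>s. smooth_step (q n (y + s *\<^sub>R axis i 1))) has_real_derivative
        smooth_step' (q n y) * ((real n)\<^sup>2 * (2 * (V y \<bullet> W i y)))) (at 0)"
      using DERIV_chain2[of smooth_step "smooth_step' (q n y)" "\<lambda>s. q n (y + s *\<^sub>R axis i 1)" 0, OF _ dq]
        smooth_step_deriv[of "q n y"] by simp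
    from DERIV_mult[OF this dVj] True show ?thesis by (simp add: Z_def G_def mult_ac)
  next
    case False
    have "((\<lambda>s::real. y + s *\<^sub>R axis i 1) \<longlongrightarrow> y + 0 *\<^sub>R axis i 1) (nhds 0)"
      by (intro tendsto_add tendsto_scaleR tendsto_const filterlim_ident)
    then have "filterlim (\<lambda>s::real. y + s *\<^sub>R axis i 1) (nhds y) (nhds 0)" by simp
    from eventually_compose_filterlim[OF qneg[OF False, of n] this]
    have ev: "\<forall>\<^sub>F s in nhds 0. q n (y + s *\<^sub>R axis i 1) < 0" .
    then have "\<forall>\<^sub>F s in nhds 0. Z n (y + s *\<^sub>R axis i 1) $ i = 0"
      by eventually_elim (use s0 in \<open>simp add: Z_def\<close>)
    from DERIV_cong_ev[OF refl this refl[of 0]] False show ?thesis by (simp add: G_def)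
  qed
  have dZ: "((\<lambda>s. Z n (y + s *\<^sub>R axis i 1) $ i) has_real_derivative G n i (y + s *\<^sub>R axis i 1)) (at s)" for n i y s
  proof -
    have "((\<lambda>t. Z n (y + (t + s) *\<^sub>R axis i 1) $ i) has_real_derivative G n i (y + s *\<^sub>R axis i 1)) (at 0)"
      using dZ0[of n "y + s *\<^sub>R axis i 1" i] by (simp add: scaleR_add_left add_ac)
    then show ?thesis using DERIV_shift[of "\<lambda>t. Z n (y + t *\<^sub>R axis i 1) $ i" _ 0 s] by simp
  qed
  define S where "S = (\<lambda>n y. G n 1 y + 1 * (G n 2 y + 1 * G n 3 y))"
  have cS: "continuous_on UNIV (S n)" for n unfolding S_def by (intro continuous_intros cG)
  have S_eq: "S n y = smooth_step' (q n y) * (real n)\<^sup>2 * (2 * (\<Sum>i\<in>UNIV. (V y \<bullet> W i y) * V y $ i))" if "y \<in> \<Omega>" for n y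
  proof -
    have "S n y = smooth_step' (q n y) * (real n)\<^sup>2 * (2 * (\<Sum>i\<in>UNIV. (V y \<bullet> W i y) * V y $ i))
       + smooth_step (q n y) * (\<Sum>i\<in>UNIV. W i y $ i)"
      using that by (simp add: S_def G_def sum_3 algebra_simps)
    then show ?thesis using div[OF that] by simp
  qed
  have S0: "S n y = 0" if "y \<notin> \<Omega>" for n y using that by (simp add: S_def G_def)
  have far0: "smooth_step' u = 0" if "u \<ge> 1" for u
    using that by (simp add: smooth_step'_def)
  \<comment> \<open>The derivative of the cut-off carries a factor n^2 but lives where n^2 |V|^2 is
    between 1 and 2, and the divergence left over is quadratic in V. The two effects balance
    uniformly in n.\<close>
  have S_bound: "\<bar>S n y\<bar> \<le> 24 * M" for n y
  proof (cases "y \<in> \<Omega>")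
    case False
    then show ?thesis using S0 M by simp
  next
    case True
    show ?thesis
    proof (cases "0 < q n y \<and> q n y < 1")
      case False
      then have "smooth_step' (q n y) = 0" using far0[of "q n y"] by (auto simp: smooth_step'_def not_less)
      then show ?thesis using S_eq[OF True, of n] M by simp
    next
      case q: True
      have t: "\<bar>(V y \<bullet> W i y) * V y $ i\<bar> \<le> M * (V y \<bullet> V y)" for i
      proof -
        have "\<bar>(V y \<bullet> W i y) * V y $ i\<bar> \<le> (norm (V y) * norm (W i y)) * norm (V y)"
          unfolding abs_mult by (intro mult_mono Cauchy_Schwarz_ineq2 component_le_norm_cart) auto
        also have "\<dots> \<le> (norm (V y) * M) * norm (V y)"
          using Wb[OF True] by (intro mult_right_mono mult_left_mono) auto
        finally show ?thesis by (simp add: dot_square_norm power2_eq_square mult_ac)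
      qed
      have "\<bar>\<Sum>i\<in>UNIV. (V y \<bullet> W i y) * V y $ i\<bar> \<le> (\<Sum>i\<in>(UNIV::3 set). M * (V y \<bullet> V y))"
        using t by (intro order_trans[OF sum_abs] sum_mono)
      then have T: "\<bar>\<Sum>i\<in>UNIV. (V y \<bullet> W i y) * V y $ i\<bar> \<le> 3 * M * (V y \<bullet> V y)" by simp
      have "\<bar>S n y\<bar> \<le> 2 * (real n)\<^sup>2 * (2 * (3 * M * (V y \<bullet> V y)))"
        unfolding S_eq[OF True] abs_mult using T smooth_step'_bound[of "q n y"]
        by (intro mult_mono) auto
      also have "\<dots> = 12 * M * (q n y + 1)" by (simp add: q_def)
      also have "\<dots> \<le> 12 * M * 2" using q M by (intro mult_left_mono) auto
      finally show ?thesis by simp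
    qed
  qed
  have big: "\<forall>\<^sub>F n in sequentially. q n y \<ge> 1" if "V y \<noteq> 0" for y
  proof -
    have pos: "V y \<bullet> V y > 0" using that by simp
    obtain N :: nat where N: "2 / (V y \<bullet> V y) \<le> real N" using real_arch_simple by blast
    show ?thesis
    proof (rule eventually_sequentiallyI[of "max N 1"])
      fix n assume n: "max N 1 \<le> n"
      have "real N \<le> real n * real n" using n by (metis le_square le_trans max.boundedE of_nat_le_iff of_nat_mult)
      then have "2 / (V y \<bullet> V y) \<le> (real n)\<^sup>2" using N by (simp add: power2_eq_square)
      then show "1 \<le> q n y" using pos by (simp add: q_def pos_divide_le_eq)
    qed
  qed
  have S_lim: "(\<lambda>n. S n y) \<longlonglongrightarrow> 0" for y
  proof (cases "V y = 0")
    case True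
    have "S n y = 0" for n using S0[of y n] S_eq[of y n] True by (cases "y \<in> \<Omega>") auto
    then show ?thesis by simp
  next
    case False
    then have yO: "y \<in> \<Omega>" using V0 by blast
    have "\<forall>\<^sub>F n in sequentially. S n y = 0"
      using big[OF False] by eventually_elim (simp add: S_eq[OF yO] far0)
    then show ?thesis by (rule tendsto_eventually)
  qed
  define E where "E = (\<lambda>i n y. Z n y $ i - V y $ i)"
  have cE: "continuous_on UNIV (E i n)" for i n unfolding E_def by (intro continuous_intros cZ V)
  have E_lim: "(\<lambda>n. E i n y) \<longlonglongrightarrow> 0" for i y
  proof (cases "V y = 0")
    case True then show ?thesis by (simp add: E_def Z_def)
  next
    case False
    have "\<forall>\<^sub>F n in sequentially. E i n y = 0"
      using big[OF False] by eventually_elim (simp add: E_def Z_def smooth_step_1)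
    then show ?thesis by (rule tendsto_eventually)
  qed
  \<comment> \<open>The index starts at 1: for n = 0 the cut-off field is zero and E is -V, for
    which no bound is assumed.\<close>
  have E_bound: "\<bar>E i (Suc n) y\<bar> \<le> 6" for i n y
  proof (cases "q (Suc n) y \<ge> 1")
    case True then show ?thesis by (simp add: E_def Z_def smooth_step_1)
  next
    case False
    have "1 * (V y \<bullet> V y) \<le> (real (Suc n))\<^sup>2 * (V y \<bullet> V y)"
      by (intro mult_right_mono one_le_power) auto
    then have "V y \<bullet> V y \<le> 2" using False unfolding q_def by linarith
    then have "(norm (V y))\<^sup>2 \<le> 2\<^sup>2" by (simp add: dot_square_norm)
    then have "norm (V y) \<le> 2" by (rule power2_le_imp_le) simp
    then have Vi: "\<bar>V y $ i\<bar> \<le> 2" using component_le_norm_cart[of "V y" i] by linarith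
    have "E i (Suc n) y = (smooth_step (q (Suc n) y) - 1) * V y $ i"
      by (simp add: E_def Z_def algebra_simps)
    also have "\<bar>\<dots>\<bar> \<le> 3 * 2"
      unfolding abs_mult using smooth_step_bound[of "q (Suc n) y"] Vi by (intro mult_mono) auto
    finally show ?thesis by simp
  qed
  let ?A = "\<lambda>i f. line_avg h (i + 1) (line_avg h (i + 2) f)"
  have lim_E: "(\<lambda>n. ?A i (E i (Suc n)) y) \<longlonglongrightarrow> 0" for i y
  proof -
    note t1 = line_avg_tendsto_zero[OF h cE E_bound LIMSEQ_Suc[OF E_lim], where i="i+2"]
    show ?thesis by (rule line_avg_tendsto_zero(3)[OF h t1])
  qed
  \<comment> \<open>i + 1, i + 2, i is a permutation of 1, 2, 3 and averages commute, so all three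
    terms of the divergence are averages over the same cube.\<close>
  have order3: "line_avg h (i + 1) (line_avg h (i + 2) (line_avg h i f)) y = line_avg h 1 (line_avg h 2 (line_avg h 3 f)) y"
    if f: "continuous_on UNIV f" for i f y
  proof -
    note c = continuous_line_avg[OF _ h]
    have e: "(1::3) + 1 = 2" "(1::3) + 2 = 3" "(2::3) + 1 = 3" "(2::3) + 2 = 1" "(3::3) + 1 = 1" "(3::3) + 2 = 2" by simp_all
    have c12: "line_avg h i (line_avg h j f) = line_avg h j (line_avg h i f)" if "continuous_on UNIV f" for i j f
      by (rule ext) (rule line_avg_commute[OF that h])
    consider "i = 1" | "i = 2" | "i = 3" using exhaust_3[of i] by blast
    then show ?thesis
    proof cases
      case 1
      have "line_avg h 2 (line_avg h 3 (line_avg h 1 f)) = line_avg h 1 (line_avg h 2 (line_avg h 3 f))"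
        by (simp only: c12[OF f, of 3 1] c12[OF c[OF f], of 2 1])
      then show ?thesis by (simp only: 1 e)
    next
      case 2
      have "line_avg h 3 (line_avg h 1 (line_avg h 2 f)) = line_avg h 1 (line_avg h 2 (line_avg h 3 f))"
        by (simp only: c12[OF c[OF f], of 3 1] c12[OF f, of 3 2])
      then show ?thesis by (simp only: 2 e)
    next
      case 3
      then show ?thesis by (simp only: 3 e)
    qed
  qed
  let ?D = "\<lambda>i g. diff_central h i g x"
  have cVi: "continuous_on UNIV (\<lambda>y. V y $ i)" and cZi: "continuous_on UNIV (\<lambda>y. Z n y $ i)" for i n
    by (intro continuous_intros V cZ)+
  have Zavg: "?D i (?A i (\<lambda>y. Z n y $ i)) = line_avg h 1 (line_avg h 2 (line_avg h 3 (G n i))) x" for n i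
  proof -
    have "diff_central h i (\<lambda>y. Z n y $ i) = line_avg h i (G n i)"
      by (rule ext) (rule line_avg_deriv[OF h dZ, symmetric])
    moreover have "diff_central h i (line_avg h (i + 2) (\<lambda>y. Z n y $ i)) = line_avg h (i + 2) (diff_central h i (\<lambda>y. Z n y $ i))"
      by (rule ext) (rule line_avg_diff_central[OF cZi])
    ultimately show ?thesis
      by (simp only: line_avg_diff_central[OF continuous_line_avg[OF cZi h]] order3[OF cG])
  qed
  have add3: "line_avg h 1 (line_avg h 2 (line_avg h 3 (S n))) x = (\<Sum>i\<in>UNIV. line_avg h 1 (line_avg h 2 (line_avg h 3 (G n i))) x)" for n
  proof -
    have a: "line_avg h i (\<lambda>y. f y + 1 * g y) = (\<lambda>y. line_avg h i f y + 1 * line_avg h i g y)"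
      if "continuous_on UNIV f" "continuous_on UNIV g" for i f g
      by (rule ext) (rule line_avg_add[OF that])
    have c: "continuous_on UNIV (\<lambda>y. G n 2 y + 1 * G n 3 y)" by (intro continuous_intros cG)
    note cc = continuous_line_avg[OF _ h]
    have cl: "continuous_on UNIV (\<lambda>y. line_avg h 3 (G n 2) y + 1 * line_avg h 3 (G n 3) y)"
      by (intro continuous_intros cc cG)
    have cl2: "continuous_on UNIV (\<lambda>y. line_avg h 2 (line_avg h 3 (G n 2)) y + 1 * line_avg h 2 (line_avg h 3 (G n 3)) y)"
      by (intro continuous_intros cc cG)
    show ?thesis
      unfolding S_def
      by (simp only: a[OF cG c] a[OF cG cG] a[OF cc[OF cG] cl] a[OF cc[OF cG] cc[OF cG]]
          a[OF cc[OF cc[OF cG]] cl2] a[OF cc[OF cc[OF cG]] cc[OF cc[OF cG]]] sum_3) simp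
  qed
  \<comment> \<open>This holds for every n. The left side does not depend on n, while both terms on
    the right tend to zero.\<close>
  have eq: "disc_div h (face_avg h V) x = line_avg h 1 (line_avg h 2 (line_avg h 3 (S n))) x
      - (\<Sum>i\<in>UNIV. ?D i (?A i (E i n)))" for n
  proof -
    have EA: "?A i (E i n) y = ?A i (\<lambda>y. Z n y $ i) y + (-1) * ?A i (\<lambda>y. V y $ i) y" for i y
    proof -
      have "E i n = (\<lambda>y. Z n y $ i + (-1) * V y $ i)" by (simp add: E_def)
      moreover have "line_avg h (i+2) (\<lambda>y. Z n y $ i + (-1) * V y $ i)
         = (\<lambda>y. line_avg h (i+2) (\<lambda>y. Z n y $ i) y + (-1) * line_avg h (i+2) (\<lambda>y. V y $ i) y)"
        by (rule ext) (rule line_avg_add[OF cZi cVi])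
      ultimately show ?thesis
        by (simp only: line_avg_add[OF continuous_line_avg[OF cZi h] continuous_line_avg[OF cVi h]])
    qed
    have "?D i (?A i (E i n)) = ?D i (?A i (\<lambda>y. Z n y $ i)) - ?D i (?A i (\<lambda>y. V y $ i))" for i
      unfolding diff_central_def EA real_divideR by (simp add: diff_divide_distrib add_divide_distrib)
    moreover have "disc_div h (face_avg h V) x = (\<Sum>i\<in>UNIV. ?D i (?A i (\<lambda>y. V y $ i)))"
      by (simp add: disc_div_def face_avg_def)
    ultimately show ?thesis unfolding add3 Zavg[symmetric] by (simp add: sum_subtractf)
  qed
  have "(\<lambda>n. line_avg h 1 (line_avg h 2 (line_avg h 3 (S (Suc n)))) x) \<longlonglongrightarrow> 0"
  proof -
    note t1 = line_avg_tendsto_zero[OF h cS S_bound LIMSEQ_Suc[OF S_lim], where i=3]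
    note t2 = line_avg_tendsto_zero[OF h t1, where i=2]
    show ?thesis by (rule line_avg_tendsto_zero(3)[OF h t2])
  qed
  moreover have "(\<lambda>n. \<Sum>i\<in>UNIV. ?D i (?A i (E i (Suc n)))) \<longlonglongrightarrow> (\<Sum>i\<in>(UNIV::3 set). (0 - 0) /\<^sub>R (2 * h))"
    unfolding diff_central_def by (intro tendsto_intros lim_E)
  ultimately have "(\<lambda>n. line_avg h 1 (line_avg h 2 (line_avg h 3 (S (Suc n)))) x
      - (\<Sum>i\<in>UNIV. ?D i (?A i (E i (Suc n))))) \<longlonglongrightarrow> 0 - (\<Sum>i\<in>(UNIV::3 set). (0 - 0) /\<^sub>R (2 * h))"
    by (rule tendsto_diff)
  then have "(\<lambda>n::nat. disc_div h (face_avg h V) x) \<longlonglongrightarrow> 0" unfolding eq[symmetric] by simp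
  then show ?thesis by (simp add: LIMSEQ_const_iff)
qed

section \<open>Consistency of the classical solution\<close>

text \<open>Only points joined by a segment inside \<Omega> are compared: \<Omega> need not be
  convex, and bounded derivatives control a function along such segments.\<close>

definition space_time_lipschitz ::
  "(real^3) set \<Rightarrow> real \<Rightarrow> (real \<Rightarrow> real^3 \<Rightarrow> 'b::real_normed_vector) \<Rightarrow> bool" where
  "space_time_lipschitz \<Omega> M g \<longleftrightarrow> (\<forall>t\<in>{1..2}. \<forall>s\<in>{1..2}. \<forall>x y. closed_segment x y \<subseteq> \<Omega> \<longrightarrow>
     norm (g t x - g s y) \<le> M * (\<bar>t - s\<bar> + norm (x - y)))"

lemma space_time_lipschitzD:
  assumes "space_time_lipschitz \<Omega> M g" "t \<in> {1..2}" "s \<in> {1..2}" "closed_segment x y \<subseteq> \<Omega>"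
  shows "norm (g t x - g s y) \<le> M * (\<bar>t - s\<bar> + norm (x - y))"
  using assms unfolding space_time_lipschitz_def by blast

text \<open>By periodicity it suffices to consider times in \<open>{1..2}\<close>, which keeps away from \<open>t = 0\<close>, where
  no derivatives are available.\<close>

locale classical_solution =
  fixes \<Omega> :: "(real^3) set" and f v :: "real \<Rightarrow> real^3 \<Rightarrow> real^3" and p :: "real \<Rightarrow> real^3 \<Rightarrow> real"
    and vt :: "real \<Rightarrow> real^3 \<Rightarrow> real^3" and vx vxx :: "3 \<Rightarrow> real \<Rightarrow> real^3 \<Rightarrow> real^3"
    and px :: "3 \<Rightarrow> real \<Rightarrow> real^3 \<Rightarrow> real" and M :: real
  assumes op: "open \<Omega>" and bd: "bounded \<Omega>" and M: "M \<ge> 0"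
    and dv: "\<And>t x. t \<in> {1..2} \<Longrightarrow> x \<in> \<Omega> \<Longrightarrow> (v t has_derivative (\<lambda>w. \<Sum>i\<in>UNIV. w $ i *\<^sub>R vx i t x)) (at x)"
    and dvx: "\<And>i t x. t \<in> {1..2} \<Longrightarrow> x \<in> \<Omega> \<Longrightarrow>
        ((\<lambda>s. vx i t (x + s *\<^sub>R axis i 1)) has_vector_derivative vxx i t x) (at 0)"
    and dvt: "\<And>t x. t \<in> {1..2} \<Longrightarrow> x \<in> \<Omega> \<Longrightarrow> ((\<lambda>s. v s x) has_vector_derivative vt t x) (at t)"
    and dp: "\<And>i t x. t \<in> {1..2} \<Longrightarrow> x \<in> \<Omega> \<Longrightarrow>
        ((\<lambda>s. p t (x + s *\<^sub>R axis i 1)) has_vector_derivative px i t x) (at 0)"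
    and lip: "space_time_lipschitz \<Omega> M v" "space_time_lipschitz \<Omega> M vt"
        "\<And>i. space_time_lipschitz \<Omega> M (vx i)" "\<And>i. space_time_lipschitz \<Omega> M (vxx i)"
        "\<And>i. space_time_lipschitz \<Omega> M (px i)"
    and bnd: "\<And>t x. t \<in> {1..2} \<Longrightarrow> x \<in> \<Omega> \<Longrightarrow> norm (v t x) \<le> M"
        "\<And>i t x. t \<in> {1..2} \<Longrightarrow> x \<in> \<Omega> \<Longrightarrow> norm (vx i t x) \<le> M"
        "\<And>i t x. t \<in> {1..2} \<Longrightarrow> x \<in> \<Omega> \<Longrightarrow> \<bar>px i t x\<bar> \<le> M"
    and ns: "\<And>t x. t \<in> {1..2} \<Longrightarrow> x \<in> \<Omega> \<Longrightarrow>
        f t x = vt t x + (\<Sum>j\<in>UNIV. v t x $ j *\<^sub>R vx j t x) - (\<Sum>j\<in>UNIV. vxx j t x) + (\<chi> i. px i t x)"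
    and solenoidal: "\<And>t x. t \<in> {1..2} \<Longrightarrow> x \<in> \<Omega> \<Longrightarrow> (\<Sum>i\<in>UNIV. vx i t x $ i) = 0"
    and cont: "\<And>t. t \<in> {1..2} \<Longrightarrow> continuous_on (closure \<Omega>) (v t)"
    and zero: "\<And>t x. t \<in> {1..2} \<Longrightarrow> x \<in> frontier \<Omega> \<Longrightarrow> v t x = 0"
begin

definition V :: "real \<Rightarrow> real^3 \<Rightarrow> real^3" where "V t x = (if x \<in> \<Omega> then v t x else 0)"

lemma V_outside: "x \<notin> \<Omega> \<Longrightarrow> V t x = 0" by (simp add: V_def)

lemma V_inside: "x \<in> \<Omega> \<Longrightarrow> V t x = v t x" by (simp add: V_def)

lemma V_continuous:
  assumes t: "t \<in> {1..2}"
  shows "continuous_on UNIV (V t)"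
proof -
  have "continuous_on (closure \<Omega> \<union> (- \<Omega>)) (\<lambda>x. if x \<in> \<Omega> then v t x else 0)"
  proof (rule continuous_on_If)
    show "closed (closure \<Omega>)" "closed (- \<Omega>)" using op by auto
    show "v t x = 0" if "x \<in> closure \<Omega>" "x \<notin> \<Omega>" for x
      using zero[OF t, of x] that op by (simp add: frontier_def interior_open)
    show "v t x = 0" if "x \<in> - \<Omega>" "x \<in> \<Omega>" for x using that by simp
  qed (use cont[OF t] in auto)
  moreover have "closure \<Omega> \<union> - \<Omega> = UNIV" using closure_subset by auto
  ultimately show ?thesis by (simp add: V_def[abs_def])
qed

end

text \<open>If a segment leaves \<Omega>, each end value is controlled by the distance to a point of
  the segment outside \<Omega>, where g vanishes, and the two distances add up to the length of the
  segment.\<close>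

lemma lipschitz_zero_extension:
  fixes g :: "real^3 \<Rightarrow> 'b::real_normed_vector"
  assumes op: "open \<Omega>" and c: "continuous_on UNIV g" and g0: "\<And>x. x \<notin> \<Omega> \<Longrightarrow> g x = 0" and L: "L \<ge> 0"
    and l: "\<And>x y. closed_segment x y \<subseteq> \<Omega> \<Longrightarrow> norm (g x - g y) \<le> L * norm (x - y)"
  shows "norm (g x - g y) \<le> L * norm (x - y)"
proof (cases "closed_segment x y \<subseteq> \<Omega>")
  case False
  text \<open>The exit point \<open>q\<close> is the point of the segment outside \<open>\<Omega>\<close> that is nearest to \<open>x\<close>.\<close>
  have key: "norm (g x) \<le> L * norm (x - c')" if c': "c' \<in> closed_segment x y - \<Omega>" for x y c'
  proof -
    have cpt: "compact (closed_segment x y - \<Omega>)" using op by (intro compact_diff) auto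
    obtain q where q: "q \<in> closed_segment x y - \<Omega>" "\<And>z. z \<in> closed_segment x y - \<Omega> \<Longrightarrow> dist x q \<le> dist x z"
      using distance_attains_inf[OF compact_imp_closed[OF cpt], of x] c' by blast
    have xq: "norm (x - q) \<le> norm (x - c')" using q(2)[OF c'] by (simp add: dist_norm)
    have "norm (g x) \<le> L * norm (x - q)"
    proof (cases "x = q")
      case True then show ?thesis using g0 q(1) L by simp
    next
      case xq: False
      have seg: "closed_segment x (x + s *\<^sub>R (q - x)) \<subseteq> \<Omega>" if s: "0 \<le> s" "s < 1" for s
      proof
        fix z assume "z \<in> closed_segment x (x + s *\<^sub>R (q - x))"
        then obtain u where u: "0 \<le> u" "u \<le> 1" and zu: "z = (1 - u) *\<^sub>R x + u *\<^sub>R (x + s *\<^sub>R (q - x))"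
          unfolding in_segment(1) by blast
        have u3: "z = x + (u * s) *\<^sub>R (q - x)" unfolding zu by (simp add: algebra_simps)
        have "u * s \<le> s" using u s by (intro mult_left_le_one_le) auto
        then have us: "0 \<le> u * s" "u * s < 1" using u s by auto
        have "z = (1 - u * s) *\<^sub>R x + (u * s) *\<^sub>R q" unfolding u3 by (simp add: algebra_simps)
        then have "z \<in> closed_segment x q" unfolding in_segment(1) using us by (intro exI[of _ "u * s"]) auto
        then have "z \<in> closed_segment x y" using q(1) subset_closed_segment[of x q x y] by blast
        moreover have "dist x z = (u * s) * dist x q" using us unfolding u3 by (simp add: dist_norm norm_minus_commute)
        moreover have "(u * s) * dist x q < dist x q" using us xq by (simp add: mult_less_cancel_right1)
        ultimately show "z \<in> \<Omega>" using q(2)[of z] by fastforce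
      qed
      have "norm (g x - g (x + s *\<^sub>R (q - x))) \<le> L * norm (x - q)" if s: "0 \<le> s" "s < 1" for s
      proof -
        have "norm (g x - g (x + s *\<^sub>R (q - x))) \<le> L * (s * norm (x - q))"
          using l[OF seg[OF s]] s by (simp add: norm_minus_commute)
        also have "\<dots> \<le> L * norm (x - q)" using s L by (intro mult_left_mono) (auto intro: mult_left_le_one_le)
        finally show ?thesis .
      qed
      \<comment> \<open>The point q itself is not in \<Omega>; the estimate holds up to every point
        before it and passes to the limit by continuity.\<close>
      then have ev: "\<forall>\<^sub>F s in at_left (1::real). norm (g x - g (x + s *\<^sub>R (q - x))) \<le> L * norm (x - q)"
        by (subst eventually_at_left[of 0]) (auto intro!: exI[of _ 0])
      have "isCont (\<lambda>s. norm (g x - g (x + s *\<^sub>R (q - x)))) 1"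
      proof -
        have "continuous_on UNIV (\<lambda>s::real. norm (g x - g (x + s *\<^sub>R (q - x))))"
          by (intro continuous_intros continuous_on_compose2[OF c]) auto
        then show ?thesis by (simp add: continuous_on_eq_continuous_at)
      qed
      then have "((\<lambda>s. norm (g x - g (x + s *\<^sub>R (q - x)))) \<longlongrightarrow> norm (g x - g (x + 1 *\<^sub>R (q - x)))) (at_left 1)"
        unfolding isCont_def by (rule tendsto_mono[OF at_le[OF subset_UNIV]])
      from tendsto_upperbound[OF this ev] show ?thesis using g0 q(1) by simp
    qed
    then show ?thesis using mult_left_mono[OF xq L] by linarith
  qed
  obtain c' where c': "c' \<in> closed_segment x y - \<Omega>" using False by blast
  have "norm (g x) \<le> L * norm (x - c')" by (rule key[OF c'])
  moreover have "norm (g y) \<le> L * norm (y - c')" using c' by (intro key[of c' y x]) (simp add: closed_segment_commute)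
  moreover have "norm (x - c') + norm (y - c') = norm (x - y)"
    using c' between_mem_segment[of x y c'] by (simp add: between dist_norm norm_minus_commute)
  then have "L * norm (x - c') + L * norm (y - c') = L * norm (x - y)" by (simp only: distrib_left[symmetric])
  ultimately show ?thesis using norm_triangle_ineq4[of "g x" "g y"] by linarith
qed (rule l)

text \<open>Mean value inequality for the function minus its linear part. With c the derivative at
  one point this is a Taylor remainder.\<close>

lemma mean_value_const:
  fixes \<phi> :: "real \<Rightarrow> 'b::real_normed_vector"
  assumes ab: "a \<le> b" and d: "\<And>s. s \<in> {a..b} \<Longrightarrow> (\<phi> has_vector_derivative \<phi>' s) (at s within {a..b})"
    and e: "\<And>s. s \<in> {a..b} \<Longrightarrow> norm (\<phi>' s - c) \<le> \<epsilon>"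
  shows "norm (\<phi> b - \<phi> a - (b - a) *\<^sub>R c) \<le> \<epsilon> * (b - a)"
proof -
  have "norm ((\<phi> b - b *\<^sub>R c) - (\<phi> a - a *\<^sub>R c)) \<le> \<epsilon> * norm (b - a)"
  proof (rule differentiable_bound[where S="{a..b}" and f'="\<lambda>s w. w *\<^sub>R (\<phi>' s - c)"])
    show "((\<lambda>s. \<phi> s - s *\<^sub>R c) has_derivative (\<lambda>w. w *\<^sub>R (\<phi>' s - c))) (at s within {a..b})" if "s \<in> {a..b}" for s
      using has_derivative_diff[OF d[OF that, unfolded has_vector_derivative_def]
          has_derivative_scaleR_left[OF has_derivative_ident, of c]]
      by (simp only: scaleR_diff_right)
    show "onorm (\<lambda>w. w *\<^sub>R (\<phi>' s - c)) \<le> \<epsilon>" if "s \<in> {a..b}" for s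
    proof (rule onorm_le)
      show "norm (w *\<^sub>R (\<phi>' s - c)) \<le> \<epsilon> * norm w" for w
        using mult_right_mono[OF e[OF that] abs_ge_zero[of w]] by (simp add: mult.commute)
    qed
  qed (use ab in \<open>simp_all add: convex_real_interval\<close>)
  moreover have "(\<phi> b - b *\<^sub>R c) - (\<phi> a - a *\<^sub>R c) = \<phi> b - \<phi> a - (b - a) *\<^sub>R c"
    by (simp add: scaleR_diff_left)
  ultimately show ?thesis using ab by simp
qed

text \<open>Symmetrising in s removes the odd terms, and subtracting s^2 times the second derivative
  at 0 leaves a function with derivative O(h^2). The second derivative is assumed to vary only by
  O(h), so the rate is one order and not two.\<close>

lemma second_difference_bound:
  fixes \<phi> :: "real \<Rightarrow> 'b::real_normed_vector"
  assumes h: "h > 0" and d1: "\<And>s. \<bar>s\<bar> \<le> h \<Longrightarrow> (\<phi> has_vector_derivative \<phi>1 s) (at s)"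
    and d2: "\<And>s. \<bar>s\<bar> \<le> h \<Longrightarrow> (\<phi>1 has_vector_derivative \<phi>2 s) (at s)"
    and e: "\<And>s. \<bar>s\<bar> \<le> h \<Longrightarrow> norm (\<phi>2 s - \<phi>2 0) \<le> K * h" and K: "K \<ge> 0"
  shows "norm ((\<phi> h + \<phi> (-h) - 2 *\<^sub>R \<phi> 0) /\<^sub>R h\<^sup>2 - \<phi>2 0) \<le> 2 * K * h"
proof -
  define \<psi> where "\<psi> = (\<lambda>s. \<phi> s + \<phi> (- s) - s\<^sup>2 *\<^sub>R \<phi>2 0)"
  define \<psi>1 where "\<psi>1 = (\<lambda>s. \<phi>1 s - \<phi>1 (- s) - (2 * s) *\<^sub>R \<phi>2 0)"
  have neg: "((\<lambda>s. \<phi> (- s)) has_vector_derivative - \<phi>1 (- s)) (at s)" if "\<bar>s\<bar> \<le> h" for s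
    using vector_diff_chain_at[OF has_vector_derivative_minus[OF has_vector_derivative_id], of \<phi> "\<phi>1 (- s)" s]
      d1[of "- s"] that by (simp add: o_def)
  have \<psi>d: "(\<psi> has_vector_derivative \<psi>1 s) (at s within {0..h})" if "s \<in> {0..h}" for s
  proof -
    have sq: "((\<lambda>s::real. s\<^sup>2) has_real_derivative 2 * s) (at s)" by (auto intro!: derivative_eq_intros)
    have d: "(\<psi> has_vector_derivative \<phi>1 s + - \<phi>1 (- s) - (s\<^sup>2 *\<^sub>R 0 + (2 * s) *\<^sub>R \<phi>2 0)) (at s)"
      unfolding \<psi>_def
      by (rule has_vector_derivative_diff[OF has_vector_derivative_add[OF d1 neg]
          has_vector_derivative_scaleR[OF sq has_vector_derivative_const]]) (use that in simp_all)
    have "\<phi>1 s + - \<phi>1 (- s) - (s\<^sup>2 *\<^sub>R 0 + (2 * s) *\<^sub>R \<phi>2 0) = \<psi>1 s" by (simp add: \<psi>1_def)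
    then show ?thesis using has_vector_derivative_at_within[OF d] by simp
  qed
  have \<psi>1b: "norm (\<psi>1 s - 0) \<le> 2 * K * h\<^sup>2" if s: "s \<in> {0..h}" for s
  proof -
    have "norm (\<phi>1 s - \<phi>1 (- s) - (s - (- s)) *\<^sub>R \<phi>2 0) \<le> (K * h) * (s - (- s))"
      using s by (intro mean_value_const[where \<phi>'=\<phi>2] has_vector_derivative_at_within[OF d2] e) auto
    also have "\<dots> \<le> (K * h) * (2 * h)" using s K h by (intro mult_left_mono) auto
    finally show ?thesis by (simp add: \<psi>1_def power2_eq_square mult_ac)
  qed
  have "norm (\<psi> h - \<psi> 0 - (h - 0) *\<^sub>R 0) \<le> (2 * K * h\<^sup>2) * (h - 0)"
    using h by (intro mean_value_const[where \<phi>'=\<psi>1] \<psi>d \<psi>1b) auto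
  then have b: "norm (\<phi> h + \<phi> (-h) - 2 *\<^sub>R \<phi> 0 - h\<^sup>2 *\<^sub>R \<phi>2 0) \<le> (2 * K * h) * h\<^sup>2"
  proof -
    have "\<psi> h - \<psi> 0 - (h - 0) *\<^sub>R 0 = \<phi> h + \<phi> (-h) - 2 *\<^sub>R \<phi> 0 - h\<^sup>2 *\<^sub>R \<phi>2 0"
      by (simp add: \<psi>_def scaleR_2)
    moreover have "(2 * K * h\<^sup>2) * (h - 0) = (2 * K * h) * h\<^sup>2" by simp
    ultimately show ?thesis
      using \<open>norm (\<psi> h - \<psi> 0 - (h - 0) *\<^sub>R 0) \<le> (2 * K * h\<^sup>2) * (h - 0)\<close> by metis
  qed
  have "(\<phi> h + \<phi> (-h) - 2 *\<^sub>R \<phi> 0) /\<^sub>R h\<^sup>2 - \<phi>2 0 = (\<phi> h + \<phi> (-h) - 2 *\<^sub>R \<phi> 0 - h\<^sup>2 *\<^sub>R \<phi>2 0) /\<^sub>R h\<^sup>2"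
    using h by (simp add: scaleR_diff_right)
  then have "norm ((\<phi> h + \<phi> (-h) - 2 *\<^sub>R \<phi> 0) /\<^sub>R h\<^sup>2 - \<phi>2 0)
      = inverse (h\<^sup>2) * norm (\<phi> h + \<phi> (-h) - 2 *\<^sub>R \<phi> 0 - h\<^sup>2 *\<^sub>R \<phi>2 0)"
    by (simp only: norm_scaleR) simp
  also have "\<dots> \<le> inverse (h\<^sup>2) * ((2 * K * h) * h\<^sup>2)" using b by (intro mult_left_mono) auto
  also have "\<dots> = 2 * K * h" using h by (simp only: mult.commute[of "inverse (h\<^sup>2)"] mult.assoc right_inverse) simp
  finally show ?thesis .
qed

lemma norm_vec3_le:
  fixes x :: "real^3"
  assumes "\<And>i. \<bar>x $ i\<bar> \<le> k"
  shows "norm x \<le> 3 * k"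
  using norm_le_sum3[of x] assms[of 1] assms[of 2] assms[of 3] by linarith

lemma segment_in_cball:
  fixes x :: "real^3"
  assumes "cball x \<rho> \<subseteq> \<Omega>" "norm (y - x) \<le> \<rho>" "norm (z - x) \<le> \<rho>"
  shows "closed_segment y z \<subseteq> \<Omega>"
proof -
  have "closed_segment y z \<subseteq> cball x \<rho>"
    using assms(2,3) by (intro closed_segment_subset convex_cball) (auto simp: dist_norm norm_minus_commute)
  then show ?thesis using assms(1) by blast
qed

section \<open>Regularity of the zero extension and consistency of the differences\<close>

context classical_solution
begin

lemma V_lipschitz:
  assumes "t \<in> {1..2}"
  shows "norm (V t x - V t y) \<le> M * norm (x - y)"
proof (rule lipschitz_zero_extension[OF op V_continuous[OF assms] V_outside M])
  fix x y assume s: "closed_segment x y \<subseteq> \<Omega>"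
  then have "x \<in> \<Omega>" "y \<in> \<Omega>" by auto
  then show "norm (V t x - V t y) \<le> M * norm (x - y)"
    using space_time_lipschitzD[OF lip(1) assms assms s] by (simp add: V_inside)
qed auto

lemma V_bound: "t \<in> {1..2} \<Longrightarrow> norm (V t x) \<le> M"
  using bnd(1) M by (simp add: V_def)

lemma V_time_lipschitz:
  assumes "t \<in> {1..2}" "s \<in> {1..2}"
  shows "norm (V t x - V s x) \<le> M * \<bar>t - s\<bar>"
proof (cases "x \<in> \<Omega>")
  case True
  then have "closed_segment x x \<subseteq> \<Omega>" by simp
  from space_time_lipschitzD[OF lip(1) assms this] show ?thesis using True by (simp add: V_inside)
qed (use M in \<open>simp add: V_outside\<close>)

lemma derivative_norm:
  fixes w :: "real^3" and a :: "3 \<Rightarrow> 'b::real_normed_vector"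
  assumes "\<And>i. norm (a i) \<le> k"
  shows "norm (\<Sum>i\<in>UNIV. w $ i *\<^sub>R a i) \<le> 3 * k * norm w"
proof -
  have "norm (\<Sum>i\<in>UNIV. w $ i *\<^sub>R a i) \<le> (\<Sum>i\<in>(UNIV::3 set). norm w * k)"
    using assms component_le_norm_cart[of w]
    by (intro order_trans[OF norm_sum] sum_mono) (auto intro!: mult_mono)
  then show ?thesis by (simp add: mult_ac)
qed

text \<open>The spatial derivatives are Lipschitz in time, which gives the bound on segments inside
  \<Omega>; \<open>lipschitz_zero_extension\<close> carries it across the boundary. The time
  difference quotient thus becomes Lipschitz in space uniformly in \<tau>.\<close>

lemma V_time_diff_lipschitz:
  assumes t: "t \<in> {1..2}" "s \<in> {1..2}"
  shows "norm ((V t x - V s x) - (V t y - V s y)) \<le> 3 * M * \<bar>t - s\<bar> * norm (x - y)"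
proof (rule lipschitz_zero_extension[OF op])
  show "continuous_on UNIV (\<lambda>x. V t x - V s x)" by (intro continuous_intros V_continuous t)
  show "0 \<le> 3 * M * \<bar>t - s\<bar>" using M by simp
  show "V t x - V s x = 0" if "x \<notin> \<Omega>" for x using that by (simp add: V_outside)
  fix x y assume seg: "closed_segment x y \<subseteq> \<Omega>"
  have "norm ((v t y - v s y) - (v t x - v s x)) \<le> 3 * M * \<bar>t - s\<bar> * norm (y - x)"
  proof (rule differentiable_bound[where S="closed_segment x y"
        and f'="\<lambda>z w. (\<Sum>i\<in>UNIV. w $ i *\<^sub>R (vx i t z - vx i s z))"])
    fix z assume "z \<in> closed_segment x y"
    then have z: "z \<in> \<Omega>" using seg by blast
    then have zz: "closed_segment z z \<subseteq> \<Omega>" by simp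
    have eq: "(\<lambda>w::real^3. \<Sum>i\<in>UNIV. w $ i *\<^sub>R (vx i t z - vx i s z))
        = (\<lambda>w. (\<Sum>i\<in>UNIV. w $ i *\<^sub>R vx i t z) - (\<Sum>i\<in>UNIV. w $ i *\<^sub>R vx i s z))"
      by (simp only: sum_subtractf scaleR_diff_right)
    show "((\<lambda>z. v t z - v s z) has_derivative (\<lambda>w. \<Sum>i\<in>UNIV. w $ i *\<^sub>R (vx i t z - vx i s z))) (at z within closed_segment x y)"
      unfolding eq by (rule has_derivative_at_withinI[OF has_derivative_diff[OF dv[OF t(1) z] dv[OF t(2) z]]])
    show "onorm (\<lambda>w. \<Sum>i\<in>UNIV. w $ i *\<^sub>R (vx i t z - vx i s z)) \<le> 3 * M * \<bar>t - s\<bar>"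
    proof (rule onorm_le)
      fix w :: "real^3"
      have "norm (vx i t z - vx i s z) \<le> M * \<bar>t - s\<bar>" for i using space_time_lipschitzD[OF lip(3) t zz] by simp
      from derivative_norm[of "\<lambda>i. vx i t z - vx i s z", OF this, of w]
      show "norm (\<Sum>i\<in>UNIV. w $ i *\<^sub>R (vx i t z - vx i s z)) \<le> 3 * M * \<bar>t - s\<bar> * norm w"
        by (simp only: mult.assoc)
    qed
  qed simp_all
  moreover have "x \<in> \<Omega>" "y \<in> \<Omega>" using seg by auto
  ultimately show "norm ((V t x - V s x) - (V t y - V s y)) \<le> 3 * M * \<bar>t - s\<bar> * norm (x - y)"
    by (simp add: V_inside norm_minus_commute)
qed

text \<open>Mean value inequality for the increment of v by a, along the segment from y to y + b;
  the ball keeps all points inside \<Omega>.\<close>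

lemma V_second_difference:
  assumes t: "t \<in> {1..2}" and ball: "cball x \<rho> \<subseteq> \<Omega>" and r: "norm (y - x) + norm a + norm b \<le> \<rho>"
  shows "norm (V t (y + a + b) - V t (y + a) - V t (y + b) + V t y) \<le> 3 * M * norm a * norm b"
proof -
  have inb: "norm (z - x) \<le> \<rho> \<and> norm (z + a - x) \<le> \<rho>" if z: "z \<in> closed_segment y (y + b)" for z
  proof -
    have "norm (z - y) \<le> norm b" using dist_in_closed_segment[OF z] by (auto simp: dist_norm norm_minus_commute)
    moreover have "norm (z - x) \<le> norm (z - y) + norm (y - x)" using norm_triangle_ineq[of "z - y" "y - x"] by simp
    moreover have "norm (z + a - x) \<le> norm (z - x) + norm a"
      using norm_triangle_ineq[of "z - x" a] by (simp add: algebra_simps)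
    ultimately show ?thesis using r norm_ge_zero[of a] by linarith
  qed
  have "norm ((v t (y + b + a) - v t (y + b)) - (v t (y + a) - v t y)) \<le> 3 * (M * norm a) * norm (y + b - y)"
  proof (rule differentiable_bound[where S="closed_segment y (y + b)" and f="\<lambda>z. v t (z + a) - v t z"
        and f'="\<lambda>z w. (\<Sum>i\<in>UNIV. w $ i *\<^sub>R (vx i t (z + a) - vx i t z))"])
    fix z assume zs: "z \<in> closed_segment y (y + b)"
    have seg: "closed_segment (z + a) z \<subseteq> \<Omega>" using inb[OF zs] by (intro segment_in_cball[OF ball]) auto
    then have z: "z \<in> \<Omega>" "z + a \<in> \<Omega>" by auto
    have "((\<lambda>z. v t (z + a)) has_derivative (\<lambda>w. \<Sum>i\<in>UNIV. w $ i *\<^sub>R vx i t (z + a))) (at z)"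
    proof -
      have "((\<lambda>z. z + a) has_derivative (\<lambda>w. w)) (at z)"
        using has_derivative_add[OF has_derivative_ident[of "at z"] has_derivative_const[of a "at z"]] by simp
      from has_derivative_compose[OF this dv[OF t z(2)]] show ?thesis .
    qed
    note d = has_derivative_diff[OF this dv[OF t z(1)]]
    have eq: "(\<lambda>w::real^3. \<Sum>i\<in>UNIV. w $ i *\<^sub>R (vx i t (z + a) - vx i t z))
        = (\<lambda>w. (\<Sum>i\<in>UNIV. w $ i *\<^sub>R vx i t (z + a)) - (\<Sum>i\<in>UNIV. w $ i *\<^sub>R vx i t z))"
      by (simp only: sum_subtractf scaleR_diff_right)
    show "((\<lambda>z. v t (z + a) - v t z) has_derivative (\<lambda>w. \<Sum>i\<in>UNIV. w $ i *\<^sub>R (vx i t (z + a) - vx i t z))) (at z within closed_segment y (y + b))"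
      unfolding eq by (rule has_derivative_at_withinI[OF d])
    show "onorm (\<lambda>w. \<Sum>i\<in>UNIV. w $ i *\<^sub>R (vx i t (z + a) - vx i t z)) \<le> 3 * (M * norm a)"
    proof (rule onorm_le)
      fix w :: "real^3"
      have "norm (vx i t (z + a) - vx i t z) \<le> M * norm a" for i using space_time_lipschitzD[OF lip(3) t t seg] by simp
      from derivative_norm[of "\<lambda>i. vx i t (z + a) - vx i t z", OF this, of w]
      show "norm (\<Sum>i\<in>UNIV. w $ i *\<^sub>R (vx i t (z + a) - vx i t z)) \<le> 3 * (M * norm a) * norm w" .
    qed
  qed simp_all
  moreover have "y \<in> closed_segment y (y + b)" "y + b \<in> closed_segment y (y + b)" by auto
  then have "z \<in> \<Omega>" if "z \<in> {y, y + a, y + b, y + b + a}" for z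
    using inb[of y] inb[of "y + b"] that ball by (auto simp: dist_norm norm_minus_commute)
  ultimately show ?thesis by (simp add: V_inside algebra_simps)
qed

text \<open>For a negative radius the ball is empty, so this also yields the global bounds around
  any point.\<close>

lemma V_regular:
  assumes t: "t \<in> {1..2}" and ball: "cball x \<rho> \<subseteq> \<Omega>"
  shows "regular (V t) x \<rho> (3 * M)"
proof -
  have l: "norm (V t (y + a) - V t y) \<le> 3 * M * norm a" for y a
  proof -
    have "norm (V t (y + a) - V t y) \<le> M * norm a" using V_lipschitz[OF t, of "y + a" y] by simp
    moreover have "0 \<le> M * norm a" using M by simp
    moreover have "3 * M * norm a = 3 * (M * norm a)" by simp
    ultimately show ?thesis by linarith
  qed
  have b: "norm (V t y) \<le> 3 * M" for y using V_bound[OF t, of y] M by linarith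
  show ?thesis unfolding diff_bounds_def by (intro conjI allI impI b l V_second_difference[OF t ball])
qed

text \<open>With radius -1 only the global bounds are recorded; they suffice for the transported
  difference quotient to be O(h)-close to the difference quotient itself.\<close>

lemma V_time_diff_regular:
  assumes t: "t \<in> {1..2}" "s \<in> {1..2}" and \<tau>: "\<tau> > 0" "\<bar>t - s\<bar> \<le> \<tau>"
  shows "regular (\<lambda>y. (1 / \<tau>) *\<^sub>R (V t y - V s y)) x (-1) (3 * M)"
proof -
  have b: "norm ((1 / \<tau>) *\<^sub>R (V t y - V s y)) \<le> 3 * M" for y
  proof -
    have "M * \<bar>t - s\<bar> \<le> M * \<tau>" using M \<tau> by (intro mult_left_mono) auto
    moreover have "0 \<le> M * \<tau>" "3 * M * \<tau> = 3 * (M * \<tau>)" using M \<tau> by simp_all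
    ultimately have "norm (V t y - V s y) \<le> 3 * M * \<tau>" using V_time_lipschitz[OF t, of y] by linarith
    then show ?thesis using \<tau> by (simp add: pos_divide_le_eq)
  qed
  have l: "norm ((1 / \<tau>) *\<^sub>R (V t (y + a) - V s (y + a)) - (1 / \<tau>) *\<^sub>R (V t y - V s y)) \<le> 3 * M * norm a" for y a
  proof -
    have "3 * M * \<bar>t - s\<bar> * norm a \<le> 3 * M * \<tau> * norm a" using M \<tau> by (intro mult_right_mono mult_left_mono) auto
    then have "norm ((V t (y + a) - V s (y + a)) - (V t y - V s y)) \<le> (3 * M * norm a) * \<tau>"
      using V_time_diff_lipschitz[OF t, of "y + a" y] by (simp add: mult_ac)
    then show ?thesis using \<tau> by (simp add: scaleR_diff_right[symmetric] pos_divide_le_eq)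
  qed
  have neg: "\<not> norm (y - x) + norm a \<le> -1" "\<not> norm (y - x) + norm a + norm b \<le> -1" for y a b :: "real^3"
    using norm_ge_zero[of "y - x"] norm_ge_zero[of a] norm_ge_zero[of b] by linarith+
  show ?thesis unfolding diff_bounds_def
    by (intro conjI allI impI b l) (simp only: neg(2) simp_thms)
qed

lemma disc_div_face_avg_V:
  assumes t: "t \<in> {1..2}" and h: "h > 0"
  shows "disc_div h (face_avg h (V t)) x = 0"
proof (rule disc_div_face_avg_eq_0[OF h M op V_continuous[OF t] V_outside, where W="\<lambda>i. vx i t"])
  fix i y assume y: "y \<in> \<Omega>"
  have "((\<lambda>s. y + s *\<^sub>R axis i 1) has_derivative (\<lambda>s. s *\<^sub>R axis i 1)) (at 0)"
    by (auto intro!: derivative_eq_intros)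
  from has_derivative_compose[OF this, of "v t" "\<lambda>w. \<Sum>i\<in>UNIV. w $ i *\<^sub>R vx i t y"] dv[OF t y]
  have "((\<lambda>s. v t (y + s *\<^sub>R axis i 1)) has_derivative (\<lambda>s. \<Sum>j\<in>UNIV. (s *\<^sub>R axis i 1) $ j *\<^sub>R vx j t y)) (at 0)" by simp
  moreover have "(\<Sum>j\<in>UNIV. (s *\<^sub>R axis i 1) $ j *\<^sub>R vx j t y) = s *\<^sub>R vx i t y" for s
  proof -
    have "(\<Sum>j\<in>UNIV. (s *\<^sub>R axis i (1::real)) $ j *\<^sub>R vx j t y) = (\<Sum>j\<in>UNIV. if j = i then s *\<^sub>R vx j t y else 0)"
      by (intro sum.cong refl) (simp add: axis_def)
    then show ?thesis by simp
  qed
  ultimately have D: "((\<lambda>s. v t (y + s *\<^sub>R axis i 1)) has_vector_derivative vx i t y) (at 0)"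
    by (simp add: has_vector_derivative_def)
  have "open ((\<lambda>s::real. y + s *\<^sub>R axis i 1) -` \<Omega>)" by (intro open_vimage op continuous_intros)
  from has_vector_derivative_transform_within_open[OF D this]
  show "((\<lambda>s. V t (y + s *\<^sub>R axis i 1)) has_vector_derivative vx i t y) (at 0)" using y by (simp add: V_inside)
next
  fix i
  show "continuous_on \<Omega> (vx i t)"
  proof (rule continuous_on_eq_continuous_at[THEN iffD2, OF op], rule ballI)
    fix y assume "y \<in> \<Omega>"
    then obtain e where e: "e > 0" "cball y e \<subseteq> \<Omega>" using op open_contains_cball by blast
    have "M-lipschitz_on (ball y e) (vx i t)"
    proof (rule lipschitz_onI)
      fix a b assume "a \<in> ball y e" "b \<in> ball y e"
      then have "closed_segment a b \<subseteq> \<Omega>" by (intro segment_in_cball[OF e(2)]) (auto simp: dist_norm norm_minus_commute)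
      from space_time_lipschitzD[OF lip(3) t t this] show "dist (vx i t a) (vx i t b) \<le> M * dist a b"
        by (simp add: dist_norm)
    qed (rule M)
    then have "continuous_on (ball y e) (vx i t)" by (rule lipschitz_on_continuous_on)
    then show "isCont (vx i t) y" using e by (simp add: continuous_on_eq_continuous_at)
  qed
qed (use bnd(2)[OF t] solenoidal[OF t] in auto)

lemma V_line_derivative:
  assumes t: "t \<in> {1..2}" and y: "y \<in> \<Omega>"
  shows "((\<lambda>s. v t (y + s *\<^sub>R axis i 1)) has_vector_derivative vx i t y) (at 0)"
proof -
  have "((\<lambda>s. y + s *\<^sub>R axis i 1) has_derivative (\<lambda>s. s *\<^sub>R axis i 1)) (at 0)"
    by (auto intro!: derivative_eq_intros)
  from has_derivative_compose[OF this, of "v t" "\<lambda>w. \<Sum>i\<in>UNIV. w $ i *\<^sub>R vx i t y"] dv[OF t y]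
  have "((\<lambda>s. v t (y + s *\<^sub>R axis i 1)) has_derivative (\<lambda>s. \<Sum>j\<in>UNIV. (s *\<^sub>R axis i 1) $ j *\<^sub>R vx j t y)) (at 0)" by simp
  moreover have "(\<Sum>j\<in>UNIV. (s *\<^sub>R axis i 1) $ j *\<^sub>R vx j t y) = s *\<^sub>R vx i t y" for s
  proof -
    have "(\<Sum>j\<in>UNIV. (s *\<^sub>R axis i (1::real)) $ j *\<^sub>R vx j t y) = (\<Sum>j\<in>UNIV. if j = i then s *\<^sub>R vx j t y else 0)"
      by (intro sum.cong refl) (simp add: axis_def)
    then show ?thesis by simp
  qed
  ultimately show ?thesis by (simp add: has_vector_derivative_def)
qed

text \<open>The smoothness of the force is assumed in \<Omega> and not up to its boundary, so it
  gives no uniform constant. The equation expresses f through v and p, whose derivatives are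
  controlled up to the boundary.\<close>

lemma f_lipschitz:
  assumes t: "t \<in> {1..2}" "s \<in> {1..2}" and seg: "closed_segment x y \<subseteq> \<Omega>"
  shows "norm (f t x - f s y) \<le> (7 * M + 6 * M\<^sup>2) * (\<bar>t - s\<bar> + norm (x - y))"
proof -
  define d where "d = \<bar>t - s\<bar> + norm (x - y)"
  have d: "d \<ge> 0" by (simp add: d_def)
  have xy: "x \<in> \<Omega>" "y \<in> \<Omega>" using seg by auto
  have l: "norm (v t x - v s y) \<le> M * d" "norm (vt t x - vt s y) \<le> M * d" "norm (vx j t x - vx j s y) \<le> M * d"
    "norm (vxx j t x - vxx j s y) \<le> M * d" "norm (px j t x - px j s y) \<le> M * d" for j
    unfolding d_def by (intro space_time_lipschitzD[OF _ t seg] lip)+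
  have nl: "norm (v t x $ j *\<^sub>R vx j t x - v s y $ j *\<^sub>R vx j s y) \<le> 2 * M\<^sup>2 * d" for j
  proof -
    have eq: "v t x $ j *\<^sub>R vx j t x - v s y $ j *\<^sub>R vx j s y
        = v t x $ j *\<^sub>R (vx j t x - vx j s y) + (v t x - v s y) $ j *\<^sub>R vx j s y"
      by (simp add: algebra_simps)
    have "\<bar>v t x $ j\<bar> \<le> M" using component_le_norm_cart[of "v t x" j] bnd(1)[OF t(1) xy(1)] by linarith
    then have a: "norm (v t x $ j *\<^sub>R (vx j t x - vx j s y)) \<le> M * (M * d)"
      unfolding norm_scaleR using l(3) M by (intro mult_mono) auto
    have "\<bar>(v t x - v s y) $ j\<bar> \<le> M * d" using component_le_norm_cart[of "v t x - v s y" j] l(1) by linarith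
    then have b: "norm ((v t x - v s y) $ j *\<^sub>R vx j s y) \<le> (M * d) * M"
      unfolding norm_scaleR using bnd(2)[OF t(2) xy(2)] M d by (intro mult_mono) auto
    show ?thesis unfolding eq using norm_triangle_mono[OF a b] by (simp add: power2_eq_square mult_ac)
  qed
  have eq: "f t x - f s y = (vt t x - vt s y) + (\<Sum>j\<in>UNIV. v t x $ j *\<^sub>R vx j t x - v s y $ j *\<^sub>R vx j s y)
      + - (\<Sum>j\<in>UNIV. vxx j t x - vxx j s y) + (\<chi> i. px i t x - px i s y)"
    unfolding ns[OF t(1) xy(1)] ns[OF t(2) xy(2)] sum_subtractf by (simp add: vec_eq_iff)
  have "norm (f t x - f s y) \<le> M * d + 3 * (2 * M\<^sup>2 * d) + 3 * (M * d) + 3 * (M * d)"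
    unfolding eq
  proof (intro norm_triangle_mono)
    show "norm (\<Sum>j\<in>UNIV. v t x $ j *\<^sub>R vx j t x - v s y $ j *\<^sub>R vx j s y) \<le> 3 * (2 * M\<^sup>2 * d)"
      using sum_norm_le[of "UNIV :: 3 set" _ "\<lambda>_. 2 * M\<^sup>2 * d", OF nl] by simp
    show "norm (- (\<Sum>j\<in>UNIV. vxx j t x - vxx j s y)) \<le> 3 * (M * d)"
      unfolding norm_minus_cancel using sum_norm_le[of "UNIV :: 3 set" _ "\<lambda>_. M * d", OF l(4)] by simp
    show "norm (\<chi> i. px i t x - px i s y) \<le> 3 * (M * d)" using l(5) by (intro norm_vec3_le) simp
  qed (rule l(2))
  then show ?thesis by (simp add: d_def[symmetric] algebra_simps)
qed

text \<open>Each difference quotient is compared with its derivative to first order only. This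
  suffices, since the boundary layer keeps the final rate below first order anyway.\<close>

lemma consistency:
  assumes t: "t \<in> {1..2}" "t - \<tau> \<in> {1..2}" and \<tau>: "\<tau> > 0" and h: "h > 0" and ball: "cball x (2 * h) \<subseteq> \<Omega>"
    and F: "norm (F - f t x) \<le> \<epsilon>"
    and P: "\<And>i. P (x + h *\<^sub>R axis i 1) = p t (x + h *\<^sub>R axis i 1)" "\<And>i. P (x - h *\<^sub>R axis i 1) = p t (x - h *\<^sub>R axis i 1)"
  shows "norm ((V t x - V (t - \<tau>) x) /\<^sub>R \<tau> + (\<Sum>j\<in>UNIV. V t x $ j *\<^sub>R diff_central h j (V t) x)
      - (\<Sum>j\<in>UNIV. diff_second h j (V t) x) - F + disc_grad h P x) \<le> (9 * M + 3 * M\<^sup>2) * (h + \<tau>) + \<epsilon>"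
    and "norm (disc_grad h P x) \<le> 3 * (M + M * h)"
proof -
  have line: "x + s *\<^sub>R axis i 1 \<in> \<Omega>" if "\<bar>s\<bar> \<le> 2 * h" for s i
    using that ball by (auto simp: subset_iff dist_norm norm_axis_1)
  have x: "x \<in> \<Omega>" using line[of 0 1] h by simp
  have seg: "closed_segment (x + s *\<^sub>R axis i 1) x \<subseteq> \<Omega>" if "\<bar>s\<bar> \<le> h" for s i
    using that h by (intro segment_in_cball[OF ball]) (auto simp: norm_axis_1)
  have shift: "((\<lambda>r. g (x + r *\<^sub>R axis i 1)) has_vector_derivative d) (at s)"
    if "((\<lambda>r. g (x + s *\<^sub>R axis i 1 + r *\<^sub>R axis i 1)) has_vector_derivative d) (at 0)"
    for g :: "real^3 \<Rightarrow> 'c::real_normed_vector" and d i s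
  proof -
    have "((\<lambda>r. r - s) has_vector_derivative 1 - 0) (at s)"
      by (rule has_vector_derivative_diff[OF has_vector_derivative_id has_vector_derivative_const])
    then have "((\<lambda>r. r - s) has_vector_derivative 1) (at s)" by simp
    from vector_diff_chain_at[OF this, of "\<lambda>r. g (x + s *\<^sub>R axis i 1 + r *\<^sub>R axis i 1)" d] that
    have "((\<lambda>r. g (x + s *\<^sub>R axis i 1 + (r - s) *\<^sub>R axis i 1)) has_vector_derivative d) (at s)" by (simp add: o_def)
    moreover have "x + s *\<^sub>R axis i 1 + (r - s) *\<^sub>R axis i 1 = x + r *\<^sub>R axis i 1" for r by (simp add: algebra_simps)
    ultimately show ?thesis by simp
  qed
  have lipb: "norm (g t (x + s *\<^sub>R axis i 1) - g t x) \<le> M * h" if "space_time_lipschitz \<Omega> M g" "\<bar>s\<bar> \<le> h"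
    for g :: "real \<Rightarrow> real^3 \<Rightarrow> 'c::real_normed_vector" and s i
  proof -
    have "norm (g t (x + s *\<^sub>R axis i 1) - g t x) \<le> M * \<bar>s\<bar>"
      using space_time_lipschitzD[OF that(1) t(1) t(1) seg[OF that(2)]] by (simp add: norm_axis_1)
    also have "\<dots> \<le> M * h" using that M by (intro mult_left_mono)
    finally show ?thesis .
  qed
  have central: "norm (diff_central h i G x - g' i t x) \<le> M * h"
    if G: "G (x + h *\<^sub>R axis i 1) = g (x + h *\<^sub>R axis i 1)" "G (x - h *\<^sub>R axis i 1) = g (x - h *\<^sub>R axis i 1)"
      and d: "\<And>y. y \<in> \<Omega> \<Longrightarrow> ((\<lambda>s. g (y + s *\<^sub>R axis i 1)) has_vector_derivative g' i t y) (at 0)"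
      and l: "space_time_lipschitz \<Omega> M (g' i)"
    for g G :: "real^3 \<Rightarrow> 'c::real_normed_vector" and g' :: "3 \<Rightarrow> real \<Rightarrow> real^3 \<Rightarrow> 'c" and i
  proof -
    have "norm (g (x + h *\<^sub>R axis i 1) - g (x + (-h) *\<^sub>R axis i 1) - (h - (-h)) *\<^sub>R g' i t x) \<le> (M * h) * (h - (-h))"
    proof (rule mean_value_const[where \<phi>="\<lambda>s. g (x + s *\<^sub>R axis i 1)" and \<phi>'="\<lambda>s. g' i t (x + s *\<^sub>R axis i 1)"])
      fix s assume s: "s \<in> {-h..h}"
      show "((\<lambda>s. g (x + s *\<^sub>R axis i 1)) has_vector_derivative g' i t (x + s *\<^sub>R axis i 1)) (at s within {-h..h})"
        by (rule has_vector_derivative_at_within[OF shift[OF d[OF line]]]) (use s h in auto)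
      show "norm (g' i t (x + s *\<^sub>R axis i 1) - g' i t x) \<le> M * h" using s by (intro lipb l) auto
    qed (use h in simp)
    then have b: "norm (G (x + h *\<^sub>R axis i 1) - G (x - h *\<^sub>R axis i 1) - (2 * h) *\<^sub>R g' i t x) \<le> (M * h) * (2 * h)"
      by (simp add: G)
    have "diff_central h i G x - g' i t x = inverse (2 * h) *\<^sub>R (G (x + h *\<^sub>R axis i 1) - G (x - h *\<^sub>R axis i 1) - (2 * h) *\<^sub>R g' i t x)"
      using h by (simp add: diff_central_def scaleR_diff_right)
    then have "norm (diff_central h i G x - g' i t x)
      = inverse (2 * h) * norm (G (x + h *\<^sub>R axis i 1) - G (x - h *\<^sub>R axis i 1) - (2 * h) *\<^sub>R g' i t x)"
      using h by (simp only: norm_scaleR) simp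
    also have "\<dots> \<le> inverse (2 * h) * ((M * h) * (2 * h))" using b h by (intro mult_left_mono) auto
    also have "\<dots> = M * h" using h by simp
    finally show ?thesis .
  qed
  have Vst: "V t (x + h *\<^sub>R axis i 1) = v t (x + h *\<^sub>R axis i 1)" "V t (x - h *\<^sub>R axis i 1) = v t (x - h *\<^sub>R axis i 1)" for i
    using line[of h i] line[of "- h" i] h by (simp_all add: V_inside)
  have e2: "norm (diff_central h i (V t) x - vx i t x) \<le> M * h" for i
    by (rule central[of "V t" i "v t" vx, OF Vst V_line_derivative[OF t(1)] lip(3)])
  have e4: "norm (diff_central h i P x - px i t x) \<le> M * h" for i
    by (rule central[of P i "p t" px, OF P dp[OF t(1)] lip(5)])
  have e3: "norm (diff_second h i (V t) x - vxx i t x) \<le> 2 * M * h" for i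
  proof -
    have "norm ((v t (x + h *\<^sub>R axis i 1) + v t (x + (-h) *\<^sub>R axis i 1) - 2 *\<^sub>R v t (x + 0 *\<^sub>R axis i 1)) /\<^sub>R h\<^sup>2
        - vxx i t (x + 0 *\<^sub>R axis i 1)) \<le> 2 * M * h"
    proof (rule second_difference_bound[where \<phi>="\<lambda>s. v t (x + s *\<^sub>R axis i 1)" and ?\<phi>1.0="\<lambda>s. vx i t (x + s *\<^sub>R axis i 1)"
          and ?\<phi>2.0="\<lambda>s. vxx i t (x + s *\<^sub>R axis i 1)"])
      fix s :: real assume s: "\<bar>s\<bar> \<le> h"
      then have y: "x + s *\<^sub>R axis i 1 \<in> \<Omega>" using h by (intro line) simp
      show "((\<lambda>s. v t (x + s *\<^sub>R axis i 1)) has_vector_derivative vx i t (x + s *\<^sub>R axis i 1)) (at s)"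
        "((\<lambda>s. vx i t (x + s *\<^sub>R axis i 1)) has_vector_derivative vxx i t (x + s *\<^sub>R axis i 1)) (at s)"
        by (rule shift[OF V_line_derivative[OF t(1) y]], rule shift[OF dvx[OF t(1) y]])
      show "norm (vxx i t (x + s *\<^sub>R axis i 1) - vxx i t (x + 0 *\<^sub>R axis i 1)) \<le> M * h"
        using lipb[OF lip(4) s] by simp
    qed (use h M in auto)
    then show ?thesis by (simp add: diff_second_def Vst V_inside[OF x])
  qed
  have e1: "norm ((V t x - V (t - \<tau>) x) /\<^sub>R \<tau> - vt t x) \<le> M * \<tau>"
  proof -
    have xx: "closed_segment x x \<subseteq> \<Omega>" using x by simp
    have "norm (v t x - v (t - \<tau>) x - (t - (t - \<tau>)) *\<^sub>R vt t x) \<le> (M * \<tau>) * (t - (t - \<tau>))"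
    proof (rule mean_value_const[where \<phi>="\<lambda>s. v s x" and \<phi>'="\<lambda>s. vt s x"])
      fix s assume s: "s \<in> {t - \<tau>..t}"
      then have s': "s \<in> {1..2}" using t by auto
      show "((\<lambda>s. v s x) has_vector_derivative vt s x) (at s within {t - \<tau>..t})"
        by (rule has_vector_derivative_at_within[OF dvt[OF s' x]])
      have "norm (vt s x - vt t x) \<le> M * \<bar>s - t\<bar>" using space_time_lipschitzD[OF lip(2) s' t(1) xx] by simp
      also have "\<dots> \<le> M * \<tau>" using s M by (intro mult_left_mono) auto
      finally show "norm (vt s x - vt t x) \<le> M * \<tau>" .
    qed (use \<tau> in simp)
    then have b: "norm (V t x - V (t - \<tau>) x - \<tau> *\<^sub>R vt t x) \<le> (M * \<tau>) * \<tau>" by (simp add: V_inside[OF x])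
    have "(V t x - V (t - \<tau>) x) /\<^sub>R \<tau> - vt t x = inverse \<tau> *\<^sub>R (V t x - V (t - \<tau>) x - \<tau> *\<^sub>R vt t x)"
      using \<tau> by (simp add: scaleR_diff_right)
    then have "norm ((V t x - V (t - \<tau>) x) /\<^sub>R \<tau> - vt t x) = inverse \<tau> * norm (V t x - V (t - \<tau>) x - \<tau> *\<^sub>R vt t x)"
      using \<tau> by (simp only: norm_scaleR) simp
    also have "\<dots> \<le> inverse \<tau> * ((M * \<tau>) * \<tau>)" using b \<tau> by (intro mult_left_mono) auto
    also have "\<dots> = M * \<tau>" using \<tau> by simp
    finally show ?thesis .
  qed
  have eq: "(V t x - V (t - \<tau>) x) /\<^sub>R \<tau> + (\<Sum>j\<in>UNIV. V t x $ j *\<^sub>R diff_central h j (V t) x)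
      - (\<Sum>j\<in>UNIV. diff_second h j (V t) x) - F + disc_grad h P x
    = ((V t x - V (t - \<tau>) x) /\<^sub>R \<tau> - vt t x) + (\<Sum>j\<in>UNIV. v t x $ j *\<^sub>R (diff_central h j (V t) x - vx j t x))
      + - (\<Sum>j\<in>UNIV. diff_second h j (V t) x - vxx j t x) + - (F - f t x) + (\<chi> i. diff_central h i P x - px i t x)"
    unfolding ns[OF t(1) x] disc_grad_def V_inside[OF x] scaleR_diff_right sum_subtractf
    by (simp add: vec_eq_iff)
  have c: "norm (v t x $ j *\<^sub>R (diff_central h j (V t) x - vx j t x)) \<le> M * (M * h)" for j
    unfolding norm_scaleR using component_le_norm_cart[of "v t x" j] bnd(1)[OF t(1) x] e2 M
    by (intro mult_mono) auto
  have "norm ((V t x - V (t - \<tau>) x) /\<^sub>R \<tau> + (\<Sum>j\<in>UNIV. V t x $ j *\<^sub>R diff_central h j (V t) x)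
      - (\<Sum>j\<in>UNIV. diff_second h j (V t) x) - F + disc_grad h P x)
    \<le> M * \<tau> + 3 * (M * (M * h)) + 3 * (2 * M * h) + \<epsilon> + 3 * (M * h)"
    unfolding eq
  proof (intro norm_triangle_mono e1)
    show "norm (\<Sum>j\<in>UNIV. v t x $ j *\<^sub>R (diff_central h j (V t) x - vx j t x)) \<le> 3 * (M * (M * h))"
      using sum_norm_le[of "UNIV :: 3 set" _ "\<lambda>_. M * (M * h)", OF c] by simp
    show "norm (- (\<Sum>j\<in>UNIV. diff_second h j (V t) x - vxx j t x)) \<le> 3 * (2 * M * h)"
      unfolding norm_minus_cancel using sum_norm_le[of "UNIV :: 3 set" _ "\<lambda>_. 2 * M * h", OF e3] by simp
    show "norm (- (F - f t x)) \<le> \<epsilon>" unfolding norm_minus_cancel by (rule F)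
    show "norm (\<chi> i. diff_central h i P x - px i t x) \<le> 3 * (M * h)" using e4 by (intro norm_vec3_le) simp
  qed
  also have "\<dots> \<le> (9 * M + 3 * M\<^sup>2) * (h + \<tau>) + \<epsilon>"
  proof -
    have "0 \<le> M * \<tau>" "0 \<le> M\<^sup>2 * \<tau>" using M \<tau> by simp_all
    moreover have "(9 * M + 3 * M\<^sup>2) * (h + \<tau>) = 9 * (M * h) + 9 * (M * \<tau>) + 3 * (M\<^sup>2 * h) + 3 * (M\<^sup>2 * \<tau>)"
      by (simp add: algebra_simps)
    moreover have "3 * (M * (M * h)) = 3 * (M\<^sup>2 * h)" "3 * (2 * M * h) = 6 * (M * h)" by (simp_all add: power2_eq_square)
    ultimately show ?thesis by linarith
  qed
  finally show "norm ((V t x - V (t - \<tau>) x) /\<^sub>R \<tau> + (\<Sum>j\<in>UNIV. V t x $ j *\<^sub>R diff_central h j (V t) x)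
      - (\<Sum>j\<in>UNIV. diff_second h j (V t) x) - F + disc_grad h P x) \<le> (9 * M + 3 * M\<^sup>2) * (h + \<tau>) + \<epsilon>" .
  show "norm (disc_grad h P x) \<le> 3 * (M + M * h)"
  proof (rule norm_vec3_le)
    show "\<bar>disc_grad h P x $ i\<bar> \<le> M + M * h" for i
      using e4[of i] bnd(3)[OF t(1) x, of i] by (simp add: disc_grad_def abs_le_iff)
  qed
qed

end

lemma force_avg_error:
  assumes h: "h > 0" and \<tau>: "\<tau> > 0" and f: "continuous_on ({0..} \<times> \<Omega>) (\<lambda>(t, x). f t x)" and c: "cube h x \<subseteq> \<Omega>"
    and e: "\<And>s y. s \<in> {\<tau> * real n .. \<tau> * real (n + 1)} \<Longrightarrow> y \<in> cube h x \<Longrightarrow> norm (f s y - F) \<le> \<epsilon>"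
  shows "norm (force_avg \<tau> h f n x - F) \<le> \<epsilon>"
proof -
  define a b where "a = \<tau> * real n" and "b = \<tau> * real (n + 1)"
  have ab: "0 \<le> a" "a \<le> b" "b - a = \<tau>" using \<tau> by (simp_all add: a_def b_def algebra_simps)
  define l u where "l = (\<chi> i. x $ i - h / 2)" and "u = (\<chi> i. x $ i + h / 2)"
  have cube: "cube h x = cbox l u" by (auto simp: cube_def l_def u_def mem_box_cart)
  have content: "measure lborel (cbox l u) = h ^ 3"
    using h by (subst content_cbox_cart) (auto simp: l_def u_def interval_eq_empty_cart not_less intro: order_less_imp_le)
  have cf: "continuous_on ({a..b} \<times> cbox l u) (\<lambda>(t, x). f t x)"
    using c ab by (intro continuous_on_subset[OF f]) (auto simp: cube)
  have int_in: "(\<lambda>y. f s y) integrable_on cbox l u" if s: "s \<in> {a..b}" for s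
  proof (rule integrable_continuous)
    have "continuous_on (cbox l u) (\<lambda>y. case (s, y) of (t, x) \<Rightarrow> f t x)"
      by (rule continuous_on_compose2[OF cf]) (use s in \<open>auto intro!: continuous_intros\<close>)
    then show "continuous_on (cbox l u) (f s)" by simp
  qed
  define J where "J = (\<lambda>s. integral (cbox l u) (\<lambda>y. f s y))"
  have cJ: "continuous_on {a..b} J" unfolding J_def by (rule integral_continuous_on_param[OF cf])
  have Je: "norm (J s - h ^ 3 *\<^sub>R F) \<le> \<epsilon> * h ^ 3" if s: "s \<in> {a..b}" for s
  proof -
    have "J s - h ^ 3 *\<^sub>R F = integral (cbox l u) (\<lambda>y. f s y - F)"
      by (simp only: J_def integral_diff[OF int_in[OF s] integrable_const] integral_const content)
    also have "norm \<dots> \<le> integral (cbox l u) (\<lambda>y. \<epsilon>)"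
      using e[of s] s by (intro integral_norm_bound_integral integrable_diff int_in) (auto simp: a_def b_def cube)
    finally show ?thesis by (simp add: content mult.commute)
  qed
  have "norm (integral {a..b} J - (\<tau> * h ^ 3) *\<^sub>R F) \<le> \<epsilon> * (\<tau> * h ^ 3)"
  proof -
    have iJ: "J integrable_on {a..b}" by (rule integrable_continuous_interval[OF cJ])
    have "integral {a..b} J - (\<tau> * h ^ 3) *\<^sub>R F = integral {a..b} (\<lambda>s. J s - h ^ 3 *\<^sub>R F)"
      using ab by (subst integral_diff[OF iJ]) auto
    also have "norm \<dots> \<le> integral {a..b} (\<lambda>s. \<epsilon> * h ^ 3)"
      using Je by (intro integral_norm_bound_integral integrable_diff iJ) auto
    finally show ?thesis using ab by (simp add: mult_ac)
  qed
  note b = this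
  have \<tau>h: "\<tau> * h ^ 3 > 0" using \<tau> h by simp
  have "force_avg \<tau> h f n x - F = inverse (\<tau> * h ^ 3) *\<^sub>R (integral {a..b} J - (\<tau> * h ^ 3) *\<^sub>R F)"
  proof -
    have ne: "\<tau> * h ^ 3 \<noteq> 0" using \<tau>h by linarith
    have "inverse (\<tau> * h ^ 3) *\<^sub>R (\<tau> * h ^ 3) *\<^sub>R F = F" unfolding scaleR_scaleR left_inverse[OF ne] by simp
    then show ?thesis unfolding force_avg_def cube J_def a_def b_def scaleR_diff_right by simp
  qed
  then have "norm (force_avg \<tau> h f n x - F) = inverse (\<tau> * h ^ 3) * norm (integral {a..b} J - (\<tau> * h ^ 3) *\<^sub>R F)"
    by (simp only: norm_scaleR abs_of_pos[OF positive_imp_inverse_positive[OF \<tau>h]])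
  also have "\<dots> \<le> inverse (\<tau> * h ^ 3) * (\<epsilon> * (\<tau> * h ^ 3))" by (rule mult_left_mono[OF b less_imp_le[OF positive_imp_inverse_positive[OF \<tau>h]]])
  also have "\<dots> = \<epsilon> * (inverse (\<tau> * h ^ 3) * (\<tau> * h ^ 3))" by (simp only: mult.left_commute)
  also have "\<dots> = \<epsilon>" using left_inverse[OF less_imp_neq[OF \<tau>h, symmetric]] by (simp only: mult_1_right)
  finally show ?thesis .
qed

section \<open>From the classes C^k to derivatives with uniform bounds\<close>

definition C1_bounded ::
  "(real^3) set \<Rightarrow> nat \<Rightarrow> (real \<times> (real^3) \<Rightarrow> 'b::real_normed_vector) \<Rightarrow>
   (real \<times> (real^3) \<Rightarrow> real \<times> (real^3) \<Rightarrow> 'b) \<Rightarrow> real \<Rightarrow> bool" where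
  "C1_bounded \<Omega> k g g' B \<longleftrightarrow> B \<ge> 0 \<and>
     (\<forall>t>0. \<forall>x\<in>\<Omega>. (g has_derivative (\<lambda>w. \<Sum>b\<in>Basis. (w \<bullet> b) *\<^sub>R g' b (t, x))) (at (t, x))) \<and>
     (\<forall>b\<in>Basis. C_class k ({0<..} \<times> \<Omega>) ({0..} \<times> closure \<Omega>) (g' b)) \<and>
     (\<forall>t\<in>{1..2}. \<forall>x\<in>\<Omega>. norm (g (t, x)) \<le> B) \<and>
     space_time_lipschitz \<Omega> B (\<lambda>t x. g (t, x))"

lemma C_class_continuous: "C_class k U S g \<Longrightarrow> continuous_on S g"
  by (cases k) auto

text \<open>On the compact set of times in {1..2} and points of the closure, g and its extended
  derivatives are bounded. The space-time segment between the two points stays where g is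
  differentiable, so the mean value inequality applies.\<close>

lemma C_class_C1_bounded:
  fixes g :: "real \<times> (real^3) \<Rightarrow> 'b::real_normed_vector"
  assumes bd: "bounded \<Omega>" and C: "C_class (Suc k) ({0<..} \<times> \<Omega>) ({0..} \<times> closure \<Omega>) g"
  shows "\<exists>g' B. C1_bounded \<Omega> k g g' B"
proof -
  let ?S = "{0..} \<times> closure \<Omega> :: (real \<times> (real^3)) set" and ?K = "{1..2} \<times> closure \<Omega> :: (real \<times> (real^3)) set"
  have KS: "?K \<subseteq> ?S" by auto
  have cK: "compact ?K" using bd by (intro compact_Times) (auto simp: compact_closure)
  have bounded: "\<exists>B\<ge>0. \<forall>z\<in>?K. norm (q z) \<le> B" if "continuous_on ?S q" for q :: "real \<times> (real^3) \<Rightarrow> 'b"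
  proof -
    have "bounded (q ` ?K)"
      using compact_continuous_image[OF continuous_on_subset[OF that KS] cK] compact_imp_bounded by blast
    then obtain B where "B > 0" "\<forall>y\<in>q ` ?K. norm y \<le> B" using bounded_pos by blast
    then show ?thesis by (intro exI[of _ B]) auto
  qed
  obtain g' where d: "\<forall>z\<in>{0<..} \<times> \<Omega>. (g has_derivative (\<lambda>w. \<Sum>b\<in>Basis. (w \<bullet> b) *\<^sub>R g' b z)) (at z)"
    and g': "\<forall>b\<in>Basis. C_class k ({0<..} \<times> \<Omega>) ?S (g' b)"
    using C by auto
  obtain B0 where B0: "B0 \<ge> 0" "\<forall>z\<in>?K. norm (g z) \<le> B0" using bounded C_class_continuous[OF C] by blast
  have "\<forall>b\<in>Basis. \<exists>B. B \<ge> 0 \<and> (\<forall>z\<in>?K. norm (g' b z) \<le> B)"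
    using bounded C_class_continuous g' by blast
  from bchoice[OF this] obtain Bb where Bb: "\<forall>b\<in>Basis. Bb b \<ge> 0 \<and> (\<forall>z\<in>?K. norm (g' b z) \<le> Bb b)" by (elim exE) (rule that)
  define B where "B = B0 + (\<Sum>b\<in>Basis. Bb b)"
  have sB: "0 \<le> (\<Sum>b\<in>Basis. Bb b)" using Bb by (intro sum_nonneg) auto
  have B: "B \<ge> 0" "B0 \<le> B" "(\<Sum>b\<in>Basis. Bb b) \<le> B" using B0 sB by (auto simp: B_def)
  have lip: "norm (g (t, x) - g (s, y)) \<le> B * (\<bar>t - s\<bar> + norm (x - y))"
    if t: "t \<in> {1..2}" "s \<in> {1..2}" and seg: "closed_segment x y \<subseteq> \<Omega>" for t s x y
  proof -
    let ?T = "closed_segment (s, y) (t, x)"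
    have sub: "fst z \<in> {1..2} \<and> snd z \<in> \<Omega>" if "z \<in> ?T" for z
    proof -
      have 1: "fst z \<in> closed_segment s t" "snd z \<in> closed_segment y x"
        using closed_segment_PairD[of "fst z" "snd z" s y t x] that by auto
      have "closed_segment s t \<subseteq> {1..2}" using t by (intro closed_segment_subset) (auto simp: convex_real_interval)
      then show ?thesis using 1 seg by (auto simp: closed_segment_commute)
    qed
    have "norm (g (t, x) - g (s, y)) \<le> (\<Sum>b\<in>Basis. Bb b) * norm ((t, x) - (s, y))"
    proof (rule differentiable_bound[where S="?T" and f=g and f'="\<lambda>z w. \<Sum>b\<in>Basis. (w \<bullet> b) *\<^sub>R g' b z"])
      fix z assume z: "z \<in> ?T"
      have zU: "z \<in> {0<..} \<times> \<Omega>" using sub[OF z] by (cases z) auto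
      show "(g has_derivative (\<lambda>w. \<Sum>b\<in>Basis. (w \<bullet> b) *\<^sub>R g' b z)) (at z within ?T)"
        by (rule has_derivative_at_withinI[OF bspec[OF d zU]])
      have zK: "z \<in> ?K" using sub[OF z] closure_subset[of \<Omega>] by (cases z) auto
      show "onorm (\<lambda>w. \<Sum>b\<in>Basis. (w \<bullet> b) *\<^sub>R g' b z) \<le> (\<Sum>b\<in>Basis. Bb b)"
      proof (rule onorm_le)
        fix w :: "real \<times> (real^3)"
        have "norm (\<Sum>b\<in>Basis. (w \<bullet> b) *\<^sub>R g' b z) \<le> (\<Sum>b\<in>Basis. norm w * Bb b)"
        proof (rule sum_norm_le)
          fix b :: "real \<times> (real^3)" assume b: "b \<in> Basis"
          show "norm ((w \<bullet> b) *\<^sub>R g' b z) \<le> norm w * Bb b"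
            unfolding norm_scaleR using Basis_le_norm[OF b, of w] Bb b zK by (intro mult_mono) auto
        qed
        then show "norm (\<Sum>b\<in>Basis. (w \<bullet> b) *\<^sub>R g' b z) \<le> (\<Sum>b\<in>Basis. Bb b) * norm w"
          by (simp add: sum_distrib_left mult.commute)
      qed
    qed simp_all
    also have "\<dots> \<le> B * (\<bar>t - s\<bar> + norm (x - y))"
      using B sB norm_Pair_le[of "t - s" "x - y"] by (intro mult_mono) auto
    finally show ?thesis .
  qed
  have "C1_bounded \<Omega> k g g' B"
    unfolding C1_bounded_def space_time_lipschitz_def
  proof (intro conjI ballI allI impI)
    show "norm (g (t, x)) \<le> B" if "t \<in> {1..2}" "x \<in> \<Omega>" for t x
    proof -
      have "(t, x) \<in> ?K" using that closure_subset[of \<Omega>] by auto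
      then show ?thesis using B0(2) B(2) order_trans by blast
    qed
  qed (use B d g' lip in auto)
  then show ?thesis by blast
qed

lemma C1_boundedD:
  assumes "C1_bounded \<Omega> k g g' B"
  shows "B \<ge> 0"
    and "t > 0 \<Longrightarrow> x \<in> \<Omega> \<Longrightarrow> (g has_derivative (\<lambda>w. \<Sum>b\<in>Basis. (w \<bullet> b) *\<^sub>R g' b (t, x))) (at (t, x))"
    and "b \<in> Basis \<Longrightarrow> C_class k ({0<..} \<times> \<Omega>) ({0..} \<times> closure \<Omega>) (g' b)"
    and "t \<in> {1..2} \<Longrightarrow> x \<in> \<Omega> \<Longrightarrow> norm (g (t, x)) \<le> B"
    and "B \<le> M \<Longrightarrow> space_time_lipschitz \<Omega> M (\<lambda>t x. g (t, x))"
proof -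
  note a = assms[unfolded C1_bounded_def]
  show "B \<ge> 0" using a by (elim conjE)
  show "(g has_derivative (\<lambda>w. \<Sum>b\<in>Basis. (w \<bullet> b) *\<^sub>R g' b (t, x))) (at (t, x))" if "t > 0" "x \<in> \<Omega>" using a that by (elim conjE) simp
  show "C_class k ({0<..} \<times> \<Omega>) ({0..} \<times> closure \<Omega>) (g' b)" if "b \<in> Basis" using a that by (elim conjE) simp
  show "norm (g (t, x)) \<le> B" if "t \<in> {1..2}" "x \<in> \<Omega>" using a that by (elim conjE) simp
  show "space_time_lipschitz \<Omega> M (\<lambda>t x. g (t, x))" if le: "B \<le> M"
  proof -
    have "space_time_lipschitz \<Omega> B (\<lambda>t x. g (t, x))" using a by (elim conjE)
    moreover have "B * (\<bar>t - s\<bar> + norm (x - y)) \<le> M * (\<bar>t - s\<bar> + norm (x - y))" for t s and x y :: "real^3"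
      using le by (intro mult_right_mono) auto
    ultimately show ?thesis unfolding space_time_lipschitz_def by (meson order_trans)
  qed
qed

lemma has_vector_derivative_direction:
  fixes g :: "'a::euclidean_space \<Rightarrow> 'b::real_normed_vector"
  assumes d: "(g has_derivative (\<lambda>w. \<Sum>b\<in>Basis. (w \<bullet> b) *\<^sub>R g' b)) (at z)" and u: "u \<in> Basis"
  shows "((\<lambda>s. g (z + s *\<^sub>R u)) has_vector_derivative g' u) (at 0)"
proof -
  have l: "((\<lambda>s. z + s *\<^sub>R u) has_derivative (\<lambda>s. s *\<^sub>R u)) (at 0)" by (auto intro!: derivative_eq_intros)
  have "(g has_derivative (\<lambda>w. \<Sum>b\<in>Basis. (w \<bullet> b) *\<^sub>R g' b)) (at (z + 0 *\<^sub>R u))" using d by simp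
  from has_derivative_compose[OF l this]
  have "((\<lambda>s. g (z + s *\<^sub>R u)) has_derivative (\<lambda>s. \<Sum>b\<in>Basis. ((s *\<^sub>R u) \<bullet> b) *\<^sub>R g' b)) (at 0)" .
  moreover have "(\<Sum>b\<in>Basis. ((s *\<^sub>R u) \<bullet> b) *\<^sub>R g' b) = s *\<^sub>R g' u" for s
  proof -
    have "(\<Sum>b\<in>Basis. ((s *\<^sub>R u) \<bullet> b) *\<^sub>R g' b) = (\<Sum>b\<in>Basis. if b = u then s *\<^sub>R g' b else 0)"
      using u by (intro sum.cong refl) (auto simp: inner_Basis)
    then show ?thesis using u by simp
  qed
  ultimately show ?thesis by (simp add: has_vector_derivative_def)
qed

lemma sum_space_time_Basis:
  "(\<Sum>b\<in>(Basis :: (real \<times> (real^3)) set). f b) = f (1, 0) + (\<Sum>i\<in>UNIV. f (0, axis i 1))"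
proof -
  have B: "(Basis :: (real \<times> (real^3)) set) = insert (1, 0) ((\<lambda>i. (0, axis i 1)) ` UNIV)"
    by (auto simp: Basis_prod_def Basis_vec_def)
  have inj: "inj (\<lambda>i::3. (0::real, axis i (1::real)))" by (auto simp: inj_def axis_eq_axis)
  have n: "(1, 0) \<notin> (\<lambda>i::3. (0::real, axis i (1::real))) ` UNIV" by auto
  show ?thesis unfolding B by (subst sum.insert) (use n in \<open>simp_all add: sum.reindex[OF inj] o_def\<close>)
qed

lemma space_time_Basis: "(0, axis i 1) \<in> (Basis :: (real \<times> (real^3)) set)" "(1, 0) \<in> (Basis :: (real \<times> (real^3)) set)"
  by (auto simp: Basis_prod_def Basis_vec_def)

text \<open>Derivatives are peeled off one order at a time. The third derivatives of v and the
  second derivatives of p do not occur in the equation; they provide the Lipschitz bounds for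
  \<open>vxx\<close> and \<open>px\<close>.\<close>

lemma classical_solution_exists:
  fixes v :: "real \<Rightarrow> real^3 \<Rightarrow> real^3" and p :: "real \<Rightarrow> real^3 \<Rightarrow> real"
  assumes op: "open \<Omega>" and bd: "bounded \<Omega>"
    and v3: "C_class 3 ({0<..} \<times> \<Omega>) ({0..} \<times> closure \<Omega>) (\<lambda>(t, x). v t x)"
    and p2: "C_class 2 ({0<..} \<times> \<Omega>) ({0..} \<times> closure \<Omega>) (\<lambda>(t, x). p t x)"
    and ns: "navier_stokes \<Omega> f v p"
  shows "\<exists>vt vx vxx px M. classical_solution \<Omega> f v p vt vx vxx px M"
proof -
  define gv where "gv = (\<lambda>z. v (fst z) (snd z))"
  define gp where "gp = (\<lambda>z. p (fst z) (snd z))"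
  let ?e = "\<lambda>i::3. (0::real, axis i (1::real))"
  have "C_class (Suc 2) ({0<..} \<times> \<Omega>) ({0..} \<times> closure \<Omega>) gv"
  proof -
    have "(\<lambda>(t, x). v t x) = gv" "Suc 2 = 3" by (simp_all add: gv_def fun_eq_iff)
    then show ?thesis using v3 by (simp only:)
  qed
  then obtain v1 Bv where v1: "C1_bounded \<Omega> 2 gv v1 Bv" using C_class_C1_bounded[OF bd] by blast
  have "C_class (Suc 1) ({0<..} \<times> \<Omega>) ({0..} \<times> closure \<Omega>) gp"
  proof -
    have "(\<lambda>(t, x). p t x) = gp" "Suc 1 = 2" by (simp_all add: gp_def fun_eq_iff)
    then show ?thesis using p2 by (simp only:)
  qed
  then obtain p1 Bp where p1: "C1_bounded \<Omega> 1 gp p1 Bp" using C_class_C1_bounded[OF bd] by blast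
  have two: "(2::nat) = Suc 1" by simp
  have "\<forall>i. \<exists>q. C1_bounded \<Omega> 1 (v1 (?e i)) (fst q) (snd q)"
  proof
    fix i
    obtain g' B where "C1_bounded \<Omega> 1 (v1 (?e i)) g' B"
      using C_class_C1_bounded[OF bd C1_boundedD(3)[OF v1 space_time_Basis(1), unfolded two]] by blast
    then show "\<exists>q. C1_bounded \<Omega> 1 (v1 (?e i)) (fst q) (snd q)" by (intro exI[of _ "(g', B)"]) simp
  qed
  from choice[OF this] obtain q where q: "\<forall>i. C1_bounded \<Omega> 1 (v1 (?e i)) (fst (q i)) (snd (q i))" by (elim exE) (rule that)
  define v2 B2 where "v2 = (\<lambda>i. fst (q i))" and "B2 = (\<lambda>i. snd (q i))"
  have v2: "C1_bounded \<Omega> 1 (v1 (?e i)) (v2 i) (B2 i)" for i using q by (simp add: v2_def B2_def)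
  obtain vt' Bt where vt: "C1_bounded \<Omega> 1 (v1 (1, 0)) vt' Bt"
    using C_class_C1_bounded[OF bd C1_boundedD(3)[OF v1 space_time_Basis(2), unfolded two]] by blast
  have "\<forall>i. \<exists>q. C1_bounded \<Omega> 0 (v2 i (?e i)) (fst q) (snd q)"
  proof
    fix i
    obtain g' B where "C1_bounded \<Omega> 0 (v2 i (?e i)) g' B"
      using C_class_C1_bounded[OF bd C1_boundedD(3)[OF v2 space_time_Basis(1), unfolded One_nat_def]] by blast
    then show "\<exists>q. C1_bounded \<Omega> 0 (v2 i (?e i)) (fst q) (snd q)" by (intro exI[of _ "(g', B)"]) simp
  qed
  from choice[OF this] obtain q3 where v3: "\<forall>i. C1_bounded \<Omega> 0 (v2 i (?e i)) (fst (q3 i)) (snd (q3 i))" by (elim exE) (rule that)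
  have "\<forall>i. \<exists>q. C1_bounded \<Omega> 0 (p1 (?e i)) (fst q) (snd q)"
  proof
    fix i
    obtain g' B where "C1_bounded \<Omega> 0 (p1 (?e i)) g' B"
      using C_class_C1_bounded[OF bd C1_boundedD(3)[OF p1 space_time_Basis(1), unfolded One_nat_def]] by blast
    then show "\<exists>q. C1_bounded \<Omega> 0 (p1 (?e i)) (fst q) (snd q)" by (intro exI[of _ "(g', B)"]) simp
  qed
  from choice[OF this] obtain q4 where p2': "\<forall>i. C1_bounded \<Omega> 0 (p1 (?e i)) (fst (q4 i)) (snd (q4 i))" by (elim exE) (rule that)
  \<comment> \<open>One constant for all bounds: the sum dominates each of its nonnegative
    summands.\<close>
  define M where "M = Bv + Bt + (\<Sum>i\<in>UNIV. B2 i) + (\<Sum>i\<in>UNIV. snd (q3 i)) + (\<Sum>i\<in>UNIV. snd (q4 i))"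
  have nn: "Bv \<ge> 0" "Bt \<ge> 0" "B2 i \<ge> 0" "snd (q3 i) \<ge> 0" "snd (q4 i) \<ge> 0" for i
    using C1_boundedD(1)[OF v1] C1_boundedD(1)[OF vt] C1_boundedD(1)[OF v2] C1_boundedD(1)[OF v3[rule_format]]
      C1_boundedD(1)[OF p2'[rule_format]] by auto
  have snn: "0 \<le> (\<Sum>i\<in>UNIV. B2 i)" "0 \<le> (\<Sum>i\<in>UNIV. snd (q3 i))" "0 \<le> (\<Sum>i\<in>UNIV. snd (q4 i))"
    using nn by (auto intro!: sum_nonneg)
  have sle: "B2 i \<le> (\<Sum>i\<in>UNIV. B2 i)" "snd (q3 i) \<le> (\<Sum>i\<in>UNIV. snd (q3 i))" "snd (q4 i) \<le> (\<Sum>i\<in>UNIV. snd (q4 i))" for i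
    using nn by (auto intro!: member_le_sum)
  have le: "Bv \<le> M" "Bt \<le> M" "B2 i \<le> M" "snd (q3 i) \<le> M" "snd (q4 i) \<le> M" "0 \<le> M" for i
    using nn(1,2) snn sle[of i] unfolding M_def by linarith+
  let ?vx = "\<lambda>i t x. v1 (?e i) (t, x)" and ?vxx = "\<lambda>i t x. v2 i (?e i) (t, x)" and ?vt = "\<lambda>t x. v1 (1, 0) (t, x)"
    and ?px = "\<lambda>i t x. p1 (?e i) (t, x)"
  have dline: "((\<lambda>s. g (t, x + s *\<^sub>R axis i 1)) has_vector_derivative g' (?e i) (t, x)) (at 0)"
    if "C1_bounded \<Omega> k g g' B" "t > 0" "x \<in> \<Omega>" for g :: "real \<times> (real^3) \<Rightarrow> 'c::real_normed_vector" and k g' B t x i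
    using has_vector_derivative_direction[OF C1_boundedD(2)[OF that] space_time_Basis(1)[of i]] by simp
  have dvl: "((\<lambda>s. v t (x + s *\<^sub>R axis i 1)) has_vector_derivative ?vx i t x) (at 0)" if "t > 0" "x \<in> \<Omega>" for t x i
    using dline[OF v1 that, of i] by (simp add: gv_def)
  have dpl: "((\<lambda>s. p t (x + s *\<^sub>R axis i 1)) has_vector_derivative ?px i t x) (at 0)" if "t > 0" "x \<in> \<Omega>" for t x i
    using dline[OF p1 that, of i] by (simp add: gp_def)
  have dvt: "((\<lambda>s. v s x) has_vector_derivative ?vt t x) (at t)" if "t > 0" "x \<in> \<Omega>" for t x
  proof -
    have "((\<lambda>s. v (t + s) x) has_vector_derivative ?vt t x) (at 0)"
      using has_vector_derivative_direction[OF C1_boundedD(2)[OF v1 that] space_time_Basis(2)] by (simp add: gv_def)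
    moreover have "((\<lambda>s. s - t) has_vector_derivative 1) (at t)"
      using has_vector_derivative_diff[OF has_vector_derivative_id has_vector_derivative_const[of t]] by simp
    ultimately show ?thesis
      using vector_diff_chain_at[of "\<lambda>s. s - t" 1 t "\<lambda>s. v (t + s) x" "?vt t x"] by (simp add: o_def)
  qed
  have pd: "partial_deriv i (v t) x = ?vx i t x" if "t > 0" "x \<in> \<Omega>" for t x i
    unfolding partial_deriv_def by (rule vector_derivative_at[OF dvl[OF that]])
  have pdp: "partial_deriv i (p t) x = ?px i t x" if "t > 0" "x \<in> \<Omega>" for t x i
    unfolding partial_deriv_def by (rule vector_derivative_at[OF dpl[OF that]])
  \<comment> \<open>The inner partial derivative is known only inside \<Omega>, so it is replaced on
    a neighbourhood of x along the line before it is differentiated again.\<close>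
  have pdd: "partial_deriv i (partial_deriv i (v t)) x = ?vxx i t x" if tx: "t > 0" "x \<in> \<Omega>" for t x i
    unfolding partial_deriv_def[of i "partial_deriv i (v t)"]
  proof (rule vector_derivative_at)
    have "open ((\<lambda>s::real. x + s *\<^sub>R axis i 1) -` \<Omega>)" by (intro open_vimage op continuous_intros)
    from has_vector_derivative_transform_within_open[OF dline[OF v2 tx, of i i] this]
    show "((\<lambda>s. partial_deriv i (v t) (x + s *\<^sub>R axis i 1)) has_vector_derivative ?vxx i t x) (at 0)"
      using tx by (simp add: pd)
  qed
  have "classical_solution \<Omega> f v p ?vt ?vx ?vxx ?px M"
  proof
    show "open \<Omega>" "bounded \<Omega>" "M \<ge> 0" by (fact op, fact bd, fact le(6))
    fix t :: real assume t: "t \<in> {1..2}"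
    then have t0: "t > 0" by simp
    show "continuous_on (closure \<Omega>) (v t)"
    proof -
      have "continuous_on (closure \<Omega>) (\<lambda>x. case (t, x) of (t, x) \<Rightarrow> v t x)"
        by (rule continuous_on_compose2[OF C_class_continuous[OF assms(3)]]) (use t in \<open>auto intro!: continuous_intros\<close>)
      then show ?thesis by simp
    qed
    show "v t x = 0" if "x \<in> frontier \<Omega>" for x using ns that t0 unfolding navier_stokes_def by blast
    fix x assume x: "x \<in> \<Omega>"
    show "(v t has_derivative (\<lambda>w. \<Sum>i\<in>UNIV. w $ i *\<^sub>R ?vx i t x)) (at x)"
    proof -
      have l: "((\<lambda>y. (t, y)) has_derivative (\<lambda>w. (0, w))) (at x)" by (auto intro!: derivative_eq_intros)
      have "((\<lambda>y. gv (t, y)) has_derivative (\<lambda>w. \<Sum>b\<in>Basis. ((0, w) \<bullet> b) *\<^sub>R v1 b (t, x))) (at x)"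
        by (rule has_derivative_compose[OF l C1_boundedD(2)[OF v1 t0 x]])
      moreover have "(\<Sum>b\<in>Basis. ((0, w) \<bullet> b) *\<^sub>R v1 b (t, x)) = (\<Sum>i\<in>UNIV. w $ i *\<^sub>R ?vx i t x)" for w
        unfolding sum_space_time_Basis by (simp add: inner_axis)
      ultimately show ?thesis by (simp add: gv_def)
    qed
    show "((\<lambda>s. ?vx i t (x + s *\<^sub>R axis i 1)) has_vector_derivative ?vxx i t x) (at 0)" for i
      by (rule dline[OF v2 t0 x])
    show "((\<lambda>s. v s x) has_vector_derivative ?vt t x) (at t)" by (rule dvt[OF t0 x])
    show "((\<lambda>s. p t (x + s *\<^sub>R axis i 1)) has_vector_derivative ?px i t x) (at 0)" for i by (rule dpl[OF t0 x])
    show "norm (v t x) \<le> M" using C1_boundedD(4)[OF v1 t x] le(1) by (simp add: gv_def)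
    show "norm (?vx i t x) \<le> M" for i using C1_boundedD(4)[OF v2[of i] t x] le(3)[of i] by linarith
    show "\<bar>?px i t x\<bar> \<le> M" for i
      using C1_boundedD(4)[OF p2'[rule_format, of i] t x] le(5)[of i] unfolding real_norm_def by linarith
    have nsx: "vector_derivative (\<lambda>s. v s x) (at t) =
          - (\<Sum>j\<in>UNIV. v t x $ j *\<^sub>R partial_deriv j (v t) x)
          + (\<Sum>j\<in>UNIV. partial_deriv j (partial_deriv j (v t)) x)
          + f t x - (\<chi> i. partial_deriv i (p t) x)" "(\<Sum>i\<in>UNIV. partial_deriv i (v t) x $ i) = 0"
      using ns t0 x unfolding navier_stokes_def by blast+
    show "f t x = ?vt t x + (\<Sum>j\<in>UNIV. v t x $ j *\<^sub>R ?vx j t x) - (\<Sum>j\<in>UNIV. ?vxx j t x) + (\<chi> i. ?px i t x)"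
      using nsx(1) unfolding vector_derivative_at[OF dvt[OF t0 x]] pd[OF t0 x] pdd[OF t0 x] pdp[OF t0 x]
      by (simp add: algebra_simps)
    show "(\<Sum>i\<in>UNIV. ?vx i t x $ i) = 0" using nsx(2) unfolding pd[OF t0 x] .
  next
    show "space_time_lipschitz \<Omega> M v" using C1_boundedD(5)[OF v1 le(1)] by (simp add: gv_def)
    show "space_time_lipschitz \<Omega> M ?vt" by (rule C1_boundedD(5)[OF vt le(2)])
    show "space_time_lipschitz \<Omega> M (?vx i)" for i by (rule C1_boundedD(5)[OF v2 le(3)])
    show "space_time_lipschitz \<Omega> M (?vxx i)" for i by (rule C1_boundedD(5)[OF v3[rule_format] le(4)])
    show "space_time_lipschitz \<Omega> M (?px i)" for i by (rule C1_boundedD(5)[OF p2'[rule_format] le(5)])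
  qed
  then show ?thesis by blast
qed

section \<open>The discrete comparison field\<close>

text \<open>\<Phi> sends a field to its comparison field. Linearity makes the image of a time
  difference quotient the difference quotient of the images. The width 7 h reaches every grid point
  outside \<open>dom_int\<close>, see \<open>exterior_point_near\<close>.\<close>

definition comparison_op ::
  "(real^3) set \<Rightarrow> real \<Rightarrow> real \<Rightarrow> real \<Rightarrow> ((real^3 \<Rightarrow> real^3) \<Rightarrow> real^3 \<Rightarrow> real^3) \<Rightarrow> bool" where
  "comparison_op \<Omega> \<kappa> C h \<Phi> \<longleftrightarrow>
     (\<forall>c V W x. continuous_on UNIV V \<longrightarrow> continuous_on UNIV W \<longrightarrow>
        \<Phi> (\<lambda>y. c *\<^sub>R (V y - W y)) x = c *\<^sub>R (\<Phi> V x - \<Phi> W x)) \<and>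
     (\<forall>V. (\<forall>x. disc_div h (face_avg h V) x = 0) \<longrightarrow> (\<forall>x. disc_div h (\<Phi> V) x = 0)) \<and>
     (\<forall>V. (\<forall>x. x \<notin> \<Omega> \<longrightarrow> V x = 0) \<longrightarrow> (\<forall>x y. y \<notin> \<Omega> \<longrightarrow> norm (x - y) \<le> 7 * h \<longrightarrow> \<Phi> V x = 0)) \<and>
     (\<forall>V x \<rho> M. continuous_on UNIV V \<longrightarrow> regular V x \<rho> M \<longrightarrow>
        small_regular h (\<lambda>y. \<Phi> V y - V y) x (\<rho> - \<kappa> * h) (C * M))"

lemma comparison_opD:
  assumes "comparison_op \<Omega> \<kappa> C h \<Phi>"
  shows "continuous_on UNIV V \<Longrightarrow> continuous_on UNIV W \<Longrightarrow> \<Phi> (\<lambda>y. c *\<^sub>R (V y - W y)) x = c *\<^sub>R (\<Phi> V x - \<Phi> W x)"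
    and "(\<And>x. disc_div h (face_avg h V) x = 0) \<Longrightarrow> disc_div h (\<Phi> V) x = 0"
    and "(\<And>x. x \<notin> \<Omega> \<Longrightarrow> V x = 0) \<Longrightarrow> y \<notin> \<Omega> \<Longrightarrow> norm (x - y) \<le> 7 * h \<Longrightarrow> \<Phi> V x = 0"
    and "continuous_on UNIV V \<Longrightarrow> regular V x \<rho> M \<Longrightarrow>
        small_regular h (\<lambda>y. \<Phi> V y - V y) x (\<rho> - \<kappa> * h) (C * M)"
  using assms unfolding comparison_op_def by (elim conjE, simp)+

text \<open>Face averaging spreads supports by 2 h; the inward push with R = 2 and t = 7 then clears
  the boundary. The numbers 18 and 19 = 1 + 18 come from
  \<open>face_avg_small_regular\<close>.\<close>

lemma comparison_op_exists:
  assumes \<Omega>: "bounded \<Omega>" "lipschitz_boundary \<Omega>"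
  obtains \<kappa> C h0 where "\<kappa> \<ge> 0" "C \<ge> 0" "h0 > 0" "h0 \<le> 1"
    "\<forall>h. 0 < h \<and> h < h0 \<longrightarrow> (\<exists>\<Phi>. comparison_op \<Omega> \<kappa> C h \<Phi>)"
proof -
  have nn: "(2::real) \<ge> 0" "(7::real) \<ge> 0" by simp_all
  show thesis
  proof (rule solenoidal_inward[OF \<Omega> nn])
    fix s C h0 :: real
    assume s: "s \<ge> 0" and C: "C \<ge> 0" and h0: "h0 > 0" "h0 \<le> 1" and T: "\<And>h. 0 < h \<Longrightarrow> h < h0 \<Longrightarrow> \<exists>T.
       (\<forall>c w w' x. T (\<lambda>y. c *\<^sub>R (w y - w' y)) x = c *\<^sub>R (T w x - T w' x)) \<and>
       (\<forall>w. (\<forall>x. disc_div h w x = 0) \<longrightarrow> (\<forall>x. disc_div h (T w) x = 0)) \<and>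
       (\<forall>w. (\<forall>x. far_from \<Omega> (2 * h) x \<longrightarrow> w x = 0) \<longrightarrow>
          (\<forall>x y. y \<notin> \<Omega> \<longrightarrow> norm (x - y) \<le> 7 * h \<longrightarrow> T w x = 0)) \<and>
       (\<forall>w x \<rho> M. regular w x \<rho> M \<longrightarrow> small_regular h (\<lambda>y. T w y - w y) x (\<rho> - s * h) (C * M))"
    have "\<exists>\<Phi>. comparison_op \<Omega> (s + 2) (18 + 19 * C) h \<Phi>" if h: "0 < h" "h < h0" for h
    proof -
      from T[OF h] obtain T where TT: "(\<forall>c w w' x. T (\<lambda>y. c *\<^sub>R (w y - w' y)) x = c *\<^sub>R (T w x - T w' x)) \<and>
       (\<forall>w. (\<forall>x. disc_div h w x = 0) \<longrightarrow> (\<forall>x. disc_div h (T w) x = 0)) \<and>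
       (\<forall>w. (\<forall>x. far_from \<Omega> (2 * h) x \<longrightarrow> w x = 0) \<longrightarrow>
          (\<forall>x y. y \<notin> \<Omega> \<longrightarrow> norm (x - y) \<le> 7 * h \<longrightarrow> T w x = 0)) \<and>
       (\<forall>w x \<rho> M. regular w x \<rho> M \<longrightarrow> small_regular h (\<lambda>y. T w y - w y) x (\<rho> - s * h) (C * M))" ..
      note T1 = TT[THEN conjunct1, rule_format]
        and T2 = TT[THEN conjunct2, THEN conjunct1, rule_format]
        and T3 = TT[THEN conjunct2, THEN conjunct2, THEN conjunct1, rule_format]
        and T4 = TT[THEN conjunct2, THEN conjunct2, THEN conjunct2, rule_format]
      have h1: "h \<le> 1" using h h0 by simp
      have "comparison_op \<Omega> (s + 2) (18 + 19 * C) h (\<lambda>V. T (face_avg h V))"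
        unfolding comparison_op_def
      proof (intro conjI allI impI)
        show "T (face_avg h (\<lambda>y. c *\<^sub>R (V y - W y))) x = c *\<^sub>R (T (face_avg h V) x - T (face_avg h W) x)"
          if "continuous_on UNIV V" "continuous_on UNIV W" for c V W x
        proof -
          have "face_avg h (\<lambda>y. c *\<^sub>R (V y - W y)) = (\<lambda>x. c *\<^sub>R (face_avg h V x - face_avg h W x))"
            by (rule ext) (rule face_avg_linear[OF that h(1)])
          then show ?thesis using T1 by simp
        qed
        show "disc_div h (T (face_avg h V)) x = 0" if "\<forall>x. disc_div h (face_avg h V) x = 0" for V x
          using that by (intro T2) simp
        show "T (face_avg h V) x = 0" if "\<forall>x. x \<notin> \<Omega> \<longrightarrow> V x = 0" "y \<notin> \<Omega>" "norm (x - y) \<le> 7 * h" for V x y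
          by (rule T3[OF face_avg_far[OF h(1)] that(2,3)]) (use that(1) in simp_all)
        show "small_regular h (\<lambda>y. T (face_avg h V) y - V y) x (\<rho> - (s + 2) * h) ((18 + 19 * C) * M)"
          if V: "continuous_on UNIV V" and r: "regular V x \<rho> M" for V x \<rho> M
        proof -
          note a = face_avg_small_regular[OF h(1) h1 V r]
          have "regular (\<lambda>y. V y + (face_avg h V y - V y)) x (\<rho> - 2 * h) (M + 18 * M)"
            using h by (intro diff_bounds_add diff_bounds_mono[OF r] small_regular_imp_regular[OF a] h1) auto
          then have "regular (face_avg h V) x (\<rho> - 2 * h) (19 * M)" by simp
          from T4[OF this] have b: "small_regular h (\<lambda>y. T (face_avg h V) y - face_avg h V y) x (\<rho> - (s + 2) * h) (C * (19 * M))"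
            by (simp add: algebra_simps)
          have "small_regular h (\<lambda>y. face_avg h V y - V y) x (\<rho> - (s + 2) * h) (18 * M)"
            using s h by (intro diff_bounds_mono[OF a]) (auto simp: algebra_simps)
          from diff_bounds_add[OF b this] show ?thesis by (simp add: algebra_simps)
        qed
      qed
      then show ?thesis by blast
    qed
    then show thesis using s C h0 by (intro that[of "s + 2" "18 + 19 * C" h0]) auto
  qed
qed

lemma convection_diff_right:
  "convection h u (\<lambda>x. v x - w x) x = convection h u v x - convection h u w x"
proof -
  have d: "diff_central h j (\<lambda>x. v x - w x) y = diff_central h j v y - diff_central h j w y" for j y
    by (simp add: diff_central_def scaleR_diff_right)
  show ?thesis
    unfolding convection_def d scaleR_diff_right[symmetric] sum_subtractf[symmetric]
    by (intro arg_cong[where f="\<lambda>y. (1/2) *\<^sub>R y"] sum.cong refl) (simp add: scaleR_diff_right)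
qed

lemma convection_diff_left:
  "convection h (\<lambda>x. u x - w x) v x = convection h u v x - convection h w v x"
  unfolding convection_def scaleR_diff_right[symmetric] sum_subtractf[symmetric]
  by (intro arg_cong[where f="\<lambda>y. (1/2) *\<^sub>R y"] sum.cong refl) (simp add: scaleR_diff_left)

lemma half_sum_diff:
  fixes a b w :: "real^3"
  shows "(1/2) *\<^sub>R (a + b) - w = (1/2) *\<^sub>R ((a - w) + (b - w))"
  by (simp add: vec_eq_iff field_simps)

lemma half_norm_le:
  fixes y :: "real^3"
  shows "norm y \<le> k + k \<Longrightarrow> norm ((1/2) *\<^sub>R y) \<le> k"
  by simp

lemma residual_collect:
  fixes b b' d d' X Y Y' I I' q :: real
  assumes "b \<le> b'" "d \<le> d'" "0 \<le> d'" "Y \<le> Y'" "3 * I \<le> I'"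
  shows "(q + b) + d + 3 * (X + (Y + I)) \<le> (q + b' + d' + 3 * X + 3 * Y' + d') + I'"
proof -
  have "3 * (X + (Y + I)) = 3 * X + 3 * Y + 3 * I" by simp
  then show ?thesis using assms by linarith
qed

lemma diff_second_diff:
  "diff_second h j (\<lambda>x. v x - w x) x = diff_second h j v x - diff_second h j w x"
  by (simp add: diff_second_def algebra_simps)

context classical_solution
begin

definition layer :: "real \<Rightarrow> (real^3) set" where
  "layer d = {x. \<exists>y. y \<notin> \<Omega> \<and> norm (x - y) \<le> d}"

lemma cball_subset_if_not_layer: "x \<notin> layer d \<Longrightarrow> cball x d \<subseteq> \<Omega>"
  by (auto simp: layer_def dist_norm)

text \<open>The first two bounds use an empty ball and hold everywhere. The third needs second
  differences of V in a ball of radius (\<kappa> + 4) h: the operator consumes \<kappa> h, and 4 h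
  remain for the differences.\<close>

lemma comparison_field:
  assumes \<Phi>: "comparison_op \<Omega> \<kappa> C h \<Phi>" and t: "t \<in> {1..2}"
  shows "norm (\<Phi> (V t) x - V t x) \<le> C * (3 * M) * h"
    and "norm ((\<Phi> (V t) (y + a) - V t (y + a)) - (\<Phi> (V t) y - V t y)) \<le> C * (3 * M) * norm a"
    and "x \<notin> layer ((\<kappa> + 4) * h) \<Longrightarrow> norm (y - x) + norm a \<le> 4 * h \<Longrightarrow>
       norm ((\<Phi> (V t) (y + a) - V t (y + a)) - (\<Phi> (V t) y - V t y)) \<le> C * (3 * M) * h * norm a"
proof -
  have e: "cball x (-1) \<subseteq> \<Omega>" by simp
  note g = comparison_opD(4)[OF \<Phi> V_continuous[OF t] V_regular[OF t e]]
  show "norm (\<Phi> (V t) x - V t x) \<le> C * (3 * M) * h" by (rule diff_boundsD(1)[OF g])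
  show "norm ((\<Phi> (V t) (y + a) - V t (y + a)) - (\<Phi> (V t) y - V t y)) \<le> C * (3 * M) * norm a"
    by (rule diff_boundsD(2)[OF g])
  show "norm ((\<Phi> (V t) (y + a) - V t (y + a)) - (\<Phi> (V t) y - V t y)) \<le> C * (3 * M) * h * norm a"
    if x: "x \<notin> layer ((\<kappa> + 4) * h)" and a: "norm (y - x) + norm a \<le> 4 * h"
  proof -
    note l = comparison_opD(4)[OF \<Phi> V_continuous[OF t] V_regular[OF t cball_subset_if_not_layer[OF x]]]
    show ?thesis by (rule diff_boundsD(3)[OF l]) (use a in \<open>simp add: algebra_simps\<close>)
  qed
qed

definition D0 :: "real \<Rightarrow> real" where "D0 C = C * (3 * M)"

text \<open>The summands cover consistency, averaging of f, transport of the time difference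
  quotient, and convection. Dominating \<open>D0 C\<close> as well, the constant also serves as
  weight for the gradient bound.\<close>

definition C1 :: "real \<Rightarrow> real" where
  "C1 C = (9 * M + 3 * M\<^sup>2) + 2 * (7 * M + 6 * M\<^sup>2) + D0 C
     + 3 * ((D0 C + M) * (3 * M + D0 C) + M * (D0 C + 6 * M)) + D0 C"

lemma residual_gradient:
  assumes \<Phi>: "comparison_op \<Omega> \<kappa> C h \<Phi>" and C: "C \<ge> 0" and t: "t \<in> {1..2}" and h: "0 < h"
  shows "norm (diff_plus h j (\<lambda>x. \<Phi> (V t) x - V t x) x)
      \<le> D0 C * h + (if x \<in> layer ((\<kappa> + 4) * h) then D0 C else 0)"
proof -
  note cf = comparison_field[OF \<Phi> t]
  have n: "norm (h *\<^sub>R axis j (1::real)) = h" using h by (simp add: norm_axis_1)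
  have D: "0 \<le> D0 C" using C M by (simp add: D0_def)
  let ?d = "(\<Phi> (V t) (x + h *\<^sub>R axis j 1) - V t (x + h *\<^sub>R axis j 1)) - (\<Phi> (V t) x - V t x)"
  have eq: "norm (diff_plus h j (\<lambda>x. \<Phi> (V t) x - V t x) x) = inverse h * norm ?d"
    unfolding diff_plus_def norm_scaleR using h by simp
  show ?thesis
  proof (cases "x \<in> layer ((\<kappa> + 4) * h)")
    case True
    have "norm ?d \<le> D0 C * h" using cf(2)[of x "h *\<^sub>R axis j 1"] unfolding n D0_def .
    then have "inverse h * norm ?d \<le> inverse h * (D0 C * h)" using h by (intro mult_left_mono) auto
    also have "\<dots> = D0 C" using h by simp
    finally have "inverse h * norm ?d \<le> D0 C" .
    moreover have "0 \<le> D0 C * h" using D h by simp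
    ultimately show ?thesis unfolding eq using True by simp
  next
    case False
    have "norm ?d \<le> D0 C * h * h" using cf(3)[OF False, of x "h *\<^sub>R axis j 1"] h unfolding n D0_def by simp
    then have "inverse h * norm ?d \<le> inverse h * (D0 C * h * h)" using h by (intro mult_left_mono) auto
    also have "\<dots> = D0 C * h" using h by simp
    finally show ?thesis unfolding eq using False by simp
  qed
qed

text \<open>Off the layer the transported gradient at a neighbour of x agrees with that of V at x to
  order h. In the layer gradients are only bounded, so the error is O(1) there, and the small number
  of layer points has to compensate.\<close>

lemma residual_convection:
  assumes \<Phi>: "comparison_op \<Omega> \<kappa> C h \<Phi>" and C: "C \<ge> 0" and k0: "\<kappa> \<ge> 0" and h: "0 < h" and \<tau>: "\<tau> > 0"
    and t: "t \<in> {1..2}" "t - \<tau> \<in> {1..2}"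
  shows "norm (convection h (\<Phi> (V (t - \<tau>))) (\<Phi> (V t)) x - (\<Sum>j\<in>UNIV. V t x $ j *\<^sub>R diff_central h j (V t) x))
     \<le> 3 * ((D0 C + M) * (h + \<tau>) * (3 * M + D0 C)
         + M * ((D0 C + 3 * M) * h + (if x \<in> layer ((\<kappa> + 4) * h) then D0 C + 6 * M else 0)))"
proof -
  let ?z = "\<Phi> (V (t - \<tau>))" and ?z' = "\<Phi> (V t)" and ?L = "layer ((\<kappa> + 4) * h)"
  define q where "q = (\<lambda>x. \<Phi> (V t) x - V t x)"
  have D: "0 \<le> D0 C" using C M by (simp add: D0_def)
  define A1 where "A1 = (D0 C + M) * (h + \<tau>)"
  define A2 where "A2 = (D0 C + 3 * M) * h + (if x \<in> ?L then D0 C + 6 * M else 0)"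
  have n2: "norm ((2 * h) *\<^sub>R axis j (1::real)) = 2 * h" for j :: 3 using h by (simp add: norm_axis_1)
  have n1: "norm (h *\<^sub>R axis j (1::real)) = h" for j :: 3 using h by (simp add: norm_axis_1)
  have dc: "diff_central h j g y = inverse (2 * h) *\<^sub>R (g ((y - h *\<^sub>R axis j 1) + (2 * h) *\<^sub>R axis j 1) - g (y - h *\<^sub>R axis j 1))"
    for g :: "real^3 \<Rightarrow> real^3" and j y
  proof -
    have "(y - h *\<^sub>R axis j 1) + (2 * h) *\<^sub>R axis j 1 = y + h *\<^sub>R axis j 1" by (simp add: vec_eq_iff algebra_simps)
    then show ?thesis by (simp only: diff_central_def)
  qed
  have quot: "norm (diff_central h j g y) \<le> k"
    if "norm (g ((y - h *\<^sub>R axis j 1) + (2 * h) *\<^sub>R axis j 1) - g (y - h *\<^sub>R axis j 1)) \<le> k * (2 * h)"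
    for g :: "real^3 \<Rightarrow> real^3" and j y k
  proof -
    have "norm (diff_central h j g y) = inverse (2 * h) * norm (g ((y - h *\<^sub>R axis j 1) + (2 * h) *\<^sub>R axis j 1) - g (y - h *\<^sub>R axis j 1))"
      unfolding dc norm_scaleR using h by simp
    also have "\<dots> \<le> inverse (2 * h) * (k * (2 * h))" using that h by (intro mult_left_mono) auto
    also have "\<dots> = k" using h by simp
    finally show ?thesis .
  qed
  have V3: "norm (V t a - V t b) \<le> 3 * M * norm (a - b)" for a b
  proof -
    have "norm (V t a - V t b) \<le> M * norm (a - b)" by (rule V_lipschitz[OF t(1)])
    also have "\<dots> \<le> 3 * M * norm (a - b)" using M by (intro mult_right_mono) auto
    finally show ?thesis .
  qed
  have DV: "norm (diff_central h j (V t) y) \<le> 3 * M" for j y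
    using V3[of "(y - h *\<^sub>R axis j 1) + (2 * h) *\<^sub>R axis j 1" "y - h *\<^sub>R axis j 1"] n2[of j] by (intro quot) simp
  have Dq: "norm (diff_central h j q y) \<le> D0 C" for j y
    using comparison_field(2)[OF \<Phi> t(1), of "y - h *\<^sub>R axis j 1" "(2 * h) *\<^sub>R axis j 1"] unfolding n2 q_def D0_def
    by (intro quot)
  have split: "diff_central h j ?z' y = diff_central h j (V t) y + diff_central h j q y" for j y
    by (simp add: diff_central_def q_def algebra_simps)
  have Dz: "norm (diff_central h j ?z' y) \<le> 3 * M + D0 C" for j y
    unfolding split by (rule norm_triangle_mono[OF DV Dq])
  have z: "\<bar>?z w $ j - V t x $ j\<bar> \<le> A1" if w: "norm (w - x) \<le> h" for w j
  proof -
    have "\<bar>?z w $ j - V t x $ j\<bar> \<le> norm (?z w - V t x)" using component_le_norm_cart[of "?z w - V t x" j] by simp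
    also have "?z w - V t x = (?z w - V (t - \<tau>) w) + (V (t - \<tau>) w - V t w) + (V t w - V t x)" by simp
    also have "norm \<dots> \<le> D0 C * h + M * \<tau> + M * h"
    proof (intro norm_triangle_mono)
      show "norm (?z w - V (t - \<tau>) w) \<le> D0 C * h" unfolding D0_def by (rule comparison_field(1)[OF \<Phi> t(2)])
      show "norm (V (t - \<tau>) w - V t w) \<le> M * \<tau>" using V_time_lipschitz[OF t(2) t(1), of w] \<tau> by simp
      show "norm (V t w - V t x) \<le> M * h"
        using V_lipschitz[OF t(1), of w x] mult_left_mono[OF w M] by linarith
    qed
    also have "\<dots> \<le> A1"
      using mult_nonneg_nonneg[OF D less_imp_le[OF \<tau>]] by (simp add: A1_def algebra_simps)
    finally show ?thesis .
  qed
  have dev: "norm (diff_central h j ?z' w - diff_central h j (V t) x) \<le> A2"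
    if w: "w = x + h *\<^sub>R axis j 1 \<or> w = x - h *\<^sub>R axis j 1" for w j
  proof (cases "x \<in> ?L")
    case True
    have "norm (diff_central h j ?z' w - diff_central h j (V t) x) \<le> (3 * M + D0 C) + 3 * M"
      using norm_triangle_ineq4[of "diff_central h j ?z' w" "diff_central h j (V t) x"] Dz[of j w] DV[of j x] by linarith
    moreover have "0 \<le> (D0 C + 3 * M) * h" using D M h by simp
    ultimately show ?thesis using True by (simp add: A2_def)
  next
    case False
    define b where "b = w - x"
    have b: "norm b = h" "w = x + b" using w h by (auto simp: b_def norm_axis_1)
    have qn: "norm (diff_central h j q w) \<le> D0 C * h"
    proof (rule quot)
      have "norm (w - h *\<^sub>R axis j 1 - x) \<le> norm b + norm (h *\<^sub>R axis j (1::real))"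
        using norm_triangle_ineq4[of b "h *\<^sub>R axis j 1"] by (simp add: b_def algebra_simps)
      \<comment> \<open>A neighbour at distance h, one further step h and a difference of length 2
        h: this is the origin of 4 h.\<close>
      then have "norm (w - h *\<^sub>R axis j 1 - x) + norm ((2 * h) *\<^sub>R axis j (1::real)) \<le> 4 * h"
        unfolding n2 n1 b(1) by linarith
      from comparison_field(3)[OF \<Phi> t(1) False this]
      show "norm (q (w - h *\<^sub>R axis j 1 + (2 * h) *\<^sub>R axis j 1) - q (w - h *\<^sub>R axis j 1)) \<le> D0 C * h * (2 * h)"
        unfolding n2 q_def D0_def .
    qed
    have \<kappa>: "cball x ((\<kappa> + 4) * h) \<subseteq> \<Omega>" by (rule cball_subset_if_not_layer[OF False])
    have vn: "norm (diff_central h j (\<lambda>y. V t (y + b) - V t y) x) \<le> 3 * M * h"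
    proof (rule quot)
      show "norm ((V t (x - h *\<^sub>R axis j 1 + (2 * h) *\<^sub>R axis j 1 + b) - V t (x - h *\<^sub>R axis j 1 + (2 * h) *\<^sub>R axis j 1))
          - (V t (x - h *\<^sub>R axis j 1 + b) - V t (x - h *\<^sub>R axis j 1))) \<le> 3 * M * h * (2 * h)"
      proof -
        have c4: "cball x (4 * h) \<subseteq> \<Omega>"
        proof (cases "\<kappa> \<ge> 0")
          case True
          then have "4 * h \<le> (\<kappa> + 4) * h" using h by (intro mult_right_mono) auto
          then show ?thesis using \<kappa> subset_cball[of "4 * h" "(\<kappa> + 4) * h" x] by blast
        qed (use k0 in simp)
        have "norm (V t (x - h *\<^sub>R axis j 1 + (2 * h) *\<^sub>R axis j 1 + b) - V t (x - h *\<^sub>R axis j 1 + (2 * h) *\<^sub>R axis j 1)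
          - V t (x - h *\<^sub>R axis j 1 + b) + V t (x - h *\<^sub>R axis j 1)) \<le> 3 * M * norm ((2 * h) *\<^sub>R axis j (1::real)) * norm b"
          by (rule V_second_difference[OF t(1) c4]) (use n1[of j] n2[of j] b in simp)
        then show ?thesis unfolding n2 b(1) by (simp add: algebra_simps)
      qed
    qed
    have "diff_central h j ?z' w - diff_central h j (V t) x
       = diff_central h j (\<lambda>y. V t (y + b) - V t y) x + diff_central h j q w"
      unfolding split b(2) by (simp add: diff_central_def algebra_simps)
    then have "norm (diff_central h j ?z' w - diff_central h j (V t) x) \<le> 3 * M * h + D0 C * h"
      using norm_triangle_mono[OF vn qn] by simp
    then show ?thesis using False by (simp add: A2_def algebra_simps)
  qed
  have A: "0 \<le> A1" "0 \<le> A2" using D M h \<tau> by (auto simp: A1_def A2_def)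
  have pt: "norm (?z w $ j *\<^sub>R diff_central h j ?z' w - V t x $ j *\<^sub>R diff_central h j (V t) x) \<le> A1 * (3 * M + D0 C) + M * A2"
    if w: "w = x + h *\<^sub>R axis j 1 \<or> w = x - h *\<^sub>R axis j 1" for w j
  proof -
    have wn: "norm (w - x) \<le> h" using w h by (auto simp: norm_axis_1)
    have eq: "?z w $ j *\<^sub>R diff_central h j ?z' w - V t x $ j *\<^sub>R diff_central h j (V t) x
       = (?z w $ j - V t x $ j) *\<^sub>R diff_central h j ?z' w + V t x $ j *\<^sub>R (diff_central h j ?z' w - diff_central h j (V t) x)"
      by (simp add: algebra_simps)
    have Vb: "\<bar>V t x $ j\<bar> \<le> M" using component_le_norm_cart[of "V t x" j] V_bound[OF t(1), of x] by linarith
    show ?thesis unfolding eq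
    proof (rule norm_triangle_mono)
      show "norm ((?z w $ j - V t x $ j) *\<^sub>R diff_central h j ?z' w) \<le> A1 * (3 * M + D0 C)"
        unfolding norm_scaleR using z[OF wn, of j] Dz[of j w] A by (intro mult_mono) auto
      show "norm (V t x $ j *\<^sub>R (diff_central h j ?z' w - diff_central h j (V t) x)) \<le> M * A2"
        unfolding norm_scaleR using Vb dev[OF w] M by (intro mult_mono) auto
    qed
  qed
  have eq: "convection h ?z ?z' x - (\<Sum>j\<in>UNIV. V t x $ j *\<^sub>R diff_central h j (V t) x)
     = (\<Sum>j\<in>UNIV. (1/2) *\<^sub>R ((?z (x - h *\<^sub>R axis j 1) $ j *\<^sub>R diff_central h j ?z' (x - h *\<^sub>R axis j 1) - V t x $ j *\<^sub>R diff_central h j (V t) x)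
       + (?z (x + h *\<^sub>R axis j 1) $ j *\<^sub>R diff_central h j ?z' (x + h *\<^sub>R axis j 1) - V t x $ j *\<^sub>R diff_central h j (V t) x)))"
    unfolding convection_def scaleR_sum_right sum_subtractf[symmetric]
    by (rule sum.cong[OF refl], rule half_sum_diff)
  have "norm (convection h ?z ?z' x - (\<Sum>j\<in>UNIV. V t x $ j *\<^sub>R diff_central h j (V t) x)) \<le> (\<Sum>j\<in>(UNIV::3 set). A1 * (3 * M + D0 C) + M * A2)"
    unfolding eq
  proof (rule sum_norm_le)
    fix j :: 3
    have "norm ((?z (x - h *\<^sub>R axis j 1) $ j *\<^sub>R diff_central h j ?z' (x - h *\<^sub>R axis j 1) - V t x $ j *\<^sub>R diff_central h j (V t) x)
       + (?z (x + h *\<^sub>R axis j 1) $ j *\<^sub>R diff_central h j ?z' (x + h *\<^sub>R axis j 1) - V t x $ j *\<^sub>R diff_central h j (V t) x))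
      \<le> (A1 * (3 * M + D0 C) + M * A2) + (A1 * (3 * M + D0 C) + M * A2)"
      by (rule norm_triangle_mono[OF pt[OF disjI2[OF refl]] pt[OF disjI1[OF refl]]])
    then show "norm ((1/2) *\<^sub>R ((?z (x - h *\<^sub>R axis j 1) $ j *\<^sub>R diff_central h j ?z' (x - h *\<^sub>R axis j 1) - V t x $ j *\<^sub>R diff_central h j (V t) x)
       + (?z (x + h *\<^sub>R axis j 1) $ j *\<^sub>R diff_central h j ?z' (x + h *\<^sub>R axis j 1) - V t x $ j *\<^sub>R diff_central h j (V t) x)))
      \<le> A1 * (3 * M + D0 C) + M * A2"
      by (rule half_norm_le)
  qed
  also have "\<dots> = 3 * (A1 * (3 * M + D0 C) + M * A2)" by simp
  finally show ?thesis unfolding A1_def A2_def .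
qed

text \<open>The Laplacian is applied to V and not to the comparison field: second differences of
  their difference quotients are controlled only by O(1) off the layer and by O(1/h) in it. That
  part is kept apart and summed by parts in \<open>energy_recursion\<close>.\<close>

lemma residual_pointwise:
  assumes \<Phi>: "comparison_op \<Omega> \<kappa> C h \<Phi>" and C: "C \<ge> 0" and k0: "\<kappa> \<ge> 0" and h: "0 < h" and \<tau>: "\<tau> > 0"
    and t: "t \<in> {1..2}" "t - \<tau> \<in> {1..2}" and ball: "cball x (2 * h) \<subseteq> \<Omega>"
    and F: "norm (F - f t x) \<le> (7 * M + 6 * M\<^sup>2) * (\<tau> + 2 * h)"
    and P: "\<And>i. P (x + h *\<^sub>R axis i 1) = p t (x + h *\<^sub>R axis i 1)" "\<And>i. P (x - h *\<^sub>R axis i 1) = p t (x - h *\<^sub>R axis i 1)"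
  shows "norm ((\<Phi> (V t) x - \<Phi> (V (t - \<tau>)) x) /\<^sub>R \<tau> + convection h (\<Phi> (V (t - \<tau>))) (\<Phi> (V t)) x
      - (\<Sum>j\<in>UNIV. diff_second h j (V t) x) - F + disc_grad h P x)
    \<le> C1 C * (h + \<tau>) + (if x \<in> layer ((\<kappa> + 4) * h) then C1 C else 0)"
proof -
  let ?z = "\<Phi> (V (t - \<tau>))" and ?z' = "\<Phi> (V t)" and ?L = "layer ((\<kappa> + 4) * h)"
  have D: "0 \<le> D0 C" using C M by (simp add: D0_def)
  let ?r0 = "(V t x - V (t - \<tau>) x) /\<^sub>R \<tau> + (\<Sum>j\<in>UNIV. V t x $ j *\<^sub>R diff_central h j (V t) x)
      - (\<Sum>j\<in>UNIV. diff_second h j (V t) x) - F + disc_grad h P x"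
  let ?\<delta> = "\<lambda>y. (1 / \<tau>) *\<^sub>R (V t y - V (t - \<tau>) y)"
  have r0: "norm ?r0 \<le> (9 * M + 3 * M\<^sup>2) * (h + \<tau>) + (7 * M + 6 * M\<^sup>2) * (\<tau> + 2 * h)"
    by (rule consistency(1)[where P=P, OF t \<tau> h ball F P])
  have c\<delta>: "continuous_on UNIV ?\<delta>" by (intro continuous_intros V_continuous t)
  have "regular ?\<delta> x (-1) (3 * M)" using \<tau> by (intro V_time_diff_regular t) auto
  from diff_boundsD(1)[OF comparison_opD(4)[OF \<Phi> c\<delta> this], of x]
  have r1: "norm (\<Phi> ?\<delta> x - ?\<delta> x) \<le> D0 C * h" by (simp add: D0_def)
  \<comment> \<open>Linearity of \<Phi> turns the estimate for one transported field into an
    estimate for the time difference of two comparison fields, uniformly in \<tau>.\<close>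
  have \<Phi>\<delta>: "\<Phi> ?\<delta> x = (1 / \<tau>) *\<^sub>R (?z' x - ?z x)"
    by (rule comparison_opD(1)[OF \<Phi> V_continuous[OF t(1)] V_continuous[OF t(2)]])
  note r2 = residual_convection[OF \<Phi> C k0 h \<tau> t, of x]
  have eq: "(?z' x - ?z x) /\<^sub>R \<tau> + convection h ?z ?z' x - (\<Sum>j\<in>UNIV. diff_second h j (V t) x) - F + disc_grad h P x
     = ?r0 + (\<Phi> ?\<delta> x - ?\<delta> x) + (convection h ?z ?z' x - (\<Sum>j\<in>UNIV. V t x $ j *\<^sub>R diff_central h j (V t) x))"
    unfolding \<Phi>\<delta> by (simp add: inverse_eq_divide)
  have "norm ((?z' x - ?z x) /\<^sub>R \<tau> + convection h ?z ?z' x - (\<Sum>j\<in>UNIV. diff_second h j (V t) x) - F + disc_grad h P x)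
    \<le> ((9 * M + 3 * M\<^sup>2) * (h + \<tau>) + (7 * M + 6 * M\<^sup>2) * (\<tau> + 2 * h)) + D0 C * h
      + 3 * ((D0 C + M) * (h + \<tau>) * (3 * M + D0 C) + M * ((D0 C + 3 * M) * h + (if x \<in> ?L then D0 C + 6 * M else 0)))"
    unfolding eq by (intro norm_triangle_mono r0 r1 r2)
  also have "\<dots> \<le> C1 C * (h + \<tau>) + (if x \<in> ?L then C1 C else 0)"
  proof -
    define u where "u = h + \<tau>"
    define B where "B = 7 * M + 6 * M\<^sup>2"
    have B: "B \<ge> 0" using M by (simp add: B_def)
    have a1: "B * (\<tau> + 2 * h) \<le> 2 * B * u" using B h \<tau> by (simp add: u_def algebra_simps)
    have a2: "D0 C * h \<le> D0 C * u" using D h \<tau> by (intro mult_left_mono) (auto simp: u_def)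
    have "(D0 C + 3 * M) * h \<le> (D0 C + 6 * M) * u" using D M h \<tau> by (intro mult_mono) (auto simp: u_def)
    then have a3: "M * ((D0 C + 3 * M) * h) \<le> M * ((D0 C + 6 * M) * u)" using M by (intro mult_left_mono)
    have a4: "3 * (M * (if x \<in> ?L then D0 C + 6 * M else 0)) \<le> (if x \<in> ?L then C1 C else 0)"
      using D M B by (auto simp: C1_def B_def[symmetric])
    have a5: "0 \<le> D0 C * u" using D h \<tau> by (simp add: u_def)
    have C1u: "C1 C * u = (9 * M + 3 * M\<^sup>2) * u + 2 * B * u + D0 C * u + 3 * ((D0 C + M) * u * (3 * M + D0 C))
        + 3 * (M * ((D0 C + 6 * M) * u)) + D0 C * u"
      by (simp add: C1_def B_def algebra_simps)
    show ?thesis unfolding u_def[symmetric] B_def[symmetric] C1u distrib_left[of M] by (rule residual_collect[OF a1 a2 a5 a3 a4])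
  qed
  finally show ?thesis .
qed

end

section \<open>The energy recursion\<close>

text \<open>A grid point missing from the domain has a point of the complement in its cube of half
  side 2 h, at distance at most 3 * 2 h by the crude bound \<open>norm_vec3_le\<close>. A boundary
  point of the grid domain has such a neighbour one step h away.\<close>

lemma exterior_point_near:
  assumes h: "h > 0" and x: "x \<in> grid h" "x \<notin> dom_int \<Omega> h"
  obtains y where "y \<notin> \<Omega>" "norm (x - y) \<le> 7 * h"
proof -
  have far: "\<exists>y. y \<notin> \<Omega> \<and> norm (w - y) \<le> 6 * h" if w: "w \<in> grid h" "w \<notin> grid_dom \<Omega> h" for w
  proof -
    from w have "w \<notin> \<Omega> \<or> \<not> cube (4 * h) w \<subseteq> \<Omega>" by (auto simp: grid_dom_def)
    then show ?thesis
    proof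
      assume "w \<notin> \<Omega>"
      then show ?thesis using h by (intro exI[of _ w]) simp
    next
      assume "\<not> cube (4 * h) w \<subseteq> \<Omega>"
      then obtain y where y: "y \<in> cube (4 * h) w" "y \<notin> \<Omega>" by blast
      have "norm (w - y) \<le> 3 * (2 * h)"
      proof (rule norm_vec3_le)
        fix i
        have "w $ i - 4 * h / 2 \<le> y $ i \<and> y $ i \<le> w $ i + 4 * h / 2" using y(1) unfolding cube_def by blast
        then show "\<bar>(w - y) $ i\<bar> \<le> 2 * h" unfolding vector_minus_component abs_le_iff by linarith
      qed
      then show ?thesis using y(2) by (intro exI[of _ y]) simp
    qed
  qed
  show thesis
  proof (cases "x \<in> grid_dom \<Omega> h")
    case False
    from far[OF x(1) False] obtain y where "y \<notin> \<Omega>" "norm (x - y) \<le> 6 * h" by blast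
    then show thesis using h by (intro that[of y]) auto
  next
    case True
    with x have "\<not> (\<Union>i. {x + h *\<^sub>R axis i 1, x - h *\<^sub>R axis i 1}) \<subseteq> grid_dom \<Omega> h"
      by (simp add: dom_int_def dom_bdry_def grid_bdry_def)
    then obtain i w where w: "w = x + h *\<^sub>R axis i 1 \<or> w = x - h *\<^sub>R axis i 1" "w \<notin> grid_dom \<Omega> h" by blast
    have "w \<in> grid h" using w(1) grid_shift[OF x(1)] by auto
    from far[OF this w(2)] obtain y where y: "y \<notin> \<Omega>" "norm (w - y) \<le> 6 * h" by blast
    have xw: "norm (x - w) = h" using w(1) h by (auto simp: norm_axis_1)
    have "norm (x - y) \<le> norm (x - w) + norm (w - y)" using norm_triangle_ineq[of "x - w" "w - y"] by simp
    then show thesis using xw y by (intro that[of y]) auto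
  qed
qed

lemma cball_subset_cube: "cball x (2 * h) \<subseteq> cube (4 * h) x"
proof
  fix y assume "y \<in> cball x (2 * h)"
  then have n: "norm (x - y) \<le> 2 * h" by (simp add: dist_norm)
  have "x $ i - 4 * h / 2 \<le> y $ i \<and> y $ i \<le> x $ i + 4 * h / 2" for i
    using component_le_norm_cart[of "x - y" i] n unfolding vector_minus_component abs_le_iff by linarith
  then show "y \<in> cube (4 * h) x" by (simp add: cube_def)
qed

lemma comparison_int_supported:
  assumes \<Phi>: "comparison_op \<Omega> \<kappa> C h \<Phi>" and h: "h > 0" and V: "\<And>x. x \<notin> \<Omega> \<Longrightarrow> V x = 0"
  shows "int_supported \<Omega> h (\<Phi> V)"
  unfolding int_supported_def
proof (intro ballI impI)
  fix x assume x: "x \<in> grid h" "x \<notin> dom_int \<Omega> h"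
  obtain y where "y \<notin> \<Omega>" "norm (x - y) \<le> 7 * h" by (rule exterior_point_near[OF h x])
  then show "\<Phi> V x = 0" by (intro comparison_opD(3)[OF \<Phi> V])
qed

lemma int_supported_diff:
  fixes a b :: "real^3 \<Rightarrow> real^3"
  shows "int_supported \<Omega> h a \<Longrightarrow> int_supported \<Omega> h b \<Longrightarrow> int_supported \<Omega> h (\<lambda>x. a x - b x)"
  by (simp add: int_supported_def)

lemma disc_div_diff: "disc_div h (\<lambda>x. v x - w x) x = disc_div h v x - disc_div h w x"
  by (simp add: disc_div_def diff_central_def sum_subtractf[symmetric] scaleR_diff_right[symmetric] algebra_simps)

lemma young_scaled:
  fixes A s w :: real
  assumes "A > 0"
  shows "w * s \<le> s\<^sup>2 / (8 * A\<^sup>2) + 2 * A\<^sup>2 * w\<^sup>2"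
proof -
  have "0 \<le> (s / A - 4 * A * w)\<^sup>2 / 8" by simp
  also have "\<dots> = s\<^sup>2 / (8 * A\<^sup>2) + 2 * A\<^sup>2 * w\<^sup>2 - w * s" using assms by (simp add: field_simps power2_eq_square)
  finally show ?thesis by simp
qed

lemma inner_young:
  fixes x y :: "real^3"
  assumes A: "A > 0" and x: "norm x \<le> w"
  shows "- (x \<bullet> y) \<le> (norm y)\<^sup>2 / (8 * A\<^sup>2) + 2 * A\<^sup>2 * w\<^sup>2"
proof -
  have "- (x \<bullet> y) \<le> norm x * norm y" using Cauchy_Schwarz_ineq2[of x y] by linarith
  also have "\<dots> \<le> w * norm y" using x by (intro mult_right_mono) auto
  also have "\<dots> \<le> (norm y)\<^sup>2 / (8 * A\<^sup>2) + 2 * A\<^sup>2 * w\<^sup>2" by (rule young_scaled[OF A])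
  finally show ?thesis .
qed

text \<open>In the application y is A^-2 \<tau>. As exp y * (1 + y / 4) <= 1 + 3 y for y <= 1/2, the
  homogeneous part decays like exp (- y n); and M1 is a supersolution of the inhomogeneous recursion
  because 1/4 + 2 <= 3.\<close>

lemma decay_recursion:
  fixes X :: "nat \<Rightarrow> real"
  assumes y: "0 < y" "y \<le> 1/2" and M1: "M1 \<ge> 0" and X: "X 0 \<ge> 0"
    and rec: "\<And>n. X (Suc n) * (1 + 3 * y) \<le> X n * (1 + y / 4) + 2 * y * M1"
  shows "X n \<le> exp (- (y * real n)) * X 0 + M1"
proof (induction n)
  case 0
  then show ?case using M1 by simp
next
  case (Suc n)
  define E where "E = exp (- (y * real n)) * X 0"
  have E: "E \<ge> 0" using X by (simp add: E_def)
  have yy: "y * y \<le> y * (1/2)" using y by (intro mult_left_mono) auto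
  have "exp y \<le> 1 + y + y\<^sup>2" using y by (intro exp_bound) auto
  then have "exp y \<le> 1 + 3/2 * y" using yy by (simp add: power2_eq_square)
  then have "exp y * (1 + y / 4) \<le> (1 + 3/2 * y) * (1 + y / 4)" using y by (intro mult_right_mono) auto
  also have "\<dots> = 1 + 7/4 * y + 3/8 * (y * y)" by (simp add: field_simps)
  also have "\<dots> \<le> 1 + 3 * y" using yy y by linarith
  finally have "exp (- y) * (exp y * (1 + y / 4)) \<le> exp (- y) * (1 + 3 * y)" by (intro mult_left_mono) auto
  moreover have "exp (- y) * exp y = 1" by (simp add: exp_minus)
  ultimately have "1 + y / 4 \<le> exp (- y) * (1 + 3 * y)" by (simp add: mult.assoc[symmetric])
  from mult_left_mono[OF this E] have e: "E * (1 + y / 4) \<le> (exp (- y) * E) * (1 + 3 * y)" by (simp add: mult_ac)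
  have "X (Suc n) * (1 + 3 * y) \<le> (E + M1) * (1 + y / 4) + 2 * y * M1"
    using rec[of n] mult_right_mono[OF Suc.IH, of "1 + y / 4"] y unfolding E_def by linarith
  also have "\<dots> = E * (1 + y / 4) + M1 * (1 + 9/4 * y)" by (simp add: field_simps)
  also have "\<dots> \<le> (exp (- y) * E) * (1 + 3 * y) + M1 * (1 + 3 * y)"
    using e y M1 by (intro add_mono mult_left_mono) auto
  also have "\<dots> = (exp (- y) * E + M1) * (1 + 3 * y)" by (simp add: algebra_simps)
  finally have "X (Suc n) \<le> exp (- y) * E + M1" using y by simp
  also have "exp (- y) * E = exp (- (y * real (Suc n))) * X 0"
    unfolding E_def mult.assoc[symmetric] exp_add[symmetric] by (simp add: algebra_simps)
  finally show ?case .
qed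

context classical_solution
begin

definition C2 :: "real \<Rightarrow> real \<Rightarrow> real \<Rightarrow> real \<Rightarrow> real" where
  "C2 A C Kd Kl = 2 * (2 * A\<^sup>2 + 6) * (2 * (C1 C)\<^sup>2 * (2 * Kd + Kl)) + 36 * M\<^sup>2 * Kd"

text \<open>There are O(h^-3) points of weight (h + \<tau>)^2 and O(h^-2) layer points of weight 1.
  Both contributions are O((h + \<tau>) / h^3), the second because h^-2 is h / h^3.\<close>

lemma residual_sum_bound:
  assumes h: "0 < h" "h \<le> 1" and \<tau>: "0 < \<tau>" "\<tau> \<le> 1" and Kd: "Kd \<ge> 0" "real (card (grid_dom \<Omega> h)) \<le> Kd / h ^ 3"
    and Kl: "Kl \<ge> 0" "real (card {x \<in> grid_dom \<Omega> h. x \<in> layer d}) \<le> Kl / h\<^sup>2"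
  shows "(\<Sum>x\<in>grid_dom \<Omega> h. (c * (h + \<tau>) + (if x \<in> layer d then c else 0))\<^sup>2)
     \<le> 2 * c\<^sup>2 * (2 * Kd + Kl) * (h + \<tau>) / h ^ 3"
proof -
  let ?D = "grid_dom \<Omega> h" and ?L = "layer d"
  have fin: "finite ?D" by (rule finite_grid_dom[OF bd h(1)])
  have "(\<Sum>x\<in>?D. (c * (h + \<tau>) + (if x \<in> ?L then c else 0))\<^sup>2)
     \<le> (\<Sum>x\<in>?D. 2 * c\<^sup>2 * (h + \<tau>)\<^sup>2 + 2 * c\<^sup>2 * (if x \<in> ?L then 1 else 0))"
  proof (rule sum_mono)
    fix x
    have sq: "(a + b)\<^sup>2 \<le> 2 * a\<^sup>2 + 2 * b\<^sup>2" for a b :: real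
      using sum_squares_bound[of a b] by (simp add: power2_sum)
    have "(c * (h + \<tau>) + (if x \<in> ?L then c else 0))\<^sup>2 \<le> 2 * (c * (h + \<tau>))\<^sup>2 + 2 * (if x \<in> ?L then c else 0)\<^sup>2" by (rule sq)
    also have "\<dots> = 2 * c\<^sup>2 * (h + \<tau>)\<^sup>2 + 2 * c\<^sup>2 * (if x \<in> ?L then 1 else 0)" by (simp add: power_mult_distrib)
    finally show "(c * (h + \<tau>) + (if x \<in> ?L then c else 0))\<^sup>2 \<le> 2 * c\<^sup>2 * (h + \<tau>)\<^sup>2 + 2 * c\<^sup>2 * (if x \<in> ?L then 1 else 0)" .
  qed
  also have "\<dots> = 2 * c\<^sup>2 * (real (card ?D) * (h + \<tau>)\<^sup>2 + (\<Sum>x\<in>?D. if x \<in> ?L then 1 else 0))"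
    unfolding sum.distrib sum_distrib_left[symmetric] sum_constant distrib_left by (simp add: mult_ac)
  also have "(\<Sum>x\<in>?D. if x \<in> ?L then 1 else 0) = real (card {x \<in> ?D. x \<in> ?L})"
    using sum.inter_filter[OF fin, of "\<lambda>x. 1::real" "\<lambda>x. x \<in> ?L"] by simp
  also have "2 * c\<^sup>2 * (real (card ?D) * (h + \<tau>)\<^sup>2 + real (card {x \<in> ?D. x \<in> ?L}))
     \<le> 2 * c\<^sup>2 * (Kd / h ^ 3 * (2 * (h + \<tau>)) + Kl * (h + \<tau>) / h ^ 3)"
  proof (intro mult_left_mono add_mono mult_mono Kd(2))
    have "(h + \<tau>) * (h + \<tau>) \<le> 2 * (h + \<tau>)" using h \<tau> by (intro mult_right_mono) auto
    then show "(h + \<tau>)\<^sup>2 \<le> 2 * (h + \<tau>)" by (simp add: power2_eq_square)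
    have "Kl / h\<^sup>2 = Kl * h / h ^ 3" using h by (simp add: power2_eq_square power3_eq_cube)
    also have "\<dots> \<le> Kl * (h + \<tau>) / h ^ 3" using h \<tau> Kl by (intro divide_right_mono mult_left_mono) auto
    finally show "real (card {x \<in> ?D. x \<in> ?L}) \<le> Kl * (h + \<tau>) / h ^ 3" using Kl(2) by linarith
  qed (use h Kd in auto)
  also have "\<dots> = 2 * c\<^sup>2 * (2 * Kd + Kl) * (h + \<tau>) / h ^ 3" by (simp add: algebra_simps add_divide_distrib)
  finally show ?thesis .
qed

text \<open>Poincare in all three directions gives 3 |e'|^2 <= A^2 G, so the half of G left by
  \<open>energy_step\<close> produces the factor 1 + 3 A^-2 \<tau>. The bound A^-1 / 3 on the
  comparison field produces 2/9 <= 1/4 in the factor of the old error.\<close>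

lemma energy_recursion:
  assumes \<Phi>: "comparison_op \<Omega> \<kappa> C h \<Phi>" and C: "C \<ge> 0" and k0: "\<kappa> \<ge> 0" and h: "0 < h" "h \<le> 1"
    and \<tau>: "0 < \<tau>" "\<tau> \<le> 1" and t: "t \<in> {1..2}" "t - \<tau> \<in> {1..2}" and A: "disc_poincare_const \<Omega> A"
    and Kd: "Kd \<ge> 0" "real (card (grid_dom \<Omega> h)) \<le> Kd / h ^ 3"
    and Kl: "Kl \<ge> 0" "real (card {x \<in> grid_dom \<Omega> h. x \<in> layer ((\<kappa> + 4) * h)}) \<le> Kl / h\<^sup>2"
    and sup: "\<And>x. norm (\<Phi> (V t) x) \<le> inverse A / 3"
    and supp: "int_supported \<Omega> h a" "int_supported \<Omega> h a'" and hh: "helmholtz_hodge \<Omega> h a u \<phi>"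
    and F: "\<And>x. x \<in> dom_int \<Omega> h \<Longrightarrow> norm (F x - f t x) \<le> (7 * M + 6 * M\<^sup>2) * (\<tau> + 2 * h)"
    and eq: "\<And>x. x \<in> dom_int \<Omega> h \<Longrightarrow> (a' x - u x) /\<^sub>R \<tau> = - convection h u a' x + (\<Sum>j\<in>UNIV. diff_second h j a' x) + F x"
  shows "(\<Sum>x\<in>grid_dom \<Omega> h. (norm (a' x - \<Phi> (V t) x))\<^sup>2) * (1 + 3 * ((inverse A)\<^sup>2 * \<tau>))
     \<le> (\<Sum>x\<in>grid_dom \<Omega> h. (norm (a x - \<Phi> (V (t - \<tau>)) x))\<^sup>2) * (1 + (inverse A)\<^sup>2 * \<tau> / 4)
       + \<tau> * (C2 A C Kd Kl * (h + \<tau>) / h ^ 3)"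
proof -
  let ?D = "grid_dom \<Omega> h" and ?I = "dom_int \<Omega> h"
  define z z' where "z = \<Phi> (V (t - \<tau>))" and "z' = \<Phi> (V t)"
  define q where "q = (\<lambda>x. z' x - V t x)"
  define e e' E where "e = (\<lambda>x. a x - z x)" and "e' = (\<lambda>x. a' x - z' x)" and "E = (\<lambda>x. u x - z x)"
  define ra where "ra = (\<lambda>x. (z' x - z x) /\<^sub>R \<tau> + convection h z z' x - (\<Sum>j\<in>UNIV. diff_second h j (V t) x) - F x + disc_grad h (p t) x)"
  define r where "r = (\<lambda>x. ra x - (\<Sum>j\<in>UNIV. diff_second h j q x))"
  define w where "w = (\<lambda>x. C1 C * (h + \<tau>) + (if x \<in> layer ((\<kappa> + 4) * h) then C1 C else 0))"
  define S where "S = (\<Sum>x\<in>?D. (w x)\<^sup>2)"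
  define G where "G = (\<Sum>j\<in>UNIV. \<Sum>x\<in>?D. (norm (diff_plus h j e' x))\<^sup>2)"
  define N0 N1 where "N0 = (\<Sum>x\<in>?D. (norm (e x))\<^sup>2)" and "N1 = (\<Sum>x\<in>?D. (norm (e' x))\<^sup>2)"
  have fin: "finite ?D" by (rule finite_grid_dom[OF bd h(1)])
  have A0: "A > 0" using A by (simp add: disc_poincare_const_def)
  have zs: "int_supported \<Omega> h z" "int_supported \<Omega> h z'"
    unfolding z_def z'_def by (intro comparison_int_supported[OF \<Phi> h(1)] V_outside, assumption)+
  have us: "int_supported \<Omega> h u" by (rule helmholtz_hodge_int_supported[OF hh])
  have es: "int_supported \<Omega> h e" "int_supported \<Omega> h e'" "int_supported \<Omega> h E"
    unfolding e_def e'_def E_def by (intro int_supported_diff zs us supp)+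
  have D0: "0 \<le> D0 C" using C M by (simp add: D0_def)
  have C1D: "D0 C \<le> C1 C" using D0 M by (simp add: C1_def)
  have divu: "disc_div h u x = 0" if "x \<in> ?D" for x using hh that by (simp add: helmholtz_hodge_def)
  have divz: "disc_div h z x = 0" for x
    unfolding z_def by (rule comparison_opD(2)[OF \<Phi> disc_div_face_avg_V[OF t(2) h(1)]])
  have divE: "disc_div h E x = 0" if "x \<in> ?D" for x
    unfolding E_def disc_div_diff using divu[OF that] divz by simp
  have ball: "cball x (2 * h) \<subseteq> \<Omega>" if "x \<in> ?I" for x
    using cball_subset_cube[of x h] grid_domD(3)[OF dom_intD(1)[OF that]] by (rule order_trans)
  have ra: "norm (ra x) \<le> w x" if x: "x \<in> ?I" for x
    unfolding ra_def w_def z_def z'_def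
    by (rule residual_pointwise[OF \<Phi> C k0 h(1) \<tau>(1) t ball[OF x] F[OF x] refl refl])
  have gp: "norm (disc_grad h (p t) x) \<le> 6 * M" if x: "x \<in> ?I" for x
  proof -
    have "norm (disc_grad h (p t) x) \<le> 3 * (M + M * h)"
      by (rule consistency(2)[where P="p t", OF t \<tau>(1) h(1) ball[OF x] F[OF x] refl refl])
    also have "\<dots> \<le> 3 * (M + M)" using M h by (intro mult_left_mono add_left_mono mult_left_le) auto
    finally show ?thesis by simp
  qed
  have dq: "norm (diff_plus h j q x) \<le> w x" for j x
  proof -
    have "norm (diff_plus h j q x) \<le> D0 C * h + (if x \<in> layer ((\<kappa> + 4) * h) then D0 C else 0)"
      unfolding q_def z'_def by (rule residual_gradient[OF \<Phi> C t(1) h(1)])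
    also have "\<dots> \<le> w x"
    proof -
      have "D0 C * h \<le> C1 C * (h + \<tau>)" using C1D D0 h \<tau> by (intro mult_mono) auto
      then show ?thesis unfolding w_def using C1D by auto
    qed
    finally show ?thesis .
  qed
  have poin: "N1 \<le> A\<^sup>2 * (\<Sum>x\<in>?D. (norm (diff_plus h j e' x))\<^sup>2)" for j
    unfolding N1_def by (rule poincare_vector[OF A h(1) fin es(2)])
  have G3: "3 * N1 \<le> A\<^sup>2 * G"
    using poin[of 1] poin[of 2] poin[of 3] unfolding G_def sum_3 distrib_left by linarith
  have N1: "0 \<le> N1" "0 \<le> N0" unfolding N1_def N0_def by (simp_all add: sum_nonneg)
  \<comment> \<open>\<open>ra\<close> is paired with e' itself and uses Poincare. The Laplacian of q
    is moved onto e' by summation by parts, so that only first differences of q remain, with one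
    Young inequality for each of the three directions. Each part costs G / 8.\<close>
  have rb: "- (\<Sum>x\<in>?D. r x \<bullet> e' x) \<le> G / 4 + (2 * A\<^sup>2 + 6) * S"
  proof -
    have "(\<Sum>x\<in>?D. (\<Sum>j\<in>UNIV. diff_second h j q x) \<bullet> e' x) = (\<Sum>x\<in>?D. \<Sum>j\<in>UNIV. diff_second h j q x \<bullet> e' x)"
      by (intro sum.cong refl inner_sum_left)
    also have "\<dots> = (\<Sum>j\<in>UNIV. \<Sum>x\<in>?D. diff_second h j q x \<bullet> e' x)" by (rule sum.swap)
    also have "\<dots> = (\<Sum>j\<in>UNIV. - (\<Sum>x\<in>?D. diff_plus h j q x \<bullet> diff_plus h j e' x))"
      by (intro sum.cong refl sum_second_by_parts[OF fin es(2)])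
    also have "\<dots> = (\<Sum>j\<in>UNIV. \<Sum>x\<in>?D. - (diff_plus h j q x \<bullet> diff_plus h j e' x))" by (simp add: sum_negf)
    also have "\<dots> \<le> (\<Sum>j\<in>(UNIV::3 set). \<Sum>x\<in>?D. (norm (diff_plus h j e' x))\<^sup>2 / (8 * 1\<^sup>2) + 2 * 1\<^sup>2 * (w x)\<^sup>2)"
      by (intro sum_mono inner_young zero_less_one dq)
    also have "\<dots> = G / 8 + 6 * S"
      unfolding sum.distrib G_def S_def by (simp add: sum_divide_distrib[symmetric] sum_distrib_left[symmetric])
    finally have b: "(\<Sum>x\<in>?D. (\<Sum>j\<in>UNIV. diff_second h j q x) \<bullet> e' x) \<le> G / 8 + 6 * S" .
    have "- (\<Sum>x\<in>?D. ra x \<bullet> e' x) = (\<Sum>x\<in>?D. - (ra x \<bullet> e' x))" by (simp add: sum_negf)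
    also have "\<dots> \<le> (\<Sum>x\<in>?D. (norm (e' x))\<^sup>2 / (8 * A\<^sup>2) + 2 * A\<^sup>2 * (w x)\<^sup>2)"
    proof (rule sum_mono)
      fix x assume x: "x \<in> ?D"
      show "- (ra x \<bullet> e' x) \<le> (norm (e' x))\<^sup>2 / (8 * A\<^sup>2) + 2 * A\<^sup>2 * (w x)\<^sup>2"
      proof (cases "x \<in> ?I")
        case True
        show ?thesis by (rule inner_young[OF A0 ra[OF True]])
      next
        case False
        have "e' x = 0" using es(2) grid_domD(2)[OF x] False by (simp add: int_supported_def)
        then show ?thesis by simp
      qed
    qed
    also have "\<dots> = N1 / (8 * A\<^sup>2) + 2 * A\<^sup>2 * S"
      unfolding sum.distrib N1_def S_def by (simp add: sum_divide_distrib[symmetric] sum_distrib_left[symmetric])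
    also have "N1 / (8 * A\<^sup>2) \<le> G / 8"
    proof -
      have "N1 \<le> A\<^sup>2 * G" using G3 N1(1) by linarith
      then show ?thesis using A0 by (simp add: field_simps)
    qed
    finally have c: "- (\<Sum>x\<in>?D. ra x \<bullet> e' x) \<le> G / 8 + 2 * A\<^sup>2 * S" by simp
    have "(\<Sum>x\<in>?D. r x \<bullet> e' x) = (\<Sum>x\<in>?D. ra x \<bullet> e' x) - (\<Sum>x\<in>?D. (\<Sum>j\<in>UNIV. diff_second h j q x) \<bullet> e' x)"
      unfolding r_def inner_diff_left sum_subtractf ..
    then show ?thesis using b c unfolding distrib_right by linarith
  qed
  have pb: "(\<Sum>x\<in>?I. (norm (disc_grad h (p t) x))\<^sup>2) \<le> 36 * M\<^sup>2 * (Kd / h ^ 3)"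
  proof -
    have "(\<Sum>x\<in>?I. (norm (disc_grad h (p t) x))\<^sup>2) \<le> (\<Sum>x\<in>?I. (6 * M)\<^sup>2)"
      by (intro sum_mono power_mono gp) auto
    also have "\<dots> = 36 * M\<^sup>2 * real (card ?I)" by (simp add: power_mult_distrib)
    also have "\<dots> \<le> 36 * M\<^sup>2 * (Kd / h ^ 3)"
      using Kd(2) card_mono[OF fin dom_int_subset] by (intro mult_left_mono) auto
    finally show ?thesis .
  qed
  \<comment> \<open>Convection of a' by u minus convection of z' by z is split into convection of e'
    by u plus convection of z' by E, the form required by \<open>energy_step\<close>.\<close>
  have eqn: "(e' x - E x) /\<^sub>R \<tau> = - convection h u e' x - convection h E z' x + (\<Sum>j\<in>UNIV. diff_second h j e' x)
      - r x + disc_grad h (p t) x" if x: "x \<in> ?I" for x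
  proof -
    have 1: "convection h u e' x = convection h u a' x - convection h u z' x"
      unfolding e'_def by (rule convection_diff_right)
    have 2: "convection h E z' x = convection h u z' x - convection h z z' x"
      unfolding E_def by (rule convection_diff_left)
    have 3: "(\<Sum>j\<in>UNIV. diff_second h j e' x) = (\<Sum>j\<in>UNIV. diff_second h j a' x) - (\<Sum>j\<in>UNIV. diff_second h j z' x)"
      unfolding e'_def diff_second_diff sum_subtractf ..
    have 4: "(\<Sum>j\<in>UNIV. diff_second h j q x) = (\<Sum>j\<in>UNIV. diff_second h j z' x) - (\<Sum>j\<in>UNIV. diff_second h j (V t) x)"
      unfolding q_def diff_second_diff sum_subtractf ..
    have 5: "(e' x - E x) /\<^sub>R \<tau> = (a' x - u x) /\<^sub>R \<tau> - (z' x - z x) /\<^sub>R \<tau>"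
      unfolding e'_def E_def scaleR_diff_right[symmetric] by (rule arg_cong[where f="\<lambda>y. y /\<^sub>R \<tau>"]) simp
    show ?thesis unfolding 1 2 3 5 r_def 4 ra_def eq[OF x] by simp
  qed
  have dec: "E x + disc_grad h \<phi> x = e x" if "x \<in> ?I" for x
  proof -
    have "u x + disc_grad h \<phi> x = a x" using hh that by (simp add: helmholtz_hodge_def)
    then show ?thesis by (simp add: E_def e_def algebra_simps)
  qed
  have iA: "0 \<le> inverse A / 3" using A0 by simp
  have zb: "norm (z' x) \<le> inverse A / 3" if "x \<in> grid h" for x unfolding z'_def by (rule sup)
  have step: "(N1 - N0) / (2 * \<tau>) + G / 2 \<le> (inverse A / 3)\<^sup>2 * N0 + (2 * A\<^sup>2 + 6) * S + \<tau> / 2 * (36 * M\<^sup>2 * (Kd / h ^ 3))"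
    unfolding N1_def N0_def G_def
    by (rule energy_step[where z'=z', OF fin \<tau>(1) iA es(1) es(2) es(3) us divu divE zb dec eqn rb[unfolded G_def] pb])
  define c where "c = (inverse A)\<^sup>2"
  have "c * (3 * N1) \<le> c * (A\<^sup>2 * G)" using G3 by (intro mult_left_mono) (auto simp: c_def)
  also have "c * (A\<^sup>2 * G) = G" using A0 by (simp add: c_def power_mult_distrib[symmetric] mult.assoc[symmetric])
  finally have cG: "3 * (c * N1) \<le> G" by simp
  have c0: "0 \<le> c" by (simp add: c_def)
  have c9: "(inverse A / 3)\<^sup>2 = c / 9" by (simp add: c_def power2_eq_square)
  have Sb: "S \<le> 2 * (C1 C)\<^sup>2 * (2 * Kd + Kl) * (h + \<tau>) / h ^ 3"
    unfolding S_def w_def by (rule residual_sum_bound[OF h \<tau> Kd Kl])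
  have "2 * \<tau> * ((N1 - N0) / (2 * \<tau>) + G / 2) \<le> 2 * \<tau> * ((c / 9) * N0 + (2 * A\<^sup>2 + 6) * S + \<tau> / 2 * (36 * M\<^sup>2 * (Kd / h ^ 3)))"
    using step \<tau> unfolding c9 by (intro mult_left_mono) auto
  also have "2 * \<tau> * ((N1 - N0) / (2 * \<tau>) + G / 2) = N1 - N0 + \<tau> * G" using \<tau> by (simp add: field_simps)
  also have "2 * \<tau> * ((c / 9) * N0 + (2 * A\<^sup>2 + 6) * S + \<tau> / 2 * (36 * M\<^sup>2 * (Kd / h ^ 3)))
     = 2 * \<tau> * (c / 9) * N0 + \<tau> * (2 * (2 * A\<^sup>2 + 6) * S + \<tau> * (36 * M\<^sup>2 * (Kd / h ^ 3)))" by (simp add: field_simps)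
  finally have i1: "N1 - N0 + \<tau> * G \<le> 2 * \<tau> * (c / 9) * N0 + \<tau> * (2 * (2 * A\<^sup>2 + 6) * S + \<tau> * (36 * M\<^sup>2 * (Kd / h ^ 3)))" .
  have i2: "\<tau> * (3 * (c * N1)) \<le> \<tau> * G" using cG \<tau> by (intro mult_left_mono) auto
  have i3: "\<tau> * (2 * (2 * A\<^sup>2 + 6) * S + \<tau> * (36 * M\<^sup>2 * (Kd / h ^ 3))) \<le> \<tau> * (C2 A C Kd Kl * (h + \<tau>) / h ^ 3)"
  proof (rule mult_left_mono)
    have "2 * (2 * A\<^sup>2 + 6) * S \<le> 2 * (2 * A\<^sup>2 + 6) * (2 * (C1 C)\<^sup>2 * (2 * Kd + Kl) * (h + \<tau>) / h ^ 3)"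
      using Sb by (intro mult_left_mono) auto
    moreover have "\<tau> * (36 * M\<^sup>2 * (Kd / h ^ 3)) \<le> (h + \<tau>) * (36 * M\<^sup>2 * (Kd / h ^ 3))"
      using h Kd by (intro mult_right_mono) auto
    moreover have "C2 A C Kd Kl * (h + \<tau>) / h ^ 3
       = 2 * (2 * A\<^sup>2 + 6) * (2 * (C1 C)\<^sup>2 * (2 * Kd + Kl) * (h + \<tau>) / h ^ 3) + (h + \<tau>) * (36 * M\<^sup>2 * (Kd / h ^ 3))"
      unfolding C2_def by (simp add: distrib_right distrib_left add_divide_distrib mult_ac)
    ultimately show "2 * (2 * A\<^sup>2 + 6) * S + \<tau> * (36 * M\<^sup>2 * (Kd / h ^ 3)) \<le> C2 A C Kd Kl * (h + \<tau>) / h ^ 3" by linarith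
  qed (use \<tau> in simp)
  have i4: "2 * \<tau> * (c / 9) * N0 \<le> N0 * (c * \<tau> / 4)"
  proof -
    have "0 \<le> c * \<tau> * N0" using c0 \<tau> N1 by simp
    then show ?thesis by (simp add: field_simps)
  qed
  have "N1 * (1 + 3 * (c * \<tau>)) = N1 + \<tau> * (3 * (c * N1))" by (simp add: algebra_simps)
  also have "\<dots> \<le> N0 + N0 * (c * \<tau> / 4) + \<tau> * (C2 A C Kd Kl * (h + \<tau>) / h ^ 3)" using i1 i2 i3 i4 by linarith
  also have "N0 + N0 * (c * \<tau> / 4) = N0 * (1 + c * \<tau> / 4)" by (simp add: distrib_left)
  finally show ?thesis unfolding N1_def N0_def e_def e'_def z_def z'_def c_def .
qed

end

section \<open>Grid norms, periodicity and the final error bound\<close>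

lemma card_grid_dom:
  assumes "bounded \<Omega>"
  obtains K where "K \<ge> 0" "\<And>h. 0 < h \<Longrightarrow> h \<le> 1 \<Longrightarrow> real (card (grid_dom \<Omega> h)) \<le> K / h ^ 3"
proof -
  obtain b where b: "b > 0" "\<And>x. x \<in> \<Omega> \<Longrightarrow> norm x \<le> b" using assms by (auto simp: bounded_pos)
  show thesis
  proof (rule that[of "(2 * b + 1) ^ 3"])
    show "0 \<le> (2 * b + 1) ^ 3" using b by simp
    fix h :: real assume h: "0 < h" "h \<le> 1"
    have b0: "b \<ge> 0" using b by simp
    have "grid_dom \<Omega> h \<subseteq> {x \<in> grid h. \<forall>i. \<bar>x $ i\<bar> \<le> b}"
    proof
      fix x assume x: "x \<in> grid_dom \<Omega> h"
      have "\<bar>x $ i\<bar> \<le> b" for i using component_le_norm_cart[of x i] b(2)[OF grid_domD(1)[OF x]] by linarith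
      then show "x \<in> {x \<in> grid h. \<forall>i. \<bar>x $ i\<bar> \<le> b}" using grid_domD(2)[OF x] by simp
    qed
    then have "real (card (grid_dom \<Omega> h)) \<le> real (card {x \<in> grid h. \<forall>i. \<bar>x $ i\<bar> \<le> b})"
      by (intro of_nat_mono card_mono card_grid_box(1)[OF h(1) b0])
    also have "\<dots> \<le> (2 * (b / h) + 1) ^ 3" by (rule card_grid_box(2)[OF h(1) b0])
    also have "\<dots> \<le> ((2 * b + 1) / h) ^ 3" using h b0 by (intro power_mono) (auto simp: field_simps)
    finally show "real (card (grid_dom \<Omega> h)) \<le> (2 * b + 1) ^ 3 / h ^ 3" by (simp add: power_divide)
  qed
qed

lemma grid_norm_eq: "grid_norm \<Omega> h g = sqrt (h ^ 3 * (\<Sum>x\<in>grid_dom \<Omega> h. (norm (g x))\<^sup>2))"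
  unfolding grid_norm_def sum_distrib_left by (simp add: mult.commute)

lemma grid_norm_L2: "h > 0 \<Longrightarrow> grid_norm \<Omega> h g = L2_set (\<lambda>x. norm (g x) * sqrt (h ^ 3)) (grid_dom \<Omega> h)"
  by (simp add: grid_norm_def L2_set_def power_mult_distrib)

lemma grid_norm_triangle:
  assumes "h > 0" "\<And>x. x \<in> grid_dom \<Omega> h \<Longrightarrow> norm (a x) \<le> norm (b x) + norm (c x)"
  shows "grid_norm \<Omega> h a \<le> grid_norm \<Omega> h b + grid_norm \<Omega> h c"
proof -
  have "grid_norm \<Omega> h a \<le> L2_set (\<lambda>x. norm (b x) * sqrt (h ^ 3) + norm (c x) * sqrt (h ^ 3)) (grid_dom \<Omega> h)"
    unfolding grid_norm_L2[OF assms(1)] distrib_right[symmetric] using assms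
    by (intro L2_set_mono mult_right_mono) auto
  also have "\<dots> \<le> grid_norm \<Omega> h b + grid_norm \<Omega> h c"
    unfolding grid_norm_L2[OF assms(1)] by (rule L2_set_triangle_ineq)
  finally show ?thesis .
qed

lemma grid_norm_bounded:
  assumes h: "h > 0" and K: "real (card (grid_dom \<Omega> h)) \<le> K / h ^ 3" and k: "k \<ge> 0"
    and g: "\<And>x. norm (g x) \<le> k"
  shows "grid_norm \<Omega> h g \<le> k * sqrt K"
proof -
  have "(\<Sum>x\<in>grid_dom \<Omega> h. (norm (g x))\<^sup>2) \<le> (\<Sum>x\<in>grid_dom \<Omega> h. k\<^sup>2)" by (intro sum_mono power_mono g) auto
  also have "\<dots> = real (card (grid_dom \<Omega> h)) * k\<^sup>2" by simp
  also have "\<dots> \<le> K / h ^ 3 * k\<^sup>2" using K by (intro mult_right_mono) auto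
  finally have "h ^ 3 * (\<Sum>x\<in>grid_dom \<Omega> h. (norm (g x))\<^sup>2) \<le> h ^ 3 * (K / h ^ 3 * k\<^sup>2)" using h by (intro mult_left_mono) auto
  also have "\<dots> = k\<^sup>2 * K" using h by simp
  finally have "grid_norm \<Omega> h g \<le> sqrt (k\<^sup>2 * K)" unfolding grid_norm_eq by (rule real_sqrt_le_mono)
  then show ?thesis using k by (simp add: real_sqrt_mult)
qed

lemma periodic_shift:
  fixes g :: "real \<Rightarrow> 'a \<Rightarrow> 'b"
  assumes "\<And>t. t \<ge> 0 \<Longrightarrow> g (t + 1) x = g t x" "t \<ge> 0"
  shows "g (t + real k) x = g t x"
proof (induction k)
  case (Suc k)
  have "g (t + real (Suc k)) x = g ((t + real k) + 1) x" by (simp add: algebra_simps)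
  also have "\<dots> = g (t + real k) x" using assms by simp
  finally show ?case using Suc by simp
qed simp

lemma cube_mono:
  assumes h: "h > 0"
  shows "cube h x \<subseteq> cube (4 * h) x"
proof
  fix y assume "y \<in> cube h x"
  then have "x $ i - h / 2 \<le> y $ i \<and> y $ i \<le> x $ i + h / 2" for i unfolding cube_def by blast
  then have "x $ i - 4 * h / 2 \<le> y $ i \<and> y $ i \<le> x $ i + 4 * h / 2" for i
    by (rule conjE[of "x $ i - h / 2 \<le> y $ i"]) (use h in auto)
  then show "y \<in> cube (4 * h) x" unfolding cube_def by blast
qed

context classical_solution
begin

text \<open>The recursion runs against the comparison field. The triangle inequality returns to v at
  step n and at step 0, which is the origin of the factor 2 before
  \<open>D0 C * h * sqrt Kd\<close>; the square root halves the decay rate.\<close>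

lemma discrete_error:
  assumes \<Phi>: "comparison_op \<Omega> \<kappa> C h \<Phi>" and C: "C \<ge> 0" and k0: "\<kappa> \<ge> 0" and h: "0 < h" "h \<le> 1"
    and T1: "T1 > 0" and \<tau>_eq: "\<tau> = 1 / real T1" and A: "disc_poincare_const \<Omega> A"
    and Kd: "Kd \<ge> 0" "real (card (grid_dom \<Omega> h)) \<le> Kd / h ^ 3"
    and Kl: "Kl \<ge> 0" "real (card {x \<in> grid_dom \<Omega> h. x \<in> layer ((\<kappa> + 4) * h)}) \<le> Kl / h\<^sup>2"
    and fc: "continuous_on ({0..} \<times> \<Omega>) (\<lambda>(t, x). f t x)"
    and fper: "\<And>t x. t \<ge> 0 \<Longrightarrow> x \<in> \<Omega> \<Longrightarrow> f (t + 1) x = f t x"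
    and vper: "\<And>t x. t \<ge> 0 \<Longrightarrow> x \<in> \<Omega> \<Longrightarrow> v (t + 1) x = v t x"
    and vsmall: "\<And>t x. t \<in> {0..1} \<Longrightarrow> x \<in> \<Omega> \<Longrightarrow> norm (v t x) \<le> inverse A / 4"
    and small: "D0 C * h \<le> inverse A / 12" "(inverse A)\<^sup>2 * \<tau> \<le> 1 / 2"
    and ns: "discrete_navier_stokes \<Omega> \<tau> h f ut u"
  shows "grid_norm \<Omega> h (\<lambda>x. ut n x - v (real n * \<tau>) x)
     \<le> exp (- ((inverse A)\<^sup>2 / 2) * (real n * \<tau>)) * grid_norm \<Omega> h (\<lambda>x. ut 0 x - v 0 x)
       + (2 * (D0 C * h * sqrt Kd) + sqrt (C2 A C Kd Kl * (h + \<tau>) / (2 * (inverse A)\<^sup>2)))"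
proof -
  let ?D = "grid_dom \<Omega> h" and ?I = "dom_int \<Omega> h" and ?B = "7 * M + 6 * M\<^sup>2"
  have A0: "A > 0" using A by (simp add: disc_poincare_const_def)
  have fin: "finite ?D" by (rule finite_grid_dom[OF bd h(1)])
  have \<tau>: "0 < \<tau>" "\<tau> \<le> 1" "\<tau> * real T1 = 1" using T1 by (simp_all add: \<tau>_eq)
  define tm where "tm = (\<lambda>n. 1 + real (n mod T1) * \<tau>)"
  define z where "z = (\<lambda>n. \<Phi> (V (tm n)))"
  have r\<tau>: "real r * \<tau> \<le> 1" if "r \<le> T1" for r
  proof -
    have "real r * \<tau> \<le> real T1 * \<tau>" using that \<tau> by (intro mult_right_mono) auto
    then show ?thesis using \<tau>(3) by (simp add: mult.commute)
  qed
  have tm: "tm n \<in> {1..2}" for n using r\<tau>[of "n mod T1"] T1 \<tau> by (simp add: tm_def)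
  have tm': "tm n + \<tau> \<in> {1..2}" for n
  proof -
    have "Suc (n mod T1) \<le> T1" using mod_less_divisor[OF T1, of n] by simp
    from r\<tau>[OF this] have "real (n mod T1) * \<tau> + \<tau> \<le> 1" by (simp add: algebra_simps)
    then show ?thesis using \<tau> by (simp add: tm_def)
  qed
  \<comment> \<open>The last step of a period ends at time 2 whereas the next one starts at time 1;
    periodicity identifies the two fields.\<close>
  have V21: "V 2 = V 1"
  proof
    fix x show "V 2 x = V 1 x" using vper[of 1 x] by (simp add: V_def)
  qed
  have tmS: "V (tm (Suc n)) = V (tm n + \<tau>)" for n
  proof (cases "Suc (n mod T1) = T1")
    case True
    then have "tm (Suc n) = 1" by (simp add: tm_def mod_Suc)
    moreover have "real (n mod T1) * \<tau> + \<tau> = real (Suc (n mod T1)) * \<tau>" by (simp add: algebra_simps)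
    then have "tm n + \<tau> = 2" unfolding True using \<tau>(3) by (simp add: tm_def mult.commute)
    ultimately show ?thesis using V21 by simp
  next
    case False
    then have "tm (Suc n) = tm n + \<tau>" by (simp add: tm_def mod_Suc algebra_simps)
    then show ?thesis by simp
  qed
  have n\<tau>: "real n * \<tau> = real (n div T1) + real (n mod T1) * \<tau>" for n
  proof -
    have "real n = real (n div T1) * real T1 + real (n mod T1)"
      unfolding of_nat_mult[symmetric] of_nat_add[symmetric] by simp
    then have "real n * \<tau> = real (n div T1) * (\<tau> * real T1) + real (n mod T1) * \<tau>" by (simp add: algebra_simps)
    then show ?thesis using \<tau>(3) by simp
  qed
  have vtm: "v (real n * \<tau>) x = V (tm n) x" if x: "x \<in> \<Omega>" for n x
  proof -
    have nn: "0 \<le> real (n mod T1) * \<tau>" using \<tau> by simp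
    have "v (real n * \<tau>) x = v (real (n mod T1) * \<tau> + real (n div T1)) x" unfolding n\<tau>[of n] by (simp add: add.commute)
    also have "\<dots> = v (real (n mod T1) * \<tau>) x" by (rule periodic_shift[of v x, OF vper nn]) (use x in simp_all)
    also have "\<dots> = v (tm n) x" using vper[OF nn x] by (simp add: tm_def add.commute)
    finally show ?thesis using x by (simp add: V_def)
  qed
  have Vs: "norm (V t x) \<le> inverse A / 4" if t: "t \<in> {1..2}" for t x
  proof (cases "x \<in> \<Omega>")
    case True
    have "v t x = v (t - 1) x" using vper[of "t - 1" x] t True by simp
    then show ?thesis using vsmall[of "t - 1" x] t True by (simp add: V_def)
  qed (use A0 in \<open>simp add: V_def\<close>)
  have q: "norm (\<Phi> (V t) x - V t x) \<le> D0 C * h" if "t \<in> {1..2}" for t x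
    unfolding D0_def by (rule comparison_field(1)[OF \<Phi> that])
  \<comment> \<open>1/4 from the smallness of v and 1/12 from the O(h) deviation add up to
    1/3.\<close>
  have sup: "norm (\<Phi> (V t) x) \<le> inverse A / 3" if t: "t \<in> {1..2}" for t x
  proof -
    have "norm (\<Phi> (V t) x) \<le> norm (\<Phi> (V t) x - V t x) + norm (V t x)"
      using norm_triangle_ineq[of "\<Phi> (V t) x - V t x" "V t x"] by simp
    then show ?thesis using q[OF t, of x] Vs[OF t, of x] small(1) by linarith
  qed
  have force: "norm (force_avg \<tau> h f n x - f (tm n + \<tau>) x) \<le> ?B * (\<tau> + 2 * h)" if x: "x \<in> ?I" for n x
  proof (rule force_avg_error[OF h(1) \<tau>(1) fc])
    have c4: "cube (4 * h) x \<subseteq> \<Omega>" by (rule grid_domD(3)[OF dom_intD(1)[OF x]])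
    have ball: "cball x (2 * h) \<subseteq> \<Omega>" by (rule order_trans[OF cball_subset_cube c4])
    show cO: "cube h x \<subseteq> \<Omega>" by (rule order_trans[OF cube_mono[OF h(1)] c4])
    fix s y assume s: "s \<in> {\<tau> * real n .. \<tau> * real (n + 1)}" and y: "y \<in> cube h x"
    \<comment> \<open>The averaging window of step n is translated by whole periods into {1..2}; its
      end point may be 2 and is not reduced to 1.\<close>
    define s' where "s' = s - real (n div T1) + 1"
    have sn: "real n * \<tau> \<le> s" "s \<le> real n * \<tau> + \<tau>" using s by (auto simp: algebra_simps)
    have s1: "tm n \<le> s'" "s' \<le> tm n + \<tau>" using sn unfolding n\<tau>[of n] s'_def tm_def by linarith+
    have s2: "s' \<in> {1..2}" using s1 tm[of n] tm'[of n] by simp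
    have yO: "y \<in> \<Omega>" using cO y by blast
    have s3: "0 \<le> s' - 1" using s2 by simp
    have "f s' y = f (s' - 1) y" using fper[OF s3 yO] by simp
    also have "\<dots> = f (s' - 1 + real (n div T1)) y" by (rule periodic_shift[of f y, OF fper s3, symmetric]) (use yO in simp_all)
    also have "s' - 1 + real (n div T1) = s" by (simp add: s'_def)
    finally have fs: "f s y = f s' y" ..
    have yx: "norm (y - x) \<le> 3 * (h / 2)"
    proof (rule norm_vec3_le)
      fix i
      have "x $ i - h / 2 \<le> y $ i \<and> y $ i \<le> x $ i + h / 2" using y unfolding cube_def by blast
      then show "\<bar>(y - x) $ i\<bar> \<le> h / 2" unfolding vector_minus_component abs_le_iff by linarith
    qed
    have seg: "closed_segment y x \<subseteq> \<Omega>" by (rule segment_in_cball[OF ball]) (use yx h in auto)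
    have "norm (f s' y - f (tm n + \<tau>) x) \<le> ?B * (\<bar>s' - (tm n + \<tau>)\<bar> + norm (y - x))"
      by (rule f_lipschitz[OF s2 tm' seg])
    also have "\<dots> \<le> ?B * (\<tau> + 2 * h)" using s1 yx h M by (intro mult_left_mono) auto
    finally show "norm (f s y - f (tm n + \<tau>) x) \<le> ?B * (\<tau> + 2 * h)" unfolding fs .
  qed
  have nsD: "grid_fun \<Omega> h (ut n)" "\<And>x. x \<in> dom_bdry \<Omega> h \<Longrightarrow> ut n x = 0" "u n = hh_proj \<Omega> h (ut n)" for n
    using ns by (simp_all add: discrete_navier_stokes_def)
  have us: "int_supported \<Omega> h (ut n)" for n
    using nsD(1)[of n] nsD(2)[of _ n] unfolding int_supported_def grid_fun_def dom_int_def by blast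
  have eqn: "(ut (Suc n) x - u n x) /\<^sub>R \<tau> = - convection h (u n) (ut (Suc n)) x
      + (\<Sum>j\<in>UNIV. diff_second h j (ut (Suc n)) x) + force_avg \<tau> h f n x" if "x \<in> ?I" for n x
    using ns[unfolded discrete_navier_stokes_def, THEN conjunct2, rule_format, OF that]
    unfolding convection_def scaleR_minus_left .
  define X where "X = (\<lambda>n. \<Sum>x\<in>?D. (norm (ut n x - z n x))\<^sup>2)"
  define y where "y = (inverse A)\<^sup>2 * \<tau>"
  define M1 where "M1 = C2 A C Kd Kl * (h + \<tau>) / h ^ 3 / (2 * (inverse A)\<^sup>2)"
  have iA: "0 < (inverse A)\<^sup>2" using A0 by simp
  have y: "0 < y" "y \<le> 1/2" using iA \<tau> small(2) by (simp_all add: y_def)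
  have C20: "0 \<le> C2 A C Kd Kl" using Kd Kl by (simp add: C2_def)
  have M10: "0 \<le> M1" using C20 h \<tau> by (simp add: M1_def)
  have X0: "0 \<le> X n" for n by (simp add: X_def sum_nonneg)
  have rec: "X (Suc n) * (1 + 3 * y) \<le> X n * (1 + y / 4) + 2 * y * M1" for n
  proof -
    obtain \<phi> where hh: "helmholtz_hodge \<Omega> h (ut n) (u n) \<phi>"
      unfolding nsD(3)[of n] by (rule hh_proj_decomposition[OF fin h(1)])
    have tt: "tm n + \<tau> - \<tau> \<in> {1..2}" using tm[of n] by simp
    have M1: "2 * y * M1 = \<tau> * (C2 A C Kd Kl * (h + \<tau>) / h ^ 3)" using iA by (simp add: y_def M1_def)
    have zS: "z (Suc n) = \<Phi> (V (tm n + \<tau>))" unfolding z_def tmS ..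
    have zn: "z n = \<Phi> (V (tm n + \<tau> - \<tau>))" by (simp add: z_def)
    show ?thesis unfolding M1 unfolding X_def y_def zS zn
      by (rule energy_recursion[where t="tm n + \<tau>" and F="force_avg \<tau> h f n" and a="ut n" and a'="ut (Suc n)" and u="u n",
          OF \<Phi> C k0 h \<tau>(1,2) tm' tt A Kd Kl sup[OF tm'] us us hh force eqn])
  qed
  have dec: "X n \<le> exp (- (y * real n)) * X 0 + M1" by (rule decay_recursion[where X=X, OF y M10 X0 rec])
  have zV: "grid_norm \<Omega> h (\<lambda>x. z n x - V (tm n) x) \<le> D0 C * h * sqrt Kd" for n
    unfolding z_def by (rule grid_norm_bounded[OF h(1) Kd(2) _ q[OF tm]]) (use C M h in \<open>simp add: D0_def\<close>)
  have gX: "grid_norm \<Omega> h (\<lambda>x. ut n x - z n x) = sqrt (h ^ 3 * X n)" for n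
    unfolding grid_norm_eq X_def ..
  have up: "grid_norm \<Omega> h (\<lambda>x. ut n x - v (real n * \<tau>) x) \<le> sqrt (h ^ 3 * X n) + D0 C * h * sqrt Kd" for n
  proof -
    have "grid_norm \<Omega> h (\<lambda>x. ut n x - v (real n * \<tau>) x) \<le> grid_norm \<Omega> h (\<lambda>x. ut n x - z n x) + grid_norm \<Omega> h (\<lambda>x. z n x - V (tm n) x)"
    proof (rule grid_norm_triangle[OF h(1)])
      fix x assume "x \<in> ?D"
      then show "norm (ut n x - v (real n * \<tau>) x) \<le> norm (ut n x - z n x) + norm (z n x - V (tm n) x)"
        using vtm[OF grid_domD(1), of x h n] norm_triangle_ineq[of "ut n x - z n x" "z n x - V (tm n) x"] by simp
    qed
    then show ?thesis using zV[of n] unfolding gX by linarith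
  qed
  have down: "sqrt (h ^ 3 * X 0) \<le> grid_norm \<Omega> h (\<lambda>x. ut 0 x - v 0 x) + D0 C * h * sqrt Kd"
  proof -
    have "grid_norm \<Omega> h (\<lambda>x. ut 0 x - z 0 x) \<le> grid_norm \<Omega> h (\<lambda>x. ut 0 x - v 0 x) + grid_norm \<Omega> h (\<lambda>x. z 0 x - V (tm 0) x)"
    proof (rule grid_norm_triangle[OF h(1)])
      fix x assume "x \<in> ?D"
      then show "norm (ut 0 x - z 0 x) \<le> norm (ut 0 x - v 0 x) + norm (z 0 x - V (tm 0) x)"
        using vtm[OF grid_domD(1), of x h 0] norm_triangle_ineq4[of "ut 0 x - v 0 x" "z 0 x - V (tm 0) x"] by simp
    qed
    then show ?thesis using zV[of 0] unfolding gX by linarith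
  qed
  let ?e = "exp (- ((inverse A)\<^sup>2 / 2) * (real n * \<tau>))"
  have e1: "?e \<le> 1" using iA \<tau> by simp
  \<comment> \<open>The decay factor of the squared error is the square of the factor claimed for
    the norm.\<close>
  have ee: "exp (- (y * real n)) = ?e\<^sup>2"
    unfolding exp_double[symmetric] by (simp add: y_def field_simps)
  have "sqrt (h ^ 3 * X n) \<le> sqrt (?e\<^sup>2 * (h ^ 3 * X 0) + h ^ 3 * M1)"
  proof (rule real_sqrt_le_mono)
    have "h ^ 3 * X n \<le> h ^ 3 * (exp (- (y * real n)) * X 0 + M1)" using dec h by (intro mult_left_mono) auto
    then show "h ^ 3 * X n \<le> ?e\<^sup>2 * (h ^ 3 * X 0) + h ^ 3 * M1" unfolding ee distrib_left by (simp only: mult_ac)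
  qed
  also have "\<dots> \<le> sqrt (?e\<^sup>2 * (h ^ 3 * X 0)) + sqrt (h ^ 3 * M1)" using M10 X0 h by (intro sqrt_add_le_add_sqrt) auto
  also have "sqrt (?e\<^sup>2 * (h ^ 3 * X 0)) = ?e * sqrt (h ^ 3 * X 0)"
    unfolding real_sqrt_mult[of "?e\<^sup>2"] real_sqrt_abs abs_exp_cancel ..
  also have "h ^ 3 * M1 = C2 A C Kd Kl * (h + \<tau>) / (2 * (inverse A)\<^sup>2)" using h by (simp add: M1_def)
  finally have sq: "sqrt (h ^ 3 * X n) \<le> ?e * sqrt (h ^ 3 * X 0) + sqrt (C2 A C Kd Kl * (h + \<tau>) / (2 * (inverse A)\<^sup>2))" .
  have "?e * sqrt (h ^ 3 * X 0) \<le> ?e * (grid_norm \<Omega> h (\<lambda>x. ut 0 x - v 0 x) + D0 C * h * sqrt Kd)"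
    using down by (intro mult_left_mono) auto
  also have "\<dots> = ?e * grid_norm \<Omega> h (\<lambda>x. ut 0 x - v 0 x) + ?e * (D0 C * h * sqrt Kd)" by (rule distrib_left)
  also have "?e * (D0 C * h * sqrt Kd) \<le> 1 * (D0 C * h * sqrt Kd)"
    using C M h Kd by (intro mult_right_mono e1) (simp add: D0_def)
  finally show ?thesis using sq up[of n] by linarith
qed

end

text \<open>For h <= 1 both h and \<tau> are bounded by multiples of h^(1/2), whose square root is
  the required h^(1/4).\<close>

lemma powr_quarter_bound:
  fixes h \<tau> \<theta> :: real
  assumes h: "0 < h" "h \<le> 1" and \<tau>: "\<tau> = \<theta> * h powr (3/4)" "\<theta> \<le> 2" and c: "c \<ge> 0"
  shows "sqrt (c * (h + \<tau>)) \<le> sqrt (3 * c) * h powr (1/4)" and "h \<le> h powr (1/4)"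
proof -
  have m: "h powr b \<le> h powr a" if "a \<le> b" for a b using powr_mono'[OF that] h by simp
  show "h \<le> h powr (1/4)" using m[of "1/4" 1] h by simp
  have "h \<le> h powr (1/2)" using m[of "1/2" 1] h by simp
  moreover have "\<tau> \<le> 2 * h powr (1/2)"
    unfolding \<tau>(1) using \<tau>(2) m[of "1/2" "3/4"] by (intro mult_mono) auto
  ultimately have "c * (h + \<tau>) \<le> c * (3 * h powr (1/2))" using c by (intro mult_left_mono) auto
  then have "sqrt (c * (h + \<tau>)) \<le> sqrt (3 * c * h powr (1/2))" by (simp add: mult_ac)
  also have "\<dots> = sqrt (3 * c) * (h powr (1/2)) powr (1/2)" using powr_half_sqrt[of "h powr (1/2)"] by (simp add: real_sqrt_mult)
  also have "(h powr (1/2)) powr (1/2) = h powr (1/4)" by (simp add: powr_powr)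
  finally show "sqrt (c * (h + \<tau>)) \<le> sqrt (3 * c) * h powr (1/4)" .
qed

theorem theorem4p7:
  fixes \<Omega> :: "(real^3) set" and A :: real
    and f :: "real \<Rightarrow> real^3 \<Rightarrow> real^3"
    and v :: "real \<Rightarrow> real^3 \<Rightarrow> real^3"
    and p :: "real \<Rightarrow> real^3 \<Rightarrow> real"
  assumes "open \<Omega>" "connected \<Omega>" "bounded \<Omega>" "lipschitz_boundary \<Omega>"
    and "condition_A \<Omega>"
    and "disc_poincare_const \<Omega> A"
    and f_smooth: "\<And>k. C_class k ({0<..} \<times> \<Omega>) ({0..} \<times> \<Omega>) (\<lambda>(t, x). f t x)"
    and f_periodic: "\<And>t x. t \<ge> 0 \<Longrightarrow> x \<in> \<Omega> \<Longrightarrow> f (t + 1) x = f t x"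
    and v_C3: "C_class 3 ({0<..} \<times> \<Omega>) ({0..} \<times> closure \<Omega>) (\<lambda>(t, x). v t x)"
    and p_C2: "C_class 2 ({0<..} \<times> \<Omega>) ({0..} \<times> closure \<Omega>) (\<lambda>(t, x). p t x)"
    and v_periodic: "\<And>t x. t \<ge> 0 \<Longrightarrow> x \<in> closure \<Omega> \<Longrightarrow> v (t + 1) x = v t x"
    and "navier_stokes \<Omega> f v p"
    and v_small: "\<And>t x. t \<in> {0..1} \<Longrightarrow> x \<in> \<Omega> \<Longrightarrow> norm (v t x) \<le> inverse A / 4"
  shows "\<exists>\<theta>0 \<theta>1 \<beta> \<delta>0 :: real. 0 < \<theta>0 \<and> \<theta>0 < \<theta>1 \<and> \<beta> > 0 \<and> \<delta>0 > 0 \<and>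
    (\<forall>\<tau> h \<theta> :: real. \<forall>T1::nat. \<forall>ut u.
       T1 > 0 \<and> \<tau> = 1 / real T1 \<and> h > 0 \<and> \<tau> = \<theta> * h powr (3/4) \<and> \<theta>0 \<le> \<theta> \<and> \<theta> \<le> \<theta>1 \<and>
       \<tau> < \<delta>0 \<and> h < \<delta>0 \<and>
       (\<forall>q. step_connected h (dom_circ_class \<Omega> h q)) \<and>
       discrete_navier_stokes \<Omega> \<tau> h f ut u \<longrightarrow>
       (\<forall>n::nat. grid_norm \<Omega> h (\<lambda>x. ut n x - v (real n * \<tau>) x)
          \<le> exp (- ((inverse A)\<^sup>2 / 2) * (real n * \<tau>)) * grid_norm \<Omega> h (\<lambda>x. ut 0 x - v 0 x)
            + \<beta> * h powr (1/4)))"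
proof -
  from classical_solution_exists[OF \<open>open \<Omega>\<close> \<open>bounded \<Omega>\<close> v_C3 p_C2 \<open>navier_stokes \<Omega> f v p\<close>]
  obtain vt vx vxx px M where "classical_solution \<Omega> f v p vt vx vxx px M" by (elim exE)
  then interpret classical_solution \<Omega> f v p vt vx vxx px M .
  have A0: "A > 0" using \<open>disc_poincare_const \<Omega> A\<close> by (simp add: disc_poincare_const_def)
  obtain \<kappa> C h0 where C: "\<kappa> \<ge> 0" "C \<ge> 0" "h0 > 0" "h0 \<le> 1"
    and ex: "\<forall>h. 0 < h \<and> h < h0 \<longrightarrow> (\<exists>\<Phi>. comparison_op \<Omega> \<kappa> C h \<Phi>)"
    by (rule comparison_op_exists[OF \<open>bounded \<Omega>\<close> \<open>lipschitz_boundary \<Omega>\<close>])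
  have k4: "\<kappa> + 4 \<ge> 0" using C by simp
  obtain Kl h1 where Kl: "Kl \<ge> 0" "h1 > 0" and layer: "\<And>h. 0 < h \<Longrightarrow> h < h1 \<Longrightarrow>
    real (card {x \<in> grid_dom \<Omega> h. \<exists>y. y \<notin> \<Omega> \<and> norm (x - y) \<le> (\<kappa> + 4) * h}) \<le> Kl / h\<^sup>2"
  proof (rule layer_card[OF \<open>bounded \<Omega>\<close> \<open>lipschitz_boundary \<Omega>\<close> k4])
    fix K h0 :: real
    assume *: "K \<ge> 0" "h0 > 0" "\<And>h. 0 < h \<Longrightarrow> h < h0 \<Longrightarrow>
      real (card {x \<in> grid_dom \<Omega> h. \<exists>y. y \<notin> \<Omega> \<and> norm (x - y) \<le> (\<kappa> + 4) * h}) \<le> K / h\<^sup>2"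
    show thesis by (rule that[OF *])
  qed
  obtain Kd where Kd: "Kd \<ge> 0" and card: "\<And>h. 0 < h \<Longrightarrow> h \<le> 1 \<Longrightarrow> real (card (grid_dom \<Omega> h)) \<le> Kd / h ^ 3"
  proof (rule card_grid_dom[OF \<open>bounded \<Omega>\<close>])
    fix K :: real
    assume *: "K \<ge> 0" "\<And>h. 0 < h \<Longrightarrow> h \<le> 1 \<Longrightarrow> real (card (grid_dom \<Omega> h)) \<le> K / h ^ 3"
    show thesis by (rule that[OF *])
  qed
  have D: "0 \<le> D0 C" using C M by (simp add: D0_def)
  define a where "a = (inverse A)\<^sup>2"
  have a0: "a > 0" using A0 by (simp add: a_def)
  define c where "c = C2 A C Kd Kl / (2 * a)"
  have c0: "c \<ge> 0" using Kd Kl a0 by (simp add: c_def C2_def)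
  \<comment> \<open>Distance to the comparison field, counted twice, the accumulated residual, and 1
    for positivity.\<close>
  define \<beta> where "\<beta> = 2 * (D0 C * sqrt Kd) + sqrt (3 * c) + 1"
  \<comment> \<open>Thresholds for the comparison operator, for the layer count, for
    \<open>D0 C * h\<close> to be at most \<open>inverse A / 12\<close>, and for y <= 1/2 in
    \<open>decay_recursion\<close>. The 1 added to \<open>D0 C\<close> avoids a division by
    zero.\<close>
  define \<delta>0 where "\<delta>0 = min (min h0 h1) (min (inverse A / (12 * (D0 C + 1))) (1 / (2 * a)))"
  have Ds: "0 \<le> D0 C * sqrt Kd" using D Kd by simp
  have \<beta>0: "\<beta> > 0" using Ds c0 by (simp add: \<beta>_def add_nonneg_pos)
  have \<delta>0: "\<delta>0 > 0" using C Kl a0 A0 D by (simp add: \<delta>0_def)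
  have fc: "continuous_on ({0..} \<times> \<Omega>) (\<lambda>(t, x). f t x)" using f_smooth[of 0] by simp
  have vper: "v (t + 1) x = v t x" if "t \<ge> 0" "x \<in> \<Omega>" for t x
    using v_periodic[OF that(1)] that(2) closure_subset by blast
  have main: "grid_norm \<Omega> h (\<lambda>x. ut n x - v (real n * \<tau>) x)
      \<le> exp (- ((inverse A)\<^sup>2 / 2) * (real n * \<tau>)) * grid_norm \<Omega> h (\<lambda>x. ut 0 x - v 0 x) + \<beta> * h powr (1/4)"
    if T1: "T1 > 0" "\<tau> = 1 / real T1" and h: "h > 0" "\<tau> = \<theta> * h powr (3/4)" "\<theta> \<le> 2" and s: "\<tau> < \<delta>0" "h < \<delta>0"
      and ns: "discrete_navier_stokes \<Omega> \<tau> h f ut u"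
    for \<tau> h \<theta> :: real and T1 :: nat and ut u n
  proof -
    have h1: "h < h0" "h < h1" "h \<le> 1" "h < inverse A / (12 * (D0 C + 1))" using s(2) C(4) by (auto simp: \<delta>0_def)
    have "\<tau> < 1 / (2 * a)" using s(1) by (simp add: \<delta>0_def)
    then have at: "(inverse A)\<^sup>2 * \<tau> \<le> 1 / 2" using a0 unfolding a_def[symmetric] by (simp add: field_simps)
    have "h * (12 * (D0 C + 1)) < inverse A" using h1(4) D by (simp add: pos_less_divide_eq)
    then have Dh: "D0 C * h \<le> inverse A / 12" using h(1) by (simp add: algebra_simps)
    obtain \<Phi> where \<Phi>: "comparison_op \<Omega> \<kappa> C h \<Phi>" using ex h(1) h1(1) by blast
    have Kl': "real (card {x \<in> grid_dom \<Omega> h. x \<in> layer ((\<kappa> + 4) * h)}) \<le> Kl / h\<^sup>2"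
      unfolding layer_def mem_Collect_eq by (rule layer[OF h(1) h1(2)])
    note de = discrete_error[OF \<Phi> C(2) C(1) h(1) h1(3) T1 \<open>disc_poincare_const \<Omega> A\<close> Kd card[OF h(1) h1(3)] Kl(1) Kl'
      fc f_periodic vper v_small Dh at ns, of n]
    have ceq: "C2 A C Kd Kl * (h + \<tau>) / (2 * (inverse A)\<^sup>2) = c * (h + \<tau>)" by (simp add: c_def a_def)
    note pq = powr_quarter_bound[OF h(1) h1(3) h(2,3) c0]
    have "D0 C * sqrt Kd * h \<le> D0 C * sqrt Kd * h powr (1/4)" by (rule mult_left_mono[OF pq(2) Ds])
    then have "2 * (D0 C * h * sqrt Kd) + sqrt (c * (h + \<tau>)) \<le> 2 * (D0 C * sqrt Kd * h powr (1/4)) + sqrt (3 * c) * h powr (1/4)"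
      using pq(1) by (simp add: mult_ac)
    also have "\<dots> \<le> \<beta> * h powr (1/4)" by (simp add: \<beta>_def distrib_right)
    finally show ?thesis using de unfolding ceq by linarith
  qed
  have fin: "\<forall>\<tau> h \<theta> :: real. \<forall>T1::nat. \<forall>ut u.
       T1 > 0 \<and> \<tau> = 1 / real T1 \<and> h > 0 \<and> \<tau> = \<theta> * h powr (3/4) \<and> 1 \<le> \<theta> \<and> \<theta> \<le> 2 \<and>
       \<tau> < \<delta>0 \<and> h < \<delta>0 \<and>
       (\<forall>q. step_connected h (dom_circ_class \<Omega> h q)) \<and>
       discrete_navier_stokes \<Omega> \<tau> h f ut u \<longrightarrow>
       (\<forall>n::nat. grid_norm \<Omega> h (\<lambda>x. ut n x - v (real n * \<tau>) x)
          \<le> exp (- ((inverse A)\<^sup>2 / 2) * (real n * \<tau>)) * grid_norm \<Omega> h (\<lambda>x. ut 0 x - v 0 x)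
            + \<beta> * h powr (1/4))"
    by (rule allI)+ (rule impI, rule allI, (erule conjE)+, rule main)
  show ?thesis
    \<comment> \<open>The range of \<theta> is taken to be from 1 to 2, the upper end being the
      bound used in \<open>powr_quarter_bound\<close>.\<close>
    by (rule exI[of _ 1], rule exI[of _ 2], rule exI[of _ \<beta>], rule exI[of _ \<delta>0], intro conjI, simp, simp,
      rule \<beta>0, rule \<delta>0, rule fin)
qed

end
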